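(* Assume the Generalized Riemann Hypothesis for Dirichlet $L$-functions, and fix $\varepsilon>0$ small enough and $M>1+\varepsilon$. Let $g:\mathbb R_{\geq1}\to\mathbb R_{\geq3}$ be an increasing function tending to infinity such that $g(u)\leq u^{1/M}$ for all sufficiently large $u$. Then, for each large enough modulus $q$ there exists an associated value $x_q$ such that $g\big((\log x_q)^{1-\frac1M-2\varepsilon}\big)\leq q\leq g(\log x_q)$ and $$\Bigg|\sum_{\substack{n\leq x_q\\ n\equiv1\,(\mathrm{mod}\ q)}}\Lambda(n)-\frac1{\phi(q)}\sum_{\substack{n\leq x_q\\(n,q)=1}}\Lambda(n)\Bigg|\gg\frac{(x_q\log q)^{1/2}}{\phi(q)^{1/2}}.$$
   Context: $\Lambda$ is the von Mangoldt function and $\phi$ is Euler's function. The implied constant in $\gg$ is absolute. If the argument $(\log x_q)^{1-\frac1M-2\varepsilon}$ is less than $1$ (so outside the domain of $g$), the inequality $g((\log x_q)^{1-\frac1M-2\varepsilon})\leq q$ is regarded as void. *)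

theory Defs
  imports
    "HOL-Complex_Analysis.Complex_Analysis"
    "HOL-Number_Theory.Number_Theory"
begin

definition dirichlet_character :: "nat \<Rightarrow> (nat \<Rightarrow> complex) \<Rightarrow> bool" where
  "dirichlet_character q X \<longleftrightarrow>
     X 1 = 1 \<and>
     (\<forall>m n. X (m * n) = X m * X n) \<and>
     (\<forall>n. X (n + q) = X n) \<and>
     (\<forall>n. X n = 0 \<longleftrightarrow> \<not> coprime n q)"

text \<open>
  The Dirichlet \<open>L\<close>-function of \<open>X\<close> is the meromorphic continuation to the whole complex plane
  of the Dirichlet series of \<open>X\<close>, which converges absolutely for \<open>Re s > 1\<close>. Being nicely
  meromorphic (analytic away from poles, with value \<open>0\<close> at the poles) makes it unique as a function
  on all of \<open>\<complex>\<close>. The only possible pole is at \<open>s = 1\<close>, so the value \<open>0\<close> at poles creates no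
  spurious zeros with \<open>0 < Re s < 1\<close>.
\<close>

definition dirichlet_L :: "(nat \<Rightarrow> complex) \<Rightarrow> complex \<Rightarrow> complex" where
  "dirichlet_L X =
     (THE L. L nicely_meromorphic_on UNIV \<and>
        (\<forall>s. Re s > 1 \<longrightarrow> L s = (\<Sum>n. X (Suc n) / of_nat (Suc n) powr s)))"

text \<open>
  All characters are included, also the principal ones (whence the Riemann zeta function, for
  \<open>q = 1\<close>) and the imprimitive ones. The zeros that the extra Euler factors of an imprimitive
  character produce lie on \<open>Re s = 0\<close>, outside the open critical strip.
\<close>

definition GRH :: bool where
  "GRH \<longleftrightarrow>
     (\<forall>q X s. q > 0 \<longrightarrow> dirichlet_character q X \<longrightarrow> 0 < Re s \<longrightarrow> Re s < 1 \<longrightarrow>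
        dirichlet_L X s = 0 \<longrightarrow> Re s = 1 / 2)"

definition psi_residue :: "real \<Rightarrow> nat \<Rightarrow> nat \<Rightarrow> real" where
  "psi_residue x q a = (\<Sum>n | 1 \<le> n \<and> real n \<le> x \<and> [n = a] (mod q). mangoldt n)"

definition psi_coprime :: "real \<Rightarrow> nat \<Rightarrow> real" where
  "psi_coprime x q = (\<Sum>n | 1 \<le> n \<and> real n \<le> x \<and> coprime n q. mangoldt n)"

end

theory Submission
 imports Defs "HOL-Probability.Probability" "HOL-Real_Asymp.Real_Asymp"
begin

text \<open>
 Write \<open>x = exp y\<close> and let \<open>F(y)\<close> be the error term divided by \<open>exp (y/2)\<close>. By orthogonality \<open>F\<close> is the
 average over all \<open>\<phi>(q)\<close> characters of terms whose Laplace transform is \<open>- L'/L(1/2 + z, X) / (1/2 + z)\<close>;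
 since the residue class is 1, every character has coefficient 1 and all residues at zeros have the
 same sign. Under GRH the poles lie on \<open>Re z = 0\<close>, so for tiny \<open>\<sigma>\<close> the mean square of the transform on
 \<open>Re z = \<sigma>\<close> is at least of order \<open>N / (\<phi>(q)\<^sup>2 \<sigma>)\<close>, where \<open>N\<close> is the number of zeros of height at most 1 of
 all \<open>L(s, X)\<close>. Plancherel turns this into a lower bound for the mean square of \<open>F\<close>; an upper bound of
 order \<open>(ln q)\<^sup>2 / \<sigma>\<close> shows that neither small nor very large \<open>y\<close> contribute, hence \<open>F\<close> is
 large somewhere in \<open>(U, U\<^bsup>1+a\<^esup>)\<close>, where \<open>U\<close> is the point at which \<open>g\<close> passes \<open>q\<close> and \<open>a = 1/M + 2\<epsilon>\<close>.

 That \<open>N\<close> is of order \<open>\<phi>(q) ln q\<close> is obtained without the functional equation: the sum of \<open>\<Lambda>(n) X(n)\<close> over \<open>n\<close>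
 between two powers of \<open>q\<close>, with a Fejer window, is in mean bounded by the number of zeros of \<open>L(s, X)\<close>,
 while its second and fourth moments over \<open>X\<close> show that it is of order \<open>ln q\<close> on average.
\<close>

section \<open>Dirichlet characters\<close>

text \<open>The mean-square argument runs with \<sigma> close to 0, but a priori the error term F is
  only known to be O(exp (3/5 y)), so its Laplace integral is known to converge only for Re z > 3/5.
  GRH continues the transform to Re z > 0; convergence of the mean square there is gained by
  applying Landau's theorem to the nonnegative function |F|^2 (\<open>plancherel_laplace\<close>).
  Landau's theorem is used a second time for non-vanishing on Re s = 1, since \<open>GRH\<close>
  speaks of the open strip only. Primitive and imprimitive characters are treated alike: the local
  discs stay in Re s > 0, away from the zeros of Euler factors on Re s = 0. The window stops at
  q^(3/8), so that products of two primes stay below q and both moments reduce to their diagonals.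
  The right end U^(1+a) of the interval is dictated by (1 + a)(1 - a) <= 1, which keeps y^(1-a)
  below U; and U >= q^M makes U^a exceed q by the factor q^(2\<epsilon>) that beats the powers of ln
  q.\<close>

lemma dirichlet_character_cong:
 assumes "dirichlet_character q X" "[m = n] (mod q)"
 shows "X m = X n"
proof -
 have *: "X (a + k * q) = X a" for a k
  by (induction k) (use assms(1) in \<open>auto simp: dirichlet_character_def algebra_simps\<close>, metis add.assoc add.commute)
 have "X m = X (m mod q)" for m
  using *[of "m mod q" "m div q"] by (simp add: mult.commute)
 then show ?thesis using assms(2) unfolding cong_def by metis
qed

lemma dirichlet_character_power:
 assumes "dirichlet_character q X"
 shows "X (a ^ k) = X a ^ k"
 by (induction k) (use assms in \<open>auto simp: dirichlet_character_def\<close>)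

lemma dirichlet_character_power_totient:
 assumes "dirichlet_character q X" "coprime a q"
 shows "X a ^ totient q = 1"
 using dirichlet_character_cong[OF assms(1) euler_theorem[OF assms(2)]]
  dirichlet_character_power[OF assms(1), of a "totient q"] assms(1)
 by (simp add: dirichlet_character_def)

lemma coprime_add_modulus: "coprime (n + q) q \<longleftrightarrow> coprime n (q :: nat)"
 unfolding coprime_iff_gcd_eq_1 gcd_add1 ..

lemma norm_dirichlet_character:
 assumes "dirichlet_character q X" "q > 0"
 shows "norm (X a) = (if coprime a q then 1 else 0)"
proof (cases "coprime a q")
 case True
 have "norm (X a) ^ totient q = 1"
  using dirichlet_character_power_totient[OF assms(1) True] by (metis norm_one norm_power)
 then have "norm (X a) = 1" using power_eq_iff_eq_base[of "totient q" "norm (X a)" 1] assms(2) True by simp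
 then show ?thesis using True by simp
qed (use assms in \<open>auto simp: dirichlet_character_def\<close>)

definition principal_character :: "nat => nat => complex" where
 "principal_character q n = (if coprime n q then 1 else 0)"

lemma dirichlet_character_principal: "dirichlet_character q (principal_character q)"
 by (auto simp: dirichlet_character_def principal_character_def coprime_add_modulus)

lemma dirichlet_character_mult:
 "dirichlet_character q X ==> dirichlet_character q Y ==> dirichlet_character q (%n. X n * Y n)"
 by (auto simp: dirichlet_character_def)

lemma dirichlet_character_cnj:
 "dirichlet_character q X ==> dirichlet_character q (%n. cnj (X n))"
 by (auto simp: dirichlet_character_def)

text \<open>A character is determined by its values on the residues below \<open>q\<close>, and each
  of these is 0 or a root of unity of order dividing \<open>totient q\<close>.\<close>

lemma finite_dirichlet_characters:
 assumes "q > 0"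
 shows "finite {X. dirichlet_character q X}"
proof -
 let ?R = "insert 0 {z::complex. z ^ totient q = 1}"
 have "finite ?R" using finite_roots_unity[of "totient q"] assms by (simp add: Suc_leI)
 then have fin: "finite (PiE {..<q} (%_. ?R))" by (intro finite_PiE) auto
 have "X a \<in> ?R" if "dirichlet_character q X" for X a
  using that dirichlet_character_power_totient[OF that, of a]
  by (cases "coprime a q") (auto simp: dirichlet_character_def)
 then have "(%X. restrict X {..<q}) ` {X. dirichlet_character q X} \<subseteq> PiE {..<q} (%_. ?R)"
  by (intro image_subsetI restrict_PiE_iff[THEN iffD2] ballI) blast
 then have "finite ((%X. restrict X {..<q}) ` {X. dirichlet_character q X})"
  using fin finite_subset by blast
 moreover have "inj_on (%X. restrict X {..<q}) {X. dirichlet_character q X}"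
 proof (rule inj_onI, rule ext)
  fix X Y n assume A: "X \<in> {X. dirichlet_character q X}" "Y \<in> {X. dirichlet_character q X}"
   "restrict X {..<q} = restrict Y {..<q}"
  have "X (n mod q) = Y (n mod q)"
   using fun_cong[OF A(3), of "n mod q"] assms by simp
  moreover have "X n = X (n mod q)" "Y n = Y (n mod q)"
   using A(1,2) by (auto intro!: dirichlet_character_cong[of q] simp: cong_def)
  ultimately show "X n = Y n" by simp
 qed
 ultimately show ?thesis using finite_imageD by blast
qed

section \<open>Extending characters from subgroups of the unit group\<close>

text \<open>A character of a subgroup of the units modulo \<open>q\<close>. The subgroup is kept as
  a set of naturals closed under products and under congruence modulo \<open>q\<close>, so that no
  quotient has to be formed; outside \<open>H\<close> the values of \<open>f\<close> are
  arbitrary.\<close>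

definition partial_character :: "nat => nat set => (nat => complex) => bool" where
 "partial_character q H f \<longleftrightarrow> 1 \<in> H \<and> (\<forall>a\<in>H. coprime a q) \<and> (\<forall>a\<in>H. \<forall>b\<in>H. a * b \<in> H) \<and>
   (\<forall>a\<in>H. \<forall>b. [b = a] (mod q) --> b \<in> H \<and> f b = f a) \<and>
   f 1 = 1 \<and> (\<forall>a\<in>H. \<forall>b\<in>H. f (a * b) = f a * f b)"

lemma partial_characterD:
 assumes "partial_character q H f"
 shows "1 \<in> H" "f 1 = 1" "!!a. a \<in> H ==> coprime a q"
  "!!a b. a \<in> H ==> b \<in> H ==> a * b \<in> H" "!!a b. a \<in> H ==> b \<in> H ==> f (a * b) = f a * f b"
  "!!a b. a \<in> H ==> [b = a] (mod q) ==> b \<in> H" "!!a b. a \<in> H ==> [b = a] (mod q) ==> f b = f a"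
 using assms unfolding partial_character_def by blast+

lemma partial_character_power:
 assumes "partial_character q H f" "a \<in> H"
 shows "a ^ k \<in> H \<and> f (a ^ k) = f a ^ k"
proof (induction k)
 case 0
 then show ?case using partial_characterD(1,2)[OF assms(1)] by simp
next
 case (Suc k)
 then show ?case using partial_characterD(4,5)[OF assms(1) assms(2), of "a ^ k"] by simp
qed

lemma partial_character_nonzero:
 assumes "partial_character q H f" "a \<in> H" "q > 0"
 shows "f a ~= 0"
proof
 assume "f a = 0"
 have "coprime a q" using partial_characterD(3)[OF assms(1,2)] .
 then have "[a ^ totient q = 1] (mod q)" by (rule euler_theorem)
 from partial_characterD(7)[OF assms(1) partial_characterD(1)[OF assms(1)] this]
 have "f (a ^ totient q) = 1" unfolding partial_characterD(2)[OF assms(1)] .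
 then have "f a ^ totient q = 1" using partial_character_power[OF assms(1,2), of "totient q"] by metis
 then show False using \<open>f a = 0\<close> assms(3) by (simp add: zero_power)
qed

text \<open>Closure under products gives closure under division: by Euler's theorem
  \<open>a ^ (totient q - 1)\<close> is an inverse of \<open>a\<close>, and it lies in
  \<open>H\<close>.\<close>

lemma partial_character_cancel:
 assumes "partial_character q H f" "a \<in> H" "a * b \<in> H" "q > 0"
 shows "b \<in> H"
proof -
 have co: "coprime a q" using partial_characterD(3)[OF assms(1,2)] .
 have "a ^ (totient q - 1) * (a * b) \<in> H"
  using partial_character_power[OF assms(1,2)] assms(3) partial_characterD(4)[OF assms(1)] by blast
 moreover have "a ^ (totient q - 1) * (a * b) = a ^ totient q * b"
  using assms(4) by (simp add: power_eq_if[of a "totient q"] mult_ac)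
 moreover have "[b = a ^ totient q * b] (mod q)"
  using cong_scalar_right[OF euler_theorem[OF co], of b] by (simp add: cong_sym)
 ultimately show ?thesis using partial_characterD(6)[OF assms(1)] by metis
qed

text \<open>The group generated by \<open>H\<close> and \<open>g\<close> consists of the residues of
  \<open>h * g ^ j\<close>, and the extension must send them to \<open>f h * w ^ j\<close>.
  Minimality of \<open>m\<close> together with \<open>w ^ m = f (g ^ m)\<close> makes this well
  defined.\<close>

lemma partial_character_extend:
 assumes pc: "partial_character q H f" and q: "q > 0" and g: "coprime g q"
  and m: "m > 0" "g ^ m \<in> H" "!!r. 0 < r ==> r < m ==> g ^ r \<notin> H" and w: "w ^ m = f (g ^ m)"
 obtains H' f' where "partial_character q H' f'" "H \<subseteq> H'" "g \<in> H'" "f' g = w" "!!a. a \<in> H ==> f' a = f a"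
proof -
 let ?R = "%n z. \<exists>j. \<exists>h\<in>H. [n = h * g ^ j] (mod q) \<and> z = f h * w ^ j"
 have uniq0: "f h * w ^ j = f h' * w ^ j'"
  if "h \<in> H" "h' \<in> H" "[h * g ^ j = h' * g ^ j'] (mod q)" "j <= j'" for h h' j j'
 proof -
  define d where "d = j' - j"
  have j': "j' = d + j" using that d_def by simp
  have "coprime (g ^ j) q" using g by simp
  moreover have "[h * g ^ j = (h' * g ^ d) * g ^ j] (mod q)"
   using that(3) by (simp add: j' power_add mult_ac)
  ultimately have c: "[h = h' * g ^ d] (mod q)" using cong_mult_rcancel_nat by blast
  then have inH: "h' * g ^ d \<in> H" "f (h' * g ^ d) = f h"
   using partial_characterD(6,7)[OF pc that(1) cong_sym[OF c]] by auto
  then have gd: "g ^ d \<in> H" using partial_character_cancel[OF pc that(2) inH(1) q] by blast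
  have gm: "g ^ (m * (d div m)) \<in> H" "f (g ^ (m * (d div m))) = f (g ^ m) ^ (d div m)"
   using partial_character_power[OF pc m(2), of "d div m"] by (auto simp: power_mult)
  have "g ^ (m * (d div m)) * g ^ (d mod m) \<in> H"
   using gd by (metis mult_div_mod_eq power_add)
  \<comment> \<open>A power of \<open>g\<close> in \<open>H\<close> has an exponent divisible by
    \<open>m\<close>: otherwise the remainder modulo \<open>m\<close> would be a smaller admissible
    exponent.\<close>
  then have "g ^ (d mod m) \<in> H" using partial_character_cancel[OF pc gm(1) _ q] by blast
  then have "d mod m = 0" using m(3)[of "d mod m"] m(1) mod_less_divisor[of m d] by blast
  then have dm: "m * (d div m) = d" by auto
  have "f h = f h' * f (g ^ d)" using inH partial_characterD(5)[OF pc that(2) gd] by simp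
  also have "f (g ^ d) = w ^ d" using gm(2) unfolding dm w[symmetric] by (simp add: dm flip: power_mult)
  finally show ?thesis by (simp add: j' power_add)
 qed
 have uniq: "z = z'" if "?R n z" "?R n z'" for n z z'
 proof -
  from that obtain j h j' h' where *: "h \<in> H" "[n = h * g ^ j] (mod q)" "z = f h * w ^ j"
   "h' \<in> H" "[n = h' * g ^ j'] (mod q)" "z' = f h' * w ^ j'" by blast
  have c: "[h * g ^ j = h' * g ^ j'] (mod q)" using cong_trans[OF cong_sym[OF *(2)] *(5)] .
  show ?thesis using uniq0[OF *(1,4) c] uniq0[OF *(4,1) cong_sym[OF c]] *(3,6)
   by (cases "j <= j'") auto
 qed
 define H' where "H' = {n. \<exists>z. ?R n z}"
 define f' where "f' n = (THE z. ?R n z)" for n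
 have f'I: "f' n = z" if "?R n z" for n z
  unfolding f'_def using that uniq by blast
 have R1: "?R h (f h)" if "h \<in> H" for h
  using that by (intro exI[of _ 0] bexI[of _ h]) auto
 note one = partial_characterD(1,2)[OF pc]
 have Rg: "?R g w" using one by (intro exI[of _ 1] bexI[of _ 1]) auto
 have Rmult: "?R (a * b) (z * z')" if "?R a z" "?R b z'" for a b z z'
 proof -
  from that obtain j h j' h' where *: "h \<in> H" "[a = h * g ^ j] (mod q)" "z = f h * w ^ j"
   "h' \<in> H" "[b = h' * g ^ j'] (mod q)" "z' = f h' * w ^ j'" by blast
  have "[a * b = (h * g ^ j) * (h' * g ^ j')] (mod q)" using * cong_mult by blast
  then have "[a * b = (h * h') * g ^ (j + j')] (mod q)" by (simp add: power_add mult_ac)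
  moreover have "h * h' \<in> H" "f (h * h') = f h * f h'" using partial_characterD(4,5)[OF pc *(1,4)] by auto
  ultimately show ?thesis using * by (intro exI[of _ "j+j'"] bexI[of _ "h*h'"]) (auto simp: power_add)
 qed
 have Rcong: "?R b z" if "?R a z" "[b = a] (mod q)" for a b z
  using that by (meson cong_trans)
 have "partial_character q H' f'"
  unfolding partial_character_def
 proof (intro conjI ballI allI impI)
  show "1 \<in> H'" using R1[OF one(1)] unfolding H'_def by blast
  show "f' 1 = 1" using f'I[OF R1[OF one(1)]] one by simp
 next
  fix a assume "a \<in> H'"
  then obtain j h where "h \<in> H" "[a = h * g ^ j] (mod q)" unfolding H'_def by blast
  moreover have "coprime (h * g ^ j) q" using g partial_characterD(3)[OF pc \<open>h \<in> H\<close>] by auto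
  ultimately show "coprime a q" using cong_imp_coprime[of "h * g ^ j" a q] cong_sym by blast
 next
  fix a b assume "a \<in> H'" "b \<in> H'"
  then obtain z z' where z: "?R a z" "?R b z'" unfolding H'_def by blast
  then show "a * b \<in> H'" using Rmult unfolding H'_def by blast
  show "f' (a * b) = f' a * f' b" using f'I[OF Rmult[OF z]] f'I[OF z(1)] f'I[OF z(2)] by simp
 next
  fix a b assume "a \<in> H'" "[b = a] (mod q)"
  then obtain z where z: "?R a z" unfolding H'_def by blast
  then show "b \<in> H'" using Rcong[OF z \<open>[b = a] (mod q)\<close>] unfolding H'_def by blast
  show "f' b = f' a" using f'I[OF z] f'I[OF Rcong[OF z \<open>[b = a] (mod q)\<close>]] by simp
 qed
 moreover have "H \<subseteq> H'" using R1 unfolding H'_def by blast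
 moreover have "g \<in> H'" using Rg unfolding H'_def by blast
 moreover have "f' g = w" using f'I[OF Rg] .
 moreover have "f' a = f a" if "a \<in> H" for a using f'I[OF R1[OF that]] .
 ultimately show thesis using that by blast
qed

text \<open>Induction on the number of residues below \<open>q\<close> outside \<open>H\<close>.
  Each missing unit \<open>g\<close> is adjoined with any complex \<open>m\<close>-th root of
  \<open>f (g ^ m)\<close>; once \<open>H\<close> contains all units, extension by 0 is a Dirichlet
  character.\<close>

lemma partial_character_extend_all:
 assumes "partial_character q H f" "q > 0"
 obtains X where "dirichlet_character q X" "!!a. a \<in> H ==> X a = f a"
proof -
 have "\<exists>X. dirichlet_character q X \<and> (\<forall>a\<in>H. X a = f a)"
  using assms(1)
 proof (induction "card ({..<q} - H)" arbitrary: H f rule: less_induct)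
  case less
  note pc = less.prems
  show ?case
  proof (cases "\<exists>g. coprime g q \<and> g \<notin> H")
   case False
   define X where "X n = (if coprime n q then f n else 0)" for n
   have H: "coprime n q \<longleftrightarrow> n \<in> H" for n using False partial_characterD(3)[OF pc] by auto
   have per: "f (n + q) = f n" if "n \<in> H" for n
    by (rule partial_characterD(7)[OF pc that]) (simp add: cong_def)
   note co = coprime_add_modulus
   have nz: "f n ~= 0" if "n \<in> H" for n using partial_character_nonzero[OF pc that assms(2)] .
   have "dirichlet_character q X"
    unfolding dirichlet_character_def
   proof (intro conjI allI)
    show "X 1 = 1" using partial_characterD(2)[OF pc] by (auto simp: X_def)
    show "X (m * n) = X m * X n" for m n
     using partial_characterD(5)[OF pc, of m n] H[of m] H[of n] by (simp add: X_def)
    show "X (n + q) = X n" for n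
     using per[of n] H co by (auto simp: X_def)
    show "(X n = 0) = (\<not> coprime n q)" for n using nz H by (auto simp: X_def)
   qed
   moreover have "\<forall>a\<in>H. X a = f a" using H by (auto simp: X_def)
   ultimately show ?thesis by blast
  next
   case True
   then obtain g where g: "coprime g q" "g \<notin> H" by blast
   note one = partial_characterD(1)[OF pc]
   let ?P = "%m. m > 0 \<and> g ^ m \<in> H"
   have "?P (totient q)" using partial_characterD(6)[OF pc one euler_theorem[OF g(1)]] assms(2) by simp
   then have m: "?P (LEAST m. ?P m)" by (rule LeastI)
   define m where "m = (LEAST m. ?P m)"
   have mm: "0 < r ==> r < m ==> g ^ r \<notin> H" for r unfolding m_def using not_less_Least by blast
   obtain w where w: "w ^ m = f (g ^ m)"
   proof -
    define c where "c = f (g ^ m)"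
    have "c ~= 0" using partial_character_nonzero[OF pc conjunct2[OF m] assms(2)] unfolding c_def m_def .
    have "exp (Ln c / of_nat m) ^ m = c"
     using m \<open>c ~= 0\<close> unfolding m_def[symmetric]
     by (simp flip: exp_of_nat_mult)
    then show ?thesis using that c_def by blast
   qed
   obtain H' f' where H': "partial_character q H' f'" "H \<subseteq> H'" "g \<in> H'" "!!a. a \<in> H ==> f' a = f a"
    using partial_character_extend[OF pc assms(2) g(1) conjunct1[OF m[folded m_def]] conjunct2[OF m[folded m_def]] mm w] by metis
   have "g mod q \<in> H'" by (rule partial_characterD(6)[OF H'(1,3)]) (simp add: cong_def)
   moreover have "g mod q \<notin> H" using g(2) partial_characterD(6)[OF pc, of "g mod q" g]
    by (auto simp: cong_def)
   moreover have "g mod q \<in> {..<q}" using assms(2) by simp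
   ultimately have "{..<q} - H' \<subset> {..<q} - H" using H'(2) by blast
   then have "card ({..<q} - H') < card ({..<q} - H)" by (intro psubset_card_mono) auto
   from less.hyps[OF this H'(1)] show ?thesis using H'(2,4) by (auto simp: subset_iff)
  qed
 qed
 then show thesis using that by blast
qed

text \<open>The residue class of 1 carries the trivial character. It is extended to \<open>a\<close>
  by a primitive root of unity of order \<open>m > 1\<close>, the order of \<open>a\<close> modulo
  \<open>q\<close>, and from there to all units.\<close>

lemma dirichlet_character_separates:
 assumes "q > 0" "coprime a q" "\<not> [a = 1] (mod q)"
 obtains X where "dirichlet_character q X" "X a ~= 1"
proof -
 define H where "H = {n. [n = 1] (mod q)}"
 have pc: "partial_character q H (%_. 1::complex)"
  unfolding partial_character_def H_def
 proof (intro conjI ballI allI impI)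
  show "coprime a q" if "a \<in> {n. [n = 1] (mod q)}" for a
   using that cong_imp_coprime[of 1 a q] by (auto simp: cong_sym_eq)
  show "a * b \<in> {n. [n = 1] (mod q)}" if "a \<in> {n. [n = 1] (mod q)}" "b \<in> {n. [n = 1] (mod q)}" for a b
   using that cong_mult[of a 1 q b 1] by auto
  show "b \<in> {n. [n = 1] (mod q)}" if "a \<in> {n. [n = 1] (mod q)}" "[b = a] (mod q)" for a b
   using that cong_trans[of b a q 1] by auto
 qed auto
 let ?P = "%m. m > 0 \<and> a ^ m \<in> H"
 have "?P (totient q)" using euler_theorem[OF assms(2)] assms(1) by (simp add: H_def)
 then have m: "?P (LEAST m. ?P m)" by (rule LeastI)
 define m where "m = (LEAST m. ?P m)"
 have mm: "0 < r ==> r < m ==> a ^ r \<notin> H" for r unfolding m_def using not_less_Least by blast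
 have "m ~= 1" using m assms(3) unfolding m_def[symmetric] by (auto simp: H_def)
 then have m2: "m > 1" using m unfolding m_def[symmetric] by linarith
 define w :: complex where "w = cis (2 * pi / real m)"
 have "real m * (2 * pi / real m) = 2 * pi" using m2 by simp
 then have wm: "w ^ m = 1" unfolding w_def Complex.DeMoivre by (metis cis_2pi)
 have w1: "w ~= 1"
 proof
  assume "w = 1"
  then have "cos (2 * pi / real m) = 1" unfolding w_def by (metis Re_complex_of_real cis.sel(1) of_real_1)
  moreover have "0 < 2 * pi / real m" "2 * pi / real m < 2 * pi" using m2 by (auto simp: field_simps)
  ultimately show False using cos_monotone_0_pi[of 0 "2 * pi / real m"] cos_monotone_0_pi[of 0 "2 * pi - 2 * pi / real m"]
   by (cases "2 * pi / real m <= pi") auto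
 qed
 obtain H' f' where H': "partial_character q H' f'" "a \<in> H'" "f' a = w"
  using partial_character_extend[OF pc assms(1,2) conjunct1[OF m[folded m_def]] conjunct2[OF m[folded m_def]] mm wm] by metis
 obtain X where "dirichlet_character q X" "!!b. b \<in> H' ==> X b = f' b"
  using partial_character_extend_all[OF H'(1) assms(1)] by blast
 then show thesis using that H' w1 by metis
qed

section \<open>Orthogonality relations\<close>

text \<open>Multiplication by a unit \<open>b\<close> with \<open>X b\<close> different from 1
  permutes the residues but multiplies the sum by \<open>X b\<close>, so the sum vanishes.\<close>

lemma sum_coprime_dirichlet_character:
 assumes q: "q > 0" and X: "dirichlet_character q X"
 shows "(\<Sum>a<q. X a) = (if X = principal_character q then of_nat (totient q) else 0)"
proof (cases "X = principal_character q")
 case True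
 have "(\<Sum>a<q. X a) = (\<Sum>a\<in>{a. a < q \<and> coprime a q}. 1)"
  unfolding True principal_character_def by (rule sum.mono_neutral_cong_right) auto
 also have "card {a. a < q \<and> coprime a q} = totient q"
 proof (cases "q = 1")
  case False
  have "{a. a < q \<and> coprime a q} = totatives q"
   using q False by (auto simp: totatives_def intro!: Nat.gr0I le_neq_implies_less)
  then show ?thesis by (simp add: totient_def)
 qed (auto)
 ultimately show ?thesis using True by simp
next
 case False
 then obtain b where b: "X b ~= principal_character q b" by blast
 then have co: "coprime b q" "X b ~= 1" using X
  by (auto simp: principal_character_def dirichlet_character_def split: if_splits)
 have bij: "bij_betw (%a. (b * a) mod q) {..<q} {..<q}"
 proof (rule bij_betwI')
  fix x y assume "x \<in> {..<q}" "y \<in> {..<q}"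
  then show "(b * x mod q = b * y mod q) = (x = y)"
   using co cong_mult_lcancel_nat[of b q x y] by (auto simp: cong_def)
 next
  fix x assume "x \<in> {..<q}" then show "b * x mod q \<in> {..<q}" using q by auto
 next
  fix y assume y: "y \<in> {..<q}"
  obtain c where c: "[b * c = 1] (mod q)" using cong_solve_coprime_nat[OF co(1)] by auto
  have "[b * (c * y) = y] (mod q)" using cong_scalar_right[OF c, of y] by (simp add: mult_ac)
  then have "y = b * (c * y mod q) mod q" using y by (simp add: cong_def mod_mult_right_eq)
  then show "\<exists>x\<in>{..<q}. y = b * x mod q" using q by (metis lessThan_iff mod_less_divisor)
 qed
 have "(\<Sum>a<q. X a) = (\<Sum>a<q. X ((b * a) mod q))"
  using sum.reindex_bij_betw[OF bij, of X] by simp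
 also have "... = (\<Sum>a<q. X b * X a)"
 proof (rule sum.cong)
  fix a
  have "X ((b * a) mod q) = X (b * a)" by (rule dirichlet_character_cong[OF X]) (simp add: cong_def)
  then show "X ((b * a) mod q) = X b * X a" using X by (simp add: dirichlet_character_def)
 qed simp
 also have "... = X b * (\<Sum>a<q. X a)" by (simp add: sum_distrib_left)
 finally show ?thesis using co False by (simp add: mult_cancel_right1)
qed

text \<open>For \<open>a\<close> not congruent to 1 a separating character makes the sum vanish. The
  value at 1, the number of characters, is found by evaluating the double sum over characters and
  residues in both orders.\<close>

lemma sum_over_characters:
 assumes q: "q > 0"
 shows "(\<Sum>X | dirichlet_character q X. X a) = (if [a = 1] (mod q) then of_nat (totient q) else 0)"
proof -
 let ?C = "{X. dirichlet_character q X}"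
 have fin: "finite ?C" by (rule finite_dirichlet_characters[OF q])
 have ne: "(\<Sum>X\<in>?C. X b) = 0" if nb: "\<not> [b = 1] (mod q)" for b
 proof (cases "coprime b q")
  case False
  then show ?thesis by (intro sum.neutral) (auto simp: dirichlet_character_def)
 next
  case True
  obtain Y where Y: "dirichlet_character q Y" "Y b ~= 1"
   using dirichlet_character_separates[OF q True nb] by metis
  have YY: "Y n * cnj (Y n) = principal_character q n" for n
   using norm_dirichlet_character[OF Y(1) q, of n]
   by (auto simp: principal_character_def complex_norm_square[symmetric] split: if_splits)
  have pX: "principal_character q n * X n = X n" if "X \<in> ?C" for X n
   using that by (auto simp: principal_character_def dirichlet_character_def)
  \<comment> \<open>Multiplication by the separating character \<open>Y\<close> permutes the
    characters; its inverse is multiplication by the conjugate, because every character vanishes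
    where \<open>principal_character q\<close> does.\<close>
  have bij: "bij_betw (%X n. Y n * X n) ?C ?C"
  proof (rule bij_betwI[where g = "%X n. cnj (Y n) * X n"])
   show "(%X n. Y n * X n) \<in> ?C \<rightarrow> ?C" using Y by (auto intro: dirichlet_character_mult)
   show "(%X n. cnj (Y n) * X n) \<in> ?C \<rightarrow> ?C"
    using dirichlet_character_cnj[OF Y(1)] by (auto intro: dirichlet_character_mult)
  next
   fix X assume "X \<in> ?C"
   then show "(%n. cnj (Y n) * (Y n * X n)) = X"
    using YY pX by (metis (no_types, lifting) ext mult.assoc mult.commute)
   show "(%n. Y n * (cnj (Y n) * X n)) = X"
    using YY pX \<open>X \<in> ?C\<close> by (metis (no_types, lifting) ext mult.assoc)
  qed
  have "(\<Sum>X\<in>?C. X b) = (\<Sum>X\<in>?C. Y b * X b)"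
   using sum.reindex_bij_betw[OF bij, of "%X. X b"] by simp
  then have "(\<Sum>X\<in>?C. X b) = Y b * (\<Sum>X\<in>?C. X b)" using sum_distrib_left[of "Y b" "%X. X b" ?C] by simp
  then show ?thesis using Y(2) by (simp add: mult_cancel_right1)
 qed
 have X1: "X 1 = 1" if "X \<in> ?C" for X using that by (auto simp: dirichlet_character_def)
 have one: "(\<Sum>X\<in>?C. X b) = (\<Sum>X\<in>?C. 1)" if "[b = 1] (mod q)" for b
 proof (rule sum.cong)
  fix X assume X: "X \<in> ?C"
  then show "X b = 1" using dirichlet_character_cong[OF _ that, of X] X1[OF X] by simp
 qed simp
 have "(\<Sum>b<q. \<Sum>X\<in>?C. X b) = (\<Sum>X\<in>?C. \<Sum>b<q. X b)" by (rule sum.swap)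
 also have "... = (\<Sum>X\<in>?C. if X = principal_character q then of_nat (totient q) else 0)"
  using sum_coprime_dirichlet_character[OF q] by (intro sum.cong) auto
 also have "... = of_nat (totient q)"
  using fin dirichlet_character_principal by (subst sum.delta) auto
 finally have A: "(\<Sum>b<q. \<Sum>X\<in>?C. X b) = of_nat (totient q)" .
 have "(\<Sum>b<q. \<Sum>X\<in>?C. X b) = (\<Sum>b\<in>{1 mod q}. \<Sum>X\<in>?C. X b)"
  using q by (intro sum.mono_neutral_right ballI) (auto intro!: ne simp: cong_def)
 also have "... = (\<Sum>X\<in>?C. 1)" using one[of "1 mod q"] by (simp add: cong_def)
 finally have "(\<Sum>X\<in>?C. 1) = (of_nat (totient q) :: complex)" using A by simp
 then show ?thesis using ne one by auto
qed

text \<open>The conjugate of \<open>X n\<close> is the value of \<open>X\<close> at the inverse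
  \<open>n ^ (totient q - 1)\<close> of \<open>n\<close>, which reduces the claim to
  \<open>sum_over_characters\<close>.\<close>

lemma orthogonality_characters:
 assumes q: "q > 0" and "coprime n q"
 shows "(\<Sum>X | dirichlet_character q X. X m * cnj (X n)) = (if [m = n] (mod q) then of_nat (totient q) else 0)"
proof -
 let ?n = "n ^ (totient q - 1)"
 have nn: "n * ?n = n ^ totient q" using q by (simp add: power_eq_if[of n "totient q"])
 have c1: "[n * ?n = 1] (mod q)" unfolding nn by (rule euler_theorem[OF assms(2)])
 have "X m * cnj (X n) = X (m * ?n)" if X: "dirichlet_character q X" for X
 proof -
  have "X n * X ?n = 1"
   using dirichlet_character_cong[OF X c1] X by (metis dirichlet_character_def)
  moreover have "X n * cnj (X n) = 1"
   using norm_dirichlet_character[OF X q, of n] assms(2) by (simp add: complex_norm_square[symmetric])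
  ultimately have "cnj (X n) = X ?n" by (metis mult.left_commute mult.right_neutral)
  then show ?thesis using X by (simp add: dirichlet_character_def)
 qed
 then have "(\<Sum>X | dirichlet_character q X. X m * cnj (X n)) = (\<Sum>X | dirichlet_character q X. X (m * ?n))"
  by (intro sum.cong) auto
 also have "... = (if [m * ?n = 1] (mod q) then of_nat (totient q) else 0)"
  by (rule sum_over_characters[OF q])
 also have "[m * ?n = 1] (mod q) \<longleftrightarrow> [m = n] (mod q)"
 proof
  assume "[m * ?n = 1] (mod q)"
  from cong_scalar_right[OF this, of n] have "[m * (n * ?n) = n] (mod q)" by (simp add: mult_ac)
  moreover have "[m * (n * ?n) = m] (mod q)" using cong_scalar_left[OF c1, of m] by simp
  ultimately show "[m = n] (mod q)" by (meson cong_sym cong_trans)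
 next
  assume "[m = n] (mod q)"
  from cong_scalar_right[OF this, of ?n] c1 show "[m * ?n = 1] (mod q)" by (meson cong_trans)
 qed
 finally show ?thesis .
qed

lemma sum_nonprincipal_characters:
 assumes q: "q > 0"
 shows "(\<Sum>X\<in>{X. dirichlet_character q X} - {principal_character q}. X a)
  = of_nat (totient q) * ((if [a = 1] (mod q) then 1 else 0) - principal_character q a / of_nat (totient q))"
 using finite_dirichlet_characters[OF q] sum_over_characters[OF q, of a] dirichlet_character_principal[of q] q
 by (subst sum_diff1) (auto simp: right_diff_distrib)

lemma card_dirichlet_characters:
 assumes q: "q > 0"
 shows "card {X. dirichlet_character q X} = totient q"
proof -
 have "(\<Sum>X | dirichlet_character q X. X 1) = of_nat (card {X. dirichlet_character q X})"
  by (subst sum.cong[OF refl, of _ _ "%_. 1"]) (auto simp: dirichlet_character_def)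
 then have "(of_nat (card {X. dirichlet_character q X}) :: complex) = of_nat (totient q)"
  using sum_over_characters[OF q, of 1] by simp
 then show ?thesis by (simp only: of_nat_eq_iff)
qed

section \<open>Dirichlet series and the continuation of L-functions\<close>

text \<open>Differences are taken in the form f(x) - f(x + 1). Each one gains a power of x, so the
  series of \<open>k\<close>-fold differences against bounded coefficients converges for Re s > 1 -
  k.\<close>

fun power_difference :: "nat => complex => real => complex" where
 "power_difference 0 s x = of_real x powr (-s)"
| "power_difference (Suc k) s x = power_difference k s x - power_difference k s (x + 1)"

lemma power_difference_has_vector_derivative:
 assumes "x > 0"
 shows "((power_difference k s) has_vector_derivative (-s * power_difference k (s + 1) x)) (at x)"
 using assms
proof (induction k arbitrary: x)
 case 0
 have "((%z. z powr (-s)) has_field_derivative (-s) * of_real x powr (-s - 1)) (at (complex_of_real x))"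
  using 0 by (intro has_field_derivative_powr) (auto simp: complex_nonpos_Reals_iff)
 from has_vector_derivative_real_field[OF this] show ?case by (simp add: minus_diff_commute)
next
 case (Suc k)
 have "((%x. power_difference k s (x + 1)) has_vector_derivative (1 *\<^sub>R (-s * power_difference k (s + 1) (x + 1)))) (at x)"
  using vector_diff_chain_at[of "%x. x + 1" 1 x "power_difference k s" "-s * power_difference k (s + 1) (x + 1)"]
   Suc.IH[of "x + 1"] Suc.prems
  by (simp add: o_def has_vector_derivative_add_const)
 from has_vector_derivative_diff[OF Suc.IH[OF Suc.prems] this] show ?case
  by (simp add: algebra_simps)
qed

text \<open>Induction with the mean value theorem: the derivative of the \<open>k\<close>-fold
  difference at \<open>s\<close> is \<open>-s\<close> times the one at \<open>s + 1\<close>, and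
  these factors build up the Pochhammer symbol.\<close>

lemma norm_power_difference_le:
 assumes "x >= 1" "Re s + real k >= 0"
 shows "norm (power_difference k s x) <= norm (pochhammer s k) * x powr (-(Re s + real k))"
 using assms
proof (induction k arbitrary: s x)
 case 0
 then show ?case by (simp add: norm_powr_real_powr)
next
 case (Suc k)
 have der: "(power_difference k s has_derivative (%h. h *\<^sub>R (-s * power_difference k (s + 1) y))) (at y)" if "y > 0" for y
  using power_difference_has_vector_derivative[OF that, of k s] unfolding has_vector_derivative_def .
 have "\<exists>y\<in>{x<..<x+1}. norm (power_difference k s (x+1) - power_difference k s x) <= norm ((x+1-x) *\<^sub>R (-s * power_difference k (s + 1) y))"
 proof (rule mvt_general)
  show "continuous_on {x..x+1} (power_difference k s)"
   using Suc.prems by (intro continuous_at_imp_continuous_on ballI has_derivative_continuous[OF der]) auto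
 qed (use der Suc.prems in auto)
 then obtain y where y: "y \<in> {x<..<x+1}" "norm (power_difference k s (x+1) - power_difference k s x) <= norm s * norm (power_difference k (s + 1) y)"
  by (auto simp: norm_mult)
 have "norm (power_difference k (s + 1) y) <= norm (pochhammer (s+1) k) * y powr (-(Re (s+1) + real k))"
  using Suc.prems y by (intro Suc.IH) auto
 also have "... <= norm (pochhammer (s+1) k) * x powr (-(Re (s+1) + real k))"
  using Suc.prems y by (intro mult_left_mono powr_mono2') auto
 finally have "norm s * norm (power_difference k (s + 1) y) <= norm s * (norm (pochhammer (s+1) k) * x powr (-(Re (s+1) + real k)))"
  by (intro mult_left_mono) auto
 then show ?case using y(2) by (simp add: pochhammer_rec norm_mult norm_minus_commute algebra_simps)
qed

lemma power_difference_holomorphic [holomorphic_intros]: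
 fixes x :: real
 shows "x > 0 ==> (%s. power_difference k s x) holomorphic_on A"
 by (induction k arbitrary: x) (auto intro!: holomorphic_intros)

lemma holomorphic_on_suminf:
 fixes f :: "nat => complex => complex"
 assumes "open S" "!!n. f n holomorphic_on S"
  and "!!x. x \<in> S ==> \<exists>d M. 0 < d \<and> summable M \<and> (\<forall>n. \<forall>y\<in>ball x d \<inter> S. norm (f n y) <= M n)"
 shows "(%s. \<Sum>n. f n s) holomorphic_on S"
  and "!!s. s \<in> S ==> ((%s. \<Sum>n. f n s) has_field_derivative (\<Sum>n. deriv (f n) s)) (at s)"
  and "!!s. s \<in> S ==> summable (%n. deriv (f n) s)"
proof -
 have "\<exists>g g'. \<forall>x \<in> S. ((%n. f n x) sums g x) \<and> ((%n. deriv (f n) x) sums g' x) \<and> (g has_field_derivative g' x) (at x)"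
 proof (rule series_and_derivative_comparison_local[OF assms(1)])
  show "!!n x. x \<in> S ==> (f n has_field_derivative deriv (f n) x) (at x)"
   using holomorphic_derivI[OF assms(2,1)] by blast
  show "\<exists>d h. 0 < d \<and> summable h \<and> (\<forall>\<^sub>F n in sequentially. \<forall>y\<in>ball x d \<inter> S. norm (f n y) <= h n)"
   if "x \<in> S" for x using assms(3)[OF that] eventually_sequentially by blast
 qed
 then obtain g g' where g: "!!x. x \<in> S ==> (%n. f n x) sums g x" "!!x. x \<in> S ==> (%n. deriv (f n) x) sums g' x"
  "!!x. x \<in> S ==> (g has_field_derivative g' x) (at x)" by blast
 have eq: "(\<Sum>n. f n s) = g s" if "s \<in> S" for s using g(1)[OF that] by (rule sums_unique[symmetric])
 show der: "((%s. \<Sum>n. f n s) has_field_derivative (\<Sum>n. deriv (f n) s)) (at s)" if "s \<in> S" for s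
 proof -
  have "((%s. \<Sum>n. f n s) has_field_derivative g' s) (at s)"
   using g(3)[OF that] by (rule has_field_derivative_transform_within_open[OF _ assms(1) that]) (simp add: eq)
  then show ?thesis using sums_unique[OF g(2)[OF that]] by simp
 qed
 show "(%s. \<Sum>n. f n s) holomorphic_on S"
  using der assms(1) holomorphic_on_open by blast
 show "!!s. s \<in> S ==> summable (%n. deriv (f n) s)" using g(2) sums_summable by blast
qed

lemma periodic_mod:
 fixes x :: "nat => 'a"
 assumes "!!n. x (n + q) = x n"
 shows "x n = x (n mod q)"
proof -
 have *: "x (a + k * q) = x a" for a k
 proof (induction k)
  case (Suc k)
  have "x (a + Suc k * q) = x (a + k * q + q)" by (simp add: algebra_simps)
  then show ?case using Suc assms by simp
 qed simp
 show ?thesis using *[of "n mod q" "n div q"] by (simp add: mult.commute)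
qed

lemma periodic_bounded:
 fixes x :: "nat => complex"
 assumes "!!n. x (n + q) = x n" "q > 0"
 shows "norm (x n) <= (\<Sum>i<q. norm (x i))"
 by (subst periodic_mod[of x q, OF assms(1)], rule member_le_sum) (use assms(2) in auto)

lemma summable_powr_Suc:
 assumes "a > (1::real)" shows "summable (%n. real (Suc n) powr (-a))"
 by (subst summable_Suc_iff) (use assms in \<open>simp add: summable_real_powr_iff\<close>)

lemma power_difference_series_holomorphic:
 assumes x: "!!n. norm (x n) <= B"
 shows "(%s. \<Sum>n. x n * power_difference k s (real (Suc n))) holomorphic_on {s. Re s > 1 - real k}" (is ?A)
  and "!!s. Re s > 1 - real k ==> summable (%n. x n * power_difference k s (real (Suc n)))"
proof -
 have B: "B >= 0" using x[of 0] norm_ge_zero order_trans by blast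
 let ?S = "{s. Re s > 1 - real k}"
 have op: "open ?S" by (simp add: open_halfspace_Re_gt)
 have loc: "\<exists>d M. 0 < d \<and> summable M \<and> (\<forall>n. \<forall>y\<in>ball s d \<inter> ?S. norm (x n * power_difference k y (real (Suc n))) <= M n)"
  if "s \<in> ?S" for s
 proof -
  \<comment> \<open>Half the distance from \<open>s\<close> to the boundary of the half-plane, so
    that \<open>Re y + real k >= 1 + d\<close> on the ball of radius \<open>d\<close>.\<close>
  define d where "d = (Re s + real k - 1) / 2"
  have d: "d > 0" using that by (simp add: d_def)
  have "compact ((%z. pochhammer z k) ` cball s d)"
   by (intro compact_continuous_image continuous_intros) auto
  then obtain C where C: "!!z. z \<in> cball s d ==> norm (pochhammer z k) <= C"
   by (meson compact_imp_bounded bounded_iff imageI)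
  have C0: "C >= 0" using order_trans[OF norm_ge_zero C[of s]] d by simp
  have "summable (%n. B * (C * real (Suc n) powr (-(1 + d))))"
   using d by (intro summable_mult summable_powr_Suc) auto
  moreover have "norm (x n * power_difference k y (real (Suc n))) <= B * (C * real (Suc n) powr (-(1 + d)))"
   if "y \<in> ball s d \<inter> ?S" for n y
  proof -
   have "norm (s - y) < d" using that by (simp add: dist_norm)
   then have "Re s - Re y < d" using abs_Re_le_cmod[of "s - y"] unfolding minus_complex.sel by linarith
   moreover have "Re s + real k = 2 * d + 1" by (simp add: d_def field_simps)
   ultimately have Re: "Re y + real k >= 1 + d" by linarith
   have "norm (power_difference k y (real (Suc n))) <= norm (pochhammer y k) * real (Suc n) powr (-(Re y + real k))"
    using Re d by (intro norm_power_difference_le) auto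
   also have "... <= C * real (Suc n) powr (-(1 + d))"
    using that Re C0 by (intro mult_mono C powr_mono) auto
   finally show ?thesis unfolding norm_mult using x[of n] B by (intro mult_mono) auto
  qed
  ultimately show ?thesis using d by blast
 qed
 show ?A
  by (rule holomorphic_on_suminf[OF op _ loc]) (auto intro!: holomorphic_intros)
 show "summable (%n. x n * power_difference k s (real (Suc n)))" if sk: "Re s > 1 - real k" for s
 proof -
  have sS: "s \<in> ?S" using sk by simp
  from loc[OF sS] obtain d M where d: "0 < d" and M: "summable M"
   and bd: "\<forall>n. \<forall>y\<in>ball s d \<inter> ?S. norm (x n * power_difference k y (real (Suc n))) <= M n"
   by (elim exE conjE)
  have "s \<in> ball s d \<inter> ?S" using d sS by simp
  then have "norm (x n * power_difference k s (real (Suc n))) <= M n" for n using bd by blast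
  then show ?thesis by (intro summable_comparison_test[OF exI[of _ 0] M] allI impI)
 qed
qed

lemma power_difference_tendsto_0:
 assumes "Re s + real k > 0"
 shows "(%n. power_difference k s (real (Suc n))) \<longlonglongrightarrow> 0"
proof (rule Lim_null_comparison)
 show "\<forall>\<^sub>F n in sequentially. norm (power_difference k s (real (Suc n))) <= norm (pochhammer s k) * real (Suc n) powr (-(Re s + real k))"
  using assms by (intro always_eventually allI norm_power_difference_le) auto
 have "(%n. real (Suc n) powr (-(Re s + real k))) \<longlonglongrightarrow> 0"
  using assms by (intro tendsto_neg_powr filterlim_compose[OF filterlim_real_sequentially filterlim_Suc]) auto
 then show "(%n. norm (pochhammer s k) * real (Suc n) powr (-(Re s + real k))) \<longlonglongrightarrow> 0"
  by (rule tendsto_mult_right_zero)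
qed

lemma summation_by_parts:
 fixes x d :: "nat => complex"
 shows "(\<Sum>n<N. x n * d n) = (\<Sum>n<N. (\<Sum>i\<le>n. x i) * (d n - d (Suc n))) + (\<Sum>i<N. x i) * d N"
 by (induction N) (auto simp: algebra_simps lessThan_Suc_atMost[symmetric])

lemma periodic_partial_sums:
 fixes x :: "nat => complex"
 assumes per: "!!n. x (n + q) = x n" and zero: "(\<Sum>i<q. x i) = 0"
 shows "(\<Sum>i\<le>n + q. x i) = (\<Sum>i\<le>n. x i)"
proof -
 have "{..n + q} = {..<q} \<union> (%i. i + q) ` {..n}"
  by (auto simp: image_iff) (metis add.commute add_le_cancel_left atMost_iff le_add_diff_inverse linorder_not_less)
 then have "(\<Sum>i\<le>n + q. x i) = (\<Sum>i<q. x i) + (\<Sum>i\<in>(%i. i + q) ` {..n}. x i)"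
  by (simp, subst sum.union_disjoint) auto
 also have "(\<Sum>i\<in>(%i. i + q) ` {..n}. x i) = (\<Sum>i\<le>n. x (i + q))"
  by (subst sum.reindex) auto
 finally show ?thesis using per zero by simp
qed

text \<open>One summation by parts; the boundary term disappears because the partial sums are
  bounded and the differences tend to 0.\<close>

lemma abel_power_difference:
 fixes x :: "nat => complex"
 assumes B: "!!n. norm (\<Sum>i\<le>n. x i) <= B" and s: "Re s + real k > 0"
 shows "(%n. x n * power_difference k s (real (Suc n))) sums (\<Sum>n. (\<Sum>i\<le>n. x i) * power_difference (Suc k) s (real (Suc n)))"
proof -
 let ?d = "%n. power_difference k s (real (Suc n))"
 have dd: "?d n - ?d (Suc n) = power_difference (Suc k) s (real (Suc n))" for n by (simp add: add_ac)
 have "(%N. \<Sum>n<N. (\<Sum>i\<le>n. x i) * power_difference (Suc k) s (real (Suc n))) \<longlonglongrightarrow> (\<Sum>n. (\<Sum>i\<le>n. x i) * power_difference (Suc k) s (real (Suc n)))"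
  using power_difference_series_holomorphic(2)[of "%n. \<Sum>i\<le>n. x i" B "Suc k" s] B s
  by (intro summable_LIMSEQ) auto
 moreover have "(%N. (\<Sum>i<N. x i) * ?d N) \<longlonglongrightarrow> 0"
 proof (rule Lim_null_comparison)
  show "\<forall>\<^sub>F N in sequentially. norm ((\<Sum>i<N. x i) * ?d N) <= B * norm (?d N)"
  proof (intro always_eventually allI)
   fix N
   have "norm (\<Sum>i<N. x i) <= B"
    using B[of "N - 1"] order_trans[OF norm_ge_zero B[of 0]]
    by (cases N) (auto simp: lessThan_Suc_atMost simp del: sum.lessThan_Suc)
   then show "norm ((\<Sum>i<N. x i) * ?d N) <= B * norm (?d N)"
    unfolding norm_mult by (intro mult_right_mono) auto
  qed
  show "(%N. B * norm (?d N)) \<longlonglongrightarrow> 0"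
   using power_difference_tendsto_0[OF s] by (intro tendsto_mult_right_zero tendsto_norm_zero)
 qed
 ultimately have "(%N. (\<Sum>n<N. (\<Sum>i\<le>n. x i) * power_difference (Suc k) s (real (Suc n))) + (\<Sum>i<N. x i) * ?d N) \<longlonglongrightarrow> (\<Sum>n. (\<Sum>i\<le>n. x i) * power_difference (Suc k) s (real (Suc n))) + 0"
  by (rule tendsto_add)
 moreover have "(\<Sum>n<N. x n * ?d n) = (\<Sum>n<N. (\<Sum>i\<le>n. x i) * power_difference (Suc k) s (real (Suc n))) + (\<Sum>i<N. x i) * ?d N" for N
  using summation_by_parts[of x ?d N] unfolding dd .
 ultimately show ?thesis unfolding sums_def by (simp del: power_difference.simps)
qed

text \<open>Each summation by parts moves the half-plane one unit to the left and replaces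
  \<open>x\<close> by its partial sums \<open>A\<close>, which are again periodic. Subtracting their
  mean \<open>c\<close> restores mean zero, so that the step can be repeated, while the constant
  part telescopes to \<open>c * power_difference k s 1\<close>.\<close>

lemma periodic_series_continuation:
 fixes x :: "nat => complex"
 assumes "q > 0" "!!n. x (n + q) = x n" "(\<Sum>i<q. x i) = 0"
 shows "\<exists>G. G holomorphic_on {s. Re s > 1 - real K - real k} \<and>
   (\<forall>s. Re s > 1 --> G s = (\<Sum>n. x n * power_difference k s (real (Suc n))))"
 using assms(2,3)
proof (induction K arbitrary: x k)
 case 0
 have "norm (x n) <= (\<Sum>i<q. norm (x i))" for n
  using periodic_bounded[of x q] 0 assms(1) by auto
 then have "(%s. \<Sum>n. x n * power_difference k s (real (Suc n))) holomorphic_on {s. Re s > 1 - real k}"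
  by (rule power_difference_series_holomorphic(1))
 then show ?case by auto
next
 case (Suc K)
 define A where "A n = (\<Sum>i\<le>n. x i)" for n
 define c where "c = (\<Sum>i<q. A i) / of_nat q"
 have Aper: "A (n + q) = A n" for n
  unfolding A_def using periodic_partial_sums[of x q n] Suc.prems by blast
 have A0: "(\<Sum>i<q. (A i - c)) = 0" using assms(1) by (simp add: sum_subtractf c_def)
 have Ab: "norm (A n) <= (\<Sum>i<q. norm (A i))" for n
  using periodic_bounded[of A q n] Aper assms(1) by auto
 have Ab2: "norm (A n - c) <= (\<Sum>i<q. norm (A i)) + norm c" for n
  using Ab[of n] norm_triangle_ineq4[of "A n" c] by linarith
 obtain G where G: "G holomorphic_on {s. Re s > 1 - real K - real (Suc k)}"
  "!!s. Re s > 1 ==> G s = (\<Sum>n. (A n - c) * power_difference (Suc k) s (real (Suc n)))"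
  using Suc.IH[of "%n. A n - c" "Suc k"] Aper A0 by auto
 have "c * power_difference k s 1 + G s = (\<Sum>n. x n * power_difference k s (real (Suc n)))" if s: "Re s > 1" for s
 proof -
  have k: "Re s + real k > 0" using s by simp
  have "(%n. power_difference k s (real (Suc n)) - power_difference k s (real (Suc (Suc n)))) sums (power_difference k s (real (Suc 0)) - 0)"
   by (rule telescope_sums'[OF power_difference_tendsto_0[OF k]])
  then have 1: "(%n. c * power_difference (Suc k) s (real (Suc n))) sums (c * power_difference k s 1)"
   by (intro sums_mult) (simp add: add_ac)
  have 2: "(%n. (A n - c) * power_difference (Suc k) s (real (Suc n))) sums G s"
   unfolding G(2)[OF s] using s
   by (intro summable_sums power_difference_series_holomorphic(2)[of "%n. A n - c", OF Ab2]) auto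
  have "(%n. c * power_difference (Suc k) s (real (Suc n)) + (A n - c) * power_difference (Suc k) s (real (Suc n))) sums (c * power_difference k s 1 + G s)"
   by (rule sums_add[OF 1 2])
  then have "(%n. A n * power_difference (Suc k) s (real (Suc n))) sums (c * power_difference k s 1 + G s)"
   by (simp add: algebra_simps del: power_difference.simps)
  then have "c * power_difference k s 1 + G s = (\<Sum>n. A n * power_difference (Suc k) s (real (Suc n)))" by (rule sums_unique)
  also have "... = (\<Sum>n. x n * power_difference k s (real (Suc n)))"
   using abel_power_difference[of x "\<Sum>i<q. norm (A i)" s k] Ab k unfolding A_def by (metis sums_unique)
  finally show ?thesis .
 qed
 moreover have "(%s. c * power_difference k s 1 + G s) holomorphic_on {s. Re s > 1 - real (Suc K) - real k}"
  using G(1) by (intro holomorphic_intros) (auto simp: algebra_simps)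
 ultimately show ?case by blast
qed

lemma convex_connected_halfplane: "connected {s. Re s > a}" "open {s. Re s > a}"
 by (auto simp: open_halfspace_Re_gt intro: convex_connected convex_halfspace_Re_gt)

lemma halfplane_continuation_unique:
 assumes "f holomorphic_on {s. Re s > a}" "g holomorphic_on {s. Re s > a}" "a <= b"
  "!!s. Re s > b ==> f s = g s" "Re s > a"
 shows "f s = g s"
proof (rule analytic_continuation_open[of "{s. Re s > b}" "{s. Re s > a}" f g s])
 have "of_real (b + 1) \<in> {s. Re s > b}" by simp
 then show "{s. Re s > b} ~= {}" by blast
 show "f z = g z" if "z \<in> {s. Re s > b}" for z using assms(4) that by simp
 show "{s. Re s > b} \<subseteq> {s. Re s > a}" using assms(3) by auto
qed (use assms(1,2,5) convex_connected_halfplane in auto)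

text \<open>The continuations to the half-planes Re s > 1 - K agree where both are defined;
  \<open>L\<close> takes at each \<open>s\<close> one whose half-plane contains
  \<open>s\<close>.\<close>

lemma periodic_series_entire:
 assumes "q > 0" "!!n. x (n + q) = (x n :: complex)" "(\<Sum>i<q. x i) = 0"
 obtains L where "L holomorphic_on UNIV" "!!s. Re s > 1 ==> L s = (\<Sum>n. x n * power_difference 0 s (real (Suc n)))"
proof -
 have "\<exists>G. \<forall>K. G K holomorphic_on {s. Re s > 1 - real K} \<and>
   (\<forall>s. Re s > 1 --> G K s = (\<Sum>n. x n * power_difference 0 s (real (Suc n))))"
  using periodic_series_continuation[OF assms, of _ 0] by (intro choice allI) simp
 then obtain G where G: "!!K. G K holomorphic_on {s. Re s > 1 - real K}"
   "!!K s. Re s > 1 ==> G K s = (\<Sum>n. x n * power_difference 0 s (real (Suc n)))" by blast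
 have agree: "G K s = G K' s" if "K <= K'" "Re s > 1 - real K" for K K' s
 proof (rule halfplane_continuation_unique[of "G K" "1 - real K" "G K'" 1])
  show "G K' holomorphic_on {s. Re s > 1 - real K}"
   by (rule holomorphic_on_subset[OF G(1)]) (use that in auto)
 qed (use G that in auto)
 define L where "L s = G (nat \<lceil>2 - Re s\<rceil>) s" for s
 have L: "L s = G K s" if "Re s > 1 - real K" for s K
 proof -
  have "Re s > 1 - real (nat \<lceil>2 - Re s\<rceil>)" by linarith
  then show ?thesis unfolding L_def using agree[of K "nat \<lceil>2 - Re s\<rceil>" s] agree[of "nat \<lceil>2 - Re s\<rceil>" K s] that
   by (cases "K <= nat \<lceil>2 - Re s\<rceil>") auto
 qed
 have "L holomorphic_on {s. Re s > 1 - real K}" for K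
  by (rule holomorphic_transform[OF G(1)[of K]]) (simp add: L)
 then have "L holomorphic_on (\<Union>K. {s. Re s > 1 - real K})"
  by (intro holomorphic_on_UN_open) (auto simp: open_halfspace_Re_gt)
 moreover have "(\<Union>K. {s. Re s > 1 - real K}) = UNIV"
 proof -
  have "s \<in> {s. Re s > 1 - real (nat \<lceil>2 - Re s\<rceil>)}" for s by simp linarith
  then show ?thesis by blast
 qed
 ultimately show thesis using that[of L] L[of 0] G(2)[of _ 0] by simp
qed

text \<open>By the mean value theorem each term after the first is at most a difference of
  consecutive values of n^(-a) / a, and these telescope to at most 1 / a.\<close>

lemma sum_powr_le:
 assumes "a > (0::real)"
 shows "(\<Sum>n. real (Suc n) powr (-(1 + a))) <= 1 + 1 / a"
proof -
 have step: "real (Suc (Suc n)) powr (-(1 + a)) <= (1 / a) * (real (Suc n) powr (-a) - real (Suc (Suc n)) powr (-a))" for n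
 proof -
  have "\<exists>z. z > real (Suc n) \<and> z < real (Suc (Suc n)) \<and>
   real (Suc (Suc n)) powr (-a) - real (Suc n) powr (-a) = (real (Suc (Suc n)) - real (Suc n)) * (-a * z powr (-a - 1))"
   by (rule MVT2) (auto intro!: derivative_eq_intros)
  then obtain z where z0: "z > real (Suc n)" "z < real (Suc (Suc n))"
   "real (Suc (Suc n)) powr (-a) - real (Suc n) powr (-a) = (real (Suc (Suc n)) - real (Suc n)) * (-a * z powr (-a - 1))"
   by blast
  have "-a - 1 = -(1+a)" by simp
  then have z: "z > real (Suc n)" "z < real (Suc (Suc n))"
   "real (Suc n) powr (-a) - real (Suc (Suc n)) powr (-a) = a * z powr (-(1+a))"
   using z0 by (simp_all only:) simp
  have "real (Suc (Suc n)) powr (-(1 + a)) <= z powr (-(1+a))"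
   using z assms by (intro powr_mono2') auto
  then show ?thesis using z(3) assms by simp
 qed
 have "(\<Sum>n<N. real (Suc n) powr (-(1 + a))) <= 1 + 1 / a" for N
 proof (cases N)
  case (Suc M)
  have "(\<Sum>n<Suc M. real (Suc n) powr (-(1 + a))) = 1 + (\<Sum>n<M. real (Suc (Suc n)) powr (-(1 + a)))"
   by (subst sum.lessThan_Suc_shift) simp
  also have "... <= 1 + (\<Sum>n<M. (1 / a) * (real (Suc n) powr (-a) - real (Suc (Suc n)) powr (-a)))"
   by (intro add_left_mono sum_mono step)
  also have "(\<Sum>n<M. (1 / a) * (real (Suc n) powr (-a) - real (Suc (Suc n)) powr (-a))) = (1 / a) * (1 - real (Suc M) powr (-a))"
   unfolding sum_distrib_left[symmetric] by (subst sum_lessThan_telescope') simp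
  also have "... <= (1 / a) * 1" using assms by (intro mult_left_mono) auto
  finally show ?thesis using Suc by simp
 qed (use assms in simp)
 then show ?thesis
  using suminf_le_const[OF summable_powr_Suc[of "1 + a"]] assms by simp
qed

lemma periodic_series_abel:
 fixes x :: "nat => complex"
 assumes "q > 0" "!!n. x (n + q) = x n" "(\<Sum>i<q. x i) = 0" "!!n. norm (x n) <= 1"
  and L: "L holomorphic_on {s. Re s > 0}" "!!s. Re s > 1 ==> L s = (\<Sum>n. x n * power_difference 0 s (real (Suc n)))"
  and s: "Re s > 0"
 shows "norm (\<Sum>i\<le>n. x i) <= real q"
  and "L s = (\<Sum>n. (\<Sum>i\<le>n. x i) * power_difference (Suc 0) s (real (Suc n)))"
proof -
 show A: "norm (\<Sum>i\<le>n. x i) <= real q" for n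
 proof -
  have "(\<Sum>i\<le>n. x i) = (\<Sum>i\<le>n mod q. x i)"
   using periodic_mod[of "%n. \<Sum>i\<le>n. x i" q n] periodic_partial_sums[of x q, OF assms(2,3)] by blast
  also have "norm ... <= (\<Sum>i\<le>n mod q. 1)" by (rule sum_norm_le) (use assms in auto)
  also have "... <= real q" using mod_less_divisor[OF assms(1), of n] by simp
  finally show ?thesis .
 qed
 let ?f = "%s. \<Sum>n. (\<Sum>i\<le>n. x i) * power_difference (Suc 0) s (real (Suc n))"
 show "L s = ?f s"
 proof (rule halfplane_continuation_unique[of L 0 ?f 1])
  show "?f holomorphic_on {s. 0 < Re s}"
   using power_difference_series_holomorphic(1)[of "%n. \<Sum>i\<le>n. x i" "real q" "Suc 0"] A by simp
  show "L s = ?f s" if "1 < Re s" for s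
   unfolding L(2)[OF that] using that by (intro sums_unique[symmetric] abel_power_difference[of x "real q" s 0] A) simp
 qed (use L s in auto)
qed

text \<open>A single summation by parts reaches Re s > 0, with partial sums bounded by
  \<open>q\<close>. That the bound is polynomial in \<open>q\<close> and \<open>norm s\<close> is
  what makes local zero counts logarithmic in both.\<close>

lemma periodic_series_bound:
 fixes x :: "nat => complex"
 assumes "q > 0" "!!n. x (n + q) = x n" "(\<Sum>i<q. x i) = 0" "!!n. norm (x n) <= 1"
  and L: "L holomorphic_on {s. Re s > 0}" "!!s. Re s > 1 ==> L s = (\<Sum>n. x n * power_difference 0 s (real (Suc n)))"
  and s: "Re s > 0"
 shows "norm (L s) <= real q * norm s * (1 + 1 / Re s)"
proof -
 note abel = periodic_series_abel[of q x L, OF assms]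
 have bd: "norm ((\<Sum>i\<le>n. x i) * power_difference (Suc 0) s (real (Suc n))) <= real q * (norm s * real (Suc n) powr (-(1 + Re s)))" for n
  unfolding norm_mult using norm_power_difference_le[of "real (Suc n)" s "Suc 0"] s abel(1)[of n]
  by (intro mult_mono) (auto simp: add_ac simp del: power_difference.simps)
 have sm: "summable (%n. real q * (norm s * real (Suc n) powr (-(1 + Re s))))"
  using s by (intro summable_mult summable_powr_Suc) auto
 have n: "summable (%n. norm ((\<Sum>i\<le>n. x i) * power_difference (Suc 0) s (real (Suc n))))"
  by (rule summable_comparison_test[OF exI[of _ 0] sm]) (use bd in simp)
 have "norm (L s) <= (\<Sum>n. real q * (norm s * real (Suc n) powr (-(1 + Re s))))"
 proof -
  have e: "L s = (\<Sum>n. (\<Sum>i\<le>n. x i) * power_difference (Suc 0) s (real (Suc n)))" by (rule abel(2))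
  show ?thesis unfolding e by (rule order_trans[OF summable_norm[OF n] suminf_le[OF bd n sm]])
 qed
 also have "... = real q * (norm s * (\<Sum>n. real (Suc n) powr (-(1 + Re s))))"
  using s summable_powr_Suc[of "1 + Re s"] by (simp add: suminf_mult summable_mult)
 also have "... <= real q * (norm s * (1 + 1 / Re s))"
  using sum_powr_le[OF s] by (intro mult_left_mono) auto
 finally show ?thesis by (simp add: mult_ac)
qed

section \<open>Identification of \<open>dirichlet_L\<close> with the continuation\<close>

text \<open>Gives the uniqueness demanded by the description in \<open>dirichlet_L\<close>. The
  difference, with its singularities removed, is nicely meromorphic and vanishes on a half-plane,
  hence everywhere. So \<open>M\<close> has the finite limit \<open>L z\<close> at every
  \<open>z\<close>, cannot have a pole there, and is therefore analytic with the right
  value.\<close>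

lemma nicely_meromorphic_eq_entire:
 assumes M: "M nicely_meromorphic_on UNIV" and L: "L holomorphic_on UNIV" and eq: "!!s. Re s > c ==> M s = L s"
 shows "M = L"
proof
 fix z
 have La: "L analytic_on A" for A using L analytic_on_holomorphic by blast
 define h where "h s = M s - L s" for s
 have mer: "h meromorphic_on UNIV" unfolding h_def
  by (rule meromorphic_on_diff[OF _ analytic_on_imp_meromorphic_on[OF La]]) (use M in \<open>auto simp: nicely_meromorphic_on_def\<close>)
 have nm: "remove_sings h nicely_meromorphic_on UNIV" by (rule remove_sings_nicely_meromorphic[OF mer])
 define z0 where "z0 = complex_of_real (c + 1)"
 have evn: "eventually (%s. Re s > c) (nhds w)" if "Re w > c" for w
  using eventually_nhds_in_open[of "{s. Re s > c}" w] that convex_connected_halfplane(2) by auto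
 have ev: "eventually (%s. h s = 0) (nhds w)" if "Re w > c" for w
  using eventually_mono[OF evn[OF that], of "%s. h s = 0"] by (simp add: h_def eq)
 have rs0: "remove_sings h w = 0" if "Re w > c" for w
 proof -
  have "h \<midarrow>w\<rightarrow> 0" using ev[OF that]
   by (intro tendsto_eventually) (auto simp: eventually_at_filter elim: eventually_mono)
  then show ?thesis by (rule remove_sings_eqI)
 qed
 have "eventually (%s. Re s > c) (at z0)"
  using eventually_nhds_in_open[of "{s. Re s > c}" z0] convex_connected_halfplane(2)
  by (auto simp: z0_def eventually_at_filter elim: eventually_mono)
 then have "eventually (%s. remove_sings h s = 0) (at z0)" by (auto elim!: eventually_mono simp: rs0)
 then have "frequently (%s. remove_sings h s = 0) (at z0)"
  using eventually_frequently[of "at z0"] by simp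
 from frequently_eq_meromorphic_imp_constant[OF this nm] have all0: "remove_sings h w = 0" for w by auto
 have "eventually (%s. remove_sings h s = h s) (at z)"
  using mer by (metis UNIV_I eventually_remove_sings_eq_at meromorphic_on_isolated_singularity meromorphic_on_subset subset_UNIV)
 then have evz: "eventually (%s. L s = M s) (at z)" by (auto elim!: eventually_mono simp: all0 h_def)
 have Lz: "L \<midarrow>z\<rightarrow> L z" using La[of "{z}"] analytic_at_imp_isCont isContD by blast
 then have Mz: "M \<midarrow>z\<rightarrow> L z" by (rule Lim_transform_eventually[OF _ evz])
 then have "\<not> is_pole M z" using is_pole_def not_tendsto_and_filterlim_at_infinity[of "at z" M "L z"] by auto
 then have "M analytic_on {z}" using nicely_meromorphic_on_imp_analytic_at[OF M] by auto
 then have "M \<midarrow>z\<rightarrow> M z" using analytic_at_imp_isCont isContD by blast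
 then show "M z = L z" using Mz LIM_unique by blast
qed

text \<open>Stated for every periodic sequence of mean zero, so that it serves the nonprincipal
  characters as well as the alternating series of period 2.\<close>

lemma dirichlet_L_periodic:
 assumes "q > 0" "!!n. X (n + q) = (X n :: complex)" "(\<Sum>i<q. X i) = 0"
 shows "dirichlet_L X holomorphic_on UNIV"
  and "!!s. Re s > 1 ==> dirichlet_L X s = (\<Sum>n. X (Suc n) / of_nat (Suc n) powr s)"
proof -
 \<comment> \<open>The series runs over \<open>Suc n\<close>, so the period from 0 to q - 1 has to
   be shifted to the one from 1 to q.\<close>
 have "(\<Sum>i<q. X (Suc i)) = (\<Sum>i<Suc q. X i) - X 0" by (subst sum.lessThan_Suc_shift) simp
 also have "... = 0" using assms(2)[of 0] assms(3) by simp
 finally have s0: "(\<Sum>i<q. X (Suc i)) = 0" .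
 obtain L where L: "L holomorphic_on UNIV" "!!s. Re s > 1 ==> L s = (\<Sum>n. X (Suc n) * power_difference 0 s (real (Suc n)))"
  using periodic_series_entire[of q "%n. X (Suc n)"] assms(1) assms(2)[of "Suc _"] s0 by (metis add_Suc)
 have L2: "L s = (\<Sum>n. X (Suc n) / of_nat (Suc n) powr s)" if "Re s > 1" for s
  unfolding L(2)[OF that] by (simp add: powr_minus_divide)
 have "dirichlet_L X = L"
  unfolding dirichlet_L_def
 proof (rule the_equality)
  show "L nicely_meromorphic_on UNIV \<and> (\<forall>s. Re s > 1 --> L s = (\<Sum>n. X (Suc n) / of_nat (Suc n) powr s))"
   using L(1) L2 by (auto intro!: analytic_on_imp_nicely_meromorphic_on simp: analytic_on_open)
  show "M = L" if "M nicely_meromorphic_on UNIV \<and> (\<forall>s. Re s > 1 --> M s = (\<Sum>n. X (Suc n) / of_nat (Suc n) powr s))" for M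
   using that L(1) L2 by (intro nicely_meromorphic_eq_entire[of M L 1]) auto
 qed
 then show "dirichlet_L X holomorphic_on UNIV"
  "!!s. Re s > 1 ==> dirichlet_L X s = (\<Sum>n. X (Suc n) / of_nat (Suc n) powr s)" using L L2 by auto
qed

lemma norm_dirichlet_L_le:
 assumes "q > 0" "!!n. X (n + q) = (X n :: complex)" "(\<Sum>i<q. X i) = 0" "!!n. norm (X n) <= 1" "Re s > 0"
 shows "norm (dirichlet_L X s) <= real q * norm s * (1 + 1 / Re s)"
proof (rule periodic_series_bound[where x = "%n. X (Suc n)"])
 have "(\<Sum>i<q. X (Suc i)) = (\<Sum>i<Suc q. X i) - X 0" by (subst sum.lessThan_Suc_shift) simp
 also have "... = 0" using assms(2)[of 0] assms(3) by simp
 finally show "(\<Sum>i<q. X (Suc i)) = 0" .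
 show "dirichlet_L X holomorphic_on {s. 0 < Re s}"
  using dirichlet_L_periodic(1)[OF assms(1-3)] holomorphic_on_subset by blast
 show "dirichlet_L X s = (\<Sum>n. X (Suc n) * power_difference 0 s (real (Suc n)))" if "1 < Re s" for s
  using dirichlet_L_periodic(2)[OF assms(1-3) that] by (simp add: powr_minus_divide)
 show "X (Suc (n + q)) = X (Suc n)" for n using assms(2)[of "Suc n"] by simp
qed (use assms in auto)

section \<open>Absolutely convergent Dirichlet series and logarithmic derivatives\<close>

definition dirichlet_series :: "(nat => complex) => complex => complex" where
 "dirichlet_series a s = (\<Sum>n. a (Suc n) / of_nat (Suc n) powr s)"

lemma norm_dirichlet_term: "norm (a / of_nat (Suc n) powr s) = norm a * real (Suc n) powr (- Re s)"
 by (simp add: norm_divide norm_powr_real_powr powr_minus_divide)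

text \<open>The logarithm is paid for by half of the excess \<open>2 * d\<close> of the exponent
  over 1.\<close>

lemma log_weight_le:
 assumes "d > 0"
 shows "(1 + ln (real (Suc n))) * real (Suc n) powr (-(1 + 2 * d)) <= (1 + 1 / d) * real (Suc n) powr (-(1 + d))"
proof -
 have "ln (real (Suc n)) <= real (Suc n) powr d / d" using assms by (intro ln_powr_bound) auto
 moreover have "1 <= real (Suc n) powr d" using assms by (intro ge_one_powr_ge_zero) auto
 ultimately have "1 + ln (real (Suc n)) <= (1 + 1 / d) * real (Suc n) powr d"
  by (simp add: algebra_simps)
 then have "(1 + ln (real (Suc n))) * real (Suc n) powr (-(1 + 2 * d)) <= (1 + 1 / d) * real (Suc n) powr d * real (Suc n) powr (-(1 + 2 * d))"
  by (intro mult_right_mono) auto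
 also have "... = (1 + 1 / d) * real (Suc n) powr (d + -(1 + 2 * d))" by (simp only: powr_add mult.assoc)
 also have "d + -(1 + 2 * d) = -(1 + d)" by simp
 finally show ?thesis .
qed

lemma summable_log_weight:
 assumes "x > (1::real)"
 shows "summable (%n. (1 + ln (real (Suc n))) * real (Suc n) powr (-x))"
proof (rule summable_comparison_test[of _ "%n. (1 + 1 / ((x-1)/2)) * real (Suc n) powr (-(1 + (x-1)/2))"])
 have "x = 1 + 2 * ((x-1)/2)" by (simp add: field_simps)
 then show "\<exists>N. \<forall>n\<ge>N. norm ((1 + ln (real (Suc n))) * real (Suc n) powr (-x)) <= (1 + 1 / ((x-1)/2)) * real (Suc n) powr (-(1 + (x-1)/2))"
  using log_weight_le[of "(x-1)/2"] assms by (intro exI[of _ 0]) (auto simp: abs_mult)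
 show "summable (%n. (1 + 1 / ((x-1)/2)) * real (Suc n) powr (-(1 + (x-1)/2)))"
  using assms by (intro summable_mult summable_powr_Suc) auto
qed

context
 fixes a :: "nat => complex"
 assumes a: "!!n. norm (a (Suc n)) <= 1 + ln (real (Suc n))"
begin

lemma dirichlet_series_abs_summable:
 assumes "Re s > 1"
 shows "summable (%n. norm (a (Suc n) / of_nat (Suc n) powr s))"
 unfolding norm_dirichlet_term
 by (rule summable_comparison_test[OF _ summable_log_weight[OF assms]])
   (use a in \<open>auto intro!: mult_right_mono exI[of _ 0]\<close>)

lemma dirichlet_series_deriv_aux:
 shows "dirichlet_series a holomorphic_on {s. Re s > 1}"
  and "!!s. Re s > 1 ==> deriv (dirichlet_series a) s = dirichlet_series (%n. - of_real (ln (real n)) * a n) s"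
proof -
 let ?S = "{s. Re s > 1}" and ?f = "%n s. a (Suc n) / of_nat (Suc n) powr s"
 have hol: "?f n holomorphic_on A" for n A by (intro holomorphic_intros) auto
 have loc: "\<exists>d M. 0 < d \<and> summable M \<and> (\<forall>n. \<forall>y\<in>ball s d \<inter> ?S. norm (?f n y) <= M n)" if "s \<in> ?S" for s
 proof -
  define d where "d = (Re s - 1) / 2"
  have d: "d > 0" using that by (simp add: d_def)
  have "norm (?f n y) <= (1 + ln (real (Suc n))) * real (Suc n) powr (-(1 + d))" if "y \<in> ball s d \<inter> ?S" for n y
  proof -
   have "\<bar>Re (s - y)\<bar> < d" using that abs_Re_le_cmod[of "s - y"] by (auto simp: dist_norm)
   moreover have "Re s = 2 * d + 1" by (simp add: d_def field_simps)
   ultimately have "Re y >= 1 + d" by simp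
   then show ?thesis unfolding norm_dirichlet_term by (intro mult_mono a powr_mono) auto
  qed
  then show ?thesis using d summable_log_weight[of "1 + d"] by (intro exI[of _ d] exI) auto
 qed
 have op: "open ?S" by (simp add: convex_connected_halfplane)
 show "dirichlet_series a holomorphic_on ?S"
  unfolding dirichlet_series_def using holomorphic_on_suminf(1)[OF op hol loc] .
 show "deriv (dirichlet_series a) s = dirichlet_series (%n. - of_real (ln (real n)) * a n) s" if s: "Re s > 1" for s
 proof -
  have "(?f n has_field_derivative - of_real (ln (real (Suc n))) * a (Suc n) / of_nat (Suc n) powr s) (at s)" for n
  proof -
   define w :: complex where "w = of_nat (Suc n)"
   have w: "w ~= 0" "Ln w = of_real (ln (real (Suc n)))" unfolding w_def by (rule of_nat_neq_0, rule Ln_of_nat) simp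
   show ?thesis unfolding w_def[symmetric] w(2)[symmetric] using w(1)
    by (auto intro!: derivative_eq_intros simp: power2_eq_square)
  qed
  then have "deriv (?f n) s = - of_real (ln (real (Suc n))) * a (Suc n) / of_nat (Suc n) powr s" for n
   by (rule DERIV_imp_deriv)
  moreover have "(dirichlet_series a has_field_derivative (\<Sum>n. deriv (?f n) s)) (at s)"
   unfolding dirichlet_series_def using holomorphic_on_suminf(2)[OF op hol loc, of s] s by simp
  ultimately show ?thesis unfolding dirichlet_series_def[of "%n. _ n * _ n"] using DERIV_imp_deriv by simp
 qed
qed

text \<open>Unordered sums over the positive integers are the form in which a product of two series
  can be regrouped by divisors.\<close>

lemma dirichlet_series_infsum:
 assumes "Re s > 1"
 shows "(%n. norm (a n / of_nat n powr s)) summable_on {1..}"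
  and "dirichlet_series a s = (\<Sum>\<^sub>\<infinity>n\<in>{1..}. a n / of_nat n powr s)"
proof -
 let ?f = "%n. a n / of_nat n powr s"
 have bij: "bij_betw Suc UNIV {1..}"
  by (rule bij_betwI[of _ _ _ "%n. n - 1"]) auto
 note s = dirichlet_series_abs_summable[OF assms]
 have "(%n. norm (?f (Suc n))) summable_on UNIV"
  using s by (intro norm_summable_imp_summable_on) auto
 then show "(%n. norm (?f n)) summable_on {1..}"
  using summable_on_reindex_bij_betw[OF bij, of "%n. norm (?f n)"] by simp
 have "((%n. ?f (Suc n)) has_sum dirichlet_series a s) UNIV"
  unfolding dirichlet_series_def by (intro norm_summable_imp_has_sum s summable_sums summable_norm_cancel[OF s])
 then have "(\<Sum>\<^sub>\<infinity>n. ?f (Suc n)) = dirichlet_series a s" by (rule infsumI)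
 then show "dirichlet_series a s = (\<Sum>\<^sub>\<infinity>n\<in>{1..}. ?f n)"
  using infsum_reindex_bij_betw[OF bij, of ?f] by simp
qed

end

lemma mangoldt_le_ln: "norm (mangoldt (Suc n) :: complex) <= ln (real (Suc n))"
 using mangoldt_le[of "Suc n"] by simp

text \<open>From \<open>\<Lambda> * 1 = log\<close>.\<close>

lemma dirichlet_series_log_derivative:
 assumes X: "!!m n. X (m * n) = X m * X n" "!!n. norm (X n) <= 1" and s: "Re s > 1"
 shows "deriv (dirichlet_series X) s = - (dirichlet_series X s * dirichlet_series (%n. mangoldt n * X n) s)"
proof -
 have Xb: "norm (X (Suc n)) <= 1 + ln (real (Suc n))" for n using X(2)[of "Suc n"] ln_ge_zero[of "real (Suc n)"] by linarith
 have Lb: "norm (mangoldt (Suc n) * X (Suc n)) <= 1 + ln (real (Suc n))" for n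
  unfolding norm_mult using mult_mono[OF mangoldt_le_ln[of n] X(2)[of "Suc n"]] by simp
 let ?A = "%n. mangoldt n * X n / of_nat n powr s" and ?B = "%n. X n / of_nat n powr s" and ?S = "{1::nat..}"
 note A = dirichlet_series_infsum[of "%n. mangoldt n * X n", OF Lb s]
 note B = dirichlet_series_infsum[of X, OF Xb s]
 have "(%p. norm (?A (fst p) * ?B (snd p))) summable_on ?S \<times> ?S"
 proof (rule Infinite_Sum.abs_summable_on_Sigma_iff[THEN iffD2], intro conjI ballI)
  show "(%y. norm (?A (fst (x, y)) * ?B (snd (x, y)))) summable_on ?S" for x
   unfolding fst_conv snd_conv norm_mult[of "?A x"] by (rule summable_on_cmult_right[OF B(1)])
  define C where "C = (\<Sum>\<^sub>\<infinity>y\<in>?S. norm (?B y))"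
  have C: "C >= 0" unfolding C_def by (intro infsum_nonneg) auto
  have "(\<Sum>\<^sub>\<infinity>y\<in>?S. norm (?A (fst (x, y)) * ?B (snd (x, y)))) = norm (?A x) * C" for x
   unfolding C_def fst_conv snd_conv norm_mult[of "?A x"] by (rule infsum_cmult_right) (use B(1) in blast)
  moreover have "norm (norm (?A x) * C) = norm (?A x) * C" for x using C by (simp add: abs_mult)
  moreover have "(%x. norm (?A x) * C) summable_on ?S" by (rule summable_on_cmult_left[OF A(1)])
  ultimately show "(%x. norm (\<Sum>\<^sub>\<infinity>y\<in>?S. norm (?A (fst (x, y)) * ?B (snd (x, y))))) summable_on ?S"
   by presburger
 qed
 then have sm: "(%p. ?A (fst p) * ?B (snd p)) summable_on ?S \<times> ?S"
  by (rule abs_summable_summable)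
 \<comment> \<open>A pair (d, e) becomes n = d e together with its divisor d. Since d carries the
   factor \<open>mangoldt\<close>, the inner sum over d will be the divisor sum of
   \<open>mangoldt\<close>.\<close>
 have bij: "bij_betw (%(d, e). (d * e, d)) (?S \<times> ?S) (Sigma ?S (%n. {d. d dvd n}))"
  by (rule bij_betwI[of _ _ _ "%(n, d). (d, n div d)"]) (auto simp: dvd_div_eq_0_iff Suc_le_eq intro!: Nat.gr0I)
 let ?F = "%p::nat\<times>nat. mangoldt (snd p) * X (fst p) / of_nat (fst p) powr s"
 have FE: "?F ((%(d, e). (d * e, d)) p) = ?A (fst p) * ?B (snd p)" if "p \<in> ?S \<times> ?S" for p
  using that by (cases p) (auto simp: X powr_times_real)
 have "(%p. ?F ((%(d, e). (d * e, d)) p)) summable_on ?S \<times> ?S"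
  using sm by (subst summable_on_cong[OF FE])
 then have smF: "?F summable_on Sigma ?S (%n. {d. d dvd n})"
  using summable_on_reindex_bij_betw[OF bij, of ?F] by simp
 have "dirichlet_series (%n. mangoldt n * X n) s * dirichlet_series X s = (\<Sum>\<^sub>\<infinity>x\<in>?S. ?A x * (\<Sum>\<^sub>\<infinity>y\<in>?S. ?B y))"
  unfolding A(2) B(2) by (rule infsum_cmult_left[symmetric]) (use abs_summable_summable[OF A(1)] in simp)
 also have "... = (\<Sum>\<^sub>\<infinity>x\<in>?S. (\<Sum>\<^sub>\<infinity>y\<in>?S. ?A (fst (x, y)) * ?B (snd (x, y))))"
  unfolding fst_conv snd_conv
  by (intro infsum_cong infsum_cmult_right[symmetric]) (use abs_summable_summable[OF B(1)] in blast)
 also have "... = (\<Sum>\<^sub>\<infinity>p\<in>?S\<times>?S. ?A (fst p) * ?B (snd p))"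
  by (rule infsum_Sigma_banach[OF sm])
 also have "... = (\<Sum>\<^sub>\<infinity>p\<in>?S\<times>?S. ?F ((%(d, e). (d * e, d)) p))"
  by (rule infsum_cong[OF FE[symmetric]])
 also have "... = (\<Sum>\<^sub>\<infinity>p\<in>Sigma ?S (%n. {d. d dvd n}). ?F p)"
  by (rule infsum_reindex_bij_betw[OF bij])
 also have "... = (\<Sum>\<^sub>\<infinity>n\<in>?S. \<Sum>\<^sub>\<infinity>d\<in>{d. d dvd n}. ?F (n, d))"
  by (rule infsum_Sigma_banach[OF smF, symmetric])
 also have "... = (\<Sum>\<^sub>\<infinity>n\<in>?S. - (- of_real (ln (real n)) * X n / of_nat n powr s))"
 proof (rule infsum_cong)
  fix n assume n: "n \<in> ?S"
  then have "finite {d. d dvd n}" by simp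
  then have "(\<Sum>\<^sub>\<infinity>d\<in>{d. d dvd n}. ?F (n, d)) = (\<Sum>d | d dvd n. mangoldt d) * X n / of_nat n powr s"
   by (simp add: sum_distrib_right sum_divide_distrib)
  also have "(\<Sum>d | d dvd n. mangoldt d :: complex) = of_real (ln (real n))" using n by (intro mangoldt_sum) auto
  finally show "(\<Sum>\<^sub>\<infinity>d\<in>{d. d dvd n}. ?F (n, d)) = - (- of_real (ln (real n)) * X n / of_nat n powr s)" by simp
 qed
 also have "... = - dirichlet_series (%n. - of_real (ln (real n)) * X n) s"
 proof -
  have nb: "norm (- of_real (ln (real (Suc n))) * X (Suc n)) <= 1 + ln (real (Suc n))" for n
   unfolding norm_mult using mult_left_mono[OF X(2)[of "Suc n"], of "ln (real (Suc n))"] ln_ge_zero[of "real (Suc n)"]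
   by (auto simp del: of_nat_Suc)
  show ?thesis unfolding infsum_uminus dirichlet_series_infsum(2)[of "%n. - of_real (ln (real n)) * X n", OF nb s] ..
 qed
 finally show ?thesis using dirichlet_series_deriv_aux(2)[of X s, OF Xb s] by (simp add: mult.commute)
qed

text \<open>Comparison with the sum of n^(-3), whose part from n = 2 on is at most 1/2.\<close>

lemma dirichlet_series_near_one:
 assumes "X 1 = 1" "!!n. norm (X n) <= 1" and s: "Re s >= 3"
 shows "norm (dirichlet_series X s - 1) <= 1 / 2"
proof -
 have Xb: "norm (X (Suc n)) <= 1 + ln (real (Suc n))" for n using assms(2)[of "Suc n"] ln_ge_zero[of "real (Suc n)"] by linarith
 have sm: "summable (%n. norm (X (Suc n) / of_nat (Suc n) powr s))"
  using dirichlet_series_abs_summable[of X s, OF Xb] s by simp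
 have sp: "summable (%n. real (Suc n) powr (-(1 + 2)))" by (intro summable_powr_Suc) auto
 have "dirichlet_series X s - 1 = (\<Sum>n. X (Suc (Suc n)) / of_nat (Suc (Suc n)) powr s)"
  unfolding dirichlet_series_def using suminf_split_head[OF summable_norm_cancel[OF sm]] assms(1) by simp
 also have "norm ... <= (\<Sum>n. norm (X (Suc (Suc n)) / of_nat (Suc (Suc n)) powr s))"
  by (rule summable_norm) (use sm in \<open>subst summable_Suc_iff\<close>)
 also have "... <= (\<Sum>n. real (Suc (Suc n)) powr (-(1 + 2)))"
 proof (rule suminf_le)
  show "summable (%n. norm (X (Suc (Suc n)) / of_nat (Suc (Suc n)) powr s))" using sm by (subst summable_Suc_iff)
  show "summable (%n. real (Suc (Suc n)) powr (-(1 + 2)))" using sp by (subst summable_Suc_iff)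
  show "norm (X (Suc (Suc n)) / of_nat (Suc (Suc n)) powr s) <= real (Suc (Suc n)) powr (-(1 + 2))" for n
   unfolding norm_dirichlet_term using mult_mono[OF assms(2)[of "Suc (Suc n)"] powr_mono[of "- Re s" "-(1+2)" "real (Suc (Suc n))"]] s by simp
 qed
 also have "... = (\<Sum>n. real (Suc n) powr (-(1 + 2))) - 1"
  using suminf_split_head[OF sp] by simp
 also have "... <= 1 / 2" using sum_powr_le[of 2] by simp
 finally show ?thesis .
qed

text \<open>If \<open>g\<close> is a primitive of the \<open>mangoldt\<close> series, then the
  series of \<open>X\<close> times \<open>exp g\<close> is constant on the half-plane. A zero would
  make this constant 0 and force a zero at 3, against
  \<open>dirichlet_series_near_one\<close>.\<close>

lemma dirichlet_series_nonzero:
 assumes X: "!!m n. X (m * n) = X m * X n" "!!n. norm (X n) <= 1" "X 1 = 1" and s: "Re s > 1"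
 shows "dirichlet_series X s ~= 0"
proof
 assume z: "dirichlet_series X s = 0"
 let ?S = "{s. Re s > 1}" and ?L = "dirichlet_series X" and ?G = "dirichlet_series (%n. mangoldt n * X n)"
 have Xb: "norm (X (Suc n)) <= 1 + ln (real (Suc n))" for n using X(2)[of "Suc n"] ln_ge_zero[of "real (Suc n)"] by linarith
 have Lb: "norm (mangoldt (Suc n) * X (Suc n)) <= 1 + ln (real (Suc n))" for n
  unfolding norm_mult using mult_mono[OF mangoldt_le_ln[of n] X(2)[of "Suc n"]] by simp
 have op: "open ?S" "convex ?S" by (auto simp: convex_connected_halfplane convex_halfspace_Re_gt)
 have hG: "?G holomorphic_on ?S" using dirichlet_series_deriv_aux(1)[of "%n. mangoldt n * X n", OF Lb] .
 have hL: "?L holomorphic_on ?S" using dirichlet_series_deriv_aux(1)[of X, OF Xb] .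
 obtain g where g: "!!x. x \<in> ?S ==> (g has_field_derivative ?G x) (at x within ?S)"
  using holomorphic_convex_primitive'[OF op(2,1) hG] by blast
 have "\<exists>c. \<forall>x\<in>?S. ?L x * exp (g x) = c"
 proof (rule has_field_derivative_zero_constant[OF op(2)])
  fix x assume x: "x \<in> ?S"
  have "(?L has_field_derivative deriv ?L x) (at x within ?S)"
   using holomorphic_derivI[OF hL op(1) x] has_field_derivative_at_within by blast
  then show "((%x. ?L x * exp (g x)) has_field_derivative 0) (at x within ?S)"
   using dirichlet_series_log_derivative[OF X(1,2), of x] x g[OF x]
   by (auto intro!: derivative_eq_intros)
 qed
 then obtain c where c: "!!x. Re x > 1 ==> ?L x * exp (g x) = c" by auto
 have "c = 0" using c[OF s] z by simp
 then have "?L 3 = 0" using c[of 3] by simp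
 then show False using dirichlet_series_near_one[of X 3, OF X(3,2)] by simp
qed

section \<open>Fourier transforms and Landau's theorem\<close>

text \<open>The characteristic function of the standard normal law, rescaled by
  \<open>sqrt e\<close>.\<close>

lemma gaussian_fourier:
 assumes "e > 0"
 shows "integrable lborel (%t. complex_of_real (exp (- e * t\<^sup>2 / 2)) * cis (u * t))"
  and "(LBINT t. complex_of_real (exp (- e * t\<^sup>2 / 2)) * cis (u * t)) = of_real (sqrt (2 * pi / e) * exp (- u\<^sup>2 / (2 * e)))"
proof -
 have se: "sqrt e > 0" "sqrt e ~= 0" using assms by auto
 have i0: "integrable lborel (%x. std_normal_density x)" by auto
 let ?g = "%x. complex_of_real (std_normal_density x) * cis (v * x)"
 have g_int: "integrable lborel (%x. complex_of_real (std_normal_density x) * cis (v * x))" for v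
  by (rule Bochner_Integration.integrable_bound[OF i0]) (auto simp: norm_mult cis_conv_exp)
 have g_val: "(LBINT x. complex_of_real (std_normal_density x) * cis (v * x)) = of_real (exp (- v\<^sup>2 / 2))" for v
 proof -
  have "char std_normal_distribution v = (LBINT x. std_normal_density x *\<^sub>R iexp (v * x))"
   unfolding char_def by (subst integral_density) auto
  then show ?thesis unfolding char_std_normal_distribution by (simp add: cis_conv_exp scaleR_conv_of_real)
 qed
 have eq: "complex_of_real (std_normal_density (0 + sqrt e * t)) * cis (u / sqrt e * (0 + sqrt e * t)) =
  of_real (1 / sqrt (2 * pi)) * (complex_of_real (exp (- e * t\<^sup>2 / 2)) * cis (u * t))" for t
  using assms se by (simp add: std_normal_density_def power_mult_distrib mult_ac)
 have "integrable lborel (%t. complex_of_real (std_normal_density (0 + sqrt e * t)) * cis (u / sqrt e * (0 + sqrt e * t)))"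
  using lborel_integrable_real_affine_iff[OF se(2), of "%x. complex_of_real (std_normal_density x) * cis (u / sqrt e * x)" 0] g_int by blast
 then show "integrable lborel (%t. complex_of_real (exp (- e * t\<^sup>2 / 2)) * cis (u * t))"
  unfolding eq
 proof -
  let ?E = "%t. complex_of_real (exp (- e * t\<^sup>2 / 2)) * cis (u * t)"
  assume "integrable lborel (%t. of_real (1 / sqrt (2 * pi)) * ?E t)"
  then have "integrable lborel (%t. of_real (sqrt (2 * pi)) * (of_real (1 / sqrt (2 * pi)) * ?E t))"
   by (rule integrable_mult_right)
  moreover have "of_real (sqrt (2 * pi)) * (of_real (1 / sqrt (2 * pi)) * ?E t) = ?E t" for t by simp
  ultimately show ?thesis by (simp only:)
 qed
 have "of_real (exp (- (u / sqrt e)\<^sup>2 / 2)) =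
   \<bar>sqrt e\<bar> *\<^sub>R (LBINT t. complex_of_real (std_normal_density (0 + sqrt e * t)) * cis (u / sqrt e * (0 + sqrt e * t)))"
  unfolding g_val[symmetric] by (rule lborel_integral_real_affine[OF se(2)])
 also have "... = of_real (sqrt e * (1 / sqrt (2 * pi))) * (LBINT t. complex_of_real (exp (- e * t\<^sup>2 / 2)) * cis (u * t))"
  unfolding eq using se by (simp add: scaleR_conv_of_real)
 finally have "of_real (exp (- (u / sqrt e)\<^sup>2 / 2)) * of_real (sqrt (2 * pi) / sqrt e) = (LBINT t. complex_of_real (exp (- e * t\<^sup>2 / 2)) * cis (u * t))"
  using se by (simp add: field_simps)
 then show "(LBINT t. complex_of_real (exp (- e * t\<^sup>2 / 2)) * cis (u * t)) = of_real (sqrt (2 * pi / e) * exp (- u\<^sup>2 / (2 * e)))"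
  using assms by (simp add: power_divide real_sqrt_divide mult_ac)
qed

definition fourier :: "(real => complex) => real => complex" where
 "fourier f t = (LBINT y. f y * cis (- t * y))"

lemma cis_measurable [measurable]: "cis \<in> borel_measurable borel"
 by (intro borel_measurable_continuous_onI continuous_intros)

lemma fourier_integrable:
 assumes "integrable lborel f"
 shows "integrable lborel (%y. f y * cis (t * y))"
 by (rule Bochner_Integration.integrable_bound[OF assms]) (use assms in \<open>auto simp: norm_mult\<close>)

lemma norm_fourier_le:
 assumes "integrable lborel f"
 shows "norm (fourier f t) <= (LBINT y. norm (f y))"
 unfolding fourier_def by (rule order_trans[OF integral_norm_bound]) (simp add: norm_mult)

lemma fourier_measurable [measurable]:
 assumes [measurable]: "f \<in> borel_measurable lborel"
 shows "fourier f \<in> borel_measurable lborel"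
 unfolding fourier_def by measurable

text \<open>The mean of \<open>f\<close> under the normal law with centre \<open>y\<close> and
  variance \<open>e\<close>. With a standard normal variable under the integral, the passage to
  \<open>e = 0\<close> changes only the argument of \<open>f\<close>.\<close>

definition gauss_mean :: "real => (real => complex) => real => complex" where
 "gauss_mean e f y = (LBINT u. of_real (std_normal_density u) * f (y - sqrt e * u))"

text \<open>The Gaussian factor makes the double integral absolutely convergent; by Fubini the
  integral over \<open>t\<close> is again a Gaussian, now of variance \<open>e\<close>.\<close>

lemma gauss_mean_fourier:
 assumes f: "integrable lborel f" and e: "e > 0"
 shows "integrable lborel (%t. fourier f t * of_real (exp (- e * t\<^sup>2 / 2)) * cis (t * y))"
  and "(LBINT t. fourier f t * of_real (exp (- e * t\<^sup>2 / 2)) * cis (t * y)) = 2 * pi * gauss_mean e f y"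
proof -
 have [measurable]: "f \<in> borel_measurable lborel" using f by simp
 let ?G = "%t. exp (- e * t\<^sup>2 / 2)"
 have Gint: "integrable lborel ?G"
 proof -
  have "integrable lborel (%t. norm (complex_of_real (?G t) * cis (0 * t)))"
   by (rule integrable_norm[OF gaussian_fourier(1)[OF e]])
  then show ?thesis by (simp add: norm_mult)
 qed
 let ?h = "%t x. f x * cis (- t * x) * of_real (?G t) * cis (t * y)"
 have prod: "integrable (lborel \<Otimes>\<^sub>M lborel) (case_prod ?h)"
 proof (rule lborel_pair.Fubini_integrable)
  show "case_prod ?h \<in> borel_measurable (lborel \<Otimes>\<^sub>M lborel)" by measurable
  have "(LBINT x. norm (?h t x)) = ?G t * (LBINT x. norm (f x))" for t
   by (simp add: norm_mult mult.commute)
  then show "integrable lborel (%t. LBINT x. norm (case (t, x) of (t, x) => ?h t x))"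
   using Gint by simp
  show "AE t in lborel. integrable lborel (%x. case (t, x) of (t, x) => ?h t x)"
  proof (rule AE_I2)
   fix t
   show "integrable lborel (%x. case (t, x) of (t, x) => ?h t x)"
    using integrable_mult_left[OF fourier_integrable[OF f, of "- t"], of "of_real (?G t) * cis (t * y)"]
    by (simp only: prod.case mult.assoc)
  qed
 qed
 have inner: "(LBINT x. ?h t x) = fourier f t * of_real (?G t) * cis (t * y)" for t
  unfolding fourier_def by simp
 show "integrable lborel (%t. fourier f t * of_real (?G t) * cis (t * y))"
  using lborel_pair.integrable_fst'[OF prod] inner by simp
 have "(LBINT t. fourier f t * of_real (?G t) * cis (t * y)) = (LBINT t. (LBINT x. ?h t x))"
  using inner by simp
 also have "... = (LBINT x. (LBINT t. ?h t x))"
  using lborel_pair.Fubini_integral[OF prod] by simp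
 also have "... = (LBINT x. f x * of_real (sqrt (2 * pi / e) * exp (- (y - x)\<^sup>2 / (2 * e))))"
 proof (intro Bochner_Integration.integral_cong refl)
  fix x
  have "?h t x = f x * (of_real (?G t) * cis ((y - x) * t))" for t
   by (simp add: cis_mult[symmetric] algebra_simps flip: cis_mult) (metis (no_types, lifting) cis_mult add.commute diff_conv_add_uminus mult.commute mult.left_commute)
  note eq = this
  show "(LBINT t. ?h t x) = f x * of_real (sqrt (2 * pi / e) * exp (- (y - x)\<^sup>2 / (2 * e)))"
   unfolding eq integral_mult_right_zero gaussian_fourier(2)[OF e] ..
 qed
 also have "... = \<bar>- sqrt e\<bar> *\<^sub>R (LBINT u. f (y + - sqrt e * u) * of_real (sqrt (2 * pi / e) * exp (- (y - (y + - sqrt e * u))\<^sup>2 / (2 * e))))"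
  using e by (intro lborel_integral_real_affine) auto
 also have "... = (LBINT u. 2 * pi * (of_real (std_normal_density u) * f (y - sqrt e * u)))"
 proof -
  have "sqrt e *\<^sub>R (f (y + - sqrt e * u) * of_real (sqrt (2 * pi / e) * exp (- (y - (y + - sqrt e * u))\<^sup>2 / (2 * e)))) =
    2 * pi * (of_real (std_normal_density u) * f (y - sqrt e * u))" for u
  proof -
   have "sqrt e * (sqrt (2 * pi / e) * exp (- (y - (y + - sqrt e * u))\<^sup>2 / (2 * e))) = 2 * pi * std_normal_density u"
    using e by (simp add: std_normal_density_def power_mult_distrib real_sqrt_divide)
     (metis (no_types, opaque_lifting) mult.commute nonzero_mult_div_cancel_left real_div_sqrt pi_ge_zero real_sqrt_mult zero_le_mult_iff zero_le_numeral times_divide_eq_left div_by_1)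
   then have "complex_of_real (sqrt e * (sqrt (2 * pi / e) * exp (- (y - (y + - sqrt e * u))\<^sup>2 / (2 * e)))) = of_real (2 * pi * std_normal_density u)"
    by (rule arg_cong)
   then show ?thesis by (simp add: scaleR_conv_of_real mult_ac)
  qed
  then show ?thesis using e by (simp flip: integral_scaleR_right)
 qed
 also have "... = 2 * pi * gauss_mean e f y" unfolding gauss_mean_def by simp
 finally show "(LBINT t. fourier f t * of_real (?G t) * cis (t * y)) = 2 * pi * gauss_mean e f y" .
qed

lemma gauss_mean_bound:
 assumes "f \<in> borel_measurable lborel" and B: "!!y. norm (f y) <= B"
 shows "norm (gauss_mean e f y) <= B"
proof -
 have "norm (gauss_mean e f y) <= (LBINT u. std_normal_density u * B)"
  unfolding gauss_mean_def
 proof -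
  have [measurable]: "f \<in> borel_measurable borel" using assms(1) by simp
  have le: "norm (of_real (std_normal_density u) * f (y - sqrt e * u)) <= std_normal_density u * B" for u
   using B[of "y - sqrt e * u"] by (auto simp: norm_mult intro!: mult_left_mono)
  have i: "integrable lborel (%u. std_normal_density u * B)" by auto
  have i2: "integrable lborel (%u. of_real (std_normal_density u) * f (y - sqrt e * u))"
   by (rule Bochner_Integration.integrable_bound[OF i]) (use le in \<open>auto intro!: AE_I2 intro: order_trans[OF _ abs_ge_self]\<close>)
  show "norm (LBINT u. of_real (std_normal_density u) * f (y - sqrt e * u)) <= (LBINT u. std_normal_density u * B)"
   by (rule order_trans[OF integral_norm_bound]) (intro integral_mono integrable_norm i i2 le)
 qed
 then show ?thesis by simp
qed

lemma gauss_mean_tendsto: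
 assumes [measurable]: "f \<in> borel_measurable lborel" and B: "!!y. norm (f y) <= B" and c: "isCont f y"
 shows "(%n. gauss_mean (1 / real (Suc n)) f y) \<longlonglongrightarrow> f y"
proof -
 have "(%n. gauss_mean (1 / real (Suc n)) f y) \<longlonglongrightarrow> (LBINT u. of_real (std_normal_density u) * f y)"
  unfolding gauss_mean_def
 proof (rule integral_dominated_convergence[where w = "%u. std_normal_density u * B"])
  have "(%n. sqrt (1 / real (Suc n))) \<longlonglongrightarrow> sqrt 0" by (intro tendsto_real_sqrt LIMSEQ_Suc lim_1_over_n)
  then have "(%n. y - sqrt (1 / real (Suc n)) * u) \<longlonglongrightarrow> y - 0 * u" for u
   unfolding real_sqrt_zero by (intro tendsto_intros)
  then have "(%n. y - sqrt (1 / real (Suc n)) * u) \<longlonglongrightarrow> y" for u by simp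
  then have "(%n. f (y - sqrt (1 / real (Suc n)) * u)) \<longlonglongrightarrow> f y" for u
   by (rule isCont_tendsto_compose[OF c])
  then show "AE u in lborel. (%n. of_real (std_normal_density u) * f (y - sqrt (1 / real (Suc n)) * u)) \<longlonglongrightarrow> of_real (std_normal_density u) * f y"
   by (intro AE_I2 tendsto_intros)
  show "AE u in lborel. norm (of_real (std_normal_density u) * f (y - sqrt (1 / real (Suc n)) * u)) <= std_normal_density u * B" for n
   using B by (intro AE_I2) (auto simp: norm_mult intro!: mult_left_mono)
 qed auto
 also have "(LBINT u. of_real (std_normal_density u) * f y) = f y" by simp
 finally show ?thesis .
qed

lemma gauss_weight_tendsto:
 fixes g :: "real => 'a :: {banach, second_countable_topology, real_normed_algebra_1}"
 assumes g: "integrable lborel g"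
 shows "(%n. LBINT t. g t * of_real (exp (- (1 / real (Suc n)) * t\<^sup>2 / 2))) \<longlonglongrightarrow> (LBINT t. g t)"
proof (rule integral_dominated_convergence[where w = "%t. norm (g t)"])
 have [measurable]: "g \<in> borel_measurable lborel" using g by simp
 show "(%t. g t * of_real (exp (- (1 / real (Suc n)) * t\<^sup>2 / 2))) \<in> borel_measurable lborel" for n by measurable
 have "(%n. exp (- (1 / real (Suc n)) * t\<^sup>2 / 2)) \<longlonglongrightarrow> exp (- 0 * t\<^sup>2 / 2)" for t
  by (intro tendsto_intros LIMSEQ_Suc lim_1_over_n) auto
 then have "(%n. g t * of_real (exp (- (1 / real (Suc n)) * t\<^sup>2 / 2))) \<longlonglongrightarrow> g t * of_real 1" for t
  by (intro tendsto_intros) auto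
 then show "AE t in lborel. (%n. g t * of_real (exp (- (1 / real (Suc n)) * t\<^sup>2 / 2))) \<longlonglongrightarrow> g t" by simp
 show "AE t in lborel. norm (g t * of_real (exp (- (1 / real (Suc n)) * t\<^sup>2 / 2))) <= norm (g t)" for n
  by (intro AE_I2 order_trans[OF norm_mult_ineq]) (auto intro!: mult_left_le)
qed (use g in auto)

text \<open>The damping in \<open>gauss_mean_fourier\<close> is sent to 0 on both sides: by
  dominated convergence under the integrable transform on one, and at the continuity point
  \<open>y\<close> on the other.\<close>

theorem fourier_inversion:
 fixes f :: "real => complex"
 assumes f: "integrable lborel f" "!!y. norm (f y) <= B" "isCont f y" and fh: "integrable lborel (fourier f)"
 shows "(LBINT t. fourier f t * cis (t * y)) = 2 * pi * f y"
proof (rule LIMSEQ_unique)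
 have "integrable lborel (%t. fourier f t * cis (t * y))"
  using fourier_integrable[OF fh, of y] by (simp add: mult.commute)
 from gauss_weight_tendsto[OF this]
 show "(%n. LBINT t. fourier f t * cis (t * y) * of_real (exp (- (1 / real (Suc n)) * t\<^sup>2 / 2))) \<longlonglongrightarrow> (LBINT t. fourier f t * cis (t * y))" .
 have "(LBINT t. fourier f t * cis (t * y) * of_real (exp (- (1 / real (Suc n)) * t\<^sup>2 / 2))) = 2 * pi * gauss_mean (1 / real (Suc n)) f y" for n
  using gauss_mean_fourier(2)[OF f(1), of "1 / real (Suc n)" y] by (simp add: mult_ac)
 moreover have "(%n. 2 * pi * gauss_mean (1 / real (Suc n)) f y) \<longlonglongrightarrow> 2 * pi * f y"
  using f by (intro tendsto_intros gauss_mean_tendsto[of _ B]) auto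
 ultimately show "(%n. LBINT t. fourier f t * cis (t * y) * of_real (exp (- (1 / real (Suc n)) * t\<^sup>2 / 2))) \<longlonglongrightarrow> 2 * pi * f y"
  by presburger
qed

text \<open>Multiply \<open>gauss_mean_fourier\<close> by the conjugate of \<open>f\<close>,
  integrate, and remove the damping. Boundedness and continuity almost everywhere let the Gaussian
  means converge pointwise under an integrable majorant; the damped step functions to which this is
  applied have both properties.\<close>

theorem plancherel:
 fixes f :: "real => complex"
 assumes f: "integrable lborel f" "!!y. norm (f y) <= B" "AE y in lborel. isCont f y"
  and fh: "integrable lborel (%t. (norm (fourier f t))\<^sup>2)"
 shows "integrable lborel (%y. (norm (f y))\<^sup>2)"
  and "(LBINT t. (norm (fourier f t))\<^sup>2) = 2 * pi * (LBINT y. (norm (f y))\<^sup>2)"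
proof -
 have fm: "f \<in> borel_measurable lborel" using f by simp
 have fm' [measurable]: "f \<in> borel_measurable borel" "fourier f \<in> borel_measurable borel"
  using fm fourier_measurable[OF fm] by auto
 have B: "B >= 0" using order_trans[OF norm_ge_zero f(2)[of 0]] .
 have fB: "integrable lborel (%y. norm (f y) * B)" using f(1) by auto
 show "integrable lborel (%y. (norm (f y))\<^sup>2)"
  by (rule Bochner_Integration.integrable_bound[OF fB])
    (use f(2) B in \<open>auto simp: power2_eq_square abs_mult intro!: mult_left_mono\<close>)
 let ?G = "%e t. complex_of_real (exp (- e * t\<^sup>2 / 2))"
 have key: "(LBINT t. of_real ((norm (fourier f t))\<^sup>2) * ?G e t) = 2 * pi * (LBINT y. cnj (f y) * gauss_mean e f y)"
  if e: "e > 0" for e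
 proof -
  let ?h = "%t y. cnj (f y) * (fourier f t * ?G e t * cis (t * y))"
  have Fint: "integrable lborel (%t. fourier f t * ?G e t)"
   using gauss_mean_fourier(1)[OF f(1) e, of 0] by simp
  have prod: "integrable (lborel \<Otimes>\<^sub>M lborel) (case_prod ?h)"
  proof (rule lborel_pair.Fubini_integrable)
   have [measurable]: "(%x. fourier f (fst x)) \<in> borel_measurable (lborel \<Otimes>\<^sub>M lborel)"
    "(%x. cnj (f (snd x))) \<in> borel_measurable (lborel \<Otimes>\<^sub>M lborel)"
    by (rule measurable_compose[OF measurable_fst], rule fourier_measurable[OF fm])
      (intro measurable_compose[OF measurable_snd] measurable_compose[OF fm] borel_measurable_continuous_onI continuous_intros)
   show "case_prod ?h \<in> borel_measurable (lborel \<Otimes>\<^sub>M lborel)" unfolding split_beta by measurable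
   have "(LBINT y. norm (?h t y)) = norm (fourier f t * ?G e t) * (LBINT y. norm (f y))" for t
    by (simp add: norm_mult mult.commute)
   then show "integrable lborel (%t. LBINT y. norm (case (t, y) of (t, y) => ?h t y))"
    using integrable_norm[OF Fint] by simp
   have "integrable lborel (%y. cnj (f y) * cis (t * y))" for t
    using f(1) by (intro fourier_integrable) auto
   then have "integrable lborel (%y. fourier f t * ?G e t * (cnj (f y) * cis (t * y)))" for t
    by (rule integrable_mult_right)
   then show "AE t in lborel. integrable lborel (%y. case (t, y) of (t, y) => ?h t y)"
    by (simp add: mult_ac)
  qed
  have cf: "cnj (fourier f t) = (LBINT y. cnj (f y) * cis (t * y))" for t
   unfolding fourier_def using Bochner_Integration.integral_cnj[of lborel "%y. f y * cis (- t * y)"] by (simp add: cis_cnj)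
  have inner: "(LBINT y. ?h t y) = fourier f t * ?G e t * cnj (fourier f t)" for t
  proof -
   have "(LBINT y. ?h t y) = (LBINT y. fourier f t * ?G e t * (cnj (f y) * cis (t * y)))"
    by (intro Bochner_Integration.integral_cong) (simp_all add: mult_ac)
   then show ?thesis unfolding integral_mult_right_zero cf .
  qed
  have "(LBINT t. of_real ((norm (fourier f t))\<^sup>2) * ?G e t) = (LBINT t. (LBINT y. ?h t y))"
   unfolding inner by (intro Bochner_Integration.integral_cong) (auto simp: complex_norm_square simp del: of_real_power)
  also have "... = (LBINT y. (LBINT t. ?h t y))"
   using lborel_pair.Fubini_integral[OF prod] by simp
  also have "... = (LBINT y. 2 * pi * (cnj (f y) * gauss_mean e f y))"
   using gauss_mean_fourier(2)[OF f(1) e] by (simp add: mult_ac)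
  finally show ?thesis by simp
 qed
 have "(%n. LBINT t. complex_of_real ((norm (fourier f t))\<^sup>2) * ?G (1 / real (Suc n)) t) \<longlonglongrightarrow> (LBINT t. complex_of_real ((norm (fourier f t))\<^sup>2))"
  using fh by (intro gauss_weight_tendsto) (auto simp del: of_real_power)
 moreover have "(%n. 2 * pi * (LBINT y. cnj (f y) * gauss_mean (1 / real (Suc n)) f y)) \<longlonglongrightarrow> 2 * pi * (LBINT y. cnj (f y) * f y)"
 proof (intro tendsto_intros integral_dominated_convergence[where w = "%y. norm (f y) * B"])
  have cf: "(%y. cnj (f y)) \<in> borel_measurable lborel" using f(1) by (intro borel_measurable_integrable) simp
  show "(%y. cnj (f y) * f y) \<in> borel_measurable lborel" by (rule borel_measurable_times[OF cf fm])
  show "(%y. cnj (f y) * gauss_mean (1 / real (Suc n)) f y) \<in> borel_measurable lborel" for n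
  proof (rule borel_measurable_times)
   show "(%y. cnj (f y)) \<in> borel_measurable lborel" using f(1) by (intro borel_measurable_integrable) simp
   have "(%p. f (fst p - sqrt (1 / real (Suc n)) * snd p)) \<in> borel_measurable (lborel \<Otimes>\<^sub>M lborel)"
    by (rule measurable_compose[OF _ fm'(1)]) measurable
   then have "(%(y, u). of_real (std_normal_density u) * f (y - sqrt (1 / real (Suc n)) * u)) \<in> borel_measurable (lborel \<Otimes>\<^sub>M lborel)"
    unfolding split_beta by (intro borel_measurable_times) measurable
   then show "gauss_mean (1 / real (Suc n)) f \<in> borel_measurable lborel"
    unfolding gauss_mean_def by (rule lborel.borel_measurable_lebesgue_integral)
  qed
  show "AE y in lborel. (%n. cnj (f y) * gauss_mean (1 / real (Suc n)) f y) \<longlonglongrightarrow> cnj (f y) * f y"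
   using f(3) by eventually_elim (intro tendsto_intros gauss_mean_tendsto[OF fm f(2)])
  show "AE y in lborel. norm (cnj (f y) * gauss_mean (1 / real (Suc n)) f y) <= norm (f y) * B" for n
   using gauss_mean_bound[OF fm f(2)] by (intro AE_I2) (auto simp: norm_mult intro!: mult_left_mono)
 qed (use fB in auto)
 moreover have "(LBINT t. complex_of_real ((norm (fourier f t))\<^sup>2) * ?G (1 / real (Suc n)) t)
  = 2 * pi * (LBINT y. cnj (f y) * gauss_mean (1 / real (Suc n)) f y)" for n
  by (rule key) simp
 ultimately have "(LBINT t. complex_of_real ((norm (fourier f t))\<^sup>2)) = 2 * pi * (LBINT y. cnj (f y) * f y)"
  by (simp only: LIMSEQ_unique)
 also have "(LBINT y. cnj (f y) * f y) = (LBINT y. complex_of_real ((norm (f y))\<^sup>2))"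
  by (intro Bochner_Integration.integral_cong) (auto simp: complex_norm_square mult.commute simp del: of_real_power)
 finally have "complex_of_real (LBINT t. (norm (fourier f t))\<^sup>2) = of_real (2 * pi * (LBINT y. (norm (f y))\<^sup>2))"
  by (simp del: of_real_power)
 then show "(LBINT t. (norm (fourier f t))\<^sup>2) = 2 * pi * (LBINT y. (norm (f y))\<^sup>2)"
  by (simp only: of_real_eq_iff)
qed

section \<open>Landau's theorem\<close>

text \<open>The difference of the two series vanishes on a one-sided interval at 0, whereas a power
  series with a nonzero coefficient has no zeros other than 0 close to 0.\<close>

lemma real_power_series_eq:
 fixes a b :: "nat => real"
 assumes r: "r > 0" and f: "!!x. \<bar>x\<bar> < r ==> (%n. a n * x ^ n) sums f x" "!!x. \<bar>x\<bar> < r ==> (%n. b n * x ^ n) sums g x"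
  and eq: "!!x. 0 <= x ==> x < r ==> f x = g x"
 shows "a = b"
proof
 fix m
 have d: "(%n. (a n - b n) * (x - 0) ^ n) sums (f x - g x)" if "norm (x - 0) < r" for x
  using sums_diff[OF f(1)[of x] f(2)[of x]] that by (simp add: left_diff_distrib)
 have "f 0 = a 0" "g 0 = b 0" using f[of 0] r powser_sums_zero sums_unique2 by (metis abs_zero)+
 then have z: "a 0 = b 0" using eq[of 0] r by simp
 show "a m = b m"
 proof (rule ccontr)
  assume ne: "a m ~= b m"
  then have m: "m > 0" using z by (cases m) auto
  obtain s where s: "0 < s" "!!x. x \<in> cball 0 s - {0} ==> f x - g x ~= 0"
   using powser_0_nonzero[OF r d _ _ m] ne eq[of 0] r by auto
  define x where "x = min s (r / 2)"
  have "x \<in> cball 0 s - {0}" "0 <= x" "x < r" using s(1) r by (auto simp: x_def)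
  then show False using s(2)[of x] eq[of x] by simp
 qed
qed

text \<open>The measure \<open>M\<close> and the exponent \<open>l\<close> cover Dirichlet series and Laplace integrals at the same time.\<close>

theorem landau_nonnegative_transform:
 fixes a l :: "'a => real" and g :: "complex => complex"
 assumes [measurable]: "a \<in> borel_measurable M" "l \<in> borel_measurable M"
  and nn: "!!t. a t >= 0" "!!t. l t >= 0"
  and U: "open U" "g holomorphic_on U" "!!x. x > \<sigma>1 ==> complex_of_real x \<in> U"
  and start: "!!x. x > \<sigma>0 ==> integrable M (%t. a t * exp (- x * l t)) \<and> Re (g (of_real x)) = (\<integral>t. a t * exp (- x * l t) \<partial>M)"
  and x: "x > \<sigma>1"
 shows "integrable M (%t. a t * exp (- x * l t)) \<and> Re (g (of_real x)) = (\<integral>t. a t * exp (- x * l t) \<partial>M)"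
proof -
 define P where "P x \<longleftrightarrow> integrable M (%t. a t * exp (- x * l t)) \<and> Re (g (of_real x)) = (\<integral>t. a t * exp (- x * l t) \<partial>M)" for x
 \<comment> \<open>The infimum \<open>w\<close> of \<open>S\<close> is the abscissa down to which
   the identity is known; the claim amounts to \<open>w = \<sigma>1\<close>.\<close>
 define S where "S = {y. y >= \<sigma>1 \<and> (\<forall>x>y. P x)}"
 define w where "w = Inf S"
 have "P x" if "x > max \<sigma>0 \<sigma>1" for x using start[of x] that by (simp add: P_def)
 then have ne: "max \<sigma>0 \<sigma>1 \<in> S" by (simp add: S_def)
 have bdd: "bdd_below S" by (auto simp: S_def intro!: bdd_belowI[of _ \<sigma>1])
 have w1: "w >= \<sigma>1" unfolding w_def
 proof (rule cInf_greatest)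
  show "S ~= {}" using ne by blast
 qed (simp add: S_def)
 have Pw: "P x" if "x > w" for x
 proof -
  have "S ~= {}" using ne by blast
  then have "\<exists>y\<in>S. y < x" using that cInf_less_iff[OF _ bdd] unfolding w_def by simp
  then show ?thesis by (auto simp: S_def)
 qed
 have "w = \<sigma>1"
 proof (rule ccontr)
  assume "w ~= \<sigma>1"
  then have w2: "w > \<sigma>1" using w1 by simp
  obtain e where e: "e > 0" "ball (complex_of_real w) e \<subseteq> U" using U(1,3) w2 by (meson openE)
  \<comment> \<open>With \<open>c = w + r\<close> the ball of radius \<open>3 * r\<close> about
    \<open>c\<close> stays inside the ball of radius \<open>e\<close> about \<open>w\<close>, yet it
    reaches to the left of \<open>w\<close>, as far as \<open>w - 2 * r\<close>.\<close>
  define r where "r = min (e / 4) (w - \<sigma>1)"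
  have "r <= e / 4" "r <= w - \<sigma>1" unfolding r_def by (rule min.cobounded1, rule min.cobounded2)
  then have r: "r > 0" "4 * r <= e" "w - r >= \<sigma>1" using e w2 by (auto simp: r_def)
  define c where "c = w + r"
  have Pc: "P c" using Pw r by (simp add: c_def)
  have "ball (complex_of_real c) (3 * r) \<subseteq> ball (complex_of_real w) e"
  proof
   fix z assume z: "z \<in> ball (complex_of_real c) (3 * r)"
   have "dist (complex_of_real w) z <= dist (complex_of_real w) (complex_of_real c) + dist (complex_of_real c) z"
    by (rule dist_triangle)
   also have "dist (complex_of_real w) (complex_of_real c) = r" using r by (simp add: c_def dist_norm)
   finally show "z \<in> ball (complex_of_real w) e" using z r by simp
  qed
  then have "g holomorphic_on ball (complex_of_real c) (3 * r)" using U(2) e(2) holomorphic_on_subset by blast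
  note ps = holomorphic_power_series[OF this]
  define B where "B k = (deriv ^^ k) g (of_real c) / fact k" for k
  define b where "b k = Re (B k) * (-1) ^ k" for k
  have b: "(%k. b k * x ^ k) sums Re (g (of_real (c - x)))" if "\<bar>x\<bar> < 3 * r" for x
  proof -
   have "(%k. (deriv ^^ k) g (of_real c) / fact k * (of_real (c - x) - of_real c) ^ k) sums g (of_real (c - x))"
    using that by (intro ps) (simp add: dist_norm)
   moreover have "of_real (c - x) - complex_of_real c = of_real (- x)" by simp
   ultimately have "(%k. B k * of_real ((- x) ^ k)) sums g (of_real (c - x))"
    by (simp only: of_real_power B_def)
   from sums_Re[OF this] show ?thesis
    by (simp add: b_def power_minus[of x] mult_ac del: of_real_power of_real_mult)
  qed
  \<comment> \<open>Up to the sign \<open>(-1) ^ k\<close> these will be the real parts of the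
    Taylor coefficients of \<open>g\<close> at \<open>c\<close>. They are extended nonnegative reals
    until finiteness is known.\<close>
  define m where "m k = (\<integral>\<^sup>+t. ennreal (a t * exp (- c * l t) * l t ^ k / fact k) \<partial>M)" for k
  \<comment> \<open>The exponential series in \<open>x * l t\<close> has nonnegative terms, so sum
    and integral may be exchanged even if the value is infinite. This is where nonnegativity of
    \<open>a\<close> and \<open>l\<close> enters.\<close>
  have ser: "(\<integral>\<^sup>+t. ennreal (a t * exp (- (c - x) * l t)) \<partial>M) = (\<Sum>k. m k * ennreal (x ^ k))" if x: "x >= 0" for x
  proof -
   have "ennreal (a t * exp (- (c - x) * l t)) = (\<Sum>k. ennreal (a t * exp (- c * l t) * l t ^ k / fact k * x ^ k))" for t
   proof -
    have "(%k. (x * l t) ^ k /\<^sub>R fact k) sums exp (x * l t)" by (rule exp_converges)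
    then have "(%k. a t * exp (- c * l t) * ((x * l t) ^ k /\<^sub>R fact k)) sums (a t * exp (- c * l t) * exp (x * l t))"
     by (rule sums_mult)
    moreover have "a t * exp (- c * l t) * exp (x * l t) = a t * exp (- (c - x) * l t)"
     by (simp add: algebra_simps flip: exp_add)
    moreover have "a t * exp (- c * l t) * ((x * l t) ^ k /\<^sub>R fact k) = a t * exp (- c * l t) * l t ^ k / fact k * x ^ k" for k
     by (simp add: power_mult_distrib field_simps)
    ultimately have s: "(%k. a t * exp (- c * l t) * l t ^ k / fact k * x ^ k) sums (a t * exp (- (c - x) * l t))" by (simp only:)
    then show ?thesis using nn x by (intro suminf_ennreal_eq[symmetric]) auto
   qed
   then have "(\<integral>\<^sup>+t. ennreal (a t * exp (- (c - x) * l t)) \<partial>M) = (\<integral>\<^sup>+t. (\<Sum>k. ennreal (a t * exp (- c * l t) * l t ^ k / fact k * x ^ k)) \<partial>M)"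
    by simp
   also have "... = (\<Sum>k. \<integral>\<^sup>+t. ennreal (a t * exp (- c * l t) * l t ^ k / fact k * x ^ k) \<partial>M)"
    by (rule nn_integral_suminf) measurable
   also have "... = (\<Sum>k. m k * ennreal (x ^ k))"
   proof (rule suminf_cong)
    fix k
    show "(\<integral>\<^sup>+t. ennreal (a t * exp (- c * l t) * l t ^ k / fact k * x ^ k) \<partial>M) = m k * ennreal (x ^ k)"
   proof -
    have "ennreal (a t * exp (- c * l t) * l t ^ k / fact k * x ^ k) = ennreal (a t * exp (- c * l t) * l t ^ k / fact k) * ennreal (x ^ k)" for t
     by (rule ennreal_mult) (use nn x in auto)
    then show ?thesis unfolding m_def by (simp only:) (rule nn_integral_multc, measurable)
    qed
   qed
   finally show ?thesis .
  qed
  have fin: "(\<integral>\<^sup>+t. ennreal (a t * exp (- y * l t)) \<partial>M) = ennreal (Re (g (of_real y)))" if "P y" for y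
   using that nn nn_integral_eq_integral[of M "%t. a t * exp (- y * l t)"] by (auto simp: P_def)
  define \<mu> where "\<mu> k = enn2real (m k)" for k
  have mfin: "m k = ennreal (\<mu> k)" "\<mu> k >= 0" for k
  proof -
   have Pr: "P (c - r / 2)" using r by (intro Pw) (simp add: c_def)
   have r2: "0 <= r / 2" using r by simp
   have "(\<Sum>k. m k * ennreal ((r/2) ^ k)) = ennreal (Re (g (of_real (c - r / 2))))"
    unfolding ser[OF r2, symmetric] by (rule fin[OF Pr])
   then have "(\<Sum>k. m k * ennreal ((r/2) ^ k)) < \<top>" by simp
   moreover have "m k * ennreal ((r/2) ^ k) <= (\<Sum>k. m k * ennreal ((r/2) ^ k))"
    using sum_le_suminf[of "%k. m k * ennreal ((r/2) ^ k)" "{k}"] by simp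
   ultimately have "m k * ennreal ((r/2) ^ k) < \<top>" by (rule le_less_trans[rotated])
   moreover have "ennreal ((r/2) ^ k) ~= 0" using r by simp
   ultimately have "m k < \<top>" by (metis ennreal_mult_less_top ennreal_zero_less_top mult_zero_right top.not_eq_extremum ennreal_mult_eq_top_iff)
   then show "m k = ennreal (\<mu> k)" by (simp add: \<mu>_def)
  qed (simp add: \<mu>_def)
  have \<mu>s: "(%k. \<mu> k * x ^ k) sums Re (g (of_real (c - x)))" if "0 <= x" "x < r" for x
  proof -
   have Px: "P (c - x)" using that by (intro Pw) (simp add: c_def)
   have "(\<Sum>k. ennreal (\<mu> k * x ^ k)) = ennreal (Re (g (of_real (c - x))))"
    using ser[OF that(1)] fin[OF Px] that by (simp add: mfin ennreal_mult')
   moreover have "Re (g (of_real (c - x))) >= 0" using Px nn by (auto simp: P_def intro!: integral_nonneg_AE)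
   moreover have "summable (%k. \<mu> k * x ^ k)"
    using calculation that mfin(2) by (intro summable_suminf_not_top) auto
   ultimately have sm: "summable (%k. \<mu> k * x ^ k)" and e: "(\<Sum>k. ennreal (\<mu> k * x ^ k)) = ennreal (Re (g (of_real (c - x))))"
    and g0: "Re (g (of_real (c - x))) >= 0" by blast+
   have nn': "0 <= \<mu> k * x ^ k" for k using that mfin(2)[of k] by simp
   have "(\<Sum>k. ennreal (\<mu> k * x ^ k)) = ennreal (\<Sum>k. \<mu> k * x ^ k)"
    by (rule suminf_ennreal2[OF nn' sm])
   then have "(\<Sum>k. \<mu> k * x ^ k) = Re (g (of_real (c - x)))"
    using e g0 suminf_nonneg[OF sm nn'] by simp
   then show ?thesis using summable_sums[OF sm] by simp
  qed
  \<comment> \<open>For \<open>0 <= x < r\<close> the point \<open>c - x\<close> lies to the right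
    of \<open>w\<close>, where the identity holds. Hence the moment series is the Taylor series of
    \<open>g\<close>, and that one converges up to \<open>3 * r\<close>.\<close>
  have "\<mu> = b"
  proof (rule real_power_series_eq[where r = r])
   show "(%n. \<mu> n * x ^ n) sums (\<Sum>n. \<mu> n * x ^ n)" if "\<bar>x\<bar> < r" for x
   proof (rule summable_sums, rule summable_norm_cancel)
    have "summable (%n. \<mu> n * \<bar>x\<bar> ^ n)" using \<mu>s[of "\<bar>x\<bar>"] that sums_summable by fastforce
    then show "summable (%n. norm (\<mu> n * x ^ n))" using mfin(2) by (simp add: abs_mult power_abs)
   qed
   show "(%n. b n * x ^ n) sums Re (g (of_real (c - x)))" if "\<bar>x\<bar> < r" for x using b[of x] that r by simp
   show "(\<Sum>n. \<mu> n * x ^ n) = Re (g (of_real (c - x)))" if "0 <= x" "x < r" for x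
    using \<mu>s[OF that] by (rule sums_unique[symmetric])
  qed (rule r)
  then have ext: "P (c - x)" if "0 <= x" "x < 3 * r" for x
  proof -
   have s: "(%k. \<mu> k * x ^ k) sums Re (g (of_real (c - x)))" using b[of x] that \<open>\<mu> = b\<close> by simp
   then have "(\<Sum>k. ennreal (\<mu> k * x ^ k)) = ennreal (Re (g (of_real (c - x))))"
    using that mfin(2) by (intro suminf_ennreal_eq) auto
   then have e: "(\<integral>\<^sup>+t. ennreal (a t * exp (- (c - x) * l t)) \<partial>M) = ennreal (Re (g (of_real (c - x))))"
    using ser[OF that(1)] that by (simp add: mfin ennreal_mult')
   have g0: "Re (g (of_real (c - x))) >= 0" using sums_le[OF _ sums_zero s] that mfin(2) by simp
   have m: "(%t. a t * exp (- (c - x) * l t)) \<in> borel_measurable M" by measurable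
   have nn': "AE t in M. 0 <= a t * exp (- (c - x) * l t)" using nn by simp
   have "integrable M (%t. a t * exp (- (c - x) * l t))"
    by (rule integrableI_nonneg[OF m nn']) (use e in simp)
   then show ?thesis unfolding P_def using integral_eq_nn_integral[OF m nn'] e g0 by simp
  qed
  have "w - r \<in> S"
  proof -
   have "P x" if "x > w - r" for x
   proof (cases "x > w")
    case False
    then show ?thesis using ext[of "c - x"] that by (simp add: c_def)
   qed (use Pw in simp)
   then show ?thesis using r by (simp add: S_def)
  qed
  then have "w <= w - r" unfolding w_def using bdd by (rule cInf_lower)
  then show False using r by simp
 qed
 then show ?thesis using Pw x by (simp add: P_def)
qed

section \<open>Local expansion of logarithmic derivatives\<close>

text \<open>Borel--Caratheodory, by applying the Schwarz lemma to \<open>F / (2A - F)\<close>.\<close>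

lemma borel_caratheodory_unit:
 assumes F: "F holomorphic_on ball 0 1" "F 0 = 0" and A: "A > 0" "!!z. norm z < 1 ==> Re (F z) < A" and w: "norm w < 1"
 shows "norm (F w) <= 2 * A * norm w / (1 - norm w)"
proof -
 define \<phi> where "\<phi> z = F z / (2 * of_real A - F z)" for z
 have nz: "2 * complex_of_real A - F z ~= 0" if "norm z < 1" for z
 proof
  assume "2 * complex_of_real A - F z = 0"
  then have "Re (F z) = 2 * A" by (auto simp: complex_eq_iff)
  then show False using A(2)[OF that] A(1) by simp
 qed
 have hol: "\<phi> holomorphic_on ball 0 1" unfolding \<phi>_def using F nz by (intro holomorphic_intros) auto
 have lt: "norm (\<phi> z) < 1" if z: "norm z < 1" for z
 proof -
  have "(norm (F z))\<^sup>2 < (norm (2 * complex_of_real A - F z))\<^sup>2"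
  proof -
   have "A * Re (F z) < A * A" using A(1) A(2)[OF z] by (intro mult_strict_left_mono)
   then show ?thesis unfolding cmod_power2 by (simp add: power2_eq_square algebra_simps)
  qed
  then have "norm (F z) < norm (2 * complex_of_real A - F z)" by (rule power_less_imp_less_base) simp
  then show ?thesis using nz[OF z] by (simp add: \<phi>_def norm_divide)
 qed
 have le: "norm (\<phi> w) <= norm w"
  by (rule Schwarz_Lemma(1)[OF hol _ lt w]) (simp_all add: \<phi>_def F)
 have "F w = \<phi> w * (2 * of_real A - F w)" using nz[OF w] by (simp add: \<phi>_def)
 then have "norm (F w) = norm (\<phi> w) * norm (2 * of_real A - F w)" by (metis norm_mult)
 also have "... <= norm w * (2 * A + norm (F w))"
  using le A(1) norm_triangle_ineq4[of "2 * complex_of_real A" "F w"] by (intro mult_mono) auto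
 finally have "norm (F w) * (1 - norm w) <= 2 * A * norm w" by (simp add: algebra_simps)
 then show ?thesis using w by (simp add: field_simps)
qed

lemma borel_caratheodory:
 assumes F: "F holomorphic_on ball c R" and A: "A > 0" "!!z. z \<in> ball c R ==> Re (F z - F c) < A"
  and r: "0 < r" "r < R" and z: "z \<in> cball c r"
 shows "norm (F z - F c) <= 2 * A * r / (R - r)"
proof -
 have R: "R > 0" using r by simp
 define G where "G w = F (c + of_real R * w) - F c" for w
 have sub: "c + of_real R * w \<in> ball c R" if "norm w < 1" for w
  using that R by (simp add: dist_norm norm_mult)
 have hol: "G holomorphic_on ball 0 1"
  unfolding G_def
  by (intro holomorphic_intros holomorphic_on_compose_gen[OF _ F, unfolded o_def]) (use sub in auto)
 define w where "w = (z - c) / of_real R"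
 have w: "norm w <= r / R" "c + of_real R * w = z" using z R by (auto simp: w_def norm_divide dist_norm norm_minus_commute divide_right_mono)
 then have w1: "norm w < 1" using r by (meson divide_less_eq_1_pos R less_le_trans order_le_less_trans)
 have "norm (G w) <= 2 * A * norm w / (1 - norm w)"
  by (rule borel_caratheodory_unit[OF hol _ A(1) _ w1]) (use A(2) sub in \<open>auto simp: G_def\<close>)
 also have "... <= 2 * A * (r / R) / (1 - r / R)"
  using w w1 A(1) r by (intro frac_le mult_left_mono mult_nonneg_nonneg) (auto simp: field_simps)
 also have "... = 2 * A * r / (R - r)" using R r by (simp add: field_simps)
 finally show ?thesis using w by (simp add: G_def)
qed

text \<open>Cauchy's inequality on circles of radius \<open>(R - r) / 2\<close>, which stay within
  the intermediate radius \<open>(r + R) / 2\<close>.\<close>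

lemma deriv_bound_from_sup:
 assumes "f holomorphic_on ball c R" "0 < r" "r < R" "!!w. w \<in> cball c ((r + R) / 2) ==> norm (f w) <= B" "z \<in> cball c r"
 shows "norm (deriv f z) <= 2 * B / (R - r)"
proof -
 have sub: "cball z ((R - r) / 2) \<subseteq> cball c ((r + R) / 2)"
 proof
  fix w assume "w \<in> cball z ((R - r) / 2)"
  then have "dist c w <= r + (R - r) / 2" using assms(5) dist_triangle[of c w z] unfolding mem_cball by linarith
  then show "w \<in> cball c ((r + R) / 2)" by (simp add: field_simps)
 qed
 have sub2: "cball c ((r + R) / 2) \<subseteq> ball c R" using assms by auto
 have "norm ((deriv ^^ 1) f z) <= fact 1 * B / ((R - r) / 2) ^ 1"
 proof (rule Cauchy_inequality)
  show "f holomorphic_on ball z ((R - r) / 2)"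
   using sub sub2 ball_subset_cball by (intro holomorphic_on_subset[OF assms(1)]) blast
  show "continuous_on (cball z ((R - r) / 2)) f"
   using sub sub2 by (intro holomorphic_on_imp_continuous_on holomorphic_on_subset[OF assms(1)]) blast
  show "0 < (R - r) / 2" using assms by simp
  show "norm (f w) <= B" if "norm (z - w) = (R - r) / 2" for w
   using that sub by (intro assms(4)) (auto simp: dist_norm subset_iff)
 qed
 then show ?thesis by (simp add: field_simps)
qed

text \<open>A zero-free \<open>g\<close> on a disc is \<open>exp h\<close>. The growth bound limits
  the real part of \<open>h - h c\<close> from above, Borel--Caratheodory turns this into a bound
  for its modulus, and Cauchy's inequality bounds the derivative of \<open>h\<close>, which is the
  logarithmic derivative of \<open>g\<close>.\<close>

lemma log_derivative_bound:
 assumes g: "g holomorphic_on ball c R" "!!z. z \<in> ball c R ==> g z ~= 0"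
  and A: "A > 0" "!!z. z \<in> ball c R ==> norm (g z) < exp A * norm (g c)"
  and r: "0 < r" "r < R" and z: "z \<in> cball c r"
 shows "norm (deriv g z / g z) <= 8 * A * R / (R - r)\<^sup>2"
proof -
 have R: "R > 0" using r by simp
 obtain h where h: "h holomorphic_on ball c R" "!!z. z \<in> ball c R ==> g z = exp (h z)"
  using contractible_imp_holomorphic_log[OF g(1) _ g(2)] convex_imp_contractible[OF convex_ball] by blast
 define q where "q z = h z - h c" for z
 have qh: "q holomorphic_on ball c R" unfolding q_def by (intro holomorphic_intros h)
 have re: "Re (h z - h c) < A" if "z \<in> ball c R" for z
 proof -
  have "exp (Re (h z)) < exp (A + Re (h c))"
   using A(2)[OF that] h(2)[OF that] h(2)[of c] R by (simp add: norm_exp_eq_Re exp_add)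
  then show ?thesis by simp
 qed
 define r' where "r' = (r + R) / 2"
 have r': "0 < r'" "r' < R" "r < r'" using r by (auto simp: r'_def)
 have qb: "norm (q w) <= 2 * A * r' / (R - r')" if "w \<in> cball c r'" for w
  unfolding q_def by (rule borel_caratheodory[OF h(1) A(1) re r'(1,2) that])
 have "norm (deriv q z) <= 2 * (2 * A * r' / (R - r')) / (R - r)"
  by (rule deriv_bound_from_sup[OF qh r]) (use qb z in \<open>auto simp: r'_def\<close>)
 also have "R - r' = (R - r) / 2" by (simp add: r'_def field_simps)
 also have "2 * (2 * A * r' / ((R - r) / 2)) / (R - r) = 8 * A * r' / (R - r)\<^sup>2" by (simp add: power2_eq_square)
 also have "... <= 8 * A * R / (R - r)\<^sup>2" using A r' by (intro divide_right_mono mult_left_mono) auto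
 finally have b: "norm (deriv q z) <= 8 * A * R / (R - r)\<^sup>2" .
 have zb: "z \<in> ball c R" using z r by auto
 have dh: "(h has_field_derivative deriv h z) (at z)" using holomorphic_derivI[OF h(1) open_ball zb] .
 have "(q has_field_derivative deriv h z) (at z)" unfolding q_def using dh by (auto intro!: derivative_eq_intros)
 then have "deriv q z = deriv h z" by (rule DERIV_imp_deriv)
 moreover have "(g has_field_derivative exp (h z) * deriv h z) (at z)"
 proof (rule has_field_derivative_transform_within_open[OF _ open_ball zb])
  show "((%z. exp (h z)) has_field_derivative exp (h z) * deriv h z) (at z)" using dh by (auto intro!: derivative_eq_intros)
 qed (simp add: h(2))
 then have "deriv g z / g z = deriv h z" using h(2)[OF zb] by (simp add: DERIV_imp_deriv)
 ultimately show ?thesis using b by simp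
qed

text \<open>Zeros are divided out one at a time. What the earlier ones leave behind still vanishes
  at the next point, because the earlier factors are nonzero there. As \<open>g\<close> is nonzero
  on \<open>Z\<close>, the exponents are the exact multiplicities.\<close>

lemma factor_out_zeros:
 assumes f: "f holomorphic_on S" "open S" "connected S" and "c \<in> S" "f c ~= 0" and Z: "finite Z" "Z \<subseteq> S" "!!z. z \<in> Z ==> f z = 0"
 shows "\<exists>m g. g holomorphic_on S \<and> (\<forall>z\<in>S. f z = (\<Prod>\<rho>\<in>Z. (z - \<rho>) ^ m \<rho>) * g z) \<and> (\<forall>\<rho>\<in>Z. g \<rho> ~= 0 \<and> m \<rho> > (0::nat))"
 using Z
proof (induction Z rule: finite_induct)
 case empty
 then show ?case using f by (intro exI[of _ "%_. 1"] exI[of _ f]) auto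
next
 case (insert a Z)
 then obtain m g where g: "g holomorphic_on S" "!!z. z \<in> S ==> f z = (\<Prod>\<rho>\<in>Z. (z - \<rho>) ^ m \<rho>) * g z"
  "!!\<rho>. \<rho> \<in> Z ==> g \<rho> ~= 0" "!!\<rho>. \<rho> \<in> Z ==> m \<rho> > 0"
 proof -
  have "\<exists>m g. g holomorphic_on S \<and> (\<forall>z\<in>S. f z = (\<Prod>\<rho>\<in>Z. (z - \<rho>) ^ m \<rho>) * g z) \<and> (\<forall>\<rho>\<in>Z. g \<rho> ~= 0 \<and> m \<rho> > (0::nat))"
   using insert by simp
  then show ?thesis using that by blast
 qed
 have a: "a \<in> S" "f a = 0" "a \<notin> Z" using insert by auto
 have "(\<Prod>\<rho>\<in>Z. (a - \<rho>) ^ m \<rho>) ~= 0" using a insert(1) by auto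
 then have ga: "g a = 0" using g(2)[OF a(1)] a(2) by simp
 have nc: "\<not> g constant_on S"
 proof
  assume "g constant_on S"
  then have "g c = g a" using a(1) assms(4) unfolding constant_on_def by metis
  then show False using ga g(2)[OF assms(4)] assms(5) by simp
 qed
 obtain k r n where k: "0 < n" "0 < r" "ball a r \<subseteq> S" "k holomorphic_on ball a r"
  "!!w. w \<in> ball a r ==> g w = (w - a) ^ n * k w" "!!w. w \<in> ball a r ==> k w ~= 0"
  using holomorphic_factor_zero_nonconstant[OF g(1) f(2,3) a(1) ga nc] by metis
 \<comment> \<open>The quotient by \<open>(w - a) ^ n\<close>, continued across \<open>a\<close> by
   the local cofactor \<open>k\<close>.\<close>
 define G where "G w = (if w \<in> ball a r then k w else g w / (w - a) ^ n)" for w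
 have G1: "g w = (w - a) ^ n * G w" if "w \<in> S" for w
  using k(2) k(5)[of w] by (auto simp: G_def)
 have G2: "G w = g w / (w - a) ^ n" if "w ~= a" for w
  using k(5)[of w] that by (auto simp: G_def)
 have "G holomorphic_on ball a r" by (rule holomorphic_transform[OF k(4)]) (simp add: G_def)
 moreover have "G holomorphic_on (S - {a})"
  by (rule holomorphic_transform[of "%w. g w / (w - a) ^ n"]) (use g(1) G2 in \<open>auto intro!: holomorphic_intros elim: holomorphic_on_subset\<close>)
 ultimately have "G holomorphic_on (ball a r \<union> (S - {a}))"
  using f(2) by (intro holomorphic_on_Un) (auto intro: open_delete)
 moreover have "ball a r \<union> (S - {a}) = S" using k(2,3) a(1) by auto
 ultimately have hG: "G holomorphic_on S" by simp
 define m' where "m' = m(a := n)"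
 have prodeq: "(\<Prod>\<rho>\<in>insert a Z. (z - \<rho>) ^ m' \<rho>) = (z - a) ^ n * (\<Prod>\<rho>\<in>Z. (z - \<rho>) ^ m \<rho>)" for z
 proof -
  have "(\<Prod>\<rho>\<in>Z. (z - \<rho>) ^ m' \<rho>) = (\<Prod>\<rho>\<in>Z. (z - \<rho>) ^ m \<rho>)"
   using a(3) by (intro prod.cong) (auto simp: m'_def)
  then show ?thesis using insert(1,2) by (simp add: m'_def)
 qed
 show ?case
 proof (intro exI[of _ m'] exI[of _ G] conjI ballI)
  show "f z = (\<Prod>\<rho>\<in>insert a Z. (z - \<rho>) ^ m' \<rho>) * G z" if "z \<in> S" for z
   unfolding prodeq using g(2)[OF that] G1[OF that] by (simp add: mult_ac)
  show "G \<rho> ~= 0" if "\<rho> \<in> insert a Z" for \<rho>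
  proof (cases "\<rho> = a")
   case True
   then show ?thesis using k(2,6) by (simp add: G_def)
  next
   case False
   then show ?thesis using g(3) that G2 by auto
  qed
  show "m' \<rho> > 0" if "\<rho> \<in> insert a Z" for \<rho> using that g(4) k(1) by (auto simp: m'_def)
 qed (rule hG)
qed

text \<open>Jensen's inequality by Blaschke factors: each \<open>z - \<rho>\<close> is replaced by a
  factor of equal modulus on the circle of radius \<open>R\<close> whose value at the centre is
  \<open>R\<close>. The maximum principle then compares the centre with the circle.\<close>

lemma zero_count_bound:
 assumes f: "g holomorphic_on ball c R0" and R: "0 < R2" "R2 < R" "R < R0" and Z: "finite Z" "Z \<subseteq> cball c R2"
  and M: "!!z. norm (z - c) = R ==> norm ((\<Prod>\<rho>\<in>Z. (z - \<rho>) ^ m \<rho>) * g z) <= M"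
 shows "norm (g c) * R ^ (\<Sum>\<rho>\<in>Z. m \<rho>) <= M"
proof -
 define B where "B z = g z * (\<Prod>\<rho>\<in>Z. ((of_real (R\<^sup>2) - cnj (\<rho> - c) * (z - c)) / of_real R) ^ m \<rho>)" for z
 have hol: "B holomorphic_on ball c R0" unfolding B_def using R by (intro holomorphic_intros f) auto
 have key: "norm (of_real (R\<^sup>2) - cnj (\<rho> - c) * (z - c)) = R * norm (z - \<rho>)" if "norm (z - c) = R" for z \<rho>
 proof -
  have "of_real (R\<^sup>2) = (z - c) * cnj (z - c)" using complex_norm_square[of "z - c"] that by (simp only: of_real_power)
  then have "of_real (R\<^sup>2) - cnj (\<rho> - c) * (z - c) = (z - c) * cnj (z - \<rho>)" by (simp add: algebra_simps)
  then show ?thesis using that by (simp only: norm_mult complex_mod_cnj)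
 qed
 have "norm (B c) <= M"
 proof (rule maximum_modulus_frontier[of B "cball c R"])
  show "B holomorphic_on interior (cball c R)" using R by (auto intro: holomorphic_on_subset[OF hol])
  show "continuous_on (closure (cball c R)) B" using R by (auto intro!: holomorphic_on_imp_continuous_on holomorphic_on_subset[OF hol])
  show "norm (B z) <= M" if "z \<in> frontier (cball c R)" for z
  proof -
   have z: "norm (z - c) = R" using that R by (simp add: frontier_cball dist_norm norm_minus_commute)
   have "norm ((of_real (R\<^sup>2) - cnj (\<rho> - c) * (z - c)) / of_real R) = norm (z - \<rho>)" for \<rho>
    unfolding norm_divide key[OF z] using R by simp
   then have "norm (B z) = norm (g z) * (\<Prod>\<rho>\<in>Z. norm (z - \<rho>) ^ m \<rho>)"
    unfolding B_def norm_mult prod_norm[symmetric] norm_power by (simp only:)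
   also have "... = norm ((\<Prod>\<rho>\<in>Z. (z - \<rho>) ^ m \<rho>) * g z)" by (simp add: norm_mult prod_norm[symmetric] norm_power)
   finally show ?thesis using M[OF z] by simp
  qed
 qed (use R in auto)
 moreover have "B c = g c * of_real R ^ (\<Sum>\<rho>\<in>Z. m \<rho>)" using R by (simp add: B_def power2_eq_square power_sum)
 ultimately show ?thesis using R by (simp add: norm_mult norm_power)
qed

text \<open>\<open>C\<close> depends on the four radii only: \<open>f\<close> is holomorphic up to
  \<open>R0\<close> and bounded up to \<open>R\<close>, zeros are collected up to \<open>R2\<close>,
  and the remainder is estimated up to \<open>r\<close>. Dividing by the zeros leaves a function
  that is zero-free up to \<open>R2\<close> and whose growth is still of order \<open>ln M\<close>;
  since \<open>ln M >= 1\<close>, constants can be absorbed.\<close>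

theorem local_log_derivative:
 assumes R: "0 < r" "r < R2" "R2 < R" "R < R0"
 shows "\<exists>C>0. \<forall>f c M. f holomorphic_on ball c R0 --> f c ~= 0 --> M >= exp 1 --> (\<forall>z\<in>cball c R. norm (f z) <= M * norm (f c)) -->
  (\<exists>m q. q holomorphic_on ball c R2 \<and> finite {z\<in>cball c R2. f z = 0} \<and> (\<forall>\<rho>\<in>{z\<in>cball c R2. f z = 0}. m \<rho> > (0::nat)) \<and>
   (\<forall>z\<in>ball c R2. f z ~= 0 --> deriv f z / f z = (\<Sum>\<rho>\<in>{z\<in>cball c R2. f z = 0}. of_nat (m \<rho>) / (z - \<rho>)) + q z) \<and>
   (\<forall>z\<in>cball c r. norm (q z) <= C * ln M \<and> norm (deriv q z) <= C * ln M) \<and>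
   real (\<Sum>\<rho>\<in>{z\<in>cball c R2. f z = 0}. m \<rho>) <= C * ln M)"
proof -
 define C1 where "C1 = 1 / ln (R / R2)"
 define D where "D = max 1 (R2 / (R - R2))"
 define C2 where "C2 = 1 + C1 * ln D + 1"
 define s where "s = (r + R2) / 2"
 define C3 where "C3 = 8 * C2 * R2 / (R2 - s)\<^sup>2"
 define C where "C = max C1 (max C3 (2 * C3 / (R2 - r)))"
 have C1: "C1 > 0" using R by (simp add: C1_def)
 have D: "D >= 1" by (simp add: D_def)
 have "C1 * ln D >= 0" using C1 D by simp
 then have C2: "C2 > 0" by (simp add: C2_def)
 have s: "0 < s" "s < R2" "r < s" using R by (auto simp: s_def)
 have "\<exists>m q. q holomorphic_on ball c R2 \<and> finite {z\<in>cball c R2. f z = 0} \<and> (\<forall>\<rho>\<in>{z\<in>cball c R2. f z = 0}. m \<rho> > (0::nat)) \<and>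
   (\<forall>z\<in>ball c R2. f z ~= 0 --> deriv f z / f z = (\<Sum>\<rho>\<in>{z\<in>cball c R2. f z = 0}. of_nat (m \<rho>) / (z - \<rho>)) + q z) \<and>
   (\<forall>z\<in>cball c r. norm (q z) <= C * ln M \<and> norm (deriv q z) <= C * ln M) \<and>
   real (\<Sum>\<rho>\<in>{z\<in>cball c R2. f z = 0}. m \<rho>) <= C * ln M"
  if f: "f holomorphic_on ball c R0" "f c ~= 0" and M: "M >= exp 1" and fM: "!!z. z \<in> cball c R ==> norm (f z) <= M * norm (f c)" for f c M
 proof -
  define Z where "Z = {z\<in>cball c R2. f z = 0}"
  have M0: "M > 0" using M exp_gt_zero less_le_trans by blast
  have M1: "M > 0" "M >= 1" "ln M >= 1" using M M0 order_trans[OF _ M, of 1] by (auto simp: ln_ge_iff)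
  have cb: "c \<in> ball c R0" using R by simp
  have fin: "finite Z" unfolding Z_def
  proof (cases "f constant_on ball c R0")
   case True
   then have "f z ~= 0" if "z \<in> cball c R2" for z using f(2) cb that R unfolding constant_on_def by auto
   then have "{z\<in>cball c R2. f z = 0} = {}" by blast
   then show "finite {z\<in>cball c R2. f z = 0}" by (simp only: finite.emptyI)
  next
   case False
   then show "finite {z\<in>cball c R2. f z = 0}"
    using f R by (intro holomorphic_compact_finite_zeros[of f "ball c R0"]) auto
  qed
  have Zs: "Z \<subseteq> cball c R2" "Z \<subseteq> ball c R0" "!!z. z \<in> Z ==> f z = 0" using R by (auto simp: Z_def)
  obtain m g where g: "g holomorphic_on ball c R0" "!!z. z \<in> ball c R0 ==> f z = (\<Prod>\<rho>\<in>Z. (z - \<rho>) ^ m \<rho>) * g z"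
   "!!\<rho>. \<rho> \<in> Z ==> g \<rho> ~= 0" "!!\<rho>. \<rho> \<in> Z ==> m \<rho> > 0"
   using factor_out_zeros[OF f(1) open_ball connected_ball cb f(2) fin Zs(2,3)] by metis
  define n where "n = (\<Sum>\<rho>\<in>Z. m \<rho>)"
  have gnz: "g z ~= 0" if "z \<in> cball c R2" for z
  proof (cases "z \<in> Z")
   case False
   then have "f z ~= 0" using that by (simp add: Z_def)
   moreover have "z \<in> ball c R0" using that R by auto
   ultimately show ?thesis using g(2) by auto
  qed (use g in auto)
  have "norm (g c) * R ^ n <= M * norm (f c)" unfolding n_def
  proof (rule zero_count_bound[OF g(1) R(1)[THEN less_trans, OF R(2)] R(3,4) fin Zs(1)])
   fix z assume "norm (z - c) = R"
   then have "z \<in> cball c R" "z \<in> ball c R0" using R by (auto simp: dist_norm norm_minus_commute)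
   then show "norm ((\<Prod>\<rho>\<in>Z. (z - \<rho>) ^ m \<rho>) * g z) <= M * norm (f c)" using fM g(2) by metis
  qed
  \<comment> \<open>Each factor \<open>c - \<rho>\<close> has modulus at most \<open>R2\<close>,
    against the \<open>R\<close> of the preceding bound; hence \<open>(R / R2) ^ n <= M\<close>,
    which limits the number \<open>n\<close> of zeros.\<close>
  moreover have fc: "norm (f c) <= R2 ^ n * norm (g c)"
  proof -
   have "(\<Prod>\<rho>\<in>Z. norm (c - \<rho>) ^ m \<rho>) <= (\<Prod>\<rho>\<in>Z. R2 ^ m \<rho>)"
    using Zs(1) by (intro prod_mono conjI power_mono) (auto simp: dist_norm)
   also have "... = R2 ^ n" by (simp add: n_def power_sum)
   finally show ?thesis using g(2)[OF cb] by (simp add: norm_mult norm_power prod_norm[symmetric] mult_right_mono)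
  qed
  moreover have gc: "norm (g c) > 0" using gnz[of c] R by simp
  ultimately have "norm (g c) * R ^ n <= M * (R2 ^ n * norm (g c))" using M1 by (meson mult_left_mono order_trans less_imp_le)
  then have "(R / R2) ^ n <= M" using gc R by (simp add: power_divide field_simps)
  then have "ln ((R / R2) ^ n) <= ln M" using R M1 by (subst ln_le_cancel_iff) auto
  then have "real n * ln (R / R2) <= ln M" using ln_realpow[of "R / R2" n] R by (simp only: divide_pos_pos less_trans)
  moreover have "ln (R / R2) > 0" using R by simp
  ultimately have n1: "real n <= C1 * ln M" by (simp add: C1_def pos_le_divide_eq del: ln_div)
  define A where "A = C2 * ln M"
  have A: "A > 0" unfolding A_def using C2 M1 by (intro mult_pos_pos) linarith+
  have gb: "norm (g z) < exp A * norm (g c)" if "z \<in> ball c R2" for z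
  proof -
   have "norm (g z) <= M * D ^ n * norm (g c)"
   proof (rule maximum_modulus_frontier[of g "cball c R"])
    show "g holomorphic_on interior (cball c R)" using R by (auto intro: holomorphic_on_subset[OF g(1)])
    show "continuous_on (closure (cball c R)) g" using R by (auto intro!: holomorphic_on_imp_continuous_on holomorphic_on_subset[OF g(1)])
    show "norm (g w) <= M * D ^ n * norm (g c)" if "w \<in> frontier (cball c R)" for w
    proof -
     have w: "norm (w - c) = R" using that R by (simp add: frontier_cball dist_norm norm_minus_commute)
     then have wb: "w \<in> cball c R" "w \<in> ball c R0" using R by (auto simp: dist_norm norm_minus_commute)
     \<comment> \<open>On the larger circle every factor \<open>w - \<rho>\<close> has modulus at
       least \<open>R - R2\<close>, so division by the zeros costs at most a constant to the power
       \<open>n\<close>, and \<open>n\<close> is of order \<open>ln M\<close>.\<close>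
     have "(R - R2) ^ n = (\<Prod>\<rho>\<in>Z. (R - R2) ^ m \<rho>)" by (simp add: n_def power_sum)
     also have "... <= (\<Prod>\<rho>\<in>Z. norm (w - \<rho>) ^ m \<rho>)"
     proof (intro prod_mono conjI power_mono)
      fix \<rho> assume "\<rho> \<in> Z"
      then have "norm (\<rho> - c) <= R2" using Zs(1) by (auto simp: dist_norm norm_minus_commute)
      then show "R - R2 <= norm (w - \<rho>)" using w norm_triangle_ineq2[of "w - c" "\<rho> - c"] by simp
     qed (use R in auto)
     finally have "(R - R2) ^ n * norm (g w) <= norm (f w)"
      using g(2)[OF wb(2)] by (simp add: norm_mult norm_power prod_norm[symmetric] mult_right_mono)
     also have "... <= M * norm (f c)" using fM wb by blast
     also have "... <= M * (R2 ^ n * norm (g c))" using fc M1 by (intro mult_left_mono) auto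
     finally have "norm (g w) <= M * (R2 / (R - R2)) ^ n * norm (g c)"
      using R by (simp add: power_divide field_simps)
     also have "... <= M * D ^ n * norm (g c)"
      using M1 R by (intro mult_right_mono mult_left_mono power_mono) (auto simp: D_def)
     finally show ?thesis .
    qed
   qed (use R that in auto)
   also have "M * D ^ n = exp (ln M + real n * ln D)" using M1 D by (simp add: exp_add ln_realpow[symmetric])
   also have "exp (ln M + real n * ln D) < exp A"
   proof -
    have "real n * ln D <= C1 * ln M * ln D" using n1 D by (intro mult_right_mono) auto
    then show ?thesis using M1 by (simp add: A_def C2_def algebra_simps)
   qed
   finally show ?thesis using gc by simp
  qed
  define q where "q z = deriv g z / g z" for z
  have gR2: "g holomorphic_on ball c R2" using R by (intro holomorphic_on_subset[OF g(1)]) auto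
  have hq: "q holomorphic_on ball c R2"
   unfolding q_def using gnz by (intro holomorphic_intros gR2 holomorphic_deriv open_ball) auto
  have qb: "norm (q z) <= C3 * ln M" if "z \<in> cball c s" for z
   using log_derivative_bound[OF gR2 _ A gb s(1,2) that] gnz by (simp add: q_def A_def C3_def mult_ac)
  have qd: "norm (deriv q z) <= 2 * (C3 * ln M) / (R2 - r)" if "z \<in> cball c r" for z
   by (rule deriv_bound_from_sup[OF hq R(1,2) qb that]) (simp add: s_def)
  have CC: "C1 * ln M <= C * ln M" "C3 * ln M <= C * ln M" "2 * C3 / (R2 - r) * ln M <= C * ln M"
   using M1 by (intro mult_right_mono; simp add: C_def)+
  show ?thesis unfolding Z_def[symmetric]
  proof (intro exI[of _ m] exI[of _ q] conjI ballI impI)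
   fix z assume z: "z \<in> ball c R2" and fz: "f z ~= 0"
   then have zR: "z \<in> ball c R0" "z \<notin> Z" using R Zs by auto
   have gz: "g z ~= 0" using gnz z by auto
   define P where "P w = (\<Prod>\<rho>\<in>Z. (w - \<rho>) ^ m \<rho>)" for w
   have Pz: "P z ~= 0" using fz g(2)[OF zR(1)] by (auto simp: P_def)
   have dP: "(P has_field_derivative P z * (\<Sum>\<rho>\<in>Z. of_nat (m \<rho>) / (z - \<rho>))) (at z)"
   proof -
    have dterm: "((%w. (w - \<rho>) ^ m \<rho>) has_field_derivative (z - \<rho>) ^ m \<rho> * (of_nat (m \<rho>) / (z - \<rho>))) (at z)" if "\<rho> \<in> Z" for \<rho>
    proof -
     have "z - \<rho> ~= 0" using zR that by auto
     moreover have "\<exists>k. m \<rho> = Suc k" using g(4)[OF that] gr0_implies_Suc by blast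
     then obtain k where "m \<rho> = Suc k" ..
     moreover have "((%w. (w - \<rho>) ^ Suc k) has_field_derivative of_nat (Suc k) * (1 * (z - \<rho>) ^ (Suc k - Suc 0))) (at z)"
      by (rule DERIV_power) (auto intro!: derivative_eq_intros)
     ultimately show ?thesis by (simp add: mult_ac)
    qed
    from has_field_derivative_prod'[of Z "%\<rho> w. (w - \<rho>) ^ m \<rho>" z "%\<rho>. (z - \<rho>) ^ m \<rho> * (of_nat (m \<rho>) / (z - \<rho>))"]
    have "((%w. \<Prod>\<rho>\<in>Z. (w - \<rho>) ^ m \<rho>) has_field_derivative
     (\<Prod>\<rho>\<in>Z. (z - \<rho>) ^ m \<rho>) * (\<Sum>\<rho>\<in>Z. (z - \<rho>) ^ m \<rho> * (of_nat (m \<rho>) / (z - \<rho>)) / (z - \<rho>) ^ m \<rho>)) (at z)"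
     using dterm zR(2) by fastforce
    moreover have "(\<Sum>\<rho>\<in>Z. (z - \<rho>) ^ m \<rho> * (of_nat (m \<rho>) / (z - \<rho>)) / (z - \<rho>) ^ m \<rho>) = (\<Sum>\<rho>\<in>Z. of_nat (m \<rho>) / (z - \<rho>))"
     using zR(2) by (intro sum.cong refl) auto
    ultimately show ?thesis unfolding P_def by simp
   qed
   have dg: "(g has_field_derivative deriv g z) (at z)" using holomorphic_derivI[OF g(1) open_ball zR(1)] .
   have "(f has_field_derivative (P z * (\<Sum>\<rho>\<in>Z. of_nat (m \<rho>) / (z - \<rho>)) * g z + deriv g z * P z)) (at z)"
    by (rule has_field_derivative_transform_within_open[OF DERIV_mult[OF dP dg] open_ball zR(1)]) (simp add: g(2) P_def)
   then have "deriv f z = P z * (\<Sum>\<rho>\<in>Z. of_nat (m \<rho>) / (z - \<rho>)) * g z + deriv g z * P z" by (rule DERIV_imp_deriv)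
   moreover have "f z = P z * g z" using g(2)[OF zR(1)] by (simp add: P_def)
   ultimately show "deriv f z / f z = (\<Sum>\<rho>\<in>Z. of_nat (m \<rho>) / (z - \<rho>)) + q z"
    using Pz gz by (simp add: q_def add_divide_distrib)
  next
   fix z assume z: "z \<in> cball c r"
   then have "z \<in> cball c s" using s by auto
   then show "norm (q z) <= C * ln M" using qb CC by (meson order_trans)
   show "norm (deriv q z) <= C * ln M" using qd[OF z] CC(3) by simp
  qed (use hq fin g(4) n1 CC(1) in \<open>auto simp: n_def\<close>)
 qed
 moreover have "C > 0" using C1 by (simp add: C_def)
 ultimately show ?thesis by (intro exI[of _ C]) auto
qed

section \<open>Elementary prime number estimates\<close>

lemma ln_fact_eq_sum: "ln (fact n :: real) = (\<Sum>k=1..n. ln (real k))"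
 by (induction n) (simp_all add: ln_mult)

lemma ln_two_ge_half: "ln 2 >= (1/2 :: real)"
 using ln_le_minus_one[of "1/2 :: real"] by (simp add: ln_div)

text \<open>Each \<open>ln k\<close> is the divisor sum of \<open>mangoldt\<close>; exchanging the
  sums counts the multiples of \<open>d\<close> up to \<open>n\<close>.\<close>

lemma ln_fact_eq_mangoldt: "ln (fact n :: real) = (\<Sum>d=1..n. mangoldt d * real (n div d))"
proof -
 have "ln (fact n :: real) = (\<Sum>k=1..n. ln (real k))" by (rule ln_fact_eq_sum)
 also have "... = (\<Sum>k=1..n. \<Sum>d | d dvd k. mangoldt d)"
  by (intro sum.cong refl) (subst mangoldt_sum, auto)
 also have "... = (\<Sum>k=1..n. \<Sum>d\<in>{1..n}. if d dvd k then mangoldt d else 0)"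
 proof (rule sum.cong[OF refl])
  fix k assume k: "k \<in> {1..n}"
  have "{d. d dvd k} = {d \<in> {1..n}. d dvd k}" using k dvd_imp_le[of _ k] dvd_pos_nat[of k]
   by (auto simp: Suc_le_eq intro: order_trans)
  show "(\<Sum>d | d dvd k. mangoldt d) = (\<Sum>d\<in>{1..n}. if d dvd k then mangoldt d else (0::real))"
   unfolding \<open>{d. d dvd k} = _\<close> by (rule sum.inter_filter) simp
 qed
 also have "... = (\<Sum>d\<in>{1..n}. \<Sum>k=1..n. if d dvd k then mangoldt d else 0)" by (rule sum.swap)
 also have "... = (\<Sum>d=1..n. mangoldt d * real (n div d))"
 proof (rule sum.cong[OF refl])
  fix d assume d: "d \<in> {1..n}"
  have "{k \<in> {1..n}. d dvd k} = (%j. d * j) ` {1..n div d}"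
   using d by (auto simp: image_iff dvd_def less_eq_div_iff_mult_less_eq mult.commute Suc_le_eq)
  then have "card {k \<in> {1..n}. d dvd k} = n div d" using d by (simp add: card_image inj_on_def)
  moreover have "(\<Sum>k=1..n. if d dvd k then mangoldt d else (0::real)) = (\<Sum>k\<in>{k \<in> {1..n}. d dvd k}. mangoldt d)"
   by (rule sum.inter_filter[symmetric]) simp
  ultimately show "(\<Sum>k=1..n. if d dvd k then mangoldt d else 0) = mangoldt d * real (n div d)" by simp
 qed
 finally show ?thesis .
qed

text \<open>The weights \<open>(2 * k) div d - 2 * (k div d)\<close> are nonnegative, and at least 1
  for \<open>k < d <= 2 * k\<close>. Summed against \<open>mangoldt\<close> they give the logarithm
  of the central binomial coefficient, which is at most \<open>2 ^ (2 * k)\<close>.\<close>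

lemma chebyshev_step: "(\<Sum>d\<in>{k<..2*k}. mangoldt d) <= 2 * real k * ln 2"
proof -
 have le: "(2 * (k div d) :: nat) <= (2 * k) div d" for d
 proof (cases "d = 0")
  case False
  have "2 * (k div d) * d <= 2 * k" using div_times_less_eq_dividend[of k d] by simp
  then show ?thesis using False by (simp add: less_eq_div_iff_mult_less_eq)
 qed simp
 have "(\<Sum>d\<in>{k<..2*k}. mangoldt d) <= (\<Sum>d\<in>{k<..2*k}. mangoldt d * (real ((2*k) div d) - 2 * real (k div d)))"
 proof (intro sum_mono)
  fix d assume d: "d \<in> {k<..2*k}"
  then have "k div d = 0" "(2 * k) div d >= 1" by (auto simp: Suc_le_eq div_greater_zero_iff)
  then have "1 <= real ((2*k) div d) - 2 * real (k div d)" by simp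
  from mult_left_mono[OF this mangoldt_nonneg] show "mangoldt d <= mangoldt d * (real ((2*k) div d) - 2 * real (k div d))" by simp
 qed
 also have "... <= (\<Sum>d=1..2*k. mangoldt d * (real ((2*k) div d) - 2 * real (k div d)))"
 proof (intro sum_mono2)
  show "0 <= mangoldt d * (real ((2*k) div d) - 2 * real (k div d))" for d
   using le[of d] mangoldt_nonneg[of d] by (intro mult_nonneg_nonneg) linarith+
 qed auto
 also have "... = ln (fact (2*k)) - 2 * (\<Sum>d=1..2*k. mangoldt d * real (k div d))"
  unfolding ln_fact_eq_mangoldt by (simp add: right_diff_distrib sum_subtractf sum_distrib_left mult_ac)
 also have "(\<Sum>d=1..2*k. mangoldt d * real (k div d)) = (\<Sum>d=1..k. mangoldt d * real (k div d))"
  by (intro sum.mono_neutral_right) auto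
 also have "... = ln (fact k)" by (rule ln_fact_eq_mangoldt[symmetric])
 also have "ln (fact (2*k)) - 2 * ln (fact k) = ln (real ((2 * k) choose k))"
 proof -
  have "real ((2*k) choose k) = fact (2*k) / (fact k * fact k)"
   using binomial_fact[of k "2*k", where 'a = real] by simp
  then show ?thesis by (simp add: ln_div ln_mult)
 qed
 also have "... <= ln (real (2 ^ (2 * k)))"
  using binomial_le_pow2[of "2*k" k] by (subst ln_le_cancel_iff) (auto simp del: of_nat_power)
 also have "... = 2 * real k * ln 2" by (simp add: ln_realpow)
 finally show ?thesis .
qed

text \<open>Strong induction by halving. Rounding up gives \<open>2 * k <= n + 1\<close>, and the
  slack between 3 and 4 absorbs the extra 1 once \<open>n >= 3\<close>.\<close>

lemma chebyshev_upper: "(\<Sum>d=1..n. mangoldt d) <= 4 * real n"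
proof (induction n rule: less_induct)
 case (less n)
 show ?case
 proof (cases "n <= 2")
  case True
  have "ln (real n) <= 2" if "n <= 2" "n >= 1" for n :: nat
   using ln_le_minus_one[of "real n"] that by simp
  then have "mangoldt d <= (2::real)" if "d \<in> {1..n}" for d
   using mangoldt_le[of d] that True by (auto intro: order_trans)
  then have "(\<Sum>d=1..n. mangoldt d) <= (\<Sum>d=1..n. 2::real)" by (rule sum_mono)
  then show ?thesis by simp
 next
  case False
  define k where "k = (n + 1) div 2"
  have k: "k < n" "n <= 2 * k" "2 * k <= n + 1" using False by (auto simp: k_def)
  have "(\<Sum>d=1..n. mangoldt d) <= (\<Sum>d=1..2*k. mangoldt d :: real)"
   using k mangoldt_nonneg by (intro sum_mono2) auto
  also have "... = (\<Sum>d=1..k. mangoldt d) + (\<Sum>d\<in>{k<..2*k}. mangoldt d)"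
   by (subst sum.union_disjoint[symmetric]) (auto intro!: sum.cong)
  also have "... <= 4 * real k + 2 * real k * ln 2"
   using less.IH[OF k(1)] chebyshev_step[of k] by simp
  also have "... <= 4 * real k + 2 * real k * 1"
   using ln_le_minus_one[of "2::real"] by (intro add_left_mono mult_left_mono) auto
  also have "... = 3 * real (2 * k)" by simp
  also have "... <= 3 * (real n + 1)" using k(3) by (intro mult_left_mono) linarith+
  also have "... <= 4 * real n" using False by simp
  finally show ?thesis .
 qed
qed

text \<open>Compare \<open>ln_fact_eq_mangoldt\<close> with n^n exp(-n) <= n! <= n^n. Replacing
  \<open>n div d\<close> by \<open>n / d\<close> costs at most the Chebyshev sum, which is the
  origin of the 4.\<close>

lemma mertens_bounds:
 assumes "n >= 1"
 shows "ln (real n) - 1 <= (\<Sum>d=1..n. mangoldt d / real d)" "(\<Sum>d=1..n. mangoldt d / real d) <= ln (real n) + 4"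
proof -
 have "real n ^ n / fact n <= exp (real n)"
 proof -
  have "(%k. real n ^ k /\<^sub>R fact k) sums exp (real n)" by (rule exp_converges)
  then have s: "summable (%k. real n ^ k /\<^sub>R fact k)" "(\<Sum>k. real n ^ k /\<^sub>R fact k) = exp (real n)"
   by (auto simp: sums_iff)
  have "(\<Sum>k\<in>{n}. real n ^ k /\<^sub>R fact k) <= exp (real n)"
   unfolding s(2)[symmetric] by (rule sum_le_suminf[OF s(1)]) auto
  then show ?thesis by (simp add: divide_inverse mult.commute)
 qed
 then have "real n ^ n <= exp (real n) * fact n" by (simp add: field_simps)
 then have "ln (real n ^ n) <= ln (exp (real n) * fact n)" using assms by (subst ln_le_cancel_iff) auto
 then have lower: "real n * ln (real n) - real n <= ln (fact n)" using assms by (simp add: ln_realpow ln_mult)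
 have "ln (fact n) <= ln (real n ^ n)"
  using fact_le_power[of n, where 'a = real] assms by (subst ln_le_cancel_iff) auto
 then have upper: "ln (fact n) <= real n * ln (real n)" using assms by (simp add: ln_realpow)
 let ?M = "\<Sum>d=1..n. mangoldt d / real d"
 have d1: "real (n div d) <= real n / real d" for d by (rule of_nat_div_le_of_nat)
 have "ln (fact n) <= (\<Sum>d=1..n. mangoldt d * (real n / real d))"
  unfolding ln_fact_eq_mangoldt by (intro sum_mono mult_left_mono d1 mangoldt_nonneg)
 also have "... = real n * ?M" by (simp add: sum_distrib_left mult_ac)
 finally have "real n * (ln (real n) - 1) <= real n * ?M" using lower by (simp add: algebra_simps)
 then show "ln (real n) - 1 <= ?M" using assms by simp
 have d2: "real n / real d - 1 <= real (n div d)" if "d >= 1" for d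
 proof -
  have "real n = real (n div d * d + n mod d)" by simp
  also have "... = real (n div d) * real d + real (n mod d)" by (simp only: of_nat_add of_nat_mult)
  also have "... <= real (n div d) * real d + real d" using mod_less_divisor[of d n] that by simp
  finally show ?thesis using that by (simp add: field_simps)
 qed
 have "real n * ?M - (\<Sum>d=1..n. mangoldt d) = (\<Sum>d=1..n. mangoldt d * (real n / real d - 1))"
  by (simp add: sum_distrib_left right_diff_distrib sum_subtractf mult_ac)
 also have "... <= ln (fact n)"
  unfolding ln_fact_eq_mangoldt by (intro sum_mono mult_left_mono d2 mangoldt_nonneg) auto
 finally have "real n * ?M <= real n * (ln (real n) + 4)" using upper chebyshev_upper[of n] by (simp add: algebra_simps)
 then show "?M <= ln (real n) + 4" using assms by simp
qed

text \<open>A proper prime power is encoded by its base and exponent, both at least 2. The geometric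
  series in the exponent leaves at most 2 ln m / m^2 <= 4 m^(-3/2) for each base, and the sum of
  m^(-3/2) is at most 3.\<close>

lemma sum_mangoldt_nonprime:
 assumes "finite A"
 shows "(\<Sum>n\<in>{n\<in>A. \<not> prime n}. mangoldt n / real n) <= 12"
proof -
 define B where "B = {n\<in>A. \<not> prime n \<and> primepow n}"
 obtain N where N: "!!n. n \<in> A ==> n <= N" using assms finite_nat_set_iff_bounded_le[of A] by blast
 have ex: "\<exists>p. fst p \<in> {2..N} \<and> snd p \<in> {2..N} \<and> n = fst p ^ snd p \<and> mangoldt n = ln (real (fst p))" if "n \<in> B" for n
 proof -
  have pp: "primepow n" "\<not> prime n" "n \<in> A" using that by (auto simp: B_def)
  then obtain p k where pk: "prime p" "k > 0" "n = p ^ k" by (auto simp: primepow_def)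
  have k: "k >= 2" using pk pp(2) by (cases "k = 1") auto
  have p2: "p >= 2" using pk prime_ge_2_nat by blast
  have "p ^ 1 <= p ^ k" using p2 k by (intro power_increasing) auto
  moreover have "k < p ^ k" using p2 by (intro less_le_trans[OF less_exp[of k]] power_mono) auto
  ultimately have "p <= N" "k <= N" using N[OF pp(3)] pk by auto
  then show ?thesis using pk k p2 by (intro exI[of _ "(p, k)"]) auto
 qed
 have "(\<Sum>n\<in>{n\<in>A. \<not> prime n}. mangoldt n / real n) = (\<Sum>n\<in>B. mangoldt n / real n)"
  using assms by (intro sum.mono_neutral_right) (auto simp: B_def mangoldt_def)
 also have "... <= (\<Sum>(m,k)\<in>{2..N}\<times>{2..N}. ln (real m) / real m ^ k)"
 proof -
  have "\<forall>n\<in>B. \<exists>p. fst p \<in> {2..N} \<and> snd p \<in> {2..N} \<and> n = fst p ^ snd p \<and> mangoldt n = ln (real (fst p))"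
   by (rule ballI) (rule ex)
  from bchoice[OF this] obtain f where f0: "\<forall>n\<in>B. fst (f n) \<in> {2..N} \<and> snd (f n) \<in> {2..N} \<and> n = fst (f n) ^ snd (f n) \<and> mangoldt n = ln (real (fst (f n)))"
   by (elim exE)
  note f = bspec[OF f0]
  have inj: "inj_on f B" by (rule inj_onI) (metis f)
  have "(\<Sum>n\<in>B. mangoldt n / real n) = (\<Sum>n\<in>B. (%(m,k). ln (real m) / real m ^ k) (f n))"
   using f by (intro sum.cong refl) (metis (no_types, lifting) case_prod_beta of_nat_power)
  also have "... = (\<Sum>x\<in>f ` B. (%(m,k). ln (real m) / real m ^ k) x)"
   by (subst sum.reindex[OF inj]) simp
  also have "... <= (\<Sum>(m,k)\<in>{2..N}\<times>{2..N}. ln (real m) / real m ^ k)"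
  proof (intro sum_mono2)
   show "f ` B \<subseteq> {2..N} \<times> {2..N}" using f by (intro image_subsetI) (simp only: mem_Times_iff)
  qed auto
  finally show ?thesis .
 qed
 also have "... = (\<Sum>m\<in>{2..N}. \<Sum>k\<in>{2..N}. ln (real m) / real m ^ k)"
  by (simp add: sum.cartesian_product)
 also have "... <= (\<Sum>m\<in>{2..N}. 4 * real m powr (-(1 + 1/2)))"
 proof (intro sum_mono)
  fix m assume m: "m \<in> {2..N}"
  define x where "x = 1 / real m"
  have x: "0 < x" "x <= 1 / 2" using m by (auto simp: x_def field_simps)
  have "(\<Sum>k\<in>{2..N}. x ^ k) <= 2 * x ^ 2"
  proof -
   have gs: "(%k. x ^ 2 * x ^ k) sums (x ^ 2 * (1 / (1 - x)))" using x by (intro sums_mult geometric_sums) auto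
   have "(\<Sum>k\<in>{2..N}. x ^ k) <= (\<Sum>k\<in>(%j. j + 2) ` {..<N}. x ^ k)"
   proof (intro sum_mono2)
    show "{2..N} \<subseteq> (%j. j + 2) ` {..<N}"
    proof
     fix k assume "k \<in> {2..N}"
     then show "k \<in> (%j. j + 2) ` {..<N}" by (intro image_eqI[of _ _ "k - 2"]) auto
    qed
   qed (use x in auto)
   also have "... = (\<Sum>j<N. x ^ 2 * x ^ j)" by (subst sum.reindex) (auto simp: inj_on_def power_add power2_eq_square mult_ac)
   also have "... <= x ^ 2 * (1 / (1 - x))"
    unfolding sums_unique[OF gs] using x by (intro sum_le_suminf sums_summable[OF gs]) auto
   also have "... <= x ^ 2 * 2" using x by (intro mult_left_mono) (auto simp: field_simps)
   finally show ?thesis by simp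
  qed
  then have "ln (real m) * (\<Sum>k\<in>{2..N}. x ^ k) <= ln (real m) * (2 * x ^ 2)" using m by (intro mult_left_mono) auto
  also have "ln (real m) <= real m powr (1/2) / (1/2)" using m by (intro ln_powr_bound) auto
  then have "ln (real m) * (2 * x ^ 2) <= (real m powr (1/2) / (1/2)) * (2 * x ^ 2)" by (intro mult_right_mono) auto
  also have "... = 4 * (real m powr (1/2) * real m powr (- 2))"
   using m by (simp add: x_def powr_minus_divide power_divide)
  also have "real m powr (1/2) * real m powr (- 2) = real m powr (-(1 + 1/2))" by (simp flip: powr_add)
  also have "ln (real m) * (\<Sum>k\<in>{2..N}. x ^ k) = (\<Sum>k\<in>{2..N}. ln (real m) / real m ^ k)"
   unfolding sum_distrib_left x_def by (intro sum.cong refl) (simp add: power_one_over)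
  finally show "(\<Sum>k\<in>{2..N}. ln (real m) / real m ^ k) <= 4 * real m powr (-(1 + 1/2))" .
 qed
 also have "... = 4 * (\<Sum>m\<in>{2..N}. real m powr (-(1 + 1/2)))" by (simp add: sum_distrib_left)
 also have "(\<Sum>m\<in>{2..N}. real m powr (-(1 + 1/2))) <= (\<Sum>m\<in>Suc ` {..<N}. real m powr (-(1 + 1/2)))"
 proof (intro sum_mono2)
  show "{2..N} \<subseteq> Suc ` {..<N}"
  proof
   fix k assume "k \<in> {2..N}"
   then show "k \<in> Suc ` {..<N}" by (intro image_eqI[of _ _ "k - 1"]) auto
  qed
 qed auto
 also have "... = (\<Sum>n<N. real (Suc n) powr (-(1 + 1/2)))" by (subst sum.reindex) auto
 also have "... <= (\<Sum>n. real (Suc n) powr (-(1 + 1/2)))" by (intro sum_le_suminf summable_powr_Suc) auto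
 also have "... <= 1 + 1 / (1/2)" by (rule sum_powr_le) simp
 finally show ?thesis by simp
qed

text \<open>Induction removing the largest element, which is at least \<open>card S + 1\<close>. The
  extreme set is \<open>{2..card S + 1}\<close>, for which the product telescopes.\<close>

lemma prod_one_minus_inverse_ge:
 assumes "finite S" "!!n. n \<in> S ==> n >= (2::nat)"
 shows "1 / (real (card S) + 1) <= (\<Prod>n\<in>S. 1 - 1 / real n)"
 using assms
proof (induction "card S" arbitrary: S)
 case (Suc k)
 then have ne: "S ~= {}" by auto
 define m where "m = Max S"
 have m: "m \<in> S" using Suc ne by (simp add: m_def)
 have "S \<subseteq> {2..m}" using Suc.prems by (auto simp: m_def)
 then have "card S <= card {2..m}" by (intro card_mono) auto
 then have mk: "m >= Suc k + 1" using Suc.hyps(2) by simp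
 have IH: "1 / (real k + 1) <= (\<Prod>n\<in>S - {m}. 1 - 1 / real n)"
 proof -
  have "k = card (S - {m})" using Suc.hyps(2) Suc.prems(1) m by (simp add: card_Diff_singleton)
  then show ?thesis using Suc.hyps(1)[of "S - {m}"] Suc.prems by auto
 qed
 have "1 - 1 / (real k + 2) <= 1 - 1 / real m" using mk by (auto simp: field_simps)
 then have "1 / (real k + 1) * (1 - 1 / (real k + 2)) <= (\<Prod>n\<in>S - {m}. 1 - 1 / real n) * (1 - 1 / real m)"
  by (intro mult_mono IH) (auto simp: field_simps intro!: prod_nonneg dest!: Suc.prems(2))
 also have "1 / (real k + 1) * (1 - 1 / (real k + 2)) = 1 / (real (card S) + 1)"
  unfolding Suc.hyps(2)[symmetric] by (simp add: field_simps)
 also have "(\<Prod>n\<in>S - {m}. 1 - 1 / real n) * (1 - 1 / real m) = (\<Prod>n\<in>S. 1 - 1 / real n)"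
  using prod.remove[OF Suc.prems(1) m, of "%n. 1 - 1 / real n"] by (simp add: mult.commute)
 finally show ?case .
qed simp

lemma card_prime_factors_le:
 assumes "q > 0"
 shows "2 ^ card (prime_factors q) <= (q :: nat)"
proof -
 have "2 ^ card (prime_factors q) = (\<Prod>p\<in>prime_factors q. 2::nat)" by simp
 also have "... <= (\<Prod>p\<in>prime_factors q. p ^ multiplicity p q)"
 proof (intro prod_mono conjI)
  fix p assume p: "p \<in> prime_factors q"
  then have "multiplicity p q > 0" "p >= 2" using prime_factors_multiplicity prime_ge_2_nat by auto
  then show "2 <= p ^ multiplicity p q" using self_le_power[of p "multiplicity p q"] by simp
 qed auto
 also have "... = q" using prime_factorization_nat[of q] assms by simp
 finally show ?thesis .
qed

text \<open>There are at most ln q / ln 2 <= 2 ln q distinct prime factors, because the product of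
  as many twos is at most \<open>q\<close>; their Euler factors are then bounded by
  \<open>prod_one_minus_inverse_ge\<close>.\<close>

lemma totient_lower_bound:
 assumes "q > 0"
 shows "real q <= real (totient q) * (2 * ln (real q) + 1)"
proof -
 let ?w = "card (prime_factors q)"
 have "real q * (1 / (real ?w + 1)) <= real (totient q)"
  unfolding totient_formula2 using prime_ge_2_nat
  by (intro mult_left_mono prod_one_minus_inverse_ge) auto
 then have "real q <= real (totient q) * (real ?w + 1)" by (simp add: field_simps)
 also have "real ?w + 1 <= 2 * ln (real q) + 1"
 proof -
  have "real (2 ^ ?w) <= real q" using card_prime_factors_le[OF assms] by (rule of_nat_mono)
  then have "ln (real (2 ^ ?w)) <= ln (real q)" using assms by (subst ln_le_cancel_iff) auto
  then have "real ?w * ln 2 <= ln (real q)" by (simp add: ln_realpow)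
  moreover have "real ?w * (1/2) <= real ?w * ln 2" using ln_two_ge_half by (intro mult_left_mono) auto
  ultimately show ?thesis by simp
 qed
 finally show ?thesis by (simp add: mult_left_mono)
qed

section \<open>Non-vanishing on the line Re s = 1\<close>

locale nonprincipal =
 fixes q :: nat and X :: "nat => complex"
 assumes q: "q > 0" and X: "dirichlet_character q X" and ne: "X ~= principal_character q"
begin

lemma sum_zero: "(\<Sum>i<q. X i) = 0"
 using sum_coprime_dirichlet_character[OF q X] ne by simp

lemma norm_le_1: "norm (X n) <= 1"
 using norm_dirichlet_character[OF X q, of n] by simp

lemma mult: "X (m * n) = X m * X n" and one: "X 1 = 1" and periodic: "X (n + q) = X n"
 using X by (auto simp: dirichlet_character_def)

lemma L_entire: "dirichlet_L X holomorphic_on A"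
 using dirichlet_L_periodic(1)[OF q periodic sum_zero] holomorphic_on_subset by blast

lemma L_eq: "Re s > 1 ==> dirichlet_L X s = dirichlet_series X s"
 using dirichlet_L_periodic(2)[OF q periodic sum_zero] by (simp add: dirichlet_series_def)

lemma L_bound: "Re s > 0 ==> norm (dirichlet_L X s) <= real q * norm s * (1 + 1 / Re s)"
 using norm_dirichlet_L_le[OF q periodic sum_zero norm_le_1] .

lemma L_nonzero_gt_1: "Re s > 1 ==> dirichlet_L X s ~= 0"
 using L_eq dirichlet_series_nonzero[OF mult norm_le_1 one] by simp

lemma L_lower_bound: "Re s >= 3 ==> norm (dirichlet_L X s) >= 1 / 2"
 using dirichlet_series_near_one[of X s, OF one norm_le_1] L_eq[of s]
  norm_triangle_ineq2[of 1 "1 - dirichlet_L X s"] by (simp add: norm_minus_commute)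

lemma L_log_deriv:
 assumes "Re s > 1"
 shows "deriv (dirichlet_L X) s / dirichlet_L X s = - dirichlet_series (%n. mangoldt n * X n) s"
proof -
 have "deriv (dirichlet_L X) s = deriv (dirichlet_series X) s"
 proof (rule complex_derivative_transform_within_open)
  show "dirichlet_series X holomorphic_on {s. Re s > 1}"
   by (rule holomorphic_transform[OF L_entire L_eq]) simp
 qed (use assms L_eq L_entire convex_connected_halfplane in auto)
 then show ?thesis using dirichlet_series_log_derivative[OF mult norm_le_1 assms] L_nonzero_gt_1[OF assms] L_eq[OF assms]
  by simp
qed

lemma GRH_nonzero:
 assumes "GRH" "Re s > 1 / 2" "Re s < 1"
 shows "dirichlet_L X s ~= 0"
 using assms(1)[unfolded GRH_def, rule_format, of q X s] assms(2,3) q X by auto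

end

text \<open>The coefficients of the Dirichlet eta function (1 - 2^(1-s)) \<zeta>(s). Being periodic
  of mean zero they have an entire \<open>dirichlet_L\<close>, which represents \<zeta> below: the
  pole at 1 turns into the zero of the elementary factor.\<close>

definition alternating :: "nat => complex" where
 "alternating n = (if odd n then 1 else -1)"

lemma alternating_periodic: "alternating (n + 2) = alternating n" "(\<Sum>i<2. alternating i) = 0" "norm (alternating n) <= 1"
proof -
 show "(\<Sum>i<2. alternating i) = 0" by (simp add: alternating_def numeral_2_eq_2)
qed (simp_all add: alternating_def)

lemma alternating_L_entire: "dirichlet_L alternating holomorphic_on A"
 using dirichlet_L_periodic(1)[OF _ alternating_periodic(1,2)] holomorphic_on_subset by auto

lemma alternating_eq_zeta:
 assumes "Re s > 1"
 shows "dirichlet_L alternating s = (1 - 2 * 2 powr (-s)) * dirichlet_series (%_. 1) s"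
proof -
 let ?z = "%n. 1 / of_nat (Suc n) powr s"
 have zs: "?z sums dirichlet_series (%_. 1) s"
  unfolding dirichlet_series_def
  by (rule summable_sums[OF summable_norm_cancel[OF dirichlet_series_abs_summable[of "%_. 1" s]]]) (use assms in auto)
 \<comment> \<open>Index \<open>n\<close> stands for the integer n + 1, so odd indices are the even
   integers; subtracting their terms twice reverses their sign.\<close>
 have "(%n. if even n then 0 else 2 * 2 powr (-s) * ?z ((n - 1) div 2)) sums (0 + 2 * 2 powr (-s) * dirichlet_series (%_. 1) s)"
 proof -
  have "strict_mono (%k::nat. 2 * k + 1)" by (auto simp: strict_mono_def)
  moreover have "(if even n then 0 else 2 * 2 powr (-s) * ?z ((n - 1) div 2)) = 0" if "n \<notin> range (%k::nat. 2 * k + 1)" for n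
   using that by (auto elim!: oddE)
  moreover have "(%k. if even (2 * k + 1) then 0 else 2 * 2 powr (-s) * ?z ((2 * k + 1 - 1) div 2)) sums (0 + 2 * 2 powr (-s) * dirichlet_series (%_. 1) s)"
   using sums_mult[OF zs, of "2 * 2 powr (-s)"] by simp
  ultimately show ?thesis by (subst (asm) sums_mono_reindex)
 qed
 from sums_diff[OF zs this]
 have "(%n. ?z n - (if even n then 0 else 2 * 2 powr (-s) * ?z ((n - 1) div 2))) sums (dirichlet_series (%_. 1) s - 2 * 2 powr (-s) * dirichlet_series (%_. 1) s)"
  by simp
 moreover have "?z n - (if even n then 0 else 2 * 2 powr (-s) * ?z ((n - 1) div 2)) = alternating (Suc n) / of_nat (Suc n) powr s" for n
 proof (cases "even n")
  case False
  then obtain k where k: "n = 2 * k + 1" by (elim oddE)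
  have "of_nat (Suc n) = (2 * of_nat (Suc k) :: complex)" by (simp add: k)
  then have "of_nat (Suc n) powr s = 2 powr s * of_nat (Suc k) powr s"
   using powr_times_real[of 2 "of_nat (Suc k)" s] by simp
  moreover have "(n - 1) div 2 = k" using k by simp
  ultimately show ?thesis using False by (simp add: alternating_def powr_minus_divide del: of_nat_Suc)
 qed (simp add: alternating_def)
 ultimately have "(%n. alternating (Suc n) / of_nat (Suc n) powr s) sums (dirichlet_series (%_. 1) s - 2 * 2 powr (-s) * dirichlet_series (%_. 1) s)"
  by simp
 then show ?thesis
  using dirichlet_L_periodic(2)[of 2 alternating s] alternating_periodic assms by (simp add: sums_iff algebra_simps)
qed

text \<open>The partial sums of the coefficients alternate between 1 and 0, so summation by parts
  leaves nonnegative differences, the first of which is positive.\<close>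

lemma alternating_L_positive:
 assumes "x > 0"
 shows "Re (dirichlet_L alternating (of_real x)) > 0"
proof -
 let ?x = "%n. alternating (Suc n)"
 have A: "(\<Sum>i\<le>n. ?x i) = (if even n then 1 else 0)" for n
  by (induction n) (auto simp: alternating_def)
 have pd: "power_difference (Suc 0) (of_real x) (real (Suc n)) = of_real (real (Suc n) powr (-x) - real (Suc (Suc n)) powr (-x))" for n
  using powr_of_real[of "real (Suc n)" "-x"] powr_of_real[of "real (Suc (Suc n))" "-x"] by (simp add: add_ac)
 have per: "(\<Sum>i<2. ?x i) = 0" by (simp add: alternating_def numeral_2_eq_2)
 have hol: "dirichlet_L alternating holomorphic_on {s. 0 < Re s}" by (rule alternating_L_entire)
 have Le: "dirichlet_L alternating s = (\<Sum>n. ?x n * power_difference 0 s (real (Suc n)))" if "1 < Re s" for s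
  using dirichlet_L_periodic(2)[of 2 alternating s] alternating_periodic that by (simp add: powr_minus_divide)
 let ?t = "%n. (\<Sum>i\<le>n. ?x i) * power_difference (Suc 0) (of_real x) (real (Suc n))"
 have eq: "dirichlet_L alternating (of_real x) = (\<Sum>n. ?t n)"
 proof (rule periodic_series_abel(2)[of 2 ?x "dirichlet_L alternating" "of_real x"])
  show "?x (n + 2) = ?x n" for n using alternating_periodic(1)[of "Suc n"] by simp
  show "norm (?x n) <= 1" for n by (rule alternating_periodic(3))
  show "0 < Re (complex_of_real x)" using assms by simp
  show "0 < (2::nat)" by simp
  show "(\<Sum>i<2. ?x i) = 0" by (rule per)
  show "dirichlet_L alternating holomorphic_on {s. 0 < Re s}" by (rule hol)
  show "dirichlet_L alternating s = (\<Sum>n. ?x n * power_difference 0 s (real (Suc n)))" if "1 < Re s" for s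
   using that by (rule Le)
 qed
 have sm: "summable ?t"
  using power_difference_series_holomorphic(2)[of "%n. \<Sum>i\<le>n. ?x i" 1 "Suc 0" "of_real x"] assms by (simp add: A del: power_difference.simps)
 have "Re (\<Sum>n. ?t n) = (\<Sum>n. Re (?t n))" by (rule bounded_linear.suminf[OF bounded_linear_Re sm])
 moreover have "Re (?t n) >= 0" for n
  unfolding pd A using powr_mono2'[of "-x" "real (Suc n)" "real (Suc (Suc n))"] assms by auto
 then have "(\<Sum>n\<in>{0}. Re (?t n)) <= (\<Sum>n. Re (?t n))"
  by (intro sum_le_suminf summable_Re sm) auto
 moreover have "Re (?t 0) > 0"
  unfolding pd A using assms powr_less_one[of 2 "-x"] by simp
 ultimately show ?thesis using eq by simp
qed

text \<open>If \<open>L(1 + i\<tau>, X) = 0\<close>, the series \<open>\<Sum> \<Lambda>(n) (1 + Re (X(n) n\<^sup>-\<^sup>i\<^sup>\<tau>)) n\<^sup>-\<^sup>s\<close> has no pole at \<open>s = 1\<close>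
 and converges for \<open>s > 1/2\<close> by Landau's theorem; but the squares of primes make it unbounded
 as \<open>s \<rightarrow> 1/2\<close>, whereas a zero of \<open>L\<close> would make it tend to \<open>-\<infinity>\<close>.\<close>

lemma log_deriv_expansion:
 assumes "f holomorphic_on UNIV" "f c ~= 0"
 obtains n h r where "r > 0" "h holomorphic_on ball (a::complex) r" "!!z. z \<in> ball a r ==> h z ~= 0"
  "!!z. z \<in> ball a r ==> f z = (z - a) ^ n * h z" "n = 0 \<longleftrightarrow> f a ~= 0"
proof (cases "f a = 0")
 case True
 have nc: "\<not> f constant_on UNIV" using True assms(2) unfolding constant_on_def by (metis UNIV_I)
 obtain h r n where "0 < n" "0 < r" "h holomorphic_on ball a r" "!!w. w \<in> ball a r ==> f w = (w - a) ^ n * h w" "!!w. w \<in> ball a r ==> h w ~= 0"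
  using holomorphic_factor_zero_nonconstant[OF assms(1) open_UNIV connected_UNIV UNIV_I True nc] by metis
 then show thesis using that[of r h n] True by auto
next
 case False
 have "continuous_on UNIV f" using assms(1) holomorphic_on_imp_continuous_on by blast
 then have "open {z. f z ~= 0}" by (intro open_Collect_neq) auto
 then obtain r where r: "r > 0" "ball a r \<subseteq> {z. f z ~= 0}" using openE[of "{z. f z ~= 0}" a] False by (metis mem_Collect_eq)
 have "f holomorphic_on ball a r" by (rule holomorphic_on_subset[OF assms(1)]) simp
 then show thesis using that[of r f 0] r False by (simp add: subset_eq)
qed

lemma deriv_power_factor:
 assumes "r > 0" "h holomorphic_on ball (a::complex) r" "!!z. z \<in> ball a r ==> f z = (z - a) ^ n * h z" "z \<in> ball a r" "z ~= a" "h z ~= 0"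
 shows "deriv f z / f z = of_nat n / (z - a) + deriv h z / h z"
proof -
 have d1: "((%w. (w - a) ^ n) has_field_derivative of_nat n * (1 * (z - a) ^ (n - Suc 0))) (at z)"
  by (rule DERIV_power) (auto intro!: derivative_eq_intros)
 have d2: "(h has_field_derivative deriv h z) (at z)" using holomorphic_derivI[OF assms(2) open_ball assms(4)] .
 have "(f has_field_derivative (of_nat n * (1 * (z - a) ^ (n - Suc 0)) * h z + deriv h z * (z - a) ^ n)) (at z)"
  by (rule has_field_derivative_transform_within_open[OF DERIV_mult[OF d1 d2] open_ball assms(4)]) (simp add: assms(3))
 then have "deriv f z = of_nat n * (z - a) ^ (n - Suc 0) * h z + deriv h z * (z - a) ^ n" using DERIV_imp_deriv by fastforce
 moreover have "of_nat n * (z - a) ^ (n - Suc 0) = of_nat n / (z - a) * (z - a) ^ n"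
  using assms(5) by (cases n) auto
 ultimately have "deriv f z = of_nat n / (z - a) * ((z - a) ^ n * h z) + deriv h z * (z - a) ^ n" by simp
 moreover have "(z - a) ^ n ~= 0" using assms(5) by simp
 ultimately show ?thesis unfolding assms(3)[OF assms(4)] using assms(6) by (simp add: add_divide_distrib)
qed

text \<open>The joint contribution of p and p^2, with \<open>u\<close> in the role of p^(-x). The
  constant is the minimum of 1 + r + 2 r^2 over real r, attained at r = -1/4.\<close>

lemma re_nonneg_cos:
 fixes c :: complex
 assumes "norm c = 1" "0 <= u" "u <= 1"
 shows "(1 + Re c) * u + (1 + Re (c * c)) * u\<^sup>2 >= 7 / 8 * u\<^sup>2"
proof -
 have "(Re c)\<^sup>2 + (Im c)\<^sup>2 = 1" using assms(1) cmod_power2[of c] by simp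
 then have cc: "Re (c * c) = 2 * (Re c)\<^sup>2 - 1" by (simp add: power2_eq_square algebra_simps)
 have "1 + Re c >= 0" using abs_Re_le_cmod[of c] assms(1) by linarith
 moreover have "u\<^sup>2 <= u" using assms by (simp add: power2_eq_square mult_left_le)
 ultimately have "(1 + Re c) * u\<^sup>2 <= (1 + Re c) * u" by (intro mult_left_mono)
 moreover have "7 / 8 * u\<^sup>2 <= (1 + Re c + 2 * (Re c)\<^sup>2) * u\<^sup>2"
 proof (intro mult_right_mono)
  have "0 <= 2 * (Re c + 1 / 4)\<^sup>2" by simp
  then show "7 / 8 <= 1 + Re c + 2 * (Re c)\<^sup>2" by (simp add: power2_eq_square algebra_simps)
 qed simp
 ultimately show ?thesis unfolding cc by (simp add: algebra_simps)
qed

context nonprincipal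
begin

lemma twisted_coeff_nonneg: "mangoldt m * (1 + Re (X m * of_nat m powr (- \<i> * of_real \<tau>))) >= 0"
proof (cases "m = 0")
 case False
 have "norm (X m * of_nat m powr (- \<i> * \<tau>)) <= 1 * 1"
  unfolding norm_mult using norm_le_1[of m] False by (intro mult_mono) (auto simp: norm_powr_real_powr)
 then have "Re (X m * of_nat m powr (- \<i> * \<tau>)) >= -1" using abs_Re_le_cmod[of "X m * of_nat m powr (- \<i> * \<tau>)"] by linarith
 then show ?thesis by (intro mult_nonneg_nonneg mangoldt_nonneg) linarith
qed simp

text \<open>As x decreases to 1/2, the terms of p and p^2 together exceed 7/16 of
  \<open>mangoldt p / real p\<close> for all primes up to any prescribed \<open>N\<close>, and by
  Mertens that sum is ln N up to a constant.\<close>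

lemma twisted_sum_unbounded:
 fixes \<tau> :: real
 defines "a \<equiv> %m. mangoldt m * (1 + Re (X m * of_nat m powr (- \<i> * \<tau>)))"
 assumes bd: "d > 0" "!!x. 1 / 2 < x ==> x < 1 / 2 + d ==> summable (%m. a m * exp (- x * ln (real m))) \<and> (\<Sum>m. a m * exp (- x * ln (real m))) <= C"
 shows False
proof -
 have a0: "a m >= 0" for m unfolding a_def by (rule twisted_coeff_nonneg)
 \<comment> \<open>16/7 inverts the factor 7/16, and 14 exceeds the losses 1 in
   \<open>mertens_bounds\<close> and 12 in \<open>sum_mangoldt_nonprime\<close>.\<close>
 obtain N :: nat where N: "real N > exp (14 + 16 / 7 * \<bar>C\<bar>)" using reals_Archimedean2 by blast
 have "exp (14 + 16 / 7 * \<bar>C\<bar>) >= 1" by simp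
 then have N0: "real N > 1" using N by linarith
 then have "ln (exp (14 + 16 / 7 * \<bar>C\<bar>)) < ln (real N)" using N by (subst ln_less_cancel_iff) auto
 then have N1: "N >= 1" "ln (real N) > 14 + 16 / 7 * \<bar>C\<bar>" "N > 1" using N0 by auto
 \<comment> \<open>So close to 1/2 that p^(-2x) >= 1 / (2 p) for all p up to \<open>N\<close>, and
   still inside the interval on which the series is bounded.\<close>
 define x where "x = 1 / 2 + min (d / 2) (ln 2 / (2 * ln (real N)))"
 have lnN: "ln (real N) > 0" using N1 by simp
 have x: "1 / 2 < x" "x < 1 / 2 + d" "(2 * x - 1) * ln (real N) <= ln 2"
 proof -
  have m: "min (d / 2) (ln 2 / (2 * ln (real N))) > 0" using bd(1) lnN by simp
  have "min (d / 2) (ln 2 / (2 * ln (real N))) <= d / 2" by simp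
  then show "1 / 2 < x" "x < 1 / 2 + d" using m bd(1) by (auto simp: x_def)
  have "2 * x - 1 = 2 * min (d / 2) (ln 2 / (2 * ln (real N)))" by (simp add: x_def)
  also have "... <= 2 * (ln 2 / (2 * ln (real N)))" by (intro mult_left_mono) auto
  finally have "(2 * x - 1) * ln (real N) <= 2 * (ln 2 / (2 * ln (real N))) * ln (real N)" using lnN by (intro mult_right_mono) auto
  then show "(2 * x - 1) * ln (real N) <= ln 2" using lnN by simp
 qed
 let ?t = "%m. a m * exp (- x * ln (real m))"
 have sm: "summable ?t" "(\<Sum>m. ?t m) <= C" using bd(2)[OF x(1,2)] by auto
 let ?P = "{p\<in>{1..N}. prime p}"
 have finP: "finite ?P" by simp
 have disj: "?P \<inter> (%p. p ^ 2) ` ?P = {}"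
  by (auto simp: prime_power_iff dest!: arg_cong[where f = prime])
 have inj: "inj_on (%p::nat. p ^ 2) ?P" by (auto simp: inj_on_def power2_eq_iff)
 have "(\<Sum>p\<in>?P. ?t p + ?t (p ^ 2)) = (\<Sum>m\<in>?P \<union> (%p. p ^ 2) ` ?P. ?t m)"
  using disj inj by (subst sum.union_disjoint) (auto simp: sum.distrib sum.reindex)
 also have "... <= (\<Sum>m. ?t m)" using a0 by (intro sum_le_suminf sm) auto
 finally have le: "(\<Sum>p\<in>?P. ?t p + ?t (p ^ 2)) <= C" using sm(2) by linarith
 have tm: "7 / 16 * (mangoldt p / real p) <= ?t p + ?t (p ^ 2)" if "p \<in> ?P" for p
 proof -
  have p: "prime p" "p >= 2" "p <= N" using that prime_ge_2_nat by auto
  define u where "u = exp (- x * ln (real p))"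
  define c where "c = X p * of_nat p powr (- \<i> * \<tau>)"
  have u: "0 <= u" "u <= 1" using p x by (auto simp: u_def)
  have pp: "X (p ^ 2) * of_nat (p ^ 2) powr (- \<i> * \<tau>) = c * c"
   using powr_times_real[of "of_nat p" "of_nat p" "- \<i> * \<tau>"] by (simp add: c_def power2_eq_square mult)
  have u2: "exp (- x * ln (real (p ^ 2))) = u\<^sup>2" using p by (simp add: u_def ln_realpow flip: exp_of_nat_mult)
  have te: "?t p + ?t (p ^ 2) = ln (real p) * ((1 + Re c) * u + (1 + Re (c * c)) * u\<^sup>2)"
   unfolding a_def pp u2 unfolding c_def[symmetric] u_def[symmetric] using p mangoldt_prime[of p] mangoldt_primepow'[of p 2]
   by (simp add: algebra_simps)
  have b: "7 / 8 * u\<^sup>2 <= (1 + Re c) * u + (1 + Re (c * c)) * u\<^sup>2"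
  proof (cases "coprime p q")
   case True
   then have "norm c = 1" using norm_dirichlet_character[OF X q, of p] p by (simp add: c_def norm_mult norm_powr_real_powr)
   then show ?thesis using re_nonneg_cos u by blast
  next
   case False
   then have "c = 0" using X by (simp add: c_def dirichlet_character_def)
   then show ?thesis using u by simp
  qed
  have "exp (- ln 2) * exp (- ln (real p)) <= u\<^sup>2"
  proof -
   have "(2 * x - 1) * ln (real p) <= (2 * x - 1) * ln (real N)" using p x by (intro mult_left_mono) auto
   then have "- ln 2 - ln (real p) <= 2 * (- x * ln (real p))" using x(3) by (simp add: algebra_simps)
   then show ?thesis unfolding u_def by (simp flip: exp_add exp_of_nat_mult)
  qed
  then have "1 / (2 * real p) <= u\<^sup>2" using p by (simp add: exp_minus field_simps)
  then have "7 / 8 * (1 / (2 * real p)) <= (1 + Re c) * u + (1 + Re (c * c)) * u\<^sup>2" using b by linarith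
  from mult_left_mono[OF this, of "ln (real p)"] show ?thesis unfolding te using p by simp
 qed
 have "7 / 16 * (\<Sum>p\<in>?P. mangoldt p / real p) <= C"
  using sum_mono[of ?P "%p. 7 / 16 * (mangoldt p / real p)" "%p. ?t p + ?t (p ^ 2)"] tm le by (simp add: sum_distrib_left)
 moreover have "(\<Sum>d=1..N. mangoldt d / real d) = (\<Sum>p\<in>?P. mangoldt p / real p) + (\<Sum>p\<in>{p\<in>{1..N}. \<not> prime p}. mangoldt p / real p)"
  by (subst sum.union_disjoint[symmetric]) (auto intro!: sum.cong)
 ultimately have "ln (real N) <= 16 / 7 * C + 13"
  using mertens_bounds(1)[OF N1(1)] sum_mangoldt_nonprime[of "{1..N}"] by simp
 then show False using N1(2) by linarith
qed

text \<open>The \<open>mangoldt\<close> series of \<zeta> is expressed through the entire functions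
  \<open>dirichlet_L alternating\<close> and \<open>E\<close>, so that the right-hand side can be
  followed through 1 and down to 1/2.\<close>

lemma twisted_sum_eq:
 fixes \<tau> :: real
 defines "a \<equiv> %m. mangoldt m * (1 + Re (X m * of_nat m powr (- \<i> * \<tau>)))"
 defines "E \<equiv> %z::complex. 1 - 2 * 2 powr (-z)"
 assumes x: "x > 1"
 shows "summable (%m. a m * exp (- x * ln (real m)))"
  "(\<Sum>m. a m * exp (- x * ln (real m))) = Re (- (deriv (dirichlet_L alternating) x / dirichlet_L alternating x) + deriv E x / E x
    - deriv (%z. dirichlet_L X (z + \<i> * \<tau>)) x / dirichlet_L X (x + \<i> * \<tau>))"
proof -
 let ?\<zeta> = "dirichlet_series (%_. 1)" and ?\<eta> = "dirichlet_L alternating"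
 have \<zeta>0: "?\<zeta> s ~= 0" if "Re s > 1" for s using dirichlet_series_nonzero[of "%_. 1" s] that by simp
 have \<zeta>d: "deriv ?\<zeta> s = - (?\<zeta> s * dirichlet_series mangoldt s)" if "Re s > 1" for s
  using dirichlet_series_log_derivative[of "%_. 1" s] that by simp
 have op: "open {s. Re s > 1}" by (rule convex_connected_halfplane)
 have h\<zeta>: "?\<zeta> holomorphic_on {s. Re s > 1}" by (rule dirichlet_series_deriv_aux(1)) simp
 have hE: "E holomorphic_on A" for A unfolding E_def by (intro holomorphic_intros) auto
 have xin: "complex_of_real x \<in> {s. Re s > 1}" using x by simp
 have d\<eta>: "(?\<eta> has_field_derivative deriv E x * ?\<zeta> x + deriv ?\<zeta> x * E x) (at x)"
  by (rule has_field_derivative_transform_within_open[OF DERIV_mult op xin])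
    (use hE holomorphic_derivI[OF h\<zeta> op xin] holomorphic_derivI[OF hE open_UNIV, of "of_real x"] alternating_eq_zeta in \<open>auto simp: E_def\<close>)
 have Ex: "E x ~= 0"
 proof
  assume "E x = 0"
  then have "?\<eta> x = 0" using alternating_eq_zeta[of x] x by (simp add: E_def)
  then show False using alternating_L_positive[of x] x by simp
 qed
 have e1: "- (deriv ?\<eta> x / ?\<eta> x) + deriv E x / E x = dirichlet_series mangoldt x"
 proof -
  have "?\<eta> x = E x * ?\<zeta> x" using alternating_eq_zeta[of x] x by (simp add: E_def)
  then show ?thesis using DERIV_imp_deriv[OF d\<eta>] \<zeta>d[of x] \<zeta>0[of x] Ex x by (simp add: field_simps)
 qed
 have "((%z. dirichlet_L X (z + \<i> * \<tau>)) has_field_derivative deriv (dirichlet_L X) (x + \<i> * \<tau>) * (1 + 0)) (at x)"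
  by (rule DERIV_chain2[OF holomorphic_derivI[OF L_entire open_UNIV UNIV_I]]) (auto intro!: derivative_eq_intros)
 then have e2: "deriv (%z. dirichlet_L X (z + \<i> * \<tau>)) x / dirichlet_L X (x + \<i> * \<tau>) = - dirichlet_series (%n. mangoldt n * X n) (x + \<i> * \<tau>)"
  using L_log_deriv[of "x + \<i> * \<tau>"] x by (simp add: DERIV_imp_deriv)
 let ?u = "%n. mangoldt (Suc n) / of_nat (Suc n) powr of_real x + mangoldt (Suc n) * X (Suc n) / of_nat (Suc n) powr (of_real x + \<i> * \<tau>)"
 have Lb: "norm (mangoldt (Suc n) * X (Suc n)) <= 1 + ln (real (Suc n))" for n
  unfolding norm_mult using mult_mono[OF mangoldt_le_ln[of n] norm_le_1[of "Suc n"]] by simp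
 have Lb1: "norm (mangoldt (Suc n) :: complex) <= 1 + ln (real (Suc n))" for n
  using mangoldt_le_ln[of n] by simp
 have s: "?u sums (dirichlet_series mangoldt x + dirichlet_series (%n. mangoldt n * X n) (x + \<i> * \<tau>))"
  unfolding dirichlet_series_def using x
  by (intro sums_add summable_sums summable_norm_cancel[OF dirichlet_series_abs_summable[of mangoldt, OF Lb1]]
     summable_norm_cancel[OF dirichlet_series_abs_summable[of "%n. mangoldt n * X n", OF Lb]]) auto
 have ue: "Re (?u n) = a (Suc n) * exp (- x * ln (real (Suc n)))" for n
 proof -
  have w: "complex_of_real (real (Suc n)) ~= 0" by (simp del: of_nat_Suc)
  have p1: "1 / complex_of_nat (Suc n) powr of_real x = of_real (exp (- x * ln (real (Suc n))))"
   using powr_of_real[of "real (Suc n)" "-x"] by (simp add: powr_minus_divide powr_def exp_minus field_simps del: of_nat_Suc)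
  have p2: "1 / complex_of_nat (Suc n) powr (of_real x + \<i> * \<tau>) = of_nat (Suc n) powr (- \<i> * \<tau>) * of_real (exp (- x * ln (real (Suc n))))"
   unfolding p1[symmetric] powr_add by (simp add: powr_minus_divide del: of_nat_Suc)
  have m: "(mangoldt (Suc n) :: complex) = of_real (mangoldt (Suc n))" by simp
  have "?u n = of_real (mangoldt (Suc n)) * of_real (exp (- x * ln (real (Suc n)))) +
    of_real (mangoldt (Suc n)) * X (Suc n) * (of_nat (Suc n) powr (- \<i> * \<tau>) * of_real (exp (- x * ln (real (Suc n)))))"
  proof -
   have "?u n = of_real (mangoldt (Suc n)) * (1 / complex_of_nat (Suc n) powr of_real x) +
    of_real (mangoldt (Suc n)) * X (Suc n) * (1 / complex_of_nat (Suc n) powr (of_real x + \<i> * \<tau>))"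
    by (simp del: of_nat_Suc)
   then show ?thesis unfolding p2 p1 .
  qed
  also have "... = of_real (mangoldt (Suc n) * exp (- x * ln (real (Suc n)))) * (1 + X (Suc n) * of_nat (Suc n) powr (- \<i> * \<tau>))"
   by (simp add: algebra_simps del: of_nat_Suc of_real_mangoldt)
  also have "Re ... = mangoldt (Suc n) * exp (- x * ln (real (Suc n))) * Re (1 + X (Suc n) * of_nat (Suc n) powr (- \<i> * \<tau>))"
   unfolding times_complex.sel Re_complex_of_real Im_complex_of_real by simp
  finally show ?thesis by (simp add: a_def del: of_nat_Suc)
 qed
 from sums_Re[OF s] have s2: "(%n. a (Suc n) * exp (- x * ln (real (Suc n)))) sums Re (dirichlet_series mangoldt x + dirichlet_series (%n. mangoldt n * X n) (x + \<i> * \<tau>))"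
  unfolding ue .
 have a0: "a 0 * exp (- x * ln (real 0)) = 0" by (simp add: a_def)
 from sums_Suc[OF s2] have s3: "(%n. a n * exp (- x * ln (real n))) sums Re (dirichlet_series mangoldt x + dirichlet_series (%n. mangoldt n * X n) (x + \<i> * \<tau>))"
  unfolding a0 by simp
 show "summable (%m. a m * exp (- x * ln (real m)))" using s3 by (rule sums_summable)
 show "(\<Sum>m. a m * exp (- x * ln (real m))) = Re (- (deriv ?\<eta> x / ?\<eta> x) + deriv E x / E x
    - deriv (%z. dirichlet_L X (z + \<i> * \<tau>)) x / dirichlet_L X (x + \<i> * \<tau>))"
  unfolding e1 e2 using sums_unique[OF s3] by simp
qed

lemma L_nonzero_line_1:
 assumes GRH
 shows "dirichlet_L X (1 + \<i> * of_real \<tau>) ~= 0"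
proof
 assume zero: "dirichlet_L X (1 + \<i> * of_real \<tau>) = 0"
 define f where "f z = dirichlet_L X (z + \<i> * of_real \<tau>)" for z
 define \<eta> where "\<eta> = dirichlet_L alternating"
 define E where "E = (%z::complex. 1 - 2 * 2 powr (-z))"
 define a where "a m = mangoldt m * (1 + Re (X m * of_nat m powr (- \<i> * of_real \<tau>)))" for m
 have hf: "f holomorphic_on A" for A
  unfolding f_def by (rule holomorphic_on_compose_gen[OF _ L_entire[of UNIV], unfolded o_def]) (auto intro!: holomorphic_intros)
 have h\<eta>: "\<eta> holomorphic_on A" for A unfolding \<eta>_def by (rule alternating_L_entire)
 have hE: "E holomorphic_on A" for A unfolding E_def by (intro holomorphic_intros) auto
 have f3: "f 3 ~= 0" unfolding f_def by (rule L_nonzero_gt_1) simp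
 have f1: "f 1 = 0" using zero by (simp add: f_def)
 have E0: "E 0 ~= 0" by (simp add: E_def)
 have Ex: "E (of_real x) = of_real (1 - 2 powr (1 - x))" for x
  using powr_of_real[of 2 "-x"] by (simp add: E_def powr_diff powr_minus_divide)
 have E1: "E 1 = 0" using Ex[of 1] by simp
 have Exn: "E (of_real x) ~= 0" if "x ~= 1" for x
 proof
  assume "E (of_real x) = 0"
  then have "2 powr (1 - x) = 1" unfolding Ex by simp
  then show False using that powr_eq_one_iff[of 2 "1 - x"] by simp
 qed
 have \<eta>x: "\<eta> (of_real x) ~= 0" if "x > 0" for x using alternating_L_positive[OF that] unfolding \<eta>_def by force
 have \<eta>3: "\<eta> 3 ~= 0" using \<eta>x[of 3] by simp
 have fx: "f (of_real x) ~= 0" if "x > 1/2" "x ~= 1" for x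
  unfolding f_def using GRH_nonzero[OF assms, of "of_real x + \<i> * of_real \<tau>"] L_nonzero_gt_1[of "of_real x + \<i> * of_real \<tau>"] that
  by (cases "x < 1") auto
 define g0 where "g0 z = - (deriv \<eta> z / \<eta> z) + deriv E z / E z - deriv f z / f z" for z
 have g0x: "summable (%m. a m * exp (- x * ln (real m)))" "(\<Sum>m. a m * exp (- x * ln (real m))) = Re (g0 (of_real x))" if "x > 1" for x
  using twisted_sum_eq[OF that, of \<tau>] unfolding a_def g0_def \<eta>_def E_def f_def by auto
 obtain n h r where h: "r > 0" "h holomorphic_on ball 1 r" "!!z. z \<in> ball 1 r ==> h z ~= 0"
  "!!z. z \<in> ball 1 r ==> f z = (z - 1) ^ n * h z" "n = 0 \<longleftrightarrow> f 1 ~= 0"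
  using log_deriv_expansion[OF hf f3, of 1] by metis
 have n: "n > 0" using h(5) f1 by simp
 obtain k e r2 where e: "r2 > 0" "e holomorphic_on ball 1 r2" "!!z. z \<in> ball 1 r2 ==> e z ~= 0"
  "!!z. z \<in> ball 1 r2 ==> E z = (z - 1) ^ k * e z" "k = 0 \<longleftrightarrow> E 1 ~= 0"
  using log_deriv_expansion[OF hE E0, of 1] by metis
 \<comment> \<open>The derivative of \<open>E\<close> at 1 is ln 2, so the zero of \<open>E\<close>
   is simple.\<close>
 have k: "k = 1"
 proof (rule ccontr)
  assume "k ~= 1"
  then have k2: "k >= 2" using e(5) E1 by simp
  have o: "(1::complex) \<in> ball 1 r2" using e(1) by simp
  have d1: "((%w. (w - 1) ^ k) has_field_derivative of_nat k * (1 * (1 - 1) ^ (k - Suc 0))) (at (1::complex))"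
   by (rule DERIV_power) (auto intro!: derivative_eq_intros)
  have "(E has_field_derivative (of_nat k * (1 * (1 - 1) ^ (k - Suc 0)) * e 1 + deriv e 1 * (1 - 1) ^ k)) (at 1)"
   by (rule has_field_derivative_transform_within_open[OF DERIV_mult[OF d1 holomorphic_derivI[OF e(2) open_ball o]] open_ball o])
    (simp add: e(4))
  moreover have "((%z. 2 powr (-z)) has_field_derivative (Ln 2 * 2 powr (-1)) * (-1)) (at (1::complex))"
   by (rule DERIV_chain2[OF has_field_derivative_powr_right]) (auto intro!: derivative_eq_intros)
  from DERIV_diff[OF DERIV_const[of 1] DERIV_cmult[OF this, of 2]]
  have "(E has_field_derivative 2 * 2 powr (-1) * Ln 2) (at 1)"
   unfolding E_def by (simp add: mult_ac)
  ultimately have "of_nat k * (1 * (1 - 1) ^ (k - Suc 0)) * e 1 + deriv e 1 * (1 - 1) ^ k = 2 * 2 powr (-1) * Ln (2::complex)"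
   by (rule DERIV_unique)
  then show False using k2 by (simp add: power_0_left)
 qed
 obtain j h3 r3 where h3: "r3 > 0" "h3 holomorphic_on ball 1 r3" "!!z. z \<in> ball 1 r3 ==> h3 z ~= 0"
  "!!z. z \<in> ball 1 r3 ==> \<eta> z = (z - 1) ^ j * h3 z" "j = 0 \<longleftrightarrow> \<eta> 1 ~= 0"
  using log_deriv_expansion[OF h\<eta> \<eta>3, of 1] by metis
 have j: "j = 0" using h3(5) \<eta>x[of 1] by simp
 define R where "R = min r (min r2 r3)"
 have R: "R > 0" "ball 1 R \<subseteq> ball 1 r" "ball 1 R \<subseteq> ball 1 r2" "ball 1 R \<subseteq> ball (1::complex) r3" using h e h3 by (auto simp: R_def)
 have nzR: "h z ~= 0" "e z ~= 0" "\<eta> z ~= 0" if "z \<in> ball 1 R" for z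
  using h(3)[of z] e(3)[of z] h3(3,4)[of z] j R that by auto
 define g1 where "g1 z = - (deriv \<eta> z / \<eta> z) + deriv e z / e z - deriv h z / h z" for z
 have hh: "h holomorphic_on ball 1 R" "e holomorphic_on ball 1 R" using h(2) e(2) R holomorphic_on_subset by blast+
 have hg1: "g1 holomorphic_on ball 1 R"
  unfolding g1_def using nzR by (intro holomorphic_intros holomorphic_deriv hh h\<eta> open_ball) auto
 \<comment> \<open>In the residue at 1 the simple zero of \<open>E\<close>, that is the pole of
   \<zeta>, counts +1, and the supposed zero of the L-function counts -n.\<close>
 have g01: "g0 z = g1 z + (1 - of_nat n) / (z - 1)" if "z \<in> ball 1 R" "z ~= 1" for z
 proof -
  have "deriv f z / f z = of_nat n / (z - 1) + deriv h z / h z"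
   using deriv_power_factor[OF h(1,2,4)] that R nzR by blast
  moreover have zin: "z \<in> ball 1 r2" using that(1) R(3) by blast
  have "deriv E z / E z = of_nat k / (z - 1) + deriv e z / e z"
   by (rule deriv_power_factor[OF e(1,2,4) zin that(2) e(3)[OF zin]])
  ultimately show ?thesis using k by (simp add: g0_def g1_def diff_divide_distrib)
 qed
 \<comment> \<open>For \<open>n >= 2\<close> the residue would be negative and the series, whose
   terms are nonnegative, would tend to minus infinity as x decreases to 1. So the two poles cancel
   exactly.\<close>
 have n1: "n = 1"
 proof (rule ccontr)
  assume "n ~= 1"
  then have n2: "n >= 2" using n by simp
  have "compact (g1 ` cball 1 (R / 2))"
   using R(1) by (intro compact_continuous_image holomorphic_on_imp_continuous_on holomorphic_on_subset[OF hg1]) auto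
  then obtain B where B: "!!z. z \<in> cball 1 (R / 2) ==> norm (g1 z) <= B" by (meson compact_imp_bounded bounded_iff imageI)
  have B0: "B >= 0" using order_trans[OF norm_ge_zero B[of 1]] R(1) by simp
  define t where "t = min (R / 4) (1 / (2 * (B + 1)))"
  have t: "t > 0" "t <= R / 4" "t <= 1 / (2 * (B + 1))" using R(1) B0 by (auto simp: t_def)
  define x where "x = 1 + t"
  have xin: "complex_of_real x \<in> cball 1 (R / 2)" "complex_of_real x \<in> ball 1 R" "complex_of_real x ~= 1" "x > 1"
   using t R(1) by (auto simp: x_def dist_norm norm_minus_commute)
  have "0 <= (\<Sum>m. a m * exp (- x * ln (real m)))"
   by (rule suminf_nonneg[OF g0x(1)[OF xin(4)]]) (unfold a_def, intro mult_nonneg_nonneg twisted_coeff_nonneg, simp)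
  also have "... = Re (g1 (of_real x)) + Re ((1 - of_nat n) / (of_real x - 1))"
   unfolding g0x(2)[OF xin(4)] g01[OF xin(2,3)] by simp
  also have "(1 - of_nat n) / (complex_of_real x - 1) = of_real ((1 - real n) / t)" by (simp add: x_def)
  also have "Re (g1 (of_real x)) <= B" using B[OF xin(1)] abs_Re_le_cmod[of "g1 (of_real x)"] by linarith
  finally have "0 <= B + (1 - real n) / t" by simp
  moreover have "(1 - real n) / t <= - 1 / t" using n2 t by (intro divide_right_mono) auto
  ultimately have "1 / t <= B" by simp
  moreover have "2 * (B + 1) <= 1 / t" using t(1,3) B0 by (simp add: field_simps)
  ultimately have "2 * (B + 1) <= B" by (rule order_trans[rotated])
  then have "2 * B + 2 <= B" by (simp only: distrib_left mult_1_right)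
  then show False using B0 by linarith
 qed
 \<comment> \<open>Here \<open>g0\<close> is holomorphic. Every real x > 1/2 other than 1 belongs to
   \<open>W\<close>, and around 1 the function \<open>g1\<close> takes over.\<close>
 define W where "W = {z. \<eta> z ~= 0 \<and> E z ~= 0 \<and> f z ~= 0}"
 have opW: "open W"
  unfolding W_def using h\<eta>[of UNIV] hE[of UNIV] hf[of UNIV]
  by (intro open_Collect_conj open_Collect_neq continuous_on_const holomorphic_on_imp_continuous_on)
 define g where "g z = (if z \<in> ball 1 R then g1 z else g0 z)" for z
 have gW: "g z = g0 z" if "z \<in> W" for z
  using g01[of z] that n1 E1 by (cases "z = 1") (auto simp: g_def W_def)
 have "g holomorphic_on ball 1 R" by (rule holomorphic_transform[OF hg1]) (simp add: g_def)
 moreover have "g0 holomorphic_on W"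
  unfolding g0_def by (intro holomorphic_intros holomorphic_deriv h\<eta> hE hf opW) (auto simp: W_def)
 then have "g holomorphic_on W" by (rule holomorphic_transform) (simp add: gW)
 ultimately have hg: "g holomorphic_on (ball 1 R \<union> W)" using opW by (intro holomorphic_on_Un) auto
 have xW: "complex_of_real x \<in> W" if "x > 1/2" "x ~= 1" for x using fx[OF that] \<eta>x[of x] Exn that by (simp add: W_def)
 \<comment> \<open>Landau's theorem for counting measure with exponent \<open>ln\<close>:
   convergence passes from x > 1 to x > 1/2.\<close>
 have landau: "summable (%m. a m * exp (- x * ln (real m))) \<and> Re (g (of_real x)) = (\<Sum>m. a m * exp (- x * ln (real m)))" if "x > 1/2" for x
 proof -
  have nn: "a m * exp (- x * ln (real m)) >= 0" for m x
   unfolding a_def by (intro mult_nonneg_nonneg twisted_coeff_nonneg) simp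
  have "integrable (count_space UNIV) (%m. a m * exp (- x * ln (real m))) \<and> Re (g (of_real x)) = (\<integral>m. a m * exp (- x * ln (real m)) \<partial>count_space UNIV)"
  proof (rule landau_nonnegative_transform[where ?\<sigma>0.0 = 1 and ?\<sigma>1.0 = "1/2" and U = "ball 1 R \<union> W"])
   show "a m >= 0" for m unfolding a_def by (rule twisted_coeff_nonneg)
   show "0 <= ln (real m)" for m by (cases m) auto
   show "complex_of_real x \<in> ball 1 R \<union> W" if "1 / 2 < x" for x using xW[OF that] R(1) by (cases "x = 1") auto
   show "integrable (count_space UNIV) (%m. a m * exp (- x * ln (real m))) \<and> Re (g (of_real x)) = (\<integral>m. a m * exp (- x * ln (real m)) \<partial>count_space UNIV)"
    if "x > 1" for x
   proof -
    have "summable (%m. norm (a m * exp (- x * ln (real m))))" using g0x(1)[OF that] nn by simp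
    then have i: "integrable (count_space UNIV) (%m. a m * exp (- x * ln (real m)))" unfolding integrable_count_space_nat_iff .
    then show ?thesis using integral_count_space_nat[OF i] g0x(2)[OF that] gW[OF xW] that by simp
   qed
  qed (use hg opW that in auto)
  then show ?thesis using integral_count_space_nat[of "%m. a m * exp (- x * ln (real m))"] nn
   by (auto simp: integrable_count_space_nat_iff)
 qed
 \<comment> \<open>The L-function may vanish at 1/2 + i\<tau>, to some order \<open>p\<close>. This
   enters as -p / (x - 1/2), which only lowers the real part; so the series stays bounded near 1/2,
   against \<open>twisted_sum_unbounded\<close>.\<close>
 obtain p h4 r4 where h4: "r4 > 0" "h4 holomorphic_on ball (1/2) r4" "!!z. z \<in> ball (1/2) r4 ==> h4 z ~= 0"
  "!!z. z \<in> ball (1/2) r4 ==> f z = (z - 1/2) ^ p * h4 z"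
  using log_deriv_expansion[OF hf f3, of "1/2"] by metis
 have "open {z. \<eta> z ~= 0 \<and> E z ~= 0}"
  using h\<eta>[of UNIV] hE[of UNIV]
  by (intro open_Collect_conj open_Collect_neq continuous_on_const holomorphic_on_imp_continuous_on)
 moreover have "1/2 \<in> {z. \<eta> z ~= 0 \<and> E z ~= 0}" using \<eta>x[of "1/2"] Exn[of "1/2"] by simp
 ultimately obtain r5 where r5: "r5 > 0" "ball (1/2) r5 \<subseteq> {z. \<eta> z ~= 0 \<and> E z ~= 0}" by (meson openE)
 define R4 where "R4 = min r4 (min r5 1)"
 have R4: "R4 > 0" "R4 <= 1" "ball (1/2::complex) R4 \<subseteq> ball (1/2) r4" "ball (1/2::complex) R4 \<subseteq> ball (1/2) r5" using h4 r5 by (auto simp: R4_def)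
 define \<phi> where "\<phi> z = - (deriv \<eta> z / \<eta> z) + deriv E z / E z - deriv h4 z / h4 z" for z
 have "h4 holomorphic_on ball (1/2) R4" using h4(2) R4 holomorphic_on_subset by blast
 then have "\<phi> holomorphic_on ball (1/2) R4"
  unfolding \<phi>_def using h4(3) r5(2) R4 by (intro holomorphic_intros holomorphic_deriv h\<eta> hE open_ball) blast+
 then have "compact (\<phi> ` cball (1/2) (R4 / 2))"
  using R4(1) by (intro compact_continuous_image holomorphic_on_imp_continuous_on) (auto elim!: holomorphic_on_subset)
 then obtain C where C: "!!z. z \<in> cball (1/2) (R4 / 2) ==> norm (\<phi> z) <= C" by (meson compact_imp_bounded bounded_iff imageI)
 have up: "(\<Sum>m. a m * exp (- x * ln (real m))) <= C" if x: "1/2 < x" "x < 1/2 + R4 / 2" for x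
 proof -
  have x1: "x ~= 1" using x R4 by simp
  have xin: "complex_of_real x \<in> cball (1/2) (R4 / 2)" "complex_of_real x \<in> ball (1/2) r4" "complex_of_real x ~= 1/2"
  proof -
   have d: "dist (1/2) (complex_of_real x) = x - 1/2"
   proof -
    have "1/2 - complex_of_real x = of_real (1/2 - x)" by simp
    then show ?thesis unfolding dist_norm using x by (simp only: norm_of_real)
   qed
   then show "complex_of_real x \<in> cball (1/2) (R4 / 2)" using x by simp
   have "complex_of_real x \<in> ball (1/2) R4" using d x R4(1) by simp
   then show "complex_of_real x \<in> ball (1/2) r4" using R4 by blast
   show "complex_of_real x ~= 1/2" using d x by force
  qed
  have "deriv f (of_real x) / f (of_real x) = of_nat p / (of_real x - 1/2) + deriv h4 (of_real x) / h4 (of_real x)"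
   by (rule deriv_power_factor[OF h4(1,2,4) xin(2,3) h4(3)[OF xin(2)]])
  then have "g0 (of_real x) = \<phi> (of_real x) - of_nat p / (of_real x - 1/2)" by (simp add: g0_def \<phi>_def)
  also have "of_nat p / (complex_of_real x - 1/2) = of_real (real p / (x - 1/2))" by simp
  finally have "Re (g0 (of_real x)) = Re (\<phi> (of_real x)) - real p / (x - 1/2)" by simp
  also have "... <= Re (\<phi> (of_real x))" using x by simp
  also have "... <= C" using C[OF xin(1)] abs_Re_le_cmod[of "\<phi> (of_real x)"] by linarith
  finally show ?thesis using landau[OF x(1)] gW[OF xW[OF x(1) x1]] by simp
 qed
 have R42: "0 < R4 / 2" using R4(1) by simp
 show False
  by (rule twisted_sum_unbounded[OF R42, of \<tau> C]) (use landau up in \<open>auto simp: a_def\<close>)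
qed

lemma L_nonzero:
 assumes GRH "Re s > 1 / 2"
 shows "dirichlet_L X s ~= 0"
proof (cases "Re s < 1")
 case False
 have "s = 1 + \<i> * of_real (Im s)" if "Re s = 1" using that by (simp add: complex_eq_iff)
 then show ?thesis using L_nonzero_line_1[OF assms(1), of "Im s"] L_nonzero_gt_1[of s] False
  by (cases "Re s = 1") auto
qed (use assms GRH_nonzero in auto)

end

section \<open>Plancherel for Laplace transforms\<close>

text \<open>Cauchy's inequality bounds the derivative, and hence all difference quotients near
  \<open>w\<close>, by the local majorant divided by \<open>r / 4\<close>; dominated convergence
  then differentiates under the integral.\<close>

lemma holomorphic_on_integral:
 fixes f :: "complex => 'a => complex"
 assumes S: "open S" and hol: "!!t. (%w. f w t) holomorphic_on S" and meas: "!!w. w \<in> S ==> f w \<in> borel_measurable M"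
  and dom: "!!w. w \<in> S ==> \<exists>r B. r > 0 \<and> ball w r \<subseteq> S \<and> integrable M B \<and> (\<forall>v\<in>ball w r. \<forall>t. norm (f v t) <= B t)"
 shows "(%w. \<integral>t. f w t \<partial>M) holomorphic_on S"
proof -
 have int: "integrable M (f w)" if w: "w \<in> S" for w
 proof -
  obtain r B where rB: "r > 0" "integrable M B" "\<forall>v\<in>ball w r. \<forall>t. norm (f v t) <= B t"
   using dom[OF w] by blast
  have "norm (f w t) <= norm (B t)" for t using rB(1,3) by (force intro: order_trans[OF _ abs_ge_self])
  then show ?thesis using rB(2) meas[OF w] by (intro Bochner_Integration.integrable_bound[OF rB(2)]) auto
 qed
 have "((%w. \<integral>t. f w t \<partial>M) has_field_derivative (\<integral>t. deriv (%w. f w t) w \<partial>M)) (at w)" if w: "w \<in> S" for w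
 proof -
  obtain r B where rB: "r > 0" "ball w r \<subseteq> S" "integrable M B" "\<forall>v\<in>ball w r. \<forall>t. norm (f v t) <= B t"
   using dom[OF w] by blast
  have der: "((%w. f w t) has_field_derivative deriv (%w. f w t) v) (at v)" if "v \<in> ball w r" for v t
   using holomorphic_derivI[OF hol S] rB(2) that by blast
  have dq: "norm ((f (w + h) t - f w t) / h) <= B t / (r / 4)" if h: "norm h < r / 4" "h ~= 0" for h t
  proof -
   have db: "norm (deriv (%w. f w t) v) <= B t / (r / 4)" if v: "v \<in> cball w (r / 4)" for v
   proof -
    have sub: "cball v (r / 4) \<subseteq> ball w r"
    proof
     fix u assume "u \<in> cball v (r / 4)"
     then show "u \<in> ball w r" using v dist_triangle[of w u v] rB(1) by simp
    qed
    have hb: "(%w. f w t) holomorphic_on ball w r" using hol rB(2) holomorphic_on_subset by blast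
    have "norm ((deriv ^^ 1) (%w. f w t) v) <= fact 1 * B t / (r / 4) ^ 1"
    proof (rule Cauchy_inequality)
     show "(%w. f w t) holomorphic_on ball v (r / 4)" using sub ball_subset_cball by (intro holomorphic_on_subset[OF hb]) blast
     show "continuous_on (cball v (r / 4)) (%w. f w t)" using sub by (intro holomorphic_on_imp_continuous_on holomorphic_on_subset[OF hb])
     show "norm (f u t) <= B t" if "norm (v - u) = r / 4" for u
      using rB(4) sub that by (auto simp: subset_iff dist_norm)
    qed (use rB in auto)
    then show ?thesis by simp
   qed
   have "norm (f (w + h) t - f w t) <= B t / (r / 4) * norm (w + h - w)"
   proof (rule field_differentiable_bound[where S = "cball w (r / 4)" and f' = "%v. deriv (%w. f w t) v"])
    show "((%w. f w t) has_field_derivative deriv (%w. f w t) v) (at v within cball w (r / 4))" if "v \<in> cball w (r / 4)" for v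
     by (rule has_field_derivative_at_within[OF der]) (use that rB(1) in auto)
   qed (use db h rB(1) in \<open>auto simp: dist_norm\<close>)
   then show ?thesis using h by (simp add: norm_divide field_simps)
  qed
  have lim: "(%i. ((\<integral>t. f (w + X i) t \<partial>M) - (\<integral>t. f w t \<partial>M)) / X i) \<longlonglongrightarrow> (\<integral>t. deriv (%w. f w t) w \<partial>M)"
   if X: "!!i. X i ~= 0" "!!i. norm (X i) < r / 4" "X \<longlonglongrightarrow> 0" for X
  proof -
   have inS: "w + X i \<in> S" for i using X(2)[of i] rB(1,2) by (auto simp: dist_norm subset_iff)
   have wlim: "(%i. (f (w + X i) t - f w t) / X i) \<longlonglongrightarrow> deriv (%w. f w t) w" for t
   proof -
    have "((%h. (f (w + h) t - f w t) / h) \<longlongrightarrow> deriv (%w. f w t) w) (at 0)"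
     using der[of w t] rB(1) by (simp add: DERIV_def)
    then show ?thesis unfolding tendsto_at_iff_sequentially using X by (auto simp: o_def)
   qed
   have m1: "(%t. (f (w + X i) t - f w t) / X i) \<in> borel_measurable M" for i
    using meas[OF inS] meas[OF w] by (intro borel_measurable_divide borel_measurable_diff) auto
   have "(%i. \<integral>t. (f (w + X i) t - f w t) / X i \<partial>M) \<longlonglongrightarrow> (\<integral>t. deriv (%w. f w t) w \<partial>M)"
   proof (rule integral_dominated_convergence[where w = "%t. B t / (r / 4)"])
    show "(%t. deriv (%w. f w t) w) \<in> borel_measurable M" by (rule borel_measurable_LIMSEQ_metric[OF m1 wlim])
    show "AE t in M. norm ((f (w + X i) t - f w t) / X i) <= B t / (r / 4)" for i using dq X by simp
   qed (use m1 wlim rB(3) in auto)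
   moreover have "(\<integral>t. (f (w + X i) t - f w t) / X i \<partial>M) = ((\<integral>t. f (w + X i) t \<partial>M) - (\<integral>t. f w t \<partial>M)) / X i" for i
    using int[OF inS] int[OF w] by simp
   ultimately show ?thesis by (simp only:)
  qed
  show ?thesis unfolding DERIV_def
  proof (subst tendsto_at_iff_sequentially, intro allI impI)
   fix X assume X: "\<forall>i. X i \<in> UNIV - {0::complex}" "X \<longlonglongrightarrow> 0"
   have "eventually (%i. norm (X i) < r / 4) sequentially"
    using tendsto_norm_zero[OF X(2)] rB(1) by (intro order_tendstoD) auto
   then obtain N where N: "!!i. i >= N ==> norm (X i) < r / 4" by (auto simp: eventually_sequentially)
   have "(%i. ((\<integral>t. f (w + X (i + N)) t \<partial>M) - (\<integral>t. f w t \<partial>M)) / X (i + N)) \<longlonglongrightarrow> (\<integral>t. deriv (%w. f w t) w \<partial>M)"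
    using X N LIMSEQ_ignore_initial_segment[OF X(2), of N] by (intro lim) auto
   then show "((%h. ((\<integral>t. f (w + h) t \<partial>M) - (\<integral>t. f w t \<partial>M)) / h) \<circ> X) \<longlonglongrightarrow> (\<integral>t. deriv (%w. f w t) w \<partial>M)"
    unfolding o_def by (rule LIMSEQ_offset)
  qed
 qed
 then show ?thesis using S holomorphic_on_open by blast
qed

lemma integrable_one_plus_abs_powr:
 assumes "a > (1::real)"
 shows "integrable lborel (%t. (1 + \<bar>t\<bar>) powr (-a))"
proof -
 have pos: "set_integrable lborel {0..} (%t. (1 + t) powr (-a))"
 proof -
  have "((%x. x powr (-a)) has_integral -(1 powr (-a + 1)) / (-a + 1)) {1..}"
   using assms by (intro has_integral_powr_to_inf) auto
  then have "(%x. x powr (-a)) absolutely_integrable_on {1..}"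
   by (intro nonnegative_absolutely_integrable_1) auto
  then have "integrable lebesgue (%x. indicator {1..} x *\<^sub>R x powr (-a))" unfolding set_integrable_def .
  then have "integrable lborel (%x. indicator {1..} x *\<^sub>R x powr (-a))" by (subst (asm) integrable_completion) auto
  then have "integrable lborel (%x. indicator {1..} (1 + 1 * x) *\<^sub>R (1 + 1 * x) powr (-a))"
   using lborel_integrable_real_affine[of "%x. indicator {1..} x *\<^sub>R x powr (-a)" 1 1] by simp
  moreover have "indicator {1..} (1 + 1 * x) *\<^sub>R (1 + 1 * x) powr (-a) = indicator {0..} x *\<^sub>R (1 + x) powr (-a)" for x
   by (auto simp: indicator_def)
  ultimately show ?thesis unfolding set_integrable_def by (simp only:)
 qed
 then have i1: "integrable lborel (%t. indicator {0..} t *\<^sub>R (1 + t) powr (-a))" unfolding set_integrable_def .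
 have i2: "integrable lborel (%t. indicator {0..} (0 + -1 * t) *\<^sub>R (1 + (0 + -1 * t)) powr (-a))"
  using lborel_integrable_real_affine[OF i1, of "-1" 0] by simp
 show ?thesis
  by (rule Bochner_Integration.integrable_bound[OF Bochner_Integration.integrable_add[OF i1 i2]])
    (auto simp: indicator_def abs_if)
qed

lemma exp_decay_integrable:
 fixes d :: real
 assumes "d > 0"
 shows "integrable lborel (%y. indicator {0..} y * exp (- d * y))"
proof -
 have "(%x. exp (- d * x)) integrable_on {0..}" using integrable_on_exp_minus_to_infinity[OF assms, of 0] by simp
 then have "(%x. exp (- d * x)) absolutely_integrable_on {0..}" by (rule nonnegative_absolutely_integrable_1) simp
 then have "integrable lebesgue (%x. indicator {0..} x *\<^sub>R exp (- d * x))" unfolding set_integrable_def .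
 then have "integrable lborel (%x. indicator {0..} x *\<^sub>R exp (- d * x))" by (subst (asm) integrable_completion) auto
 then show ?thesis by (simp only: real_scaleR_def)
qed

text \<open>To the right of \<open>c\<close> the damped function is integrable and
  \<open>plancherel\<close> applies directly. The exponent is \<open>2 * max 0 y\<close> because
  Landau's theorem asks for an exponent nonnegative everywhere; on negative \<open>y\<close> the
  function \<open>F\<close> vanishes.\<close>

lemma plancherel_laplace_initial:
 fixes F :: "real => complex"
 assumes F [measurable]: "F \<in> borel_measurable borel" and neg: "!!y. y < 0 ==> F y = 0" and bd: "!!y. y >= 0 ==> norm (F y) <= C * exp (c * y)" "C >= 0"
  and cont: "AE y in lborel. isCont F y" and \<sigma>: "\<sigma> > c"
  and H2: "integrable lborel (%t. (norm (H (Complex \<sigma> t)))\<^sup>2)"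
  and H: "!!z. Re z > c ==> H z = (LBINT y. F y * exp (- z * of_real y))"
 shows "integrable lborel (%y. (norm (F y))\<^sup>2 * exp (- \<sigma> * (2 * max 0 y)))"
  and "(LBINT t. (norm (H (Complex \<sigma> t)))\<^sup>2) = 2 * pi * (LBINT y. (norm (F y))\<^sup>2 * exp (- \<sigma> * (2 * max 0 y)))"
proof -
 define f where "f y = F y * of_real (exp (- \<sigma> * y))" for y
 have fm [measurable]: "f \<in> borel_measurable borel" unfolding f_def by measurable
 have fb: "norm (f y) <= C * (indicator {0..} y * exp (- (\<sigma> - c) * y))" for y
 proof (cases "y < 0")
  case False
  then have "norm (F y) * exp (- \<sigma> * y) <= C * exp (c * y) * exp (- \<sigma> * y)" using bd(1)[of y] by (intro mult_right_mono) auto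
  then show ?thesis using False by (simp add: f_def norm_mult algebra_simps flip: exp_add)
 qed (simp add: f_def neg)
 have i: "integrable lborel (%y. C * (indicator {0..} y * exp (- (\<sigma> - c) * y)))"
  using exp_decay_integrable[of "\<sigma> - c"] \<sigma> by (intro integrable_mult_right) simp
 have fi: "integrable lborel f"
  by (rule Bochner_Integration.integrable_bound[OF i]) (use fb in \<open>auto intro!: AE_I2 intro: order_trans[OF _ abs_ge_self]\<close>)
 have fB: "norm (f y) <= C" for y
 proof (cases "y < 0")
  case False
  have "C * (indicator {0..} y * exp (- (\<sigma> - c) * y)) <= C * (1 * 1)"
   using bd(2) False \<sigma> mult_nonpos_nonneg[of "- (\<sigma> - c)" y] by (intro mult_left_mono mult_mono) (auto simp: indicator_def)
  then show ?thesis using fb[of y] by simp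
 qed (use bd in \<open>simp add: f_def neg\<close>)
 have fc: "AE y in lborel. isCont f y"
 proof -
  have "isCont f y" if "isCont F y" for y
   unfolding f_def by (rule isCont_mult[OF that]) (intro continuous_intros)
  then show ?thesis using cont by (auto elim: eventually_mono)
 qed
 have ft: "fourier f t = H (Complex \<sigma> t)" for t
 proof -
  have "exp (- Complex \<sigma> t * of_real y) = of_real (exp (- \<sigma> * y)) * cis (- t * y)" for y
   by (simp add: exp_eq_polar)
  then show ?thesis unfolding fourier_def f_def using H[of "Complex \<sigma> t"] \<sigma> by (simp add: mult.assoc)
 qed
 have sq: "(norm (f y))\<^sup>2 = (norm (F y))\<^sup>2 * exp (- \<sigma> * (2 * max 0 y))" for y
  by (cases "y < 0") (auto simp: f_def neg norm_mult power_mult_distrib max_def power2_eq_square algebra_simps simp flip: exp_add)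
 note P = plancherel[OF fi fB fc, unfolded ft sq, OF H2]
 show "integrable lborel (%y. (norm (F y))\<^sup>2 * exp (- \<sigma> * (2 * max 0 y)))"
  "(LBINT t. (norm (H (Complex \<sigma> t)))\<^sup>2) = 2 * pi * (LBINT y. (norm (F y))\<^sup>2 * exp (- \<sigma> * (2 * max 0 y)))"
  using P by auto
qed

section \<open>Carrying Plancherel to the whole half-plane of holomorphy\<close>

text \<open>An exponent of decay above 1/2 makes \<open>H\<close> square integrable on vertical
  lines. The value 3/4 arises from the factor 1 / (1/2 + z) after bounding a logarithm of the height
  by a fourth root.\<close>

locale paley_wiener =
 fixes F :: "real => complex" and H :: "complex => complex" and C c :: real
 assumes F [measurable]: "F \<in> borel_measurable borel" and neg: "!!y. y < 0 ==> F y = 0" and bd: "!!y. y >= 0 ==> norm (F y) <= C * exp (c * y)" "C >= 0" "c >= 0"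
  and cont: "AE y in lborel. isCont F y"
  and hol: "H holomorphic_on {z. Re z > 0}"
  and Hb: "!!d B. d > 0 ==> \<exists>K. \<forall>z. d <= Re z --> Re z <= B --> norm (H z) <= K * (1 + \<bar>Im z\<bar>) powr (- (3 / 4))"
  and H: "!!z. Re z > c ==> H z = (LBINT y. F y * exp (- z * of_real y))"
begin

lemma H_measurable: "Re w > 0 ==> (%t. H (w + \<i> * of_real t)) \<in> borel_measurable lborel"
proof -
 assume "Re w > 0"
 then have "continuous_on UNIV (%t. H (w + \<i> * of_real t))"
  by (intro continuous_on_compose2[OF holomorphic_on_imp_continuous_on[OF hol]] continuous_intros) auto
 then show ?thesis by (simp add: borel_measurable_continuous_onI)
qed

lemma Complex_line: "Complex x t = of_real x + \<i> * of_real t"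
 by (simp add: complex_eq_iff)

lemma H_square_bound:
 assumes "d > 0"
 obtains K where "!!w t. d <= Re w ==> Re w <= B ==> \<bar>Im w\<bar> <= 1 ==> norm (H (w + \<i> * of_real t)) <= K * (1 + \<bar>t\<bar>) powr (- (3 / 4))" "K >= 0"
proof -
 obtain K where K: "!!z. d <= Re z ==> Re z <= B ==> norm (H z) <= K * (1 + \<bar>Im z\<bar>) powr (- (3 / 4))" using Hb[OF assms] by blast
 define K' where "K' = max K 0 * 2 powr (3 / 4)"
 have "norm (H (w + \<i> * of_real t)) <= K' * (1 + \<bar>t\<bar>) powr (- (3 / 4))" if w: "d <= Re w" "Re w <= B" "\<bar>Im w\<bar> <= 1" for w t
 proof -
  have "norm (H (w + \<i> * of_real t)) <= K * (1 + \<bar>Im w + t\<bar>) powr (- (3 / 4))" using K[of "w + \<i> * of_real t"] w by simp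
  also have "... <= max K 0 * (1 + \<bar>Im w + t\<bar>) powr (- (3 / 4))" by (intro mult_right_mono) auto
  also have "... <= max K 0 * ((1 + \<bar>t\<bar>) / 2) powr (- (3 / 4))"
  proof (intro mult_left_mono powr_mono2')
   show "(1 + \<bar>t\<bar>) / 2 <= 1 + \<bar>Im w + t\<bar>"
   proof -
    have "\<bar>t\<bar> <= \<bar>Im w + t\<bar> + \<bar>Im w\<bar>" using abs_triangle_ineq4[of "Im w + t" "Im w"] by simp
    moreover have "x <= 1 + 2 * A" if "x <= A + B" "B <= 1" "0 <= A" for x A B :: real using that by linarith
    ultimately have "\<bar>t\<bar> <= 1 + 2 * \<bar>Im w + t\<bar>" using w(3) abs_ge_zero by blast
    then show ?thesis by simp
   qed
  qed auto
  also have "... = K' * (1 + \<bar>t\<bar>) powr (- (3 / 4))" by (simp add: K'_def powr_divide powr_minus_divide)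
  finally show ?thesis .
 qed
 then show thesis using that[of K'] by (simp add: K'_def)
qed

lemma H_square_integrable:
 assumes "x > 0"
 shows "integrable lborel (%t. (norm (H (Complex x t)))\<^sup>2)"
proof -
 obtain K where K: "!!w t. x <= Re w ==> Re w <= x ==> \<bar>Im w\<bar> <= 1 ==> norm (H (w + \<i> * of_real t)) <= K * (1 + \<bar>t\<bar>) powr (- (3 / 4))" "K >= 0"
  using H_square_bound[OF assms, of x] by blast
 have "(norm (H (Complex x t)))\<^sup>2 <= K\<^sup>2 * (1 + \<bar>t\<bar>) powr (- (3 / 2))" for t
 proof -
  have "(norm (H (Complex x t)))\<^sup>2 <= (K * (1 + \<bar>t\<bar>) powr (- (3 / 4)))\<^sup>2"
   unfolding Complex_line using K(1)[of "of_real x" t] by (intro power_mono) auto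
  also have "... = K\<^sup>2 * (1 + \<bar>t\<bar>) powr (- (3 / 2))"
   by (simp add: power_mult_distrib power2_eq_square[of "_ powr _"] flip: powr_add)
  finally show ?thesis .
 qed
 moreover have "(%t. H (Complex x t)) \<in> borel_measurable lborel" unfolding Complex_line using H_measurable[of "of_real x"] assms by simp
 ultimately show ?thesis
  by (intro Bochner_Integration.integrable_bound[OF integrable_mult_right[OF integrable_one_plus_abs_powr[of "3/2"], of "K\<^sup>2"]]) auto
qed

text \<open>The mean square of \<open>H\<close> on Re z = x is the value at x of a function
  holomorphic in \<open>w\<close>: the second factor is conjugated both outside and inside, which
  keeps the product holomorphic. Landau's theorem for the square of \<open>norm (F y)\<close> then
  moves Plancherel from \<sigma> > c to \<sigma> > 0, and the convergence of the right-hand side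
  with it.\<close>

theorem plancherel_laplace:
 assumes "\<sigma> > 0"
 shows "integrable lborel (%y. (norm (F y))\<^sup>2 * exp (- \<sigma> * (2 * max 0 y)))"
  and "(LBINT t. (norm (H (Complex \<sigma> t)))\<^sup>2) = 2 * pi * (LBINT y. (norm (F y))\<^sup>2 * exp (- \<sigma> * (2 * max 0 y)))"
proof -
 define k where "k w t = H (w + \<i> * of_real t) * cnj (H (cnj w + \<i> * of_real t))" for w t
 define g where "g w = (LBINT t. k w t) / (2 * pi)" for w
 let ?S = "{w. Re w > 0}"
 have op: "open ?S" by (rule convex_connected_halfplane)
 have "(%w. LBINT t. k w t) holomorphic_on ?S"
 proof (rule holomorphic_on_integral[OF op])
  fix t
  have h1: "(%w. H (w + \<i> * of_real t)) holomorphic_on ?S"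
   by (rule holomorphic_on_compose_gen[OF _ hol, unfolded o_def]) (auto intro!: holomorphic_intros)
  have h2: "(%w. H (w - \<i> * of_real (- t))) holomorphic_on ?S" using h1 by simp
  have cS: "cnj ` ?S = ?S"
  proof (rule equalityI; rule subsetI)
   fix x assume "x \<in> ?S"
   then show "x \<in> cnj ` ?S" by (intro image_eqI[of _ _ "cnj x"]) auto
  qed auto
  have "(cnj \<circ> (%w. H (w + \<i> * of_real t)) \<circ> cnj) holomorphic_on ?S"
   by (rule holomorphic_on_compose_cnj_cnj) (use h1 op cS in simp_all)
  then have "(%w. cnj (H (cnj w + \<i> * of_real t))) holomorphic_on ?S" by (simp add: o_def)
  then show "(%w. k w t) holomorphic_on ?S" unfolding k_def using h1 by (intro holomorphic_intros)
 next
  fix w assume w: "w \<in> ?S"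
  have m: "(%t. H (w + \<i> * of_real t)) \<in> borel_measurable lborel" "(%t. H (cnj w + \<i> * of_real t)) \<in> borel_measurable lborel"
   using H_measurable[of w] H_measurable[of "cnj w"] w by auto
  have "(%t. cnj (H (cnj w + \<i> * of_real t))) \<in> borel_measurable lborel"
   by (rule measurable_compose[OF m(2)]) (intro borel_measurable_continuous_onI continuous_intros)
  then show "k w \<in> borel_measurable lborel" unfolding k_def using m(1) by (intro borel_measurable_times)
 next
  fix w assume w: "w \<in> ?S"
  define v where "v = Im w"
  define r where "r = min (Re w / 2) 1"
  have r: "r > 0" "r <= 1" "r <= Re w / 2" using w by (auto simp: r_def)
  obtain K where K: "!!z. Re w / 2 <= Re z ==> Re z <= 2 * Re w ==> norm (H z) <= K * (1 + \<bar>Im z\<bar>) powr (- (3 / 4))"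
   using Hb[of "Re w / 2" "2 * Re w"] w by auto
  \<comment> \<open>The power of \<open>2 + \<bar>v\<bar>\<close> pays for replacing the height Im u
    + t by t, uniformly on the ball.\<close>
  define K' where "K' = max K 0 * (2 + \<bar>v\<bar>) powr (3 / 4)"
  have Hle: "norm (H (u + \<i> * of_real t)) <= K' * (1 + \<bar>t\<bar>) powr (- (3 / 4))"
   if u: "Re w / 2 <= Re u" "Re u <= 2 * Re w" "\<bar>Im u\<bar> <= 1 + \<bar>v\<bar>" for u t
  proof -
   have "norm (H (u + \<i> * of_real t)) <= K * (1 + \<bar>Im u + t\<bar>) powr (- (3 / 4))" using K[of "u + \<i> * of_real t"] u by simp
   also have "... <= max K 0 * (1 + \<bar>Im u + t\<bar>) powr (- (3 / 4))" by (intro mult_right_mono) auto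
   also have "... <= max K 0 * ((1 + \<bar>t\<bar>) / (2 + \<bar>v\<bar>)) powr (- (3 / 4))"
   proof (intro mult_left_mono powr_mono2')
    have "1 + \<bar>t\<bar> <= 1 + \<bar>Im u + t\<bar> + (1 + \<bar>v\<bar>)" using u(3) by linarith
    also have "... <= (1 + \<bar>Im u + t\<bar>) * (2 + \<bar>v\<bar>)" by (simp add: algebra_simps)
    finally show "(1 + \<bar>t\<bar>) / (2 + \<bar>v\<bar>) <= 1 + \<bar>Im u + t\<bar>" by (simp add: field_simps)
   qed (auto intro!: divide_pos_pos)
   also have "... = K' * (1 + \<bar>t\<bar>) powr (- (3 / 4))" by (simp add: K'_def powr_divide powr_minus_divide)
   finally show ?thesis .
  qed
  show "\<exists>r B. r > 0 \<and> ball w r \<subseteq> ?S \<and> integrable lborel B \<and> (\<forall>u\<in>ball w r. \<forall>t. norm (k u t) <= B t)"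
  proof (intro exI[of _ r] exI[of _ "%t. K'\<^sup>2 * (1 + \<bar>t\<bar>) powr (- (3 / 2))"] conjI ballI allI)
   have reu: "Re w / 2 <= Re u" "Re u <= 2 * Re w" "\<bar>Im u\<bar> <= 1 + \<bar>v\<bar>" if "u \<in> ball w r" for u
    using that abs_Re_le_cmod[of "w - u"] abs_Im_le_cmod[of "w - u"] r w by (auto simp: dist_norm v_def)
   show "ball w r \<subseteq> ?S" using reu(1) w by force
   show "norm (k u t) <= K'\<^sup>2 * (1 + \<bar>t\<bar>) powr (- (3 / 2))" if "u \<in> ball w r" for u t
   proof -
    have "norm (k u t) <= (K' * (1 + \<bar>t\<bar>) powr (- (3 / 4))) * (K' * (1 + \<bar>t\<bar>) powr (- (3 / 4)))"
     unfolding k_def norm_mult complex_mod_cnj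
     using reu[OF that] by (intro mult_mono Hle) (auto simp: K'_def)
    also have "... = K'\<^sup>2 * ((1 + \<bar>t\<bar>) powr (- (3 / 4)) * (1 + \<bar>t\<bar>) powr (- (3 / 4)))" by (simp add: power2_eq_square)
    also have "(1 + \<bar>t\<bar>) powr (- (3 / 4)) * (1 + \<bar>t\<bar>) powr (- (3 / 4)) = (1 + \<bar>t\<bar>) powr (- (3 / 2))" by (simp flip: powr_add)
    finally show ?thesis .
   qed
  qed (use r integrable_one_plus_abs_powr[of "3/2"] in auto)
 qed
 then have hg: "g holomorphic_on ?S" unfolding g_def by (intro holomorphic_intros) auto
 have gx: "g (of_real x) = of_real ((LBINT t. (norm (H (Complex x t)))\<^sup>2) / (2 * pi))" for x
 proof -
  have "k (of_real x) t = of_real ((norm (H (Complex x t)))\<^sup>2)" for t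
   unfolding k_def Complex_line using complex_norm_square[of "H (of_real x + \<i> * of_real t)"] by (simp del: of_real_power)
  then show ?thesis by (simp add: g_def del: of_real_power)
 qed
 have "integrable lborel (%y. (norm (F y))\<^sup>2 * exp (- \<sigma> * (2 * max 0 y))) \<and> Re (g (of_real \<sigma>)) = (LBINT y. (norm (F y))\<^sup>2 * exp (- \<sigma> * (2 * max 0 y)))"
 proof (rule landau_nonnegative_transform[where U = ?S and ?\<sigma>0.0 = c and ?\<sigma>1.0 = 0])
  fix x assume x: "x > c"
  show "integrable lborel (%y. (norm (F y))\<^sup>2 * exp (- x * (2 * max 0 y))) \<and> Re (g (of_real x)) = (LBINT y. (norm (F y))\<^sup>2 * exp (- x * (2 * max 0 y)))"
   using plancherel_laplace_initial[OF F neg bd(1,2) cont x H_square_integrable H] x bd(3) unfolding gx by simp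
 qed (use hg op assms in auto)
 then show "integrable lborel (%y. (norm (F y))\<^sup>2 * exp (- \<sigma> * (2 * max 0 y)))"
  "(LBINT t. (norm (H (Complex \<sigma> t)))\<^sup>2) = 2 * pi * (LBINT y. (norm (F y))\<^sup>2 * exp (- \<sigma> * (2 * max 0 y)))"
  unfolding gx by (auto simp: field_simps)
qed

text \<open>From norm F <= (norm F)^2 + 1 the mean-square convergence gives absolute convergence for
  every Re z > 0. The integral is then holomorphic there and agrees with \<open>H\<close> by
  uniqueness of continuation.\<close>

theorem laplace_integrable:
 assumes "Re z > 0"
 shows "integrable lborel (%y. F y * exp (- z * of_real y))" "H z = (LBINT y. F y * exp (- z * of_real y))"
proof -
 define B where "B d y = (norm (F y))\<^sup>2 * exp (- (d / 2) * (2 * max 0 y)) + indicator {0..} y * exp (- d * y)" for d y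
 have Bi: "integrable lborel (B d)" if "d > 0" for d
  unfolding B_def using plancherel_laplace(1)[of "d/2"] exp_decay_integrable that by (intro Bochner_Integration.integrable_add) auto
 have le: "norm (F y * exp (- w * of_real y)) <= B d y" if "Re w >= d" for w d y
 proof (cases "y < 0")
  case False
  then have y: "y >= 0" by simp
  have "0 <= (norm (F y) - 1 / 2)\<^sup>2" by simp
  then have "norm (F y) <= (norm (F y))\<^sup>2 + 1" by (simp add: power2_eq_square algebra_simps)
  then have "norm (F y) * exp (- d * y) <= ((norm (F y))\<^sup>2 + 1) * exp (- d * y)" by (intro mult_right_mono) auto
  moreover have "exp (- Re w * y) <= exp (- d * y)" using that y by (auto intro!: mult_right_mono)
  then have "norm (F y) * exp (- Re w * y) <= norm (F y) * exp (- d * y)" by (intro mult_left_mono) auto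
  ultimately show ?thesis using y by (simp add: B_def norm_mult max_def algebra_simps)
 qed (simp add: neg B_def)
 have meas: "(%y. F y * exp (- w * of_real y)) \<in> borel_measurable lborel" for w by measurable
 show "integrable lborel (%y. F y * exp (- z * of_real y))"
  by (rule Bochner_Integration.integrable_bound[OF Bi[OF assms] meas]) (use le[of "Re z" z] in \<open>auto intro: order_trans[OF _ abs_ge_self]\<close>)
 have hI: "(%z. LBINT y. F y * exp (- z * of_real y)) holomorphic_on {z. Re z > 0}"
 proof (rule holomorphic_on_integral[OF convex_connected_halfplane(2)])
  show "(%w. F y * exp (- w * of_real y)) holomorphic_on {z. Re z > 0}" for y by (intro holomorphic_intros)
  fix w assume w: "w \<in> {z. Re z > 0}"
  show "\<exists>r B. r > 0 \<and> ball w r \<subseteq> {z. Re z > 0} \<and> integrable lborel B \<and> (\<forall>v\<in>ball w r. \<forall>y. norm (F y * exp (- v * of_real y)) <= B y)"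
  proof (intro exI[of _ "Re w / 2"] exI[of _ "B (Re w / 2)"] conjI ballI allI)
   have re: "Re v > Re w / 2" if "v \<in> ball w (Re w / 2)" for v
   proof -
    have "norm (w - v) < Re w / 2" using that by (simp add: dist_norm)
    then show ?thesis using abs_Re_le_cmod[of "w - v"] unfolding minus_complex.sel by linarith
   qed
   show "ball w (Re w / 2) \<subseteq> {z. Re z > 0}" using re w by force
   show "norm (F y * exp (- v * of_real y)) <= B (Re w / 2) y" if "v \<in> ball w (Re w / 2)" for v y
    using re[OF that] by (intro le) simp
  qed (use w Bi in auto)
 qed (rule meas)
 show "H z = (LBINT y. F y * exp (- z * of_real y))"
  using halfplane_continuation_unique[OF hol hI bd(3), of z] H assms by blast
qed

end

lemma exp_tail_integral:
 fixes s :: complex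
 assumes "Re s > 0"
 shows "integrable lborel (%y. indicator {a..} y *\<^sub>R exp (- s * of_real y))"
  and "(LBINT y. indicator {a..} y *\<^sub>R exp (- s * of_real y)) = exp (- s * of_real a) / s"
  and "(LBINT y. norm (indicator {a..} y *\<^sub>R exp (- s * of_real y))) = exp (- Re s * a) / Re s"
proof -
 have gen: "integrable lborel (%y. indicator {a..} y *\<^sub>R exp (- s * of_real y)) \<and> (LBINT y. indicator {a..} y *\<^sub>R exp (- s * of_real y)) = exp (- s * of_real a) / s"
  if s: "Re s > 0" for s :: complex
 proof
  have i0: "integrable lborel (%y. exp (- Re s * a) * (indicator {0..} (- a + 1 * y) * exp (- Re s * (- a + 1 * y))))"
   using lborel_integrable_real_affine[OF exp_decay_integrable[OF s], of 1 "-a"] by (intro integrable_mult_right) simp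
  have eq: "exp (- Re s * a) * (indicator {0..} (- a + 1 * y) * exp (- Re s * (- a + 1 * y))) = indicator {a..} y * exp (- Re s * y)" for y
   by (simp add: indicator_def algebra_simps flip: exp_add)
  show i: "integrable lborel (%y. indicator {a..} y *\<^sub>R exp (- s * of_real y))"
   by (rule Bochner_Integration.integrable_bound[OF i0]) (unfold eq, auto simp: indicator_def)
  have nz: "s ~= 0" using s by auto
  have ind: "indicator (einterval (ereal a) \<infinity>) y *\<^sub>R exp (- s * of_real y) = indicator {a..} y *\<^sub>R exp (- s * of_real y)" if "y ~= a" for y
   using that by (auto simp: indicator_def einterval_def)
  have AE: "AE y in lborel. indicator (einterval (ereal a) \<infinity>) y *\<^sub>R exp (- s * of_real y) = indicator {a..} y *\<^sub>R exp (- s * of_real y)"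
   using AE_lborel_singleton[of a] by eventually_elim (use ind in auto)
  have "(LBINT y=ereal a..\<infinity>. exp (- s * of_real y)) = 0 - (- exp (- s * of_real a) / s)"
  proof (rule interval_integral_FTC_integrable[where F = "%y. - exp (- s * of_real y) / s"])
   show "ereal a < \<infinity>" by simp
   show "((%y. - exp (- s * of_real y) / s) has_vector_derivative exp (- s * of_real x)) (at x)" for x
   proof -
    have "((%z. - exp (- s * z) / s) has_field_derivative exp (- s * of_real x)) (at (of_real x))"
     using nz by (auto intro!: derivative_eq_intros)
    from has_vector_derivative_real_field[OF this] show ?thesis .
   qed
   show "isCont (%y. exp (- s * of_real y)) x" for x by (intro continuous_intros)
   show "set_integrable lborel (einterval (ereal a) \<infinity>) (%y. exp (- s * of_real y))"
    unfolding set_integrable_def by (subst integrable_cong_AE[OF _ _ AE]) (use i in auto)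
   have "((%y. - exp (- s * of_real y) / s) \<longlongrightarrow> - exp (- s * of_real a) / s) (at a within {a<..})"
    by (intro tendsto_intros nz)
   then show "(((%y. - exp (- s * of_real y) / s) \<circ> real_of_ereal) \<longlongrightarrow> - exp (- s * of_real a) / s) (at_right (ereal a))"
    by (intro ereal_tendsto_simps1(2)[THEN iffD2]) (simp add: o_def)
   have "((%y. - exp (- s * of_real y) / s) \<longlongrightarrow> 0) at_top"
   proof (rule tendsto_norm_zero_cancel)
    have "((%y. exp (- Re s * y) / norm s) \<longlongrightarrow> 0) at_top"
     by (intro tendsto_divide_zero filterlim_compose[OF exp_at_bot] filterlim_tendsto_neg_mult_at_bot[OF tendsto_const _ filterlim_ident]) (use s in simp)
    then show "((%y. norm (- exp (- s * of_real y) / s)) \<longlongrightarrow> 0) at_top" by (simp add: norm_divide)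
   qed
   then show "(((%y. - exp (- s * of_real y) / s) \<circ> real_of_ereal) \<longlongrightarrow> 0) (at_left \<infinity>)"
    by (simp add: ereal_tendsto_simps1)
  qed
  moreover have "(LBINT y=ereal a..\<infinity>. exp (- s * of_real y)) = (LBINT y. indicator {a..} y *\<^sub>R exp (- s * of_real y))"
   unfolding interval_lebesgue_integral_def set_lebesgue_integral_def by (simp, rule integral_cong_AE) (use AE in auto)
  ultimately show "(LBINT y. indicator {a..} y *\<^sub>R exp (- s * of_real y)) = exp (- s * of_real a) / s" by simp
 qed
 show "integrable lborel (%y. indicator {a..} y *\<^sub>R exp (- s * of_real y))"
  "(LBINT y. indicator {a..} y *\<^sub>R exp (- s * of_real y)) = exp (- s * of_real a) / s" using gen[OF assms] by auto
 have "complex_of_real (LBINT y. norm (indicator {a..} y *\<^sub>R exp (- s * of_real y))) = (LBINT y. indicator {a..} y *\<^sub>R exp (- of_real (Re s) * of_real y))"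
 proof -
  have pt: "complex_of_real (norm (indicator {a..} y *\<^sub>R exp (- s * of_real y))) = indicator {a..} y *\<^sub>R exp (- of_real (Re s) * of_real y)" for y
   by (cases "y \<in> {a..}") (simp_all add: norm_exp_eq_Re exp_of_real[symmetric])
  show ?thesis unfolding pt[symmetric] by (rule integral_complex_of_real[symmetric])
 qed
 also have "... = of_real (exp (- Re s * a) / Re s)"
  using gen[of "of_real (Re s)"] assms by (simp add: exp_of_real[symmetric])
 finally show "(LBINT y. norm (indicator {a..} y *\<^sub>R exp (- s * of_real y))) = exp (- Re s * a) / Re s"
  by (simp only: of_real_eq_iff)
qed

section \<open>Summatory functions in logarithmic scale\<close>

definition step_sum :: "(nat => complex) => real => complex" where
 "step_sum c y = (\<Sum>n | 1 <= n \<and> real n <= exp y. c n)"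

lemma step_sum_set: "{n. 1 <= n \<and> real n <= exp y} = {1..nat \<lfloor>exp y\<rfloor>}"
 by (auto simp: le_nat_iff le_floor_iff)

lemma finite_step_set: "finite {n. 1 <= n \<and> real n <= exp y}"
 unfolding step_sum_set by simp

locale step_function =
 fixes c :: "nat => complex" and B :: real
 assumes c: "!!n. norm (c (Suc n)) <= B * ln (real (Suc n))" and B: "B >= 0" "B <= 1"
begin

definition "F y = step_sum c y * of_real (exp (- y / 2))"

lemma F_measurable [measurable]: "F \<in> borel_measurable borel"
proof -
 have "(%y::real. nat \<lfloor>exp y\<rfloor>) \<in> measurable borel (count_space UNIV)"
 proof -
  have 1: "(%y::real. \<lfloor>exp y\<rfloor>) \<in> measurable borel (count_space UNIV)"
   by (rule measurable_compose[OF borel_measurable_exp measurable_real_floor])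
  show ?thesis by (rule measurable_compose[OF 1]) simp
 qed
 moreover have "(%k::nat. \<Sum>n\<in>{1..k}. c n) \<in> measurable (count_space UNIV) borel" by simp
 ultimately have "(%y::real. \<Sum>n\<in>{1..nat \<lfloor>exp y\<rfloor>}. c n) \<in> borel_measurable borel" by (rule measurable_compose)
 then show ?thesis unfolding F_def step_sum_def step_sum_set by measurable
qed

lemma F_neg: "y < 0 ==> F y = 0"
proof -
 assume "y < 0"
 then have "exp y < 1" by simp
 have "\<not> (1 <= n \<and> real n <= exp y)" for n :: nat
 proof
  assume n: "1 <= n \<and> real n <= exp y"
  then have "1 <= real n" by simp
  then show False using n \<open>exp y < 1\<close> by linarith
 qed
 then have "{n::nat. 1 <= n \<and> real n <= exp y} = {}" by blast
 then show ?thesis unfolding F_def step_sum_def by (simp only: sum.empty mult_zero_left)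
qed

text \<open>The trivial bound y exp(y) for the sum, with the factor y traded for 10 exp(y/10); this
  gives the rate 1/2 + 1/10 = 3/5.\<close>

lemma F_bound:
 assumes "y >= 0" shows "norm (F y) <= 10 * exp (3 / 5 * y)"
proof -
 have "norm (step_sum c y) <= (\<Sum>n\<in>{1..nat \<lfloor>exp y\<rfloor>}. y)"
  unfolding step_sum_def step_sum_set
 proof (rule sum_norm_le)
  fix n assume n: "n \<in> {1..nat \<lfloor>exp y\<rfloor>}"
  then obtain k where k: "n = Suc k" by (cases n) auto
  have "real n <= exp y" using n by (simp add: le_nat_iff le_floor_iff)
  then have "ln (real n) <= y" using n by (metis exp_gt_zero ln_exp ln_le_cancel_iff atLeastAtMost_iff less_le_trans of_nat_0_less_iff zero_less_one)
  moreover have "norm (c n) <= B * ln (real n)" using c[of k] k by simp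
  moreover have "B * ln (real n) <= 1 * ln (real n)" using B n by (intro mult_right_mono) auto
  ultimately show "norm (c n) <= y" by linarith
 qed
 also have "... = real (nat \<lfloor>exp y\<rfloor>) * y" by simp
 also have "... <= exp y * y" using assms by (intro mult_right_mono of_nat_floor) auto
 finally have 1: "norm (step_sum c y) <= exp y * y" .
 have "1 + y / 10 <= exp (y / 10)" by (rule exp_ge_add_one_self)
 then have 2: "y <= 10 * exp (y / 10)" by linarith
 have "norm (F y) <= exp y * y * exp (- y / 2)" unfolding F_def norm_mult using 1 by (simp add: mult_right_mono)
 also have "... <= exp y * (10 * exp (y / 10)) * exp (- y / 2)" using 2 by (intro mult_right_mono mult_left_mono) auto
 also have "... = 10 * (exp y * exp (y / 10) * exp (- y / 2))" by simp
 also have "... = 10 * exp (y + y / 10 + - y / 2)" by (simp only: exp_add)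
 also have "y + y / 10 + - y / 2 = 3 / 5 * y" by simp
 finally show ?thesis .
qed

text \<open>Jumps occur only at logarithms of integers, which form a countable set.\<close>

lemma F_cont: "AE y in lborel. isCont F y"
proof -
 have "AE y in lborel. y \<notin> range (%n::nat. ln (real n))"
  by (rule AE_not_in, rule countable_imp_null_set_lborel) simp
 then show ?thesis
 proof eventually_elim
  case (elim y)
  have "exp y \<notin> \<int>"
  proof
   assume "exp y \<in> \<int>"
   then obtain k where k: "exp y = of_int k" by (elim Ints_cases)
   then have "k > 0" by (metis exp_gt_zero of_int_0_less_iff)
   then have "exp y = real (nat k)" using k by simp
   then have "y = ln (real (nat k))" by (metis ln_exp)
   then show False using elim by blast
  qed
  moreover have "(exp \<longlongrightarrow> exp y) (nhds y)" by (intro tendsto_exp filterlim_ident)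
  ultimately have "eventually (%u. \<lfloor>exp u\<rfloor> = \<lfloor>exp y\<rfloor>) (nhds y)" by (intro eventually_floor_eq) auto
  then have ev: "eventually (%u. step_sum c y * of_real (exp (- u / 2)) = F u) (nhds y)"
   by eventually_elim (simp only: F_def step_sum_def step_sum_set)
  moreover have "isCont (%u. step_sum c y * of_real (exp (- u / 2))) y" by (intro continuous_intros) auto
  then show ?case using isCont_cong[OF ev] by simp
 qed
qed

text \<open>The term of index n starts at y = ln n, and its tail integral is n^(-s) / s with s = 1/2
  + z, the 1/2 coming from the normalisation of \<open>F\<close>. Absolute convergence for Re s > 1
  permits the exchange.\<close>

lemma F_laplace:
 assumes z: "Re z > 3 / 5"
 shows "(LBINT y. F y * exp (- z * of_real y)) = dirichlet_series c (1 / 2 + z) / (1 / 2 + z)"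
proof -
 define s where "s = 1 / 2 + z"
 have s: "Re s > 1" using z by (simp add: s_def)
 let ?f = "%n y. c (Suc n) * (indicator {ln (real (Suc n))..} y *\<^sub>R exp (- s * of_real y))"
 have pw: "exp (- s * of_real (ln (real (Suc n)))) = 1 / of_nat (Suc n) powr s" for n
 proof -
  have "Ln (of_nat (Suc n)) = of_real (ln (real (Suc n)))" by (rule Ln_of_nat) simp
  then show ?thesis by (simp add: powr_def exp_minus divide_inverse del: of_nat_Suc)
 qed
 have int: "integrable lborel (?f n)" for n using exp_tail_integral(1)[of s] s by (intro integrable_mult_right) simp
 have fs: "(%n. ?f n y) sums (F y * exp (- z * of_real y))" for y
 proof -
  have "(%n. ?f n y) sums (\<Sum>n\<in>{..<nat \<lfloor>exp y\<rfloor>}. ?f n y)"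
  proof (rule sums_finite)
   fix n assume "n \<notin> {..<nat \<lfloor>exp y\<rfloor>}"
   then have "real (Suc n) > exp y" by (simp add: not_less nat_le_iff floor_le_iff)
   then have "ln (real (Suc n)) > ln (exp y)" by (subst ln_less_cancel_iff) auto
   then show "?f n y = 0" by simp
  qed simp
  also have "(\<Sum>n\<in>{..<nat \<lfloor>exp y\<rfloor>}. ?f n y) = (\<Sum>n\<in>{..<nat \<lfloor>exp y\<rfloor>}. c (Suc n) * exp (- s * of_real y))"
  proof (intro sum.cong refl)
   fix n assume "n \<in> {..<nat \<lfloor>exp y\<rfloor>}"
   then have "Suc n <= nat \<lfloor>exp y\<rfloor>" by simp
   then have "real (Suc n) <= exp y" by (simp add: le_nat_iff le_floor_iff del: of_nat_Suc)
   then have "ln (real (Suc n)) <= ln (exp y)" by (subst ln_le_cancel_iff) auto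
   then show "?f n y = c (Suc n) * exp (- s * of_real y)" by simp
  qed
  also have "... = (\<Sum>n\<in>{1..nat \<lfloor>exp y\<rfloor>}. c n) * exp (- s * of_real y)"
   unfolding sum_distrib_right[symmetric] using sum.atLeast1_atMost_eq[of c "nat \<lfloor>exp y\<rfloor>"] by (simp add: lessThan_atLeast0)
  also have "... = F y * exp (- z * of_real y)"
   unfolding F_def step_sum_def step_sum_set by (simp add: s_def mult.assoc exp_of_real[symmetric] flip: exp_add) (simp add: algebra_simps)
  finally show ?thesis .
 qed
 have "(%n. LBINT y. ?f n y) sums (LBINT y. (\<Sum>n. ?f n y))"
 proof (rule sums_integral[OF int])
  show "AE y in lborel. summable (%n. norm (?f n y))"
  proof (rule AE_I2)
   fix y :: real
   show "summable (%n. norm (?f n y))"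
   proof (rule summable_finite[of "{..<nat \<lfloor>exp y\<rfloor>}"])
    fix n assume "n \<notin> {..<nat \<lfloor>exp y\<rfloor>}"
    then have "real (Suc n) > exp y" by (simp add: not_less nat_le_iff floor_le_iff)
    then have "ln (real (Suc n)) > ln (exp y)" by (subst ln_less_cancel_iff) auto
    then show "norm (?f n y) = 0" by simp
   qed simp
  qed
  have ni: "(LBINT y. norm (?f n y)) = norm (c (Suc n)) * (real (Suc n) powr (- Re s) / Re s)" for n
  proof -
   have "(LBINT y. norm (?f n y)) = norm (c (Suc n)) * (exp (- Re s * ln (real (Suc n))) / Re s)"
   proof -
    have "(%y. norm (?f n y)) = (%y. norm (c (Suc n)) * norm (indicator {ln (real (Suc n))..} y *\<^sub>R exp (- s * of_real y)))"
     by (rule ext) (rule norm_mult)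
    then show ?thesis using exp_tail_integral(3)[of s "ln (real (Suc n))"] s by (simp only: integral_mult_right_zero)
   qed
   then show ?thesis by (simp add: powr_def)
  qed
  have "summable (%n. (1 + ln (real (Suc n))) * real (Suc n) powr (- Re s) * (1 / Re s))"
   by (intro summable_mult2 summable_log_weight s)
  then show "summable (%n. LBINT y. norm (?f n y))"
  proof (rule summable_comparison_test'[where N = 0])
   fix n :: nat
   have "norm (c (Suc n)) <= 1 + ln (real (Suc n))"
    using c[of n] mult_right_mono[OF B(2), of "ln (real (Suc n))"] by (simp del: of_nat_Suc)
   then show "norm (LBINT y. norm (?f n y)) <= (1 + ln (real (Suc n))) * real (Suc n) powr (- Re s) * (1 / Re s)"
    unfolding ni using s by (auto simp: abs_mult intro!: divide_right_mono mult_right_mono simp del: of_nat_Suc)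
  qed
 qed
 moreover have "(\<Sum>n. ?f n y) = F y * exp (- z * of_real y)" for y using fs by (rule sums_unique[symmetric])
 moreover have "(LBINT y. ?f n y) = c (Suc n) / of_nat (Suc n) powr s / s" for n
 proof -
  have s0: "Re s > 0" using s by simp
  show ?thesis by (simp only: integral_mult_right_zero exp_tail_integral(2)[OF s0] pw times_divide_eq_right mult_1_right)
 qed
 ultimately have "(%n. c (Suc n) / of_nat (Suc n) powr s / s) sums (LBINT y. F y * exp (- z * of_real y))" by simp
 moreover have "(%n. c (Suc n) / of_nat (Suc n) powr s / s) sums (dirichlet_series c s / s)"
 proof (rule sums_divide)
  have "norm (c (Suc n)) <= 1 + ln (real (Suc n))" for n
   using c[of n] mult_right_mono[OF B(2), of "ln (real (Suc n))"] by (simp del: of_nat_Suc)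
  from dirichlet_series_abs_summable[of c, OF this s]
  show "(%n. c (Suc n) / of_nat (Suc n) powr s) sums dirichlet_series c s"
   unfolding dirichlet_series_def by (rule summable_sums[OF summable_norm_cancel])
 qed
 ultimately show ?thesis unfolding s_def by (rule sums_unique2)
qed

end

section \<open>Zeros of L-functions under GRH\<close>

definition log_deriv_half :: "(nat => complex) => complex => complex" where
 "log_deriv_half X z = deriv (dirichlet_L X) (1 / 2 + z) / dirichlet_L X (1 / 2 + z)"

definition psi_transform :: "(nat => complex) => complex => complex" where
 "psi_transform X z = - log_deriv_half X z / (1 / 2 + z)"

text \<open>The logarithm of the ratio between an upper bound 11 q (6 + |T|) for the L-function on
  the disc and its lower bound 1/2 at the centre.\<close>

definition conductor_log :: "nat => real => real" where
 "conductor_log q T = ln (22 * real q * (6 + \<bar>T\<bar>))"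

text \<open>After the shift by 1/2 this lies on Re s = 3, where \<open>L_lower_bound\<close>
  applies.\<close>

definition center :: "real => complex" where
 "center T = Complex (5 / 2) T"

text \<open>\<open>G\<close> holds the ordinates of the zeros near height \<open>T\<close>,
  \<open>m\<close> their multiplicities, \<open>h\<close> the regular part. In the shifted variable
  GRH places the zeros on the imaginary axis, so real ordinates describe them.\<close>

definition local_zeros :: "real => nat => (nat => complex) => real => real set => (real => nat) => (complex => complex) => bool" where
 "local_zeros C q X T G m h \<longleftrightarrow>
   finite G \<and> (\<forall>\<gamma>\<in>G. m \<gamma> > 0) \<and> h holomorphic_on ball (center T) (14 / 5) \<and>
   (\<forall>z\<in>ball (center T) (14 / 5). Re z > 0 -->
    log_deriv_half X z = (\<Sum>\<gamma>\<in>G. of_nat (m \<gamma>) / (z - \<i> * of_real \<gamma>)) + h z) \<and>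
   (\<forall>z\<in>cball (center T) (27 / 10). norm (h z) <= C * conductor_log q T \<and> norm (deriv h z) <= C * conductor_log q T) \<and>
   real (\<Sum>\<gamma>\<in>G. m \<gamma>) <= C * conductor_log q T"

lemma holomorphic_on_half_shift:
 assumes "f holomorphic_on UNIV"
 shows "(%z. f (1 / 2 + z)) holomorphic_on A"
 using holomorphic_on_compose_gen[of "%z. 1 / 2 + z" A f UNIV, OF _ assms] by (simp add: o_def holomorphic_intros)

lemma (in nonprincipal) deriv_L_shift: "deriv (%z. dirichlet_L X (1 / 2 + z)) z = deriv (dirichlet_L X) (1 / 2 + z)"
proof -
 have "(dirichlet_L X has_field_derivative deriv (dirichlet_L X) (1 / 2 + z)) (at (1 / 2 + z))"
  using L_entire[of UNIV] by (intro holomorphic_derivI[of _ UNIV]) auto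
 then have "((%z. dirichlet_L X (1 / 2 + z)) has_field_derivative deriv (dirichlet_L X) (1 / 2 + z) * 1) (at z)"
  by (rule DERIV_chain2) (auto intro!: derivative_eq_intros)
 then show ?thesis by (simp add: DERIV_imp_deriv)
qed

text \<open>The radii 27/10, 14/5, 29/10 and 59/20 are measured from real part 5/2. Up to 29/10 one
  has Re s >= 1/10, so that \<open>L_bound\<close> has last factor at most 11. Zeros found up to
  14/5 have Re s > 0, and GRH together with \<open>L_nonzero\<close> puts them on the critical
  line.\<close>

lemma local_expansion:
 assumes GRH
 shows "\<exists>C>0. \<forall>q X T. nonprincipal q X --> (\<exists>G m h. local_zeros C q X T G m h)"
proof -
 obtain C where C: "C > 0" and loc: "!!f c M. f holomorphic_on ball c (59 / 20) ==> f c ~= 0 ==> M >= exp 1 ==> (\<forall>z\<in>cball c (29 / 10). norm (f z) <= M * norm (f c)) ==>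
  (\<exists>m q. q holomorphic_on ball c (14 / 5) \<and> finite {z\<in>cball c (14 / 5). f z = 0} \<and> (\<forall>\<rho>\<in>{z\<in>cball c (14 / 5). f z = 0}. m \<rho> > (0::nat)) \<and>
   (\<forall>z\<in>ball c (14 / 5). f z ~= 0 --> deriv f z / f z = (\<Sum>\<rho>\<in>{z\<in>cball c (14 / 5). f z = 0}. of_nat (m \<rho>) / (z - \<rho>)) + q z) \<and>
   (\<forall>z\<in>cball c (27 / 10). norm (q z) <= C * ln M \<and> norm (deriv q z) <= C * ln M) \<and>
   real (\<Sum>\<rho>\<in>{z\<in>cball c (14 / 5). f z = 0}. m \<rho>) <= C * ln M)"
  using local_log_derivative[of "27 / 10" "14 / 5" "29 / 10" "59 / 20"] by auto
 have "\<exists>G m h. local_zeros C q X T G m h" if np: "nonprincipal q X" for q X T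
 proof -
  interpret nonprincipal q X by (rule np)
  define f where "f = (%z. dirichlet_L X (1 / 2 + z))"
  define M where "M = 22 * real q * (6 + \<bar>T\<bar>)"
  define c where "c = center T"
  have q1: "real q >= 1" using q by simp
  have M132: "M >= 132"
  proof -
   have "22 * 1 * (6 + 0) <= 22 * real q * (6 + \<bar>T\<bar>)" using q1 by (intro mult_mono) auto
   then show ?thesis by (simp add: M_def)
  qed
  have hf: "f holomorphic_on A" for A
   unfolding f_def by (rule holomorphic_on_half_shift[OF L_entire])
  have fc: "norm (f c) >= 1 / 2" unfolding f_def by (rule L_lower_bound) (simp add: c_def center_def)
  have fb: "norm (f z) <= M * norm (f c)" if z: "z \<in> cball c (29 / 10)" for z
  proof -
   have "\<bar>Re (c - z)\<bar> <= 29 / 10" using z abs_Re_le_cmod[of "c - z"] by (simp add: dist_norm)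
   then have re: "Re (1 / 2 + z) >= 1 / 10" by (simp add: c_def center_def abs_if split: if_splits)
   have "norm (1 / 2 + z) <= norm (1 / 2 + c) + norm (z - c)" using norm_triangle_ineq[of "1 / 2 + c" "z - c"] by simp
   also have "norm (1 / 2 + c) <= \<bar>Re (1 / 2 + c)\<bar> + \<bar>Im (1 / 2 + c)\<bar>" by (rule cmod_le)
   also have "... = 3 + \<bar>T\<bar>" by (simp add: c_def center_def)
   finally have n: "norm (1 / 2 + z) <= 6 + \<bar>T\<bar>" using z by (simp add: dist_norm norm_minus_commute)
   have "norm (f z) <= real q * norm (1 / 2 + z) * (1 + 1 / Re (1 / 2 + z))" unfolding f_def by (rule L_bound) (use re in simp)
   also have "... <= real q * (6 + \<bar>T\<bar>) * 11"
    using n re by (intro mult_mono) (auto simp: field_simps)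
   also have "... = M * (1 / 2)" by (simp add: M_def)
   also have "... <= M * norm (f c)" using fc M132 by (intro mult_left_mono) auto
   finally show ?thesis .
  qed
  define Z where "Z = {z\<in>cball c (14 / 5). f z = 0}"
  have "f c ~= 0" "M >= exp 1" using fc M132 exp_le by auto
  from loc[OF hf this] fb obtain m h where H: "h holomorphic_on ball c (14 / 5)" "finite Z" "!!\<rho>. \<rho> \<in> Z ==> m \<rho> > (0::nat)"
   "!!z. z \<in> ball c (14 / 5) ==> f z ~= 0 ==> deriv f z / f z = (\<Sum>\<rho>\<in>Z. of_nat (m \<rho>) / (z - \<rho>)) + h z"
   "!!z. z \<in> cball c (27 / 10) ==> norm (h z) <= C * ln M \<and> norm (deriv h z) <= C * ln M"
   "real (\<Sum>\<rho>\<in>Z. m \<rho>) <= C * ln M"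
   unfolding Z_def by blast
  have Z0: "\<rho> = \<i> * of_real (Im \<rho>)" if "\<rho> \<in> Z" for \<rho>
  proof -
   have "\<bar>Re (c - \<rho>)\<bar> <= 14 / 5" using that abs_Re_le_cmod[of "c - \<rho>"] by (simp add: Z_def dist_norm)
   then have re: "Re (1 / 2 + \<rho>) > 0" by (simp add: c_def center_def abs_if split: if_splits)
   have z: "dirichlet_L X (1 / 2 + \<rho>) = 0" using that by (simp add: Z_def f_def)
   then have le: "\<not> Re (1 / 2 + \<rho>) > 1 / 2" using L_nonzero[OF assms] by blast
   then have "Re (1 / 2 + \<rho>) = 1 / 2"
    using assms[unfolded GRH_def, rule_format, of q X "1 / 2 + \<rho>"] q X re z by simp
   then show ?thesis by (simp add: complex_eq_iff)
  qed
  have inj: "inj_on Im Z" using Z0 by (metis inj_onI)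
  define mm where "mm \<gamma> = m (\<i> * complex_of_real \<gamma>)" for \<gamma>
  have mm: "mm (Im \<rho>) = m \<rho>" if "\<rho> \<in> Z" for \<rho> using Z0[OF that] by (simp add: mm_def)
  have "local_zeros C q X T (Im ` Z) mm h"
   unfolding local_zeros_def
  proof (intro conjI ballI impI)
   show "finite (Im ` Z)" using H(2) by simp
   show "\<gamma> \<in> Im ` Z ==> mm \<gamma> > 0" for \<gamma> using H(3) mm by auto
   show "h holomorphic_on ball (center T) (14 / 5)" using H(1) by (simp add: c_def)
   show "norm (h z) <= C * conductor_log q T" "norm (deriv h z) <= C * conductor_log q T" if "z \<in> cball (center T) (27 / 10)" for z
    using H(5)[of z] that by (auto simp: c_def conductor_log_def M_def)
   have "(\<Sum>\<gamma>\<in>Im ` Z. mm \<gamma>) = (\<Sum>\<rho>\<in>Z. m \<rho>)"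
    by (subst sum.reindex[OF inj]) (simp add: mm)
   then show "real (\<Sum>\<gamma>\<in>Im ` Z. mm \<gamma>) <= C * conductor_log q T" using H(6) by (simp add: conductor_log_def M_def)
   fix z assume z: "z \<in> ball (center T) (14 / 5)" "Re z > 0"
   have fz: "f z ~= 0" unfolding f_def by (rule L_nonzero[OF assms]) (use z in simp)
   have "(\<Sum>\<gamma>\<in>Im ` Z. of_nat (mm \<gamma>) / (z - \<i> * of_real \<gamma>)) = (\<Sum>\<rho>\<in>Z. of_nat (m \<rho>) / (z - \<rho>))"
    by (subst sum.reindex[OF inj]) (auto intro!: sum.cong simp: mm Z0[symmetric])
   then show "log_deriv_half X z = (\<Sum>\<gamma>\<in>Im ` Z. of_nat (mm \<gamma>) / (z - \<i> * of_real \<gamma>)) + h z"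
    using H(4)[OF z(1)[folded c_def] fz] deriv_L_shift[of z] by (simp add: log_deriv_half_def f_def)
  qed
  then show ?thesis by blast
 qed
 then show ?thesis using C by blast
qed

text \<open>The height enters through a fourth root, so that a factor (1 + |T|)^(-3/4) is left after
  division by 1/2 + z.\<close>

lemma conductor_log_le:
 assumes "q > 0"
 shows "conductor_log q T <= (ln (132 * real q) + 4) * (1 + \<bar>T\<bar>) powr (1 / 4)" and "conductor_log q T > 0"
proof -
 have q1: "real q >= 1" using assms by simp
 have "1 < 22 * 1 * (6 + (0::real))" by simp
 also have "... <= 22 * real q * (6 + \<bar>T\<bar>)" using q1 by (intro mult_mono) auto
 finally have g1: "1 < 22 * real q * (6 + \<bar>T\<bar>)" .
 then show "conductor_log q T > 0" by (simp add: conductor_log_def)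
 have "22 * real q * (6 + \<bar>T\<bar>) <= 22 * real q * (6 * (1 + \<bar>T\<bar>))" using q1 by (intro mult_left_mono) auto
 also have "... = 132 * real q * (1 + \<bar>T\<bar>)" by simp
 finally have "conductor_log q T <= ln (132 * real q * (1 + \<bar>T\<bar>))"
  unfolding conductor_log_def using g1 by (subst ln_le_cancel_iff) auto
 also have "... = ln (132 * real q) + ln (1 + \<bar>T\<bar>)" using q1 by (intro ln_mult_pos) auto
 also have "ln (1 + \<bar>T\<bar>) <= (1 + \<bar>T\<bar>) powr (1 / 4) / (1 / 4)" by (intro ln_powr_bound) auto
 also have "... = 4 * (1 + \<bar>T\<bar>) powr (1 / 4)" by simp
 also have "ln (132 * real q) <= ln (132 * real q) * (1 + \<bar>T\<bar>) powr (1 / 4)"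
 proof -
  have "ln (132 * real q) >= 0" "(1 + \<bar>T\<bar>) powr (1 / 4) >= 1" using q1 by (auto intro!: ln_ge_zero ge_one_powr_ge_zero)
  then show ?thesis using mult_left_mono by fastforce
 qed
 finally show "conductor_log q T <= (ln (132 * real q) + 4) * (1 + \<bar>T\<bar>) powr (1 / 4)" by (simp add: algebra_simps)
qed

lemma conductor_log_le':
 assumes "q >= 3"
 shows "conductor_log q T <= 11 * ln (real q) * (1 + \<bar>T\<bar>) powr (1 / 4)" and "ln (real q) >= 1"
proof -
 have "exp 1 <= real q" using exp_le assms by linarith
 then show l1: "ln (real q) >= 1" using assms by (subst ln_ge_iff) auto
 have "ln (132::real) <= ln (2 ^ 8)" by (subst ln_le_cancel_iff) auto
 also have "... = 8 * ln 2" by (subst ln_realpow) auto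
 also have "... <= 6" using ln2_le_25_over_36 by simp
 finally have "ln 132 <= (6::real)" .
 then have "ln (132 * real q) + 4 <= 11 * ln (real q)" using l1 assms by (subst ln_mult_pos) auto
 then have "(ln (132 * real q) + 4) * (1 + \<bar>T\<bar>) powr (1 / 4) <= 11 * ln (real q) * (1 + \<bar>T\<bar>) powr (1 / 4)"
  by (intro mult_right_mono) auto
 then show "conductor_log q T <= 11 * ln (real q) * (1 + \<bar>T\<bar>) powr (1 / 4)"
  using conductor_log_le(1)[of q T] assms by linarith
qed

text \<open>(5/2)^2 + 1 = 7.25 is just below (27/10)^2 = 7.29; this fixes the radius 27/10.\<close>

lemma near_center:
 assumes "0 <= Re z" "Re z <= 1" "\<bar>Im z - T\<bar> <= 1"
 shows "z \<in> cball (center T) (27 / 10)" "z \<in> ball (center T) (14 / 5)"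
proof -
 have "(norm (center T - z))\<^sup>2 = (5 / 2 - Re z)\<^sup>2 + (Im z - T)\<^sup>2"
  by (simp add: center_def cmod_power2 power2_commute)
 also have "... <= (5 / 2)\<^sup>2 + 1\<^sup>2" using assms by (intro add_mono abs_le_square_iff[THEN iffD1]) auto
 also have "... <= (27 / 10)\<^sup>2" by (simp add: power2_eq_square)
 finally have "norm (center T - z) <= 27 / 10" by (rule power2_le_imp_le) simp
 then show "z \<in> cball (center T) (27 / 10)" "z \<in> ball (center T) (14 / 5)" by (auto simp: dist_norm)
qed

lemma norm_half_plus_ge:
 assumes "Re z >= 0"
 shows "norm (1 / 2 + z) >= (1 + \<bar>Im z\<bar>) / 3"
proof -
 have "norm (1 / 2 + z) >= 1 / 2" using complex_Re_le_cmod[of "1 / 2 + z"] assms by simp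
 moreover have "norm (1 / 2 + z) >= \<bar>Im z\<bar>" using abs_Im_le_cmod[of "1 / 2 + z"] by simp
 moreover have "n >= 1 / 2 ==> n >= b ==> n >= (1 + b) / 3" for n b :: real by (simp add: field_simps)
 ultimately show ?thesis by blast
qed

text \<open>Chosen expansions for all moduli, characters and heights with one common
  \<open>C\<close>, so that the size demanded of \<open>q\<close> can be read off from
  \<open>C\<close>.\<close>

locale zero_data =
 fixes C :: real and G :: "nat => (nat => complex) => real => real set"
  and m :: "nat => (nat => complex) => real => real => nat" and h :: "nat => (nat => complex) => real => complex => complex"
 assumes grh: GRH and C: "C > 0"
  and data: "!!q X T. nonprincipal q X ==> local_zeros C q X T (G q X T) (m q X T) (h q X T)"

lemma zero_data_exists:
 assumes GRH
 obtains C G m h where "zero_data C G m h"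
proof -
 obtain C where C: "C > 0" "\<forall>q X T. nonprincipal q X --> (\<exists>G m h. local_zeros C q X T G m h)"
  using local_expansion[OF assms] by blast
 then obtain G where "\<forall>q X T. nonprincipal q X --> (\<exists>m h. local_zeros C q X T (G q X T) m h)" by metis
 then obtain m where "\<forall>q X T. nonprincipal q X --> (\<exists>h. local_zeros C q X T (G q X T) (m q X T) h)" by metis
 then obtain h where "\<forall>q X T. nonprincipal q X --> local_zeros C q X T (G q X T) (m q X T) (h q X T)" by metis
 then have "zero_data C G m h" using assms C(1) by unfold_locales auto
 then show ?thesis by (rule that)
qed

locale character_zeros = zero_data + nonprincipal
begin

lemma finite_zeros: "finite (G q X T)" and hol_remainder: "h q X T holomorphic_on ball (center T) (14 / 5)"
 and expansion: "z \<in> ball (center T) (14 / 5) ==> Re z > 0 ==> log_deriv_half X z = (\<Sum>\<gamma>\<in>G q X T. of_nat (m q X T \<gamma>) / (z - \<i> * of_real \<gamma>)) + h q X T z"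
 and remainder_bound: "z \<in> cball (center T) (27 / 10) ==> norm (h q X T z) <= C * conductor_log q T"
 and remainder_deriv_bound: "z \<in> cball (center T) (27 / 10) ==> norm (deriv (h q X T) z) <= C * conductor_log q T"
 and zero_count_le: "real (\<Sum>\<gamma>\<in>G q X T. m q X T \<gamma>) <= C * conductor_log q T"
 using data[OF nonprincipal_axioms, of T] unfolding local_zeros_def by auto

lemma log_deriv_bound:
 assumes "0 < Re z" "Re z <= 1"
 shows "norm (log_deriv_half X z) <= C * conductor_log q (Im z) * (1 + 1 / Re z)"
proof -
 let ?T = "Im z"
 note nc = near_center[of z ?T]
 have "norm (log_deriv_half X z) <= norm (\<Sum>\<gamma>\<in>G q X ?T. of_nat (m q X ?T \<gamma>) / (z - \<i> * of_real \<gamma>)) + norm (h q X ?T z)"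
  using expansion[of z ?T] nc assms norm_triangle_ineq by auto
 also have "norm (\<Sum>\<gamma>\<in>G q X ?T. of_nat (m q X ?T \<gamma>) / (z - \<i> * of_real \<gamma>)) <= (\<Sum>\<gamma>\<in>G q X ?T. real (m q X ?T \<gamma>) * (1 / Re z))"
 proof (rule sum_norm_le)
  fix \<gamma>
  have "norm (z - \<i> * of_real \<gamma>) >= Re z" using complex_Re_le_cmod[of "z - \<i> * of_real \<gamma>"] by simp
  then show "norm (of_nat (m q X ?T \<gamma>) / (z - \<i> * of_real \<gamma>)) <= real (m q X ?T \<gamma>) * (1 / Re z)"
   using assms by (auto simp: norm_divide intro!: divide_left_mono mult_pos_pos)
 qed
 also have "... = real (\<Sum>\<gamma>\<in>G q X ?T. m q X ?T \<gamma>) * (1 / Re z)" by (simp add: sum_divide_distrib)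
 also have "... <= C * conductor_log q ?T * (1 / Re z)" using zero_count_le assms by (intro mult_right_mono) auto
 also have "norm (h q X ?T z) <= C * conductor_log q ?T" using remainder_bound[of z ?T] nc assms by simp
 finally show ?thesis by (simp add: algebra_simps)
qed

lemma mangoldt_coeff: "norm (mangoldt (Suc n) * X (Suc n)) <= 1 * ln (real (Suc n))"
 unfolding norm_mult using mult_mono[OF mangoldt_le_ln[of n] norm_le_1[of "Suc n"]] by (simp del: of_nat_Suc)

text \<open>For Re z <= 1 by the local expansion, beyond that by the absolutely convergent series at
  Re s > 3/2. The constant depends on the character and on \<open>d\<close>;
  \<open>paley_wiener\<close> asks only for its existence.\<close>

lemma psi_transform_bound:
 assumes "d > 0"
 shows "\<exists>K. \<forall>z. d <= Re z --> Re z <= B --> norm (psi_transform X z) <= K * (1 + \<bar>Im z\<bar>) powr (- (3 / 4))"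
proof -
 define S where "S = (\<Sum>n. (1 + ln (real (Suc n))) * real (Suc n) powr (- (3 / 2)))"
 have Sm: "summable (%n. (1 + ln (real (Suc n))) * real (Suc n) powr (- (3 / 2)))" by (rule summable_log_weight) simp
 have S0: "S >= 0" unfolding S_def by (intro suminf_nonneg[OF Sm] mult_nonneg_nonneg add_nonneg_nonneg) auto
 define K1 where "K1 = C * (ln (132 * real q) + 4) * (1 + 1 / d)"
 have lq: "ln (132 * real q) >= 0" using q by (intro ln_ge_zero) linarith
 have K10: "K1 >= 0" unfolding K1_def using C assms lq by (intro mult_nonneg_nonneg) auto
 have LD: "norm (log_deriv_half X z) <= (K1 + S) * (1 + \<bar>Im z\<bar>) powr (1 / 4)" if z: "Re z >= d" for z
 proof (cases "Re z <= 1")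
  case True
  have "norm (log_deriv_half X z) <= C * conductor_log q (Im z) * (1 + 1 / Re z)"
   using log_deriv_bound[of z] True z assms by simp
  also have "... <= C * ((ln (132 * real q) + 4) * (1 + \<bar>Im z\<bar>) powr (1 / 4)) * (1 + 1 / d)"
   using C z assms lq conductor_log_le[OF q, of "Im z"]
   by (intro mult_mono mult_left_mono mult_nonneg_nonneg add_left_mono divide_left_mono mult_pos_pos) auto
  also have "... = K1 * (1 + \<bar>Im z\<bar>) powr (1 / 4)" by (simp add: K1_def algebra_simps)
  also have "... <= (K1 + S) * (1 + \<bar>Im z\<bar>) powr (1 / 4)" using S0 by (intro mult_right_mono) auto
  finally show ?thesis .
 next
  case False
  then have re: "Re (1 / 2 + z) > 1" by simp
  let ?t = "%n. mangoldt (Suc n) * X (Suc n) / of_nat (Suc n) powr (1 / 2 + z)"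
  have nt: "norm (?t n) <= (1 + ln (real (Suc n))) * real (Suc n) powr (- (3 / 2))" for n
  proof -
   have "norm (?t n) = norm (mangoldt (Suc n) * X (Suc n)) * real (Suc n) powr (- Re (1 / 2 + z))"
    by (rule norm_dirichlet_term)
   also have "... <= (1 + ln (real (Suc n))) * real (Suc n) powr (- (3 / 2))"
    using mangoldt_coeff[of n] False by (intro mult_mono powr_mono) (auto simp del: of_nat_Suc intro: add_nonneg_nonneg)
   finally show ?thesis .
  qed
  have "norm (log_deriv_half X z) = norm (dirichlet_series (%n. mangoldt n * X n) (1 / 2 + z))"
   unfolding log_deriv_half_def L_log_deriv[OF re] by simp
  also have "... <= S"
   unfolding dirichlet_series_def S_def
  proof (rule order_trans[OF summable_norm])
   show sn: "summable (%n. norm (?t n))" by (rule summable_comparison_test'[OF Sm, of 0]) (use nt in auto)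
   show "(\<Sum>n. norm (?t n)) <= (\<Sum>n. (1 + ln (real (Suc n))) * real (Suc n) powr (- (3 / 2)))"
    by (rule suminf_le[OF nt sn Sm])
  qed
  also have "... <= (K1 + S) * 1" using K10 by simp
  also have "... <= (K1 + S) * (1 + \<bar>Im z\<bar>) powr (1 / 4)"
   using K10 S0 by (intro mult_left_mono ge_one_powr_ge_zero) auto
  finally show ?thesis .
 qed
 have "norm (psi_transform X z) <= (3 * (K1 + S)) * (1 + \<bar>Im z\<bar>) powr (- (3 / 4))" if z: "d <= Re z" for z
 proof -
  have p: "(1 + \<bar>Im z\<bar>) / 3 > 0" by auto
  have "norm (psi_transform X z) = norm (log_deriv_half X z) / norm (1 / 2 + z)" by (simp add: psi_transform_def norm_divide)
  also have "... <= (K1 + S) * (1 + \<bar>Im z\<bar>) powr (1 / 4) / ((1 + \<bar>Im z\<bar>) / 3)"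
   using LD[OF z] norm_half_plus_ge[of z] z assms p by (intro frac_le) (auto intro: order_trans[OF norm_ge_zero])
  also have "... = (3 * (K1 + S)) * ((1 + \<bar>Im z\<bar>) powr (1 / 4) * (1 + \<bar>Im z\<bar>) powr (- 1))"
   by (simp add: powr_minus_divide)
  also have "(1 + \<bar>Im z\<bar>) powr (1 / 4) * (1 + \<bar>Im z\<bar>) powr (- 1) = (1 + \<bar>Im z\<bar>) powr (1 / 4 + - 1)" by (rule powr_add[symmetric])
  finally show ?thesis by simp
 qed
 then show ?thesis by blast
qed

lemma psi_transform_holomorphic: "psi_transform X holomorphic_on {z. Re z > 0}"
 and log_deriv_half_holomorphic: "log_deriv_half X holomorphic_on {z. Re z > 0}"
proof -
 note L = holomorphic_on_half_shift
 have "1 / 2 + z ~= 0" "dirichlet_L X (1 / 2 + z) ~= 0" if "Re z > 0" for z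
  using that L_nonzero[OF grh, of "1 / 2 + z"] by (auto simp: complex_eq_iff)
 then show "log_deriv_half X holomorphic_on {z. Re z > 0}" unfolding log_deriv_half_def[abs_def]
  using L[OF L_entire] L[OF holomorphic_deriv[OF L_entire open_UNIV]] by (intro holomorphic_intros) auto
 then show "psi_transform X holomorphic_on {z. Re z > 0}" unfolding psi_transform_def[abs_def]
  using \<open>!!z. Re z > 0 ==> 1 / 2 + z ~= 0\<close> by (intro holomorphic_intros) auto
qed

end

lemma sum_weighted_square_le:
 fixes w :: "'a => real" and x :: "'a => 'b::real_normed_field"
 assumes "!!i. i \<in> I ==> w i >= 0"
 shows "(norm (\<Sum>i\<in>I. of_real (w i) * x i))\<^sup>2 <= (\<Sum>i\<in>I. w i) * (\<Sum>i\<in>I. w i * (norm (x i))\<^sup>2)"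
proof -
 have "norm (\<Sum>i\<in>I. of_real (w i) * x i) <= (\<Sum>i\<in>I. w i * norm (x i))"
  by (rule sum_norm_le) (use assms in \<open>auto simp: norm_mult\<close>)
 also have "... = (\<Sum>i\<in>I. sqrt (w i) * (sqrt (w i) * norm (x i)))"
  using assms by (intro sum.cong refl) (auto simp: mult.assoc[symmetric])
 finally have "(norm (\<Sum>i\<in>I. of_real (w i) * x i))\<^sup>2 <= (\<Sum>i\<in>I. sqrt (w i) * (sqrt (w i) * norm (x i)))\<^sup>2" by (intro power_mono) auto
 also have "... <= (\<Sum>i\<in>I. (sqrt (w i))\<^sup>2) * (\<Sum>i\<in>I. (sqrt (w i) * norm (x i))\<^sup>2)" by (rule Cauchy_Schwarz_ineq_sum)
 also have "... = (\<Sum>i\<in>I. w i) * (\<Sum>i\<in>I. w i * (norm (x i))\<^sup>2)"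
  using assms by (intro arg_cong2[of _ _ _ _ "(*)"] sum.cong refl) (auto simp: power_mult_distrib)
 finally show ?thesis .
qed

lemma poisson_integral:
 assumes "\<sigma> > 0"
 shows "integrable lborel (%t. 1 / (\<sigma>\<^sup>2 + (t - \<gamma>)\<^sup>2))" "(LBINT t. 1 / (\<sigma>\<^sup>2 + (t - \<gamma>)\<^sup>2)) = pi / \<sigma>"
proof -
 let ?F = "%t. arctan ((t - \<gamma>) / \<sigma>) / \<sigma>"
 have nz: "\<sigma>\<^sup>2 + (t - \<gamma>)\<^sup>2 > 0" for t using assms by (intro add_pos_nonneg) auto
 have D: "(?F has_real_derivative 1 / (\<sigma>\<^sup>2 + (t - \<gamma>)\<^sup>2)) (at t)" for t
 proof -
  have "(?F has_real_derivative inverse (1 + ((t - \<gamma>) / \<sigma>)\<^sup>2) * (1 / \<sigma>) / \<sigma>) (at t)"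
   using assms by (auto intro!: derivative_eq_intros)
  also have "inverse (1 + ((t - \<gamma>) / \<sigma>)\<^sup>2) * (1 / \<sigma>) / \<sigma> = 1 / ((1 + ((t - \<gamma>) / \<sigma>)\<^sup>2) * \<sigma>\<^sup>2)"
   by (simp add: divide_inverse power2_eq_square mult_ac)
  also have "(1 + ((t - \<gamma>) / \<sigma>)\<^sup>2) * \<sigma>\<^sup>2 = \<sigma>\<^sup>2 + (t - \<gamma>)\<^sup>2" using assms by (simp add: power_divide distrib_right)
  finally show ?thesis .
 qed
 have cont: "isCont (%t. 1 / (\<sigma>\<^sup>2 + (t - \<gamma>)\<^sup>2)) t" for t using nz[of t] by (intro continuous_intros) auto
 have L: "(?F \<longlongrightarrow> (pi / 2) / \<sigma>) at_top" "(?F \<longlongrightarrow> (- (pi / 2)) / \<sigma>) at_bot"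
 proof -
  have "filterlim (%t. (t - \<gamma>) / \<sigma>) at_top at_top" "filterlim (%t. (t - \<gamma>) / \<sigma>) at_bot at_bot" using assms by real_asymp+
  note l = tendsto_arctan_at_top[THEN filterlim_compose, OF this(1)] tendsto_arctan_at_bot[THEN filterlim_compose, OF this(2)]
  show "(?F \<longlongrightarrow> (pi / 2) / \<sigma>) at_top" "(?F \<longlongrightarrow> (- (pi / 2)) / \<sigma>) at_bot"
   by (rule tendsto_divide[OF l(1) tendsto_const] tendsto_divide[OF l(2) tendsto_const], use assms in simp)+
 qed
 note FTC = interval_integral_FTC_nonneg[where a = "-\<infinity>" and b = "\<infinity>" and F = ?F and f = "%t. 1 / (\<sigma>\<^sup>2 + (t - \<gamma>)\<^sup>2)" and A = "(- (pi / 2)) / \<sigma>" and B = "(pi / 2) / \<sigma>"]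
 have "set_integrable lborel (einterval (-\<infinity>) \<infinity>) (%t. 1 / (\<sigma>\<^sup>2 + (t - \<gamma>)\<^sup>2))"
  "(LBINT t=-\<infinity>..\<infinity>. 1 / (\<sigma>\<^sup>2 + (t - \<gamma>)\<^sup>2)) = (pi / 2) / \<sigma> - (- (pi / 2)) / \<sigma>"
  using FTC D cont nz L by (auto simp: ereal_tendsto_simps less_imp_le)
 then show "integrable lborel (%t. 1 / (\<sigma>\<^sup>2 + (t - \<gamma>)\<^sup>2))" "(LBINT t. 1 / (\<sigma>\<^sup>2 + (t - \<gamma>)\<^sup>2)) = pi / \<sigma>"
  by (auto simp: set_integrable_def interval_integral_to_infinity_eq interval_lebesgue_integral_def set_lebesgue_integral_def field_simps)
qed

context character_zeros
begin

text \<open>Cauchy--Schwarz over the zeros gives their number times a sum of Poisson kernels, each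
  of integral pi / \<sigma>. So the order is 1 / \<sigma>, although the pointwise bound only gives 1
  / \<sigma>^2.\<close>

lemma local_square_integral:
 assumes \<sigma>: "0 < \<sigma>" "\<sigma> <= 1"
 shows "(\<integral>\<^sup>+t. ennreal ((norm (log_deriv_half X (Complex \<sigma> t)))\<^sup>2) * indicator {T - 1 / 2..T + 1 / 2} t \<partial>lborel)
  <= ennreal (10 * (C * conductor_log q T)\<^sup>2 / \<sigma>)"
proof -
 let ?G = "G q X T" and ?m = "m q X T" and ?l = "C * conductor_log q T"
 have l0: "?l > 0" using C conductor_log_le(2)[OF q] by simp
 define n where "n = (\<Sum>\<gamma>\<in>?G. real (?m \<gamma>))"
 have n: "n <= ?l" "n >= 0" using zero_count_le[of T] by (auto simp: n_def intro!: sum_nonneg)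
 define P where "P t = (\<Sum>\<gamma>\<in>?G. real (?m \<gamma>) * (1 / (\<sigma>\<^sup>2 + (t - \<gamma>)\<^sup>2)))" for t
 have P0: "P t >= 0" for t unfolding P_def by (intro sum_nonneg mult_nonneg_nonneg) auto
 have Pint: "integrable lborel P" "(LBINT t. P t) = n * (pi / \<sigma>)"
 proof -
  show "integrable lborel P" unfolding P_def
   by (intro Bochner_Integration.integrable_sum integrable_mult_right poisson_integral \<sigma>)
  show "(LBINT t. P t) = n * (pi / \<sigma>)" unfolding P_def n_def sum_distrib_right
   by (subst Bochner_Integration.integral_sum) (auto intro!: integrable_mult_right poisson_integral(1) \<sigma>(1) simp only: integral_mult_right_zero poisson_integral(2)[OF \<sigma>(1)])
 qed
 have pt: "(norm (log_deriv_half X (Complex \<sigma> t)))\<^sup>2 <= 2 * n * P t + 2 * ?l\<^sup>2" if t: "t \<in> {T - 1 / 2..T + 1 / 2}" for t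
 proof -
  let ?z = "Complex \<sigma> t"
  have nc: "?z \<in> cball (center T) (27 / 10)" "?z \<in> ball (center T) (14 / 5)" using near_center[of ?z T] \<sigma> t by auto
  let ?S = "\<Sum>\<gamma>\<in>?G. of_nat (?m \<gamma>) / (?z - \<i> * of_real \<gamma>)"
  have "(norm ?S)\<^sup>2 = (norm (\<Sum>\<gamma>\<in>?G. of_real (real (?m \<gamma>)) * (1 / (?z - \<i> * of_real \<gamma>))))\<^sup>2" by simp
  also have "... <= n * (\<Sum>\<gamma>\<in>?G. real (?m \<gamma>) * (norm (1 / (?z - \<i> * of_real \<gamma>)))\<^sup>2)"
   unfolding n_def by (rule sum_weighted_square_le) simp
  also have "(\<Sum>\<gamma>\<in>?G. real (?m \<gamma>) * (norm (1 / (?z - \<i> * of_real \<gamma>)))\<^sup>2) = P t"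
   unfolding P_def by (intro sum.cong refl) (simp add: norm_divide power_divide cmod_power2)
  finally have S: "(norm ?S)\<^sup>2 <= n * P t" .
  have "norm (log_deriv_half X ?z) <= norm ?S + ?l"
   using expansion[OF nc(2)] \<sigma> remainder_bound[OF nc(1)] norm_triangle_ineq[of ?S "h q X T ?z"] by simp
  then have "(norm (log_deriv_half X ?z))\<^sup>2 <= (norm ?S + ?l)\<^sup>2" by (intro power_mono) auto
  also have "... <= 2 * (norm ?S)\<^sup>2 + 2 * ?l\<^sup>2" using sum_squares_bound[of "norm ?S" ?l] by (simp add: power2_sum)
  finally show ?thesis using S by simp
 qed
 have "(\<integral>\<^sup>+t. ennreal ((norm (log_deriv_half X (Complex \<sigma> t)))\<^sup>2) * indicator {T - 1 / 2..T + 1 / 2} t \<partial>lborel)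
   <= (\<integral>\<^sup>+t. ennreal (2 * n * P t + 2 * ?l\<^sup>2 * indicator {T - 1 / 2..T + 1 / 2} t) \<partial>lborel)"
 proof (rule nn_integral_mono)
  fix t
  show "ennreal ((norm (log_deriv_half X (Complex \<sigma> t)))\<^sup>2) * indicator {T - 1 / 2..T + 1 / 2} t <= ennreal (2 * n * P t + 2 * ?l\<^sup>2 * indicator {T - 1 / 2..T + 1 / 2} t)"
  proof (cases "t \<in> {T - 1 / 2..T + 1 / 2}")
   case True
   then show ?thesis using ennreal_leI[OF pt[OF True]] by (simp del: ennreal_plus)
  qed simp
 qed
 also have "... = ennreal (LBINT t. 2 * n * P t + 2 * ?l\<^sup>2 * indicator {T - 1 / 2..T + 1 / 2} t)"
  by (intro nn_integral_eq_integral Bochner_Integration.integrable_add integrable_mult_right Pint(1) AE_I2 add_nonneg_nonneg mult_nonneg_nonneg P0 n(2)) auto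
 also have "(LBINT t. 2 * n * P t + 2 * ?l\<^sup>2 * indicator {T - 1 / 2..T + 1 / 2} t) = 2 * n * (n * (pi / \<sigma>)) + 2 * ?l\<^sup>2"
  by (subst Bochner_Integration.integral_add) (auto intro!: integrable_mult_right Pint(1) simp: Pint(2))
 also have "... <= 8 * ?l\<^sup>2 / \<sigma> + 2 * ?l\<^sup>2 / \<sigma>"
 proof (rule add_mono)
  have "2 * n * (n * (pi / \<sigma>)) <= 2 * l * (l * (4 / \<sigma>))" if "n <= l" for l
   using n(2) that \<sigma> pi_less_4 by (intro mult_mono divide_right_mono mult_nonneg_nonneg) auto
  from this[OF n(1)] have "2 * n * (n * (pi / \<sigma>)) <= 2 * ?l * (?l * (4 / \<sigma>))" .
  then show "2 * n * (n * (pi / \<sigma>)) <= 8 * ?l\<^sup>2 / \<sigma>" by (simp add: power2_eq_square)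
  show "2 * ?l\<^sup>2 <= 2 * ?l\<^sup>2 / \<sigma>" using \<sigma> mult_left_le[of \<sigma> "2 * ?l\<^sup>2"] by (simp add: pos_le_divide_eq)
 qed
 finally show ?thesis by (auto intro: ennreal_leI simp: add_divide_distrib[symmetric])
qed

text \<open>The integral adds up the local bounds over all heights: (1 + |T|)^(1/2) from the squared
  logarithm against (1 + |T|)^(-2) from the denominator. The number generously rounds up 36 * 10 *
  121.\<close>

definition "square_const = 1600000 * C\<^sup>2 * (LBINT t. (1 + \<bar>t\<bar>) powr (- (3 / 2)))"

text \<open>Averaging over the unit windows about all heights \<open>T\<close>: each
  \<open>t\<close> lies in windows of total measure 1, and Fubini reduces the integral to
  \<open>local_square_integral\<close>.\<close>

lemma square_integral_bound:
 assumes \<sigma>: "0 < \<sigma>" "\<sigma> <= 1" and q3: "q >= 3"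
 shows "(\<integral>\<^sup>+t. ennreal ((norm (psi_transform X (Complex \<sigma> t)))\<^sup>2) \<partial>lborel) <= ennreal (square_const * (ln (real q))\<^sup>2 / \<sigma>)"
proof -
 define f where "f t = norm (psi_transform X (Complex \<sigma> t))" for t
 have fm [measurable]: "f \<in> borel_measurable borel"
 proof -
  have "continuous_on UNIV (%t. psi_transform X (of_real \<sigma> + \<i> * of_real t))"
   using \<sigma> by (intro continuous_on_compose2[OF holomorphic_on_imp_continuous_on[OF psi_transform_holomorphic]] continuous_intros) auto
  then have "continuous_on UNIV f" unfolding f_def Complex_eq by (intro continuous_intros)
  then show ?thesis by (simp add: borel_measurable_continuous_onI)
 qed
 have [measurable]: "(%t. norm (log_deriv_half X (Complex \<sigma> t))) \<in> borel_measurable borel"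
 proof -
  have "continuous_on UNIV (%t. log_deriv_half X (of_real \<sigma> + \<i> * of_real t))"
   using \<sigma> by (intro continuous_on_compose2[OF holomorphic_on_imp_continuous_on[OF log_deriv_half_holomorphic]] continuous_intros) auto
  then have "continuous_on UNIV (%t. norm (log_deriv_half X (Complex \<sigma> t)))" unfolding Complex_eq by (intro continuous_intros)
  then show ?thesis by (simp add: borel_measurable_continuous_onI)
 qed
 have l1: "ln (real q) >= 1" by (rule conductor_log_le'(2)[OF q3])
 have inner: "(\<integral>\<^sup>+t. ennreal ((f t)\<^sup>2) * indicator {-(1/2)..1/2} (t - T) \<partial>lborel) <= ennreal (1600000 * C\<^sup>2 * (ln (real q))\<^sup>2 / \<sigma> * (1 + \<bar>T\<bar>) powr (- (3 / 2)))" for T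
 proof -
  let ?D = "%t. norm (log_deriv_half X (Complex \<sigma> t))"
  have "(\<integral>\<^sup>+t. ennreal ((f t)\<^sup>2) * indicator {-(1/2)..1/2} (t - T) \<partial>lborel)
   <= (\<integral>\<^sup>+t. ennreal (36 / (1 + \<bar>T\<bar>)\<^sup>2) * (ennreal ((?D t)\<^sup>2) * indicator {T - 1 / 2..T + 1 / 2} t) \<partial>lborel)"
  proof (intro nn_integral_mono)
   fix t
   have "(f t)\<^sup>2 <= 36 / (1 + \<bar>T\<bar>)\<^sup>2 * (?D t)\<^sup>2" if t: "t \<in> {T - 1 / 2..T + 1 / 2}"
   proof -
    have "norm (1 / 2 + Complex \<sigma> t) >= (1 + \<bar>t\<bar>) / 3" using norm_half_plus_ge[of "Complex \<sigma> t"] \<sigma> by simp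
    moreover have "(1 + \<bar>t\<bar>) / 3 >= (1 + \<bar>T\<bar>) / 6" using t by (auto simp: abs_if)
    ultimately have "norm (1 / 2 + Complex \<sigma> t) >= (1 + \<bar>T\<bar>) / 6" by linarith
    then have "f t <= ?D t / ((1 + \<bar>T\<bar>) / 6)"
     unfolding f_def psi_transform_def norm_divide norm_minus_cancel by (intro divide_left_mono mult_pos_pos) (auto intro: less_le_trans[rotated])
    then have "(f t)\<^sup>2 <= (?D t / ((1 + \<bar>T\<bar>) / 6))\<^sup>2" by (intro power_mono) (auto simp: f_def)
    then show ?thesis by (simp add: power_divide power_mult_distrib mult.commute)
   qed
   then show "ennreal ((f t)\<^sup>2) * indicator {-(1/2)..1/2} (t - T) <= ennreal (36 / (1 + \<bar>T\<bar>)\<^sup>2) * (ennreal ((?D t)\<^sup>2) * indicator {T - 1 / 2..T + 1 / 2} t)"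
    by (auto simp: indicator_def ennreal_mult[symmetric] intro!: ennreal_leI)
  qed
  also have "... <= ennreal (36 / (1 + \<bar>T\<bar>)\<^sup>2) * (\<integral>\<^sup>+t. ennreal ((?D t)\<^sup>2) * indicator {T - 1 / 2..T + 1 / 2} t \<partial>lborel)"
   by (subst nn_integral_cmult) auto
  also have "... <= ennreal (36 / (1 + \<bar>T\<bar>)\<^sup>2) * ennreal (10 * (C * conductor_log q T)\<^sup>2 / \<sigma>)"
   by (intro mult_left_mono local_square_integral \<sigma>) auto
  also have "... = ennreal (36 / (1 + \<bar>T\<bar>)\<^sup>2 * (10 * (C * conductor_log q T)\<^sup>2 / \<sigma>))" using \<sigma> by (intro ennreal_mult[symmetric]) auto
  also have "... <= ennreal (1600000 * C\<^sup>2 * (ln (real q))\<^sup>2 / \<sigma> * (1 + \<bar>T\<bar>) powr (- (3 / 2)))"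
  proof (rule ennreal_leI)
   have "conductor_log q T <= 11 * ln (real q) * (1 + \<bar>T\<bar>) powr (1 / 4)" by (rule conductor_log_le'(1)[OF q3])
   then have "(conductor_log q T)\<^sup>2 <= (11 * ln (real q) * (1 + \<bar>T\<bar>) powr (1 / 4))\<^sup>2"
    using conductor_log_le(2)[OF q, of T] by (intro power_mono) auto
   also have "... = 121 * (ln (real q))\<^sup>2 * (1 + \<bar>T\<bar>) powr (1 / 2)" by (simp add: power_mult_distrib powr_power)
   finally have cl: "(conductor_log q T)\<^sup>2 <= 121 * (ln (real q))\<^sup>2 * (1 + \<bar>T\<bar>) powr (1 / 2)" .
   have "36 / (1 + \<bar>T\<bar>)\<^sup>2 * (10 * (C * conductor_log q T)\<^sup>2 / \<sigma>) = (360 * C\<^sup>2 / \<sigma> / (1 + \<bar>T\<bar>)\<^sup>2) * (conductor_log q T)\<^sup>2"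
    by (simp add: power_mult_distrib mult_ac)
   also have "... <= (360 * C\<^sup>2 / \<sigma> / (1 + \<bar>T\<bar>)\<^sup>2) * (121 * (ln (real q))\<^sup>2 * (1 + \<bar>T\<bar>) powr (1 / 2))"
    using \<sigma> by (intro mult_left_mono cl) auto
   also have "... = 43560 * C\<^sup>2 * (ln (real q))\<^sup>2 / \<sigma> * ((1 + \<bar>T\<bar>) powr (1 / 2) * (1 + \<bar>T\<bar>) powr (- 2))"
    by (simp add: powr_minus_divide powr_numeral)
   also have "(1 + \<bar>T\<bar>) powr (1 / 2) * (1 + \<bar>T\<bar>) powr (- 2) = (1 + \<bar>T\<bar>) powr (1 / 2 + - 2)" by (rule powr_add[symmetric])
   also have "43560 * C\<^sup>2 * (ln (real q))\<^sup>2 / \<sigma> * ... <= 1600000 * C\<^sup>2 * (ln (real q))\<^sup>2 / \<sigma> * ..."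
    using \<sigma> by (intro mult_right_mono divide_right_mono) auto
   finally show "36 / (1 + \<bar>T\<bar>)\<^sup>2 * (10 * (C * conductor_log q T)\<^sup>2 / \<sigma>) <= 1600000 * C\<^sup>2 * (ln (real q))\<^sup>2 / \<sigma> * (1 + \<bar>T\<bar>) powr (- (3 / 2))" by simp
  qed
  finally show ?thesis .
 qed
 have one: "(\<integral>\<^sup>+T. indicator {-(1/2)..1/2} (t - T) \<partial>lborel) = (1::ennreal)" for t :: real
 proof -
  have "(\<integral>\<^sup>+T. indicator {-(1/2)..1/2} (t - T) \<partial>lborel) = (\<integral>\<^sup>+T. indicator {t - 1/2..t + 1/2} T \<partial>lborel)"
   by (intro nn_integral_cong) (auto simp: indicator_def)
  also have "... = 1" by simp
  finally show ?thesis .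
 qed
 have "(\<integral>\<^sup>+t. ennreal ((f t)\<^sup>2) \<partial>lborel) = (\<integral>\<^sup>+t. (\<integral>\<^sup>+T. ennreal ((f t)\<^sup>2) * indicator {-(1/2)..1/2} (t - T) \<partial>lborel) \<partial>lborel)"
  by (subst nn_integral_cmult) (simp_all add: one)
 also have "... = (\<integral>\<^sup>+T. (\<integral>\<^sup>+t. ennreal ((f t)\<^sup>2) * indicator {-(1/2)..1/2} (t - T) \<partial>lborel) \<partial>lborel)"
  by (rule lborel_pair.Fubini') measurable
 also have "... <= (\<integral>\<^sup>+T. ennreal (1600000 * C\<^sup>2 * (ln (real q))\<^sup>2 / \<sigma> * (1 + \<bar>T\<bar>) powr (- (3 / 2))) \<partial>lborel)"
  by (intro nn_integral_mono inner)
 also have "... = ennreal (LBINT T. 1600000 * C\<^sup>2 * (ln (real q))\<^sup>2 / \<sigma> * (1 + \<bar>T\<bar>) powr (- (3 / 2)))"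
  using \<sigma> integrable_one_plus_abs_powr[of "3 / 2"] by (intro nn_integral_eq_integral integrable_mult_right) auto
 also have "... = ennreal (square_const * (ln (real q))\<^sup>2 / \<sigma>)" by (simp add: square_const_def mult_ac)
 finally show ?thesis by (simp add: f_def)
qed

end

section \<open>The Fejer window\<close>

definition triangle :: "real => real => real" where
 "triangle h y = max 0 (1 - \<bar>y\<bar> / h)"

definition fejer :: "real => real => complex" where
 "fejer h = fourier (%y. complex_of_real (triangle h y))"

lemma triangle_bounds: "0 <= triangle h y" "h > 0 ==> triangle h y <= 1"
 by (auto simp: triangle_def)

lemma triangle_eq_0: "h > 0 ==> \<bar>y\<bar> >= h ==> triangle h y = 0"
 by (simp add: triangle_def max_def field_simps)

lemma triangle_eq: "h > 0 ==> \<bar>y\<bar> <= h ==> triangle h y = 1 - \<bar>y\<bar> / h"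
 by (simp add: triangle_def max_def field_simps)

lemma triangle_continuous: "continuous_on A (triangle h)"
 unfolding triangle_def divide_inverse by (intro continuous_intros)

lemma triangle_measurable [measurable]: "triangle h \<in> borel_measurable borel"
 by (rule borel_measurable_continuous_onI[OF triangle_continuous])

lemma triangle_lipschitz: "h > 0 ==> \<bar>triangle h x - triangle h y\<bar> <= \<bar>x - y\<bar> / h"
proof -
 assume h: "h > 0"
 have "\<bar>max 0 (1 - a) - max 0 (1 - b)\<bar> <= \<bar>a - b\<bar>" for a b :: real by linarith
 from this[of "\<bar>x\<bar> / h" "\<bar>y\<bar> / h"] have "\<bar>triangle h x - triangle h y\<bar> <= \<bar>\<bar>x\<bar> / h - \<bar>y\<bar> / h\<bar>" by (simp add: triangle_def)
 also have "... = \<bar>\<bar>x\<bar> - \<bar>y\<bar>\<bar> / h" using h by (simp add: diff_divide_distrib[symmetric])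
 also have "... <= \<bar>x - y\<bar> / h" using h by (intro divide_right_mono) auto
 finally show ?thesis .
qed

lemma triangle_integrable_mult:
 fixes g :: "real => complex"
 assumes h: "h > 0" and g: "continuous_on UNIV g"
 shows "integrable lborel (%y. of_real (triangle h y) * g y)"
proof -
 have "integrable lborel (%y. indicator {-h..h} y *\<^sub>R (of_real (triangle h y) * g y))"
  by (rule borel_integrable_compact) (auto intro!: continuous_intros continuous_on_subset[OF g] triangle_continuous)
 also have "(%y. indicator {-h..h} y *\<^sub>R (of_real (triangle h y) * g y)) = (%y. of_real (triangle h y) * g y)"
  using triangle_eq_0[OF h] by (auto simp: indicator_def fun_eq_iff abs_if)
 finally show ?thesis .
qed

lemma triangle_exp_integral:
 fixes a :: complex
 assumes h: "h > 0" and a: "a ~= 0"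
 shows "(LBINT y. of_real (triangle h y) * exp (a * of_real y)) = (exp (a * of_real h) + exp (- a * of_real h) - 2) / (of_real h * a\<^sup>2)"
proof -
 let ?f = "%y. of_real (triangle h y) * exp (a * of_real y)"
 have nz: "complex_of_real h ~= 0" using h by simp
 let ?G = "%\<epsilon> z. (1 - \<epsilon> * z / of_real h) * exp (a * z) / a + \<epsilon> * exp (a * z) / (of_real h * a\<^sup>2)"
 have der: "((%y. ?G \<epsilon> (of_real y)) has_vector_derivative (1 - \<epsilon> * of_real x / of_real h) * exp (a * of_real x)) (at x within S)" for \<epsilon> x S
 proof -
  have "(?G \<epsilon> has_field_derivative (1 - \<epsilon> * of_real x / of_real h) * exp (a * of_real x)) (at (of_real x))"
   using a nz by (auto intro!: derivative_eq_intros simp: field_simps power2_eq_square)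
  from has_vector_derivative_real_field[OF this] show ?thesis using has_vector_derivative_at_within by blast
 qed
 have I1: "(?f has_integral (?G 1 (of_real h) - ?G 1 (of_real 0))) {0..h}"
 proof -
  have "((%y. (1 - 1 * of_real y / of_real h) * exp (a * of_real y)) has_integral (?G 1 (of_real h) - ?G 1 (of_real 0))) {0..h}"
   by (rule fundamental_theorem_of_calculus[OF _ der]) (use h in simp)
  then show ?thesis by (rule has_integral_eq[rotated]) (use triangle_eq[OF h] in auto)
 qed
 have I2: "(?f has_integral (?G (-1) (of_real 0) - ?G (-1) (of_real (-h)))) {-h..0}"
 proof -
  have "((%y. (1 - (-1) * of_real y / of_real h) * exp (a * of_real y)) has_integral (?G (-1) (of_real 0) - ?G (-1) (of_real (-h)))) {-h..0}"
   by (rule fundamental_theorem_of_calculus[OF _ der]) (use h in simp)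
  then show ?thesis by (rule has_integral_eq[rotated]) (use triangle_eq[OF h] in auto)
 qed
 have val: "(?G (-1) (of_real 0) - ?G (-1) (of_real (-h))) + (?G 1 (of_real h) - ?G 1 (of_real 0)) = (exp (a * of_real h) + exp (- a * of_real h) - 2) / (of_real h * a\<^sup>2)"
  using a nz by (simp add: field_simps power2_eq_square)
 have "(?f has_integral (exp (a * of_real h) + exp (- a * of_real h) - 2) / (of_real h * a\<^sup>2)) {-h..h}"
  unfolding val[symmetric] by (rule has_integral_combine[OF _ _ I2 I1]) (use h in auto)
 then have "(?f has_integral (exp (a * of_real h) + exp (- a * of_real h) - 2) / (of_real h * a\<^sup>2)) UNIV"
  by (rule has_integral_on_superset) (use triangle_eq_0[OF h] in auto)
 moreover have "integrable lborel ?f" by (rule triangle_integrable_mult[OF h]) (intro continuous_intros)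
 then have "(?f has_integral (LBINT y. ?f y)) UNIV" by (rule has_integral_integral_lborel)
 ultimately show ?thesis by (rule has_integral_unique[symmetric])
qed

lemma triangle_integrable: "h > 0 ==> integrable lborel (%y. complex_of_real (triangle h y))"
 using triangle_integrable_mult[of h "%_. 1"] by simp

lemma triangle_mass: "h > 0 ==> (LBINT y. norm (complex_of_real (triangle h y))) <= 2 * h"
proof -
 assume h: "h > 0"
 have "(LBINT y. norm (complex_of_real (triangle h y))) <= (LBINT y. indicator {-h..h} y)"
 proof (rule integral_mono)
  show "integrable lborel (%y. norm (complex_of_real (triangle h y)))" by (rule integrable_norm[OF triangle_integrable[OF h]])
  show "norm (complex_of_real (triangle h y)) <= indicator {-h..h} y" for y
   using triangle_bounds[of h y] triangle_eq_0[OF h, of y] h by (auto simp: indicator_def abs_if)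
 qed (use h in auto)
 then show ?thesis using h by simp
qed

text \<open>The bounds 2h and 4 / (h u^2) combine to a multiple of the Poisson kernel of width 1/h,
  so that the L1 norm is bounded independently of \<open>h\<close>.\<close>

lemma fejer_bound:
 assumes h: "h > 0"
 shows "norm (fejer h u) <= (6 / h) * (1 / ((1 / h)\<^sup>2 + (u - 0)\<^sup>2))"
proof -
 have 1: "norm (fejer h u) <= 2 * h"
  unfolding fejer_def using norm_fourier_le[OF triangle_integrable[OF h]] triangle_mass[OF h] order_trans by blast
 have 2: "norm (fejer h u) * (h * u\<^sup>2) <= 4"
 proof (cases "u = 0")
  case False
  have "fejer h u = (LBINT y. of_real (triangle h y) * exp ((- \<i> * of_real u) * of_real y))"
   unfolding fejer_def fourier_def cis_conv_exp by (simp add: mult.assoc)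
  also have "... = (exp ((- \<i> * of_real u) * of_real h) + exp (- (- \<i> * of_real u) * of_real h) - 2) / (of_real h * (- \<i> * of_real u)\<^sup>2)"
   by (rule triangle_exp_integral[OF h]) (use False in simp)
  finally have "norm (fejer h u) = norm (exp ((- \<i> * of_real u) * of_real h) + exp (- (- \<i> * of_real u) * of_real h) - 2) / (h * u\<^sup>2)"
   using h by (simp add: norm_divide norm_mult norm_power)
  also have "norm (exp ((- \<i> * of_real u) * of_real h) + exp (- (- \<i> * of_real u) * of_real h) - 2) <= (1 + 1) + 2"
   by (intro order_trans[OF norm_triangle_ineq4] add_mono order_trans[OF norm_triangle_ineq]) (auto simp: norm_exp_eq_Re)
  finally have "norm (fejer h u) <= 4 / (h * u\<^sup>2)" using h by (simp add: divide_right_mono)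
  then show ?thesis using h False by (simp add: pos_le_divide_eq)
 qed simp
 have "norm (fejer h u) * ((1 / h)\<^sup>2 + u\<^sup>2) = (norm (fejer h u) / h + norm (fejer h u) * (h * u\<^sup>2)) / h"
  using h by (simp add: field_simps power2_eq_square)
 also have "... <= (2 + 4) / h"
  using h 1 2 by (intro divide_right_mono add_mono) (auto simp: pos_divide_le_eq)
 finally have "norm (fejer h u) * ((1 / h)\<^sup>2 + u\<^sup>2) <= 6 / h" by simp
 moreover have "(1 / h)\<^sup>2 + u\<^sup>2 > 0" using h by (intro add_pos_nonneg) auto
 ultimately have "norm (fejer h u) <= (6 / h) / ((1 / h)\<^sup>2 + u\<^sup>2)" by (simp only: pos_le_divide_eq)
 then show ?thesis by simp
qed

lemma fejer_tail: "h > 0 ==> u ~= 0 ==> norm (fejer h u) <= 6 / (h * u\<^sup>2)"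
proof -
 assume h: "h > 0" and u: "u ~= 0"
 note fejer_bound[OF h, of u]
 also have "(6 / h) * (1 / ((1 / h)\<^sup>2 + (u - 0)\<^sup>2)) <= (6 / h) * (1 / u\<^sup>2)"
  using h u by (intro mult_left_mono divide_left_mono mult_pos_pos add_pos_pos) auto
 finally show ?thesis by simp
qed

lemma fejer_integrable:
 assumes h: "h > 0"
 shows "integrable lborel (fejer h)" "(LBINT u. norm (fejer h u)) <= 24"
proof -
 have m [measurable]: "fejer h \<in> borel_measurable lborel" unfolding fejer_def by (rule fourier_measurable) simp
 note p = poisson_integral[of "1 / h" 0]
 have i: "integrable lborel (%u. (6 / h) * (1 / ((1 / h)\<^sup>2 + (u - 0)\<^sup>2)))" using p(1) h by (intro integrable_mult_right) auto
 show fi: "integrable lborel (fejer h)"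
  by (rule Bochner_Integration.integrable_bound[OF i m], rule AE_I2, rule order_trans[OF fejer_bound[OF h]])
   (unfold real_norm_def, rule abs_ge_self)
 have "(LBINT u. norm (fejer h u)) <= (LBINT u. (6 / h) * (1 / ((1 / h)\<^sup>2 + (u - 0)\<^sup>2)))"
  by (rule integral_mono[OF integrable_norm[OF fi] i]) (rule fejer_bound[OF h])
 also have "... = (6 / h) * (pi / (1 / h))" using p(2) h by (subst integral_mult_right_zero) simp
 also have "... <= 24" using h pi_less_4 by simp
 finally show "(LBINT u. norm (fejer h u)) <= 24" .
qed

lemma fejer_inversion:
 assumes h: "h > 0"
 shows "(LBINT u. fejer h u * cis (u * y)) = 2 * pi * of_real (triangle h y)"
proof -
 have "isCont (%y. complex_of_real (triangle h y)) y"
  using triangle_continuous[of UNIV h] by (intro continuous_intros) (simp add: continuous_on_eq_continuous_at)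
 moreover have "norm (complex_of_real (triangle h y)) <= 1" for y using triangle_bounds[of h y] h by simp
 ultimately show ?thesis unfolding fejer_def
  using fourier_inversion[OF triangle_integrable[OF h], where y = y and B = 1] fejer_integrable(1)[OF h] by (simp add: fejer_def)
qed

text \<open>The triangle is written as the transform of its Fejer kernel and the integrals are
  exchanged: a window in \<open>y\<close> becomes an average of the transform over heights near the
  given one.\<close>

lemma window_convolution:
 assumes h: "h > 0" and f: "integrable lborel f"
 shows "(LBINT y. f y * of_real (triangle h (y - b))) = (LBINT u. fejer h u * cis (- u * b) * (LBINT y. f y * cis (u * y))) / (2 * pi)"
proof -
 have [measurable]: "f \<in> borel_measurable lborel" "fejer h \<in> borel_measurable lborel" using f fejer_integrable(1)[OF h] by auto
 let ?g = "%y u. f y * (fejer h u * cis (u * (y - b)))"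
 have fi: "integrable lborel (%u. fejer h u * cis (u * (y - b)))" for y
  using fourier_integrable[OF fejer_integrable(1)[OF h], of "y - b"] by (simp add: mult.commute)
 have prod: "integrable (lborel \<Otimes>\<^sub>M lborel) (case_prod ?g)"
 proof (rule lborel_pair.Fubini_integrable)
  show "case_prod ?g \<in> borel_measurable (lborel \<Otimes>\<^sub>M lborel)" by measurable
  have "(LBINT u. norm (?g y u)) = norm (f y) * (LBINT u. norm (fejer h u))" for y by (simp add: norm_mult)
  then show "integrable lborel (%y. LBINT u. norm (case (y, u) of (y, u) => ?g y u))" using f by simp
  show "AE y in lborel. integrable lborel (%u. case (y, u) of (y, u) => ?g y u)"
   using fi by (intro AE_I2) simp
 qed
 have "2 * pi * (LBINT y. f y * of_real (triangle h (y - b))) = (LBINT y. f y * (2 * pi * of_real (triangle h (y - b))))"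
  by (subst integral_mult_right_zero[symmetric]) (simp add: mult_ac)
 also have "... = (LBINT y. (LBINT u. ?g y u))"
  unfolding fejer_inversion[OF h, symmetric] by simp
 also have "... = (LBINT u. (LBINT y. ?g y u))" using lborel_pair.Fubini_integral[OF prod] by simp
 also have "... = (LBINT u. fejer h u * cis (- u * b) * (LBINT y. f y * cis (u * y)))"
 proof (intro Bochner_Integration.integral_cong refl)
  fix u
  have eq: "?g y u = fejer h u * cis (- u * b) * (f y * cis (u * y))" for y
  proof -
   have "cis (u * (y - b)) = cis (- u * b) * cis (u * y)" by (simp add: cis_mult algebra_simps)
   then show ?thesis by simp
  qed
  show "(LBINT y. ?g y u) = fejer h u * cis (- u * b) * (LBINT y. f y * cis (u * y))"
   unfolding eq by (rule integral_mult_right_zero)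
 qed
 finally show ?thesis by (simp add: field_simps)
qed

text \<open>What a single zero at height \<gamma> contributes through the window, with
  \<open>\<tau> = t - \<gamma>\<close>. The window has centre 2h and half-width h, hence lies in
  [h, 3h].\<close>

definition window_transform :: "real => real => real => complex" where
 "window_transform h \<sigma> \<tau> = (LBINT y. indicator {0..} y *\<^sub>R exp (- Complex \<sigma> \<tau> * of_real y) * of_real (triangle h (y - 2 * h)))"

lemma window_transform_bound:
 assumes h: "h > 0" and \<sigma>: "\<sigma> > 0"
 shows "norm (window_transform h \<sigma> \<tau>) <= (4 / h) * (1 / (\<sigma>\<^sup>2 + (\<tau> - 0)\<^sup>2))"
proof -
 let ?s = "Complex \<sigma> \<tau>"
 have s0: "?s ~= 0" using \<sigma> by (simp add: complex_eq_iff)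
 have "window_transform h \<sigma> \<tau> = (LBINT y. exp (- ?s * of_real y) * of_real (triangle h (y - 2 * h)))"
  unfolding window_transform_def
 proof (intro Bochner_Integration.integral_cong refl)
  fix y show "indicator {0..} y *\<^sub>R exp (- ?s * of_real y) * of_real (triangle h (y - 2 * h)) = exp (- ?s * of_real y) * of_real (triangle h (y - 2 * h))"
   using triangle_eq_0[OF h, of "y - 2 * h"] h by (cases "y >= 0") auto
 qed
 also have "... = (LBINT y. exp (- ?s * of_real (2 * h + 1 * y)) * of_real (triangle h ((2 * h + 1 * y) - 2 * h)))"
  using lborel_integral_real_affine[of 1 "%y. exp (- ?s * of_real y) * of_real (triangle h (y - 2 * h))" "2 * h"] by simp
 also have "... = (LBINT y. exp (- ?s * of_real (2 * h)) * (of_real (triangle h y) * exp (- ?s * of_real y)))"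
  by (intro Bochner_Integration.integral_cong refl) (simp add: distrib_left exp_add exp_minus divide_inverse exp_diff)
 also have "... = exp (- ?s * of_real (2 * h)) * ((exp (- ?s * of_real h) + exp (- (- ?s) * of_real h) - 2) / (of_real h * (- ?s)\<^sup>2))"
  using s0 by (subst integral_mult_right_zero, subst triangle_exp_integral[OF h]) auto
 finally have eq: "window_transform h \<sigma> \<tau> = exp (- ?s * of_real (2 * h)) * ((exp (- ?s * of_real h) + exp (- (- ?s) * of_real h) - 2) / (of_real h * (- ?s)\<^sup>2))" .
 have "norm (exp (- ?s * of_real (2 * h)) * (exp (- ?s * of_real h) + exp (- (- ?s) * of_real h) - 2)) <= 4"
 proof -
  have "exp (- ?s * of_real (2 * h)) * (exp (- ?s * of_real h) + exp (- (- ?s) * of_real h) - 2) = exp (- ?s * of_real (3 * h)) + exp (- ?s * of_real h) - 2 * exp (- ?s * of_real (2 * h))"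
   by (simp add: algebra_simps flip: exp_add)
  also have "norm ... <= (1 + 1) + 2"
  proof (intro order_trans[OF norm_triangle_ineq4] add_mono order_trans[OF norm_triangle_ineq])
   have e: "norm (exp (- ?s * of_real k)) <= 1" if "k >= 0" for k using that \<sigma> by (simp add: norm_exp_eq_Re mult_nonneg_nonneg)
   show "norm (exp (- ?s * of_real (3 * h))) <= 1" "norm (exp (- ?s * of_real h)) <= 1" using h by (intro e; simp)+
   show "norm (2 * exp (- ?s * of_real (2 * h))) <= 2" using e[of "2 * h"] h by (simp add: norm_mult)
  qed
  finally show ?thesis by simp
 qed
 then have "norm (window_transform h \<sigma> \<tau>) <= 4 / (h * (norm ?s)\<^sup>2)"
  unfolding eq times_divide_eq_right norm_divide using h by (simp add: norm_mult norm_power divide_right_mono)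
 then show ?thesis by (simp add: cmod_power2)
qed

lemma window_transform_integral:
 assumes h: "h > 0" and \<sigma>: "\<sigma> > 0"
 shows "(\<integral>\<^sup>+t. ennreal (norm (window_transform h \<sigma> (t - \<gamma>))) \<partial>lborel) <= ennreal (16 / (h * \<sigma>))"
proof -
 note p = poisson_integral[OF \<sigma>, of \<gamma>]
 have "(\<integral>\<^sup>+t. ennreal (norm (window_transform h \<sigma> (t - \<gamma>))) \<partial>lborel) <= (\<integral>\<^sup>+t. ennreal ((4 / h) * (1 / (\<sigma>\<^sup>2 + (t - \<gamma>)\<^sup>2))) \<partial>lborel)"
  using window_transform_bound[OF h \<sigma>] by (intro nn_integral_mono ennreal_leI) simp
 also have "... = ennreal (LBINT t. (4 / h) * (1 / (\<sigma>\<^sup>2 + (t - \<gamma>)\<^sup>2)))"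
  using h by (intro nn_integral_eq_integral integrable_mult_right p(1) AE_I2 mult_nonneg_nonneg) auto
 also have "(LBINT t. (4 / h) * (1 / (\<sigma>\<^sup>2 + (t - \<gamma>)\<^sup>2))) = (4 / h) * (pi / \<sigma>)" by (simp only: integral_mult_right_zero p(2))
 also have "... <= 16 / (h * \<sigma>)" using h \<sigma> pi_less_4 by (simp add: field_simps)
 finally show ?thesis by (simp add: ennreal_leI)
qed

lemma integrable_mult_triangle:
 assumes "h > 0" and f: "integrable lborel f"
 shows "integrable lborel (%y. f y * complex_of_real (triangle h (y - b)))"
proof (rule Bochner_Integration.integrable_bound[OF f])
 have [measurable]: "f \<in> borel_measurable lborel" using f by simp
 show "(%y. f y * complex_of_real (triangle h (y - b))) \<in> borel_measurable lborel" by measurable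
 show "AE y in lborel. norm (f y * complex_of_real (triangle h (y - b))) <= norm (f y)"
  using triangle_bounds[of h] assms(1) by (intro AE_I2) (simp add: norm_mult mult_left_le)
qed

definition windowed :: "real => real => (nat => complex) => real => complex" where
 "windowed h \<sigma> c t = (LBINT y. step_function.F c y * exp (- Complex \<sigma> t * of_real y) * of_real (triangle h (y - 2 * h)))"

context character_zeros
begin

sublocale Psi: step_function "%n. mangoldt n * X n" 1
 using mangoldt_coeff by unfold_locales auto

sublocale PW: paley_wiener Psi.F "psi_transform X" 10 "3 / 5"
proof unfold_locales
 fix z :: complex assume z: "Re z > 3 / 5"
 then have "Re (1 / 2 + z) > 1" by simp
 from L_log_deriv[OF this] show "psi_transform X z = (LBINT y. Psi.F y * exp (- z * of_real y))"
  unfolding Psi.F_laplace[OF z] psi_transform_def log_deriv_half_def by simp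
qed (use Psi.F_neg Psi.F_bound Psi.F_cont psi_transform_holomorphic psi_transform_bound in auto)

lemma psi_square_integral:
 assumes \<sigma>: "0 < \<sigma>" "\<sigma> <= 1" and q3: "q >= 3"
 shows "(LBINT t. (norm (psi_transform X (Complex \<sigma> t)))\<^sup>2) <= square_const * (ln (real q))\<^sup>2 / \<sigma>"
proof -
 have "ennreal (LBINT t. (norm (psi_transform X (Complex \<sigma> t)))\<^sup>2) <= ennreal (square_const * (ln (real q))\<^sup>2 / \<sigma>)"
  using square_integral_bound[OF assms] by (subst nn_integral_eq_integral[symmetric]) (auto intro: PW.H_square_integrable[OF \<sigma>(1)])
 moreover have "square_const >= 0" unfolding square_const_def by (intro mult_nonneg_nonneg integral_nonneg_AE) auto
 ultimately show ?thesis using \<sigma> by (simp add: ennreal_le_iff)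
qed

section \<open>Zeros of height near 0 and the windowed sums\<close>

abbreviation (input) "Z \<equiv> G q X 0"
abbreviation (input) "mu \<equiv> m q X 0"
definition "D = C * conductor_log q 0"
definition "num = (\<Sum>\<gamma>\<in>Z. real (mu \<gamma>))"
text \<open>Minus the residue of \<open>psi_transform X\<close> at \<open>\<i> * \<gamma>\<close>;
  adding the corresponding polar terms in \<open>H0\<close> removes the poles at the zeros in
  \<open>Z\<close>.\<close>

definition "zcoeff \<gamma> = of_nat (mu \<gamma>) / Complex (1 / 2) \<gamma>"
definition "H0 \<sigma> \<tau> = psi_transform X (Complex \<sigma> \<tau>) + (\<Sum>\<gamma>\<in>Z. zcoeff \<gamma> / Complex \<sigma> (\<tau> - \<gamma>))"

lemma num: "0 <= num" "num <= D" and D0: "D > 0"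
 using zero_count_le[of 0] C conductor_log_le(2)[OF q] by (auto simp: num_def D_def intro!: sum_nonneg)

lemma norm_half: "norm (Complex (1 / 2) \<gamma>) >= 1 / 2"
 using abs_Re_le_cmod[of "Complex (1 / 2) \<gamma>"] by simp

lemma zcoeff_bound: "norm (zcoeff \<gamma>) <= 2 * real (mu \<gamma>)"
proof -
 have "norm (zcoeff \<gamma>) <= real (mu \<gamma>) / (1 / 2)"
  unfolding zcoeff_def norm_divide using norm_half[of \<gamma>] by (intro frac_le) auto
 then show ?thesis by simp
qed

text \<open>Partial fractions for 1 / ((z - i\<gamma>)(1/2 + z)): the poles at the zeros cancel, and
  only the harmless denominator 1/2 + z remains.\<close>

lemma H0_eq:
 assumes "0 < \<sigma>" "\<sigma> <= 1" "\<bar>\<tau>\<bar> <= 1"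
 shows "H0 \<sigma> \<tau> = ((\<Sum>\<gamma>\<in>Z. zcoeff \<gamma>) - h q X 0 (Complex \<sigma> \<tau>)) / (1 / 2 + Complex \<sigma> \<tau>)"
proof -
 let ?z = "Complex \<sigma> \<tau>"
 have zb: "?z \<in> ball (center 0) (14 / 5)" using near_center[of ?z 0] assms by simp
 have w: "1 / 2 + ?z ~= 0" using assms by (simp add: complex_eq_iff)
 have pf: "of_nat (mu \<gamma>) / (?z - \<i> * of_real \<gamma>) / (1 / 2 + ?z) = zcoeff \<gamma> / Complex \<sigma> (\<tau> - \<gamma>) - zcoeff \<gamma> / (1 / 2 + ?z)" for \<gamma>
 proof -
  have c: "?z - \<i> * of_real \<gamma> = Complex \<sigma> (\<tau> - \<gamma>)" by (simp add: complex_eq_iff)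
  have s: "Complex \<sigma> (\<tau> - \<gamma>) + Complex (1 / 2) \<gamma> = 1 / 2 + ?z" by (simp add: complex_eq_iff)
  have nz: "Complex \<sigma> (\<tau> - \<gamma>) ~= 0" "Complex (1 / 2) \<gamma> ~= 0" using assms by (simp_all add: complex_eq_iff)
  have gen: "a / u / w = a / v / u - a / v / w" if "u + v = w" "u ~= 0" "v ~= 0" "w ~= 0" for a u v w :: complex
  proof -
   have "a / v / u - a / v / w = a * (w - u) / (v * (u * w))" using that(2-4) by (simp add: field_simps)
   also have "w - u = v" using that(1) by (simp add: algebra_simps)
   finally show ?thesis using that(2-4) by simp
  qed
  show ?thesis unfolding c zcoeff_def by (rule gen[OF s nz w])
 qed
 have "psi_transform X ?z = - ((\<Sum>\<gamma>\<in>Z. of_nat (mu \<gamma>) / (?z - \<i> * of_real \<gamma>) / (1 / 2 + ?z)) + h q X 0 ?z / (1 / 2 + ?z))"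
 proof -
  have "(\<Sum>\<gamma>\<in>Z. of_nat (mu \<gamma>) / (?z - \<i> * of_real \<gamma>) / (1 / 2 + ?z)) + h q X 0 ?z / (1 / 2 + ?z) = ((\<Sum>\<gamma>\<in>Z. of_nat (mu \<gamma>) / (?z - \<i> * of_real \<gamma>)) + h q X 0 ?z) / (1 / 2 + ?z)"
   by (simp only: sum_divide_distrib add_divide_distrib)
  also have "(\<Sum>\<gamma>\<in>Z. of_nat (mu \<gamma>) / (?z - \<i> * of_real \<gamma>)) + h q X 0 ?z = log_deriv_half X ?z"
   using expansion[OF zb] assms by simp
  finally show ?thesis by (simp only: psi_transform_def minus_divide_left)
 qed
 also have "... = - ((\<Sum>\<gamma>\<in>Z. zcoeff \<gamma> / Complex \<sigma> (\<tau> - \<gamma>)) - (\<Sum>\<gamma>\<in>Z. zcoeff \<gamma>) / (1 / 2 + ?z) + h q X 0 ?z / (1 / 2 + ?z))"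
  unfolding pf by (simp add: sum_subtractf sum_divide_distrib)
 finally show ?thesis unfolding H0_def by (simp add: diff_divide_distrib)
qed

lemma H0_bounds:
 assumes \<sigma>: "0 < \<sigma>" "\<sigma> <= 1" and t: "\<bar>\<tau>\<bar> <= 1" "\<bar>\<tau>'\<bar> <= 1"
 shows "norm (H0 \<sigma> \<tau>) <= 6 * D" "norm (H0 \<sigma> \<tau> - H0 \<sigma> \<tau>') <= 14 * D * \<bar>\<tau> - \<tau>'\<bar>"
proof -
 let ?B = "\<Sum>\<gamma>\<in>Z. zcoeff \<gamma>" and ?z = "Complex \<sigma> \<tau>" and ?z' = "Complex \<sigma> \<tau>'"
 have zb: "?z \<in> cball (center 0) (27 / 10)" "?z' \<in> cball (center 0) (27 / 10)"
  using near_center[of ?z 0] near_center[of ?z' 0] assms by auto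
 have w: "norm (1 / 2 + Complex \<sigma> x) >= 1 / 2" for x using abs_Re_le_cmod[of "1 / 2 + Complex \<sigma> x"] \<sigma> by simp
 have w0: "1 / 2 + Complex \<sigma> x ~= 0" for x using w[of x] by auto
 have B: "norm ?B <= 2 * D"
 proof -
  have "norm ?B <= (\<Sum>\<gamma>\<in>Z. 2 * real (mu \<gamma>))" by (rule sum_norm_le) (rule zcoeff_bound)
  also have "... = 2 * num" by (simp add: num_def sum_distrib_left)
  finally show ?thesis using num by linarith
 qed
 have N: "norm (?B - h q X 0 ?z) <= 3 * D"
  using norm_triangle_ineq4[of ?B "h q X 0 ?z"] B remainder_bound[OF zb(1)] by (simp add: D_def)
 have D3: "3 * D >= 0" using D0 by simp
 show "norm (H0 \<sigma> \<tau>) <= 6 * D"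
 proof -
  have "norm (H0 \<sigma> \<tau>) <= (3 * D) / (1 / 2)"
   unfolding H0_eq[OF \<sigma> t(1)] norm_divide by (rule frac_le[OF D3 N _ w]) simp
  then show ?thesis by simp
 qed
 have hl: "norm (h q X 0 ?z - h q X 0 ?z') <= D * norm (?z - ?z')"
 proof (rule field_differentiable_bound[OF convex_cball, where f' = "deriv (h q X 0)"])
  show "?z \<in> cball (center 0) (27 / 10)" "?z' \<in> cball (center 0) (27 / 10)" by fact+
  fix z assume z: "z \<in> cball (center 0) (27 / 10)"
  show "norm (deriv (h q X 0) z) <= D" using remainder_deriv_bound[OF z] by (simp add: D_def)
  have "z \<in> ball (center 0) (14 / 5)" using z by auto
  then have "(h q X 0 has_field_derivative deriv (h q X 0) z) (at z)"
   by (rule holomorphic_derivI[OF hol_remainder open_ball])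
  then show "(h q X 0 has_field_derivative deriv (h q X 0) z) (at z within cball (center 0) (27 / 10))"
   by (rule has_field_derivative_at_within)
 qed
 have zz: "?z - ?z' = \<i> * of_real (\<tau> - \<tau>')" by (simp add: complex_eq_iff)
 have dz: "norm (?z - ?z') = \<bar>\<tau> - \<tau>'\<bar>" unfolding zz norm_mult norm_of_real by simp
 have eq: "H0 \<sigma> \<tau> - H0 \<sigma> \<tau>' = (?B - h q X 0 ?z) * (?z' - ?z) / ((1 / 2 + ?z) * (1 / 2 + ?z')) + (h q X 0 ?z' - h q X 0 ?z) / (1 / 2 + ?z')"
 proof -
  have gen: "(b - u) / w - (b - u') / w' = (b - u) * (w' - w) / (w * w') + (u' - u) / w'" if "w ~= 0" "w' ~= 0" for b u u' w w' :: complex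
   using that by (simp add: field_simps)
  show ?thesis unfolding H0_eq[OF \<sigma> t(1)] H0_eq[OF \<sigma> t(2)] using gen[OF w0[of \<tau>] w0[of \<tau>'], of ?B "h q X 0 ?z" "h q X 0 ?z'"] by simp
 qed
 have "norm ((?B - h q X 0 ?z) * (?z' - ?z) / ((1 / 2 + ?z) * (1 / 2 + ?z'))) <= (3 * D * \<bar>\<tau> - \<tau>'\<bar>) / (1 / 2 * (1 / 2))"
  unfolding norm_divide norm_mult norm_minus_commute[of ?z' ?z] dz
  using D3 N w by (intro frac_le mult_mono mult_nonneg_nonneg) auto
 moreover have "norm ((h q X 0 ?z' - h q X 0 ?z) / (1 / 2 + ?z')) <= (D * \<bar>\<tau> - \<tau>'\<bar>) / (1 / 2)"
  unfolding norm_divide norm_minus_commute[of "h q X 0 ?z'"] using hl D0 w dz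
  by (intro frac_le) auto
 ultimately have n: "norm (H0 \<sigma> \<tau> - H0 \<sigma> \<tau>') <= 3 * D * \<bar>\<tau> - \<tau>'\<bar> / (1 / 2 * (1 / 2)) + D * \<bar>\<tau> - \<tau>'\<bar> / (1 / 2)"
  unfolding eq by (rule norm_triangle_mono)
 have e: "3 * D * x / (1 / 2 * (1 / 2)) + D * x / (1 / 2) = 14 * D * x" for x by simp
 show "norm (H0 \<sigma> \<tau> - H0 \<sigma> \<tau>') <= 14 * D * \<bar>\<tau> - \<tau>'\<bar>" by (rule n[unfolded e])
qed

text \<open>A majorant of the squared norm of \<open>H0\<close> at every height, including those
  outside the range of the local expansion, with integral of order (ln q)^2 / \<sigma>.\<close>

definition "Q \<sigma> \<tau> = 2 * (norm (psi_transform X (Complex \<sigma> \<tau>)))\<^sup>2 + 8 * num * (\<Sum>\<gamma>\<in>Z. real (mu \<gamma>) * (1 / (\<sigma>\<^sup>2 + (\<tau> - \<gamma>)\<^sup>2)))"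

lemma H0_square_le: "(norm (H0 \<sigma> \<tau>))\<^sup>2 <= Q \<sigma> \<tau>"
proof -
 let ?S = "\<Sum>\<gamma>\<in>Z. zcoeff \<gamma> / Complex \<sigma> (\<tau> - \<gamma>)"
 have "(norm ?S)\<^sup>2 = (norm (\<Sum>\<gamma>\<in>Z. of_real (real (mu \<gamma>)) * (1 / (Complex (1 / 2) \<gamma> * Complex \<sigma> (\<tau> - \<gamma>)))))\<^sup>2"
  by (simp add: zcoeff_def)
 also have "... <= num * (\<Sum>\<gamma>\<in>Z. real (mu \<gamma>) * (norm (1 / (Complex (1 / 2) \<gamma> * Complex \<sigma> (\<tau> - \<gamma>))))\<^sup>2)"
  unfolding num_def by (rule sum_weighted_square_le) simp
 also have "... <= num * (\<Sum>\<gamma>\<in>Z. real (mu \<gamma>) * (4 * (1 / (\<sigma>\<^sup>2 + (\<tau> - \<gamma>)\<^sup>2))))"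
 proof (intro mult_left_mono sum_mono num)
  fix \<gamma>
  have "(1 / 2)\<^sup>2 <= (norm (Complex (1 / 2) \<gamma>))\<^sup>2" by (rule power_mono[OF norm_half]) simp
  then have "(1 / norm (Complex (1 / 2) \<gamma>))\<^sup>2 <= 4" using norm_half[of \<gamma>] by (simp add: power_divide divide_le_eq power2_eq_square)
  then have "(1 / norm (Complex (1 / 2) \<gamma>))\<^sup>2 * (1 / (\<sigma>\<^sup>2 + (\<tau> - \<gamma>)\<^sup>2)) <= 4 * (1 / (\<sigma>\<^sup>2 + (\<tau> - \<gamma>)\<^sup>2))" by (rule mult_right_mono) simp
  then show "(norm (1 / (Complex (1 / 2) \<gamma> * Complex \<sigma> (\<tau> - \<gamma>))))\<^sup>2 <= 4 * (1 / (\<sigma>\<^sup>2 + (\<tau> - \<gamma>)\<^sup>2))"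
   by (simp add: norm_divide norm_mult power_divide power_mult_distrib cmod_power2[of "Complex \<sigma> (\<tau> - \<gamma>)"])
 qed simp
 also have "... = 4 * num * (\<Sum>\<gamma>\<in>Z. real (mu \<gamma>) * (1 / (\<sigma>\<^sup>2 + (\<tau> - \<gamma>)\<^sup>2)))"
  by (simp add: sum_distrib_left mult_ac)
 finally have S: "(norm ?S)\<^sup>2 <= 4 * num * (\<Sum>\<gamma>\<in>Z. real (mu \<gamma>) * (1 / (\<sigma>\<^sup>2 + (\<tau> - \<gamma>)\<^sup>2)))" .
 have "(norm (H0 \<sigma> \<tau>))\<^sup>2 <= (norm (psi_transform X (Complex \<sigma> \<tau>)) + norm ?S)\<^sup>2"
  unfolding H0_def by (intro power_mono norm_triangle_ineq) auto
 also have "... <= 2 * (norm (psi_transform X (Complex \<sigma> \<tau>)))\<^sup>2 + 2 * (norm ?S)\<^sup>2"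
  using sum_squares_bound[of "norm (psi_transform X (Complex \<sigma> \<tau>))" "norm ?S"] by (simp add: power2_sum)
 finally show ?thesis using S unfolding Q_def by linarith
qed

lemma Q_integral:
 assumes \<sigma>: "0 < \<sigma>" "\<sigma> <= 1" and q3: "q >= 3"
 shows "integrable lborel (Q \<sigma>)" "(LBINT \<tau>. Q \<sigma> \<tau>) <= 2 * square_const * (ln (real q))\<^sup>2 / \<sigma> + 32 * D\<^sup>2 / \<sigma>"
proof -
 have i1: "integrable lborel (%\<tau>. 2 * (norm (psi_transform X (Complex \<sigma> \<tau>)))\<^sup>2)"
  by (intro integrable_mult_right PW.H_square_integrable \<sigma>)
 have i2: "integrable lborel (%\<tau>. real (mu \<gamma>) * (1 / (\<sigma>\<^sup>2 + (\<tau> - \<gamma>)\<^sup>2)))" for \<gamma>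
  by (intro integrable_mult_right poisson_integral \<sigma>)
 have i3: "integrable lborel (%\<tau>. 8 * num * (\<Sum>\<gamma>\<in>Z. real (mu \<gamma>) * (1 / (\<sigma>\<^sup>2 + (\<tau> - \<gamma>)\<^sup>2))))"
  by (intro integrable_mult_right Bochner_Integration.integrable_sum i2)
 show "integrable lborel (Q \<sigma>)" unfolding Q_def by (intro Bochner_Integration.integrable_add i1 i3)
 have "(LBINT \<tau>. (\<Sum>\<gamma>\<in>Z. real (mu \<gamma>) * (1 / (\<sigma>\<^sup>2 + (\<tau> - \<gamma>)\<^sup>2)))) = num * (pi / \<sigma>)"
  unfolding num_def sum_distrib_right
  by (subst Bochner_Integration.integral_sum[OF i2]) (simp only: integral_mult_right_zero poisson_integral(2)[OF \<sigma>(1)])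
 then have "(LBINT \<tau>. Q \<sigma> \<tau>) = 2 * (LBINT \<tau>. (norm (psi_transform X (Complex \<sigma> \<tau>)))\<^sup>2) + 8 * num * (num * (pi / \<sigma>))"
  unfolding Q_def by (subst Bochner_Integration.integral_add[OF i1 i3]) (simp only: integral_mult_right_zero)
 also have "... <= 2 * (square_const * (ln (real q))\<^sup>2 / \<sigma>) + 8 * D * (D * (4 / \<sigma>))"
  using num D0 \<sigma> pi_less_4 psi_square_integral[OF assms] by (intro add_mono mult_mono mult_left_mono divide_right_mono mult_nonneg_nonneg) auto
 finally show "(LBINT \<tau>. Q \<sigma> \<tau>) <= 2 * square_const * (ln (real q))\<^sup>2 / \<sigma> + 32 * D\<^sup>2 / \<sigma>"
  by (simp add: power2_eq_square)
qed

text \<open>\<open>Psi.F\<close> plus the exponentials exp(i\<gamma>y) with weights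
  \<open>zcoeff \<gamma>\<close> has transform \<open>H0\<close>. The window is applied to this sum
  by \<open>window_convolution\<close>, and the exponentials are then taken off again.\<close>

lemma window_decomposition:
 assumes k: "k > 0" and \<sigma>: "\<sigma> > 0"
 shows "windowed k \<sigma> (%n. mangoldt n * X n) t =
  (LBINT u. fejer k u * cis (- u * (2 * k)) * H0 \<sigma> (t - u)) / (2 * pi) - (\<Sum>\<gamma>\<in>Z. zcoeff \<gamma> * window_transform k \<sigma> (t - \<gamma>))"
proof -
 let ?F = "%y. Psi.F y * exp (- Complex \<sigma> t * of_real y)"
 let ?e = "%\<gamma> y. indicator {0..} y *\<^sub>R exp (- Complex \<sigma> (t - \<gamma>) * of_real y)"
 have Fi: "integrable lborel ?F" using PW.laplace_integrable(1)[of "Complex \<sigma> t"] \<sigma> by simp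
 have ei: "integrable lborel (?e \<gamma>)" for \<gamma> using exp_tail_integral(1)[of "Complex \<sigma> (t - \<gamma>)" 0] \<sigma> by simp
 define f where "f y = ?F y + (\<Sum>\<gamma>\<in>Z. zcoeff \<gamma> * ?e \<gamma> y)" for y
 have fi: "integrable lborel f" unfolding f_def
  by (intro Bochner_Integration.integrable_add Bochner_Integration.integrable_sum integrable_mult_right Fi ei)
 have inner: "(LBINT y. f y * cis (u * y)) = H0 \<sigma> (t - u)" for u
 proof -
  have ex: "exp (- Complex \<sigma> a * of_real y) * cis (u * y) = exp (- Complex \<sigma> (a - u) * of_real y)" for a y
   unfolding cis_conv_exp exp_add[symmetric] by (rule arg_cong[of _ _ exp]) (simp add: complex_eq_iff algebra_simps)
  have "f y * cis (u * y) = Psi.F y * exp (- Complex \<sigma> (t - u) * of_real y) + (\<Sum>\<gamma>\<in>Z. zcoeff \<gamma> * (indicator {0..} y *\<^sub>R exp (- Complex \<sigma> (t - u - \<gamma>) * of_real y)))" for y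
   unfolding f_def distrib_right sum_distrib_right mult.assoc mult_scaleR_left ex
   by (simp add: cancel_ab_semigroup_add_class.diff_right_commute[of t _ u])
  moreover have "integrable lborel (%y. Psi.F y * exp (- Complex \<sigma> (t - u) * of_real y))"
   "(LBINT y. Psi.F y * exp (- Complex \<sigma> (t - u) * of_real y)) = psi_transform X (Complex \<sigma> (t - u))"
   using PW.laplace_integrable[of "Complex \<sigma> (t - u)"] \<sigma> by auto
  moreover have e': "integrable lborel (%y. zcoeff \<gamma> * (indicator {0..} y *\<^sub>R exp (- Complex \<sigma> (t - u - \<gamma>) * of_real y)))"
   "(LBINT y. zcoeff \<gamma> * (indicator {0..} y *\<^sub>R exp (- Complex \<sigma> (t - u - \<gamma>) * of_real y))) = zcoeff \<gamma> / Complex \<sigma> (t - u - \<gamma>)" for \<gamma>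
  proof -
   have s: "Re (Complex \<sigma> (t - u - \<gamma>)) > 0" using \<sigma> by simp
   show "integrable lborel (%y. zcoeff \<gamma> * (indicator {0..} y *\<^sub>R exp (- Complex \<sigma> (t - u - \<gamma>) * of_real y)))"
    by (intro integrable_mult_right exp_tail_integral(1)[OF s])
   show "(LBINT y. zcoeff \<gamma> * (indicator {0..} y *\<^sub>R exp (- Complex \<sigma> (t - u - \<gamma>) * of_real y))) = zcoeff \<gamma> / Complex \<sigma> (t - u - \<gamma>)"
    unfolding integral_mult_right_zero exp_tail_integral(2)[OF s] by simp
  qed
  ultimately show ?thesis unfolding H0_def
   by (simp only: Bochner_Integration.integral_add Bochner_Integration.integrable_sum Bochner_Integration.integral_sum)
 qed
 have Ti: "integrable lborel (%y. ?F y * of_real (triangle k (y - 2 * k)))" by (rule integrable_mult_triangle[OF k Fi])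
 have Te: "integrable lborel (%y. zcoeff \<gamma> * (?e \<gamma> y * of_real (triangle k (y - 2 * k))))" for \<gamma>
  by (intro integrable_mult_right integrable_mult_triangle[OF k ei])
 have "(LBINT y. f y * of_real (triangle k (y - 2 * k))) = (LBINT y. ?F y * of_real (triangle k (y - 2 * k)) + (\<Sum>\<gamma>\<in>Z. zcoeff \<gamma> * (?e \<gamma> y * of_real (triangle k (y - 2 * k)))))"
  unfolding f_def by (simp only: distrib_right sum_distrib_right mult.assoc)
 also have "... = windowed k \<sigma> (%n. mangoldt n * X n) t + (\<Sum>\<gamma>\<in>Z. zcoeff \<gamma> * window_transform k \<sigma> (t - \<gamma>))"
  unfolding Bochner_Integration.integral_add[OF Ti Bochner_Integration.integrable_sum[OF Te]] Bochner_Integration.integral_sum[OF Te] integral_mult_right_zero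
  by (simp add: windowed_def window_transform_def)
 finally show ?thesis using window_convolution[OF k fi, of "2 * k"] unfolding inner by (simp add: eq_diff_eq)
qed

text \<open>The modulated kernel has integral 0, since the window about \<open>2 * k\<close>
  vanishes at 0; hence \<open>H0 \<sigma> t\<close> may be subtracted. Close to u = 0 its Lipschitz
  bound is used, farther away the mean square in \<open>Q\<close>. \<open>\<delta>\<close> and
  \<open>\<mu>\<close> are the free parameters of the two arithmetic-geometric splittings.\<close>

lemma remainder_integral_bound:
 assumes k: "k > 0" and \<sigma>: "0 < \<sigma>" "\<sigma> <= 1" and q3: "q >= 3" and t: "\<bar>t\<bar> <= 1 / 4" and \<delta>: "\<delta> > 0" and \<mu>: "\<mu> > 0"
 shows "norm (LBINT u. fejer k u * cis (- u * (2 * k)) * H0 \<sigma> (t - u))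
  <= 168 * D * \<delta> + 42 * D / (k * \<delta>) + 3 / k * (16640 * \<mu> + (2 * square_const * (ln (real q))\<^sup>2 / \<sigma> + 32 * D\<^sup>2 / \<sigma>) / \<mu>) + 9360 * D / k"
proof -
 let ?E = "2 * square_const * (ln (real q))\<^sup>2 / \<sigma> + 32 * D\<^sup>2 / \<sigma>"
 let ?K = "%u. fejer k u * cis (- u * (2 * k))"
 let ?p = "%u::real. 1 / (1\<^sup>2 + (u - 0)\<^sup>2)"
 note p = poisson_integral[of 1 0, simplified div_by_1, OF zero_less_one]
 have Ki: "integrable lborel ?K" using fourier_integrable[OF fejer_integrable(1)[OF k], of "- (2 * k)"] by (simp add: mult.commute)
 have K0: "(LBINT u. ?K u) = 0"
  using fejer_inversion[OF k, of "- (2 * k)"] triangle_eq_0[OF k, of "- (2 * k)"] k by simp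
 define M where "M u = 7 * D * \<delta> * norm (fejer k u) + 42 * D / (k * \<delta>) * indicator {-(1/8)..1/8} u + 3 / k * (4160 * \<mu> * ?p u + Q \<sigma> (t - u) / \<mu>) + 2340 * D / k * ?p u" for u
 have Qi: "integrable lborel (%u. Q \<sigma> (t - u))" "(LBINT u. Q \<sigma> (t - u)) = (LBINT \<tau>. Q \<sigma> \<tau>)"
  using lborel_integrable_real_affine[OF Q_integral(1)[OF \<sigma> q3], of "-1" t] lborel_integral_real_affine[of "-1" "Q \<sigma>" t] by auto
 have Q0: "Q \<sigma> x >= 0" for x using H0_square_le[of \<sigma> x] by (rule order_trans[rotated]) simp
 have i1: "integrable lborel (%u. 7 * D * \<delta> * norm (fejer k u))" by (intro integrable_mult_right integrable_norm fejer_integrable k)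
 have i2: "integrable lborel (%u::real. 42 * D / (k * \<delta>) * indicator {-(1/8)..1/8} u :: real)" by (intro integrable_mult_right) simp
 have i3: "integrable lborel (%u. 4160 * \<mu> * ?p u)" "integrable lborel (%u. 2340 * D / k * ?p u)" by (intro integrable_mult_right p(1))+
 have i4: "integrable lborel (%u. Q \<sigma> (t - u) / \<mu>)" using Qi(1) by simp
 have i5: "integrable lborel (%u. 3 / k * (4160 * \<mu> * ?p u + Q \<sigma> (t - u) / \<mu>))" by (intro integrable_mult_right Bochner_Integration.integrable_add i3 i4)
 have Mi: "integrable lborel M" unfolding M_def by (intro Bochner_Integration.integrable_add i1 i2 i5 i3(2))
 have MI: "(LBINT u. M u) = 7 * D * \<delta> * (LBINT u. norm (fejer k u)) + 42 * D / (k * \<delta>) * (1 / 4) + 3 / k * (4160 * \<mu> * pi + (LBINT \<tau>. Q \<sigma> \<tau>) / \<mu>) + 2340 * D / k * pi"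
  unfolding M_def
  by (subst Bochner_Integration.integral_add, intro Bochner_Integration.integrable_add i1 i2 i5, rule i3,
    subst Bochner_Integration.integral_add, intro Bochner_Integration.integrable_add i1 i2, rule i5,
    subst Bochner_Integration.integral_add[OF i1 i2],
    subst integral_mult_right_zero[where c = "3 / k"], subst Bochner_Integration.integral_add[OF i3(1) i4])
    (simp only: integral_mult_right_zero p(2) Bochner_Integration.integral_divide_zero Qi(2), simp)
 \<comment> \<open>For |u| <= 1/8 and |t| <= 1/4 the height t - u is in the range of
   \<open>H0_bounds\<close>. For larger |u| one has 1 / u^2 <= 65 / (1 + u^2) and 1 / u^2 <= 64,
   whose product gives 4160.\<close>
 have pt: "norm (?K u * (H0 \<sigma> (t - u) - H0 \<sigma> t)) <= M u" for u
 proof (cases "\<bar>u\<bar> <= 1 / 8")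
  case True
  let ?n = "norm (fejer k u)"
  have "\<bar>t - u\<bar> <= 1" "\<bar>t\<bar> <= 1" using True t by (auto simp: abs_if split: if_splits)
  from H0_bounds(2)[OF \<sigma> this] have l: "norm (H0 \<sigma> (t - u) - H0 \<sigma> t) <= 14 * D * \<bar>u\<bar>" by simp
  have k2: "?n * u\<^sup>2 <= 6 / k"
  proof (cases "u = 0")
   case False
   then show ?thesis using fejer_tail[OF k False] by (simp add: pos_le_divide_eq field_simps k)
  qed (use k in simp)
  have am: "\<bar>u\<bar> <= \<delta> / 2 + u\<^sup>2 / (2 * \<delta>)"
  proof -
   have "0 <= (\<bar>u\<bar> - \<delta>)\<^sup>2" by simp
   then show ?thesis using \<delta> by (simp add: field_simps power2_eq_square)
  qed
  have "norm (?K u * (H0 \<sigma> (t - u) - H0 \<sigma> t)) <= ?n * (14 * D * (\<delta> / 2 + u\<^sup>2 / (2 * \<delta>)))"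
   unfolding norm_mult norm_cis mult_1_right using l am D0 by (intro mult_left_mono) (auto intro: order_trans)
  also have "... = 7 * D * \<delta> * ?n + 7 * D / \<delta> * (?n * u\<^sup>2)" using \<delta> by (simp add: field_simps)
  also have "7 * D / \<delta> * (?n * u\<^sup>2) <= 7 * D / \<delta> * (6 / k)" using D0 \<delta> by (intro mult_left_mono k2) auto
  also have "... = 42 * D / (k * \<delta>) * indicator {-(1/8)..1/8} u" using True by (auto simp: indicator_def abs_le_iff)
  finally have "norm (?K u * (H0 \<sigma> (t - u) - H0 \<sigma> t)) <= 7 * D * \<delta> * ?n + 42 * D / (k * \<delta>) * indicator {-(1/8)..1/8} u" by simp
  moreover have "0 <= 3 / k * (4160 * \<mu> * ?p u + Q \<sigma> (t - u) / \<mu>)" "0 <= 2340 * D / k * ?p u"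
   using k \<mu> D0 Q0 by (auto intro!: mult_nonneg_nonneg divide_nonneg_nonneg add_nonneg_nonneg)
  ultimately show ?thesis unfolding M_def by linarith
 next
  case False
  let ?H = "norm (H0 \<sigma> (t - u))"
  have u: "u ~= 0" "\<bar>u\<bar> >= 1 / 8" using False by auto
  have u2: "u\<^sup>2 >= 1 / 64" using power_mono[OF u(2), of 2] by (simp add: power_divide)
  have iu: "1 / u\<^sup>2 <= 65 * ?p u"
  proof -
   have "1 + u\<^sup>2 <= 65 * u\<^sup>2" using u2 by simp
   then show ?thesis using u by (simp add: divide_le_eq le_divide_eq add_pos_nonneg)
  qed
  have iu2: "1 / u\<^sup>2 <= 64" using u2 u(1) by (simp add: divide_le_eq)
  have iu4: "1 / u\<^sup>2 * (1 / u\<^sup>2) <= 4160 * ?p u"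
  proof -
   have "1 / u\<^sup>2 * (1 / u\<^sup>2) <= 64 * (65 * ?p u)" by (intro mult_mono iu iu2) auto
   then show ?thesis by simp
  qed
  have "norm (H0 \<sigma> (t - u) - H0 \<sigma> t) <= ?H + 6 * D"
   using norm_triangle_ineq4[of "H0 \<sigma> (t - u)" "H0 \<sigma> t"] H0_bounds(1)[OF \<sigma>, of t t] t by linarith
  then have "norm (?K u * (H0 \<sigma> (t - u) - H0 \<sigma> t)) <= 6 / (k * u\<^sup>2) * (?H + 6 * D)"
   unfolding norm_mult norm_cis mult_1_right using fejer_tail[OF k u(1)] D0 k by (intro mult_mono) auto
  also have "... = 6 / k * ((1 / u\<^sup>2) * ?H) + 36 * D / k * (1 / u\<^sup>2)" using k u by (simp add: field_simps)
  also have "... <= 6 / k * ((\<mu> * (4160 * ?p u) + Q \<sigma> (t - u) / \<mu>) / 2) + 36 * D / k * (65 * ?p u)"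
  proof (intro add_mono mult_left_mono iu)
   have am: "x * y <= (\<mu> * (x * x) + y\<^sup>2 / \<mu>) / 2" for x y
   proof -
    have "0 <= (\<mu> * x - y)\<^sup>2" by simp
    then show ?thesis using \<mu> by (simp add: field_simps power2_eq_square)
   qed
   have "(1 / u\<^sup>2) * ?H <= (\<mu> * (1 / u\<^sup>2 * (1 / u\<^sup>2)) + ?H\<^sup>2 / \<mu>) / 2" by (rule am)
   also have "... <= (\<mu> * (4160 * ?p u) + Q \<sigma> (t - u) / \<mu>) / 2"
    using iu4 \<mu> H0_square_le by (intro divide_right_mono add_mono mult_left_mono) auto
   finally show "(1 / u\<^sup>2) * ?H <= (\<mu> * (4160 * ?p u) + Q \<sigma> (t - u) / \<mu>) / 2" .
  qed (use D0 k in auto)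
  also have "... = 3 / k * (4160 * \<mu> * ?p u + Q \<sigma> (t - u) / \<mu>) + 2340 * D / k * ?p u" using k \<mu> by (simp add: field_simps)
  also have "... <= M u" unfolding M_def using D0 \<delta> k by simp
  finally show ?thesis .
 qed
 have H0m: "(%u. H0 \<sigma> (t - u)) \<in> borel_measurable lborel"
 proof -
  have "(%t. psi_transform X (0 + of_real \<sigma> + \<i> * of_real t)) \<in> borel_measurable lborel" using PW.H_measurable[of "of_real \<sigma>"] \<sigma> by simp
  then have [measurable]: "(%t. psi_transform X (of_real \<sigma> + \<i> * of_real t)) \<in> borel_measurable borel" by simp
  have "H0 \<sigma> \<in> borel_measurable borel" unfolding H0_def[abs_def] Complex_eq by measurable
  then show ?thesis by (simp add: measurable_compose[where f = "%u. t - u"])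
 qed
 have [measurable]: "?K \<in> borel_measurable lborel" using Ki by simp
 have di: "integrable lborel (%u. ?K u * (H0 \<sigma> (t - u) - H0 \<sigma> t))"
 proof (rule Bochner_Integration.integrable_bound[OF Mi])
  show "(%u. ?K u * (H0 \<sigma> (t - u) - H0 \<sigma> t)) \<in> borel_measurable lborel" using H0m by measurable
  show "AE u in lborel. norm (?K u * (H0 \<sigma> (t - u) - H0 \<sigma> t)) <= norm (M u)"
   by (rule AE_I2, rule order_trans[OF pt]) (unfold real_norm_def, rule abs_ge_self)
 qed
 have ci: "integrable lborel (%u. ?K u * H0 \<sigma> t)" by (rule integrable_mult_left) (rule Ki)
 have "(LBINT u. ?K u * H0 \<sigma> (t - u)) = (LBINT u. ?K u * (H0 \<sigma> (t - u) - H0 \<sigma> t) + ?K u * H0 \<sigma> t)"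
  by (simp only: right_diff_distrib diff_add_cancel)
 also have "... = (LBINT u. ?K u * (H0 \<sigma> (t - u) - H0 \<sigma> t)) + (LBINT u. ?K u * H0 \<sigma> t)" by (rule Bochner_Integration.integral_add[OF di ci])
 also have "(LBINT u. ?K u * H0 \<sigma> t) = 0" by (simp only: integral_mult_left_zero K0 mult_zero_left)
 finally have "norm (LBINT u. ?K u * H0 \<sigma> (t - u)) = norm (LBINT u. ?K u * (H0 \<sigma> (t - u) - H0 \<sigma> t))" by simp
 also have "... <= (LBINT u. norm (?K u * (H0 \<sigma> (t - u) - H0 \<sigma> t)))" by (rule integral_norm_bound)
 also have "... <= (LBINT u. M u)" by (rule integral_mono[OF integrable_norm[OF di] Mi pt])
 also have "... <= 7 * D * \<delta> * 24 + 42 * D / (k * \<delta>) * 1 + 3 / k * (4160 * \<mu> * 4 + ?E / \<mu>) + 2340 * D / k * 4"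
  unfolding MI using D0 \<delta> k \<mu> pi_less_4 fejer_integrable(2)[OF k] Q_integral(2)[OF \<sigma> q3]
  by (intro add_mono mult_left_mono divide_right_mono) auto
 finally show ?thesis by (simp add: algebra_simps)
qed

definition "window_const = 2000000 * C + 24 * (16640 + 2 * square_const + 3872 * C\<^sup>2)"

text \<open>In terms of n the window reaches from q^(1/8) to q^(3/8). With \<sigma> = 1 / l the
  product \<open>k * \<sigma>\<close> is 1/8, so a zero of height at most 1 contributes at most 2 *
  128. The choices \<delta> = 1 / sqrt l and \<mu> = l sqrt l bring every remainder term down to
  order sqrt l, below the expected main term of order l.\<close>

lemma windowed_integral_bound:
 assumes q3: "q >= 3"
 defines "l \<equiv> ln (real q)"
 shows "(\<integral>\<^sup>+t. ennreal (norm (windowed (l / 8) (1 / l) (%n. mangoldt n * X n) t)) * indicator {-(1/4)..1/4} t \<partial>lborel)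
  <= ennreal (256 * (\<Sum>\<gamma>\<in>{\<gamma>\<in>Z. \<bar>\<gamma>\<bar> <= 1}. real (mu \<gamma>)) + window_const * sqrt l)"
proof -
 define k where "k = l / 8"
 define \<sigma> where "\<sigma> = 1 / l"
 have l: "l >= 1" unfolding l_def by (rule conductor_log_le'(2)[OF q3])
 have k: "k > 0" using l by (simp add: k_def)
 have \<sigma>: "0 < \<sigma>" "\<sigma> <= 1" using l by (auto simp: \<sigma>_def)
 have k\<sigma>: "k * \<sigma> = 1 / 8" using l by (simp add: k_def \<sigma>_def)
 define s where "s = sqrt l"
 have s: "s >= 1" "l = s * s" using l by (auto simp: s_def)
 have D: "D <= 11 * C * l" using conductor_log_le'(1)[OF q3, of 0] C by (simp add: D_def l_def)
 have sc0: "square_const >= 0" unfolding square_const_def by (intro mult_nonneg_nonneg integral_nonneg_AE) auto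
 let ?Z1 = "{\<gamma>\<in>Z. \<bar>\<gamma>\<bar> <= 1}" and ?Z2 = "{\<gamma>\<in>Z. \<not> \<bar>\<gamma>\<bar> <= 1}"
 have fin: "finite Z" by (rule finite_zeros)
 define R where "R = 168 * D * (1 / s) + 42 * D / (k * (1 / s)) + 3 / k * (16640 * (l * s) + (2 * square_const * l\<^sup>2 / \<sigma> + 32 * D\<^sup>2 / \<sigma>) / (l * s)) + 9360 * D / k"
 have R: "R + 128 * D / l <= window_const * s"
 proof -
  have 1: "168 * D * (1 / s) <= 1848 * C * s"
  proof -
   have "168 * D * (1 / s) <= 168 * (11 * C * l) * (1 / s)" using D s by (intro mult_right_mono mult_left_mono) auto
   also have "... = 1848 * C * s" using s by simp
   finally show ?thesis .
  qed
  have 2: "42 * D / (k * (1 / s)) <= 3696 * C * s"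
  proof -
   have "42 * D / (k * (1 / s)) <= 42 * (11 * C * l) / (k * (1 / s))" using D s k by (intro divide_right_mono mult_left_mono) auto
   also have "... = 3696 * C * s" using s l by (simp add: k_def)
   finally show ?thesis .
  qed
  have 3: "3 / k * (16640 * (l * s) + (2 * square_const * l\<^sup>2 / \<sigma> + 32 * D\<^sup>2 / \<sigma>) / (l * s)) <= 24 * (16640 + 2 * square_const + 3872 * C\<^sup>2) * s"
  proof -
   have "D\<^sup>2 <= (11 * C * l)\<^sup>2" using D D0 by (intro power_mono) auto
   then have "3 / k * (16640 * (l * s) + (2 * square_const * l\<^sup>2 / \<sigma> + 32 * D\<^sup>2 / \<sigma>) / (l * s)) <= 3 / k * (16640 * (l * s) + (2 * square_const * l\<^sup>2 / \<sigma> + 32 * (11 * C * l)\<^sup>2 / \<sigma>) / (l * s))"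
    using k \<sigma> s l by (intro mult_left_mono add_left_mono divide_right_mono) auto
   also have "... = 24 * (16640 + 2 * square_const + 3872 * C\<^sup>2) * s"
   proof -
    have nz: "s ~= 0" using s by simp
    show ?thesis unfolding k_def \<sigma>_def s(2) using nz by (simp add: field_simps power2_eq_square)
   qed
   finally show ?thesis .
  qed
  have 4: "9360 * D / k + 128 * D / l <= 900000 * C * s"
  proof -
   have "9360 * D / k + 128 * D / l = 75008 * (D / l)" using l by (simp add: k_def)
   also have "D / l <= 11 * C" using D l by (simp add: divide_le_eq mult.commute)
   also have "75008 * (11 * C) <= 900000 * C * 1" using C by simp
   also have "... <= 900000 * C * s" using C s by (intro mult_left_mono) auto
   finally show ?thesis by simp
  qed
  have "1848 * C * s + 3696 * C * s + 900000 * C * s <= 2000000 * C * s" using C s by (simp add: mult_right_mono)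
  then show ?thesis using 1 2 3 4 unfolding R_def window_const_def distrib_right by linarith
 qed
 have pt: "norm (windowed k \<sigma> (%n. mangoldt n * X n) t) <= (\<Sum>\<gamma>\<in>?Z1. 2 * real (mu \<gamma>) * norm (window_transform k \<sigma> (t - \<gamma>))) + window_const * s" if t: "\<bar>t\<bar> <= 1 / 4" for t
 proof -
  let ?I = "(LBINT u. fejer k u * cis (- u * (2 * k)) * H0 \<sigma> (t - u))"
  have I: "norm (?I / (2 * pi)) <= R"
  proof -
   have s0: "1 / s > 0" "l * s > 0" using s l by auto
   have "norm (?I / (2 * pi)) <= norm ?I"
    using pi_gt3 by (simp add: norm_divide norm_mult divide_le_eq mult_right_le_one_le mult_le_cancel_left1)
   also have "... <= R" unfolding R_def using remainder_integral_bound[OF k \<sigma> q3 t s0] by (simp only: l_def)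
   finally show ?thesis .
  qed
  \<comment> \<open>Zeros above height 1 are at distance at least 3/4 from \<open>t\<close>. Each
    gives O(1 / l) and there are O(l) of them, so together they are bounded.\<close>
  have far: "norm (zcoeff \<gamma> * window_transform k \<sigma> (t - \<gamma>)) <= real (mu \<gamma>) * (128 / l)" if "\<gamma> \<in> ?Z2" for \<gamma>
  proof -
   have "\<bar>\<gamma>\<bar> <= \<bar>t - \<gamma>\<bar> + \<bar>t\<bar>" "\<bar>\<gamma>\<bar> > 1" using that by auto
   then have "\<bar>t - \<gamma>\<bar> >= 3 / 4" using t by linarith
   then have "(3 / 4)\<^sup>2 <= \<bar>t - \<gamma>\<bar>\<^sup>2" by (intro power_mono) auto
   then have "1 / 2 <= \<sigma>\<^sup>2 + (t - \<gamma> - 0)\<^sup>2" by (simp add: power2_eq_square add_increasing)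
   then have "1 / (\<sigma>\<^sup>2 + (t - \<gamma> - 0)\<^sup>2) <= 1 / (1 / 2)" by (intro divide_left_mono mult_pos_pos) auto
   then have "(4 / k) * (1 / (\<sigma>\<^sup>2 + (t - \<gamma> - 0)\<^sup>2)) <= (4 / k) * (1 / (1 / 2))" using k by (intro mult_left_mono) auto
   also have "... = 64 / l" using l by (simp add: k_def)
   finally have "norm (window_transform k \<sigma> (t - \<gamma>)) <= 64 / l" using window_transform_bound[OF k \<sigma>(1), of "t - \<gamma>"] by linarith
   then have "norm (zcoeff \<gamma> * window_transform k \<sigma> (t - \<gamma>)) <= (2 * real (mu \<gamma>)) * (64 / l)"
    unfolding norm_mult using zcoeff_bound[of \<gamma>] by (intro mult_mono) auto
   then show ?thesis by (simp add: mult_ac)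
  qed
  have eq: "(\<Sum>\<gamma>\<in>Z. zcoeff \<gamma> * window_transform k \<sigma> (t - \<gamma>)) = (\<Sum>\<gamma>\<in>?Z1. zcoeff \<gamma> * window_transform k \<sigma> (t - \<gamma>)) + (\<Sum>\<gamma>\<in>?Z2. zcoeff \<gamma> * window_transform k \<sigma> (t - \<gamma>))"
   using fin by (subst sum.union_disjoint[symmetric]) (auto intro!: sum.cong)
  have n1: "norm (\<Sum>\<gamma>\<in>?Z1. zcoeff \<gamma> * window_transform k \<sigma> (t - \<gamma>)) <= (\<Sum>\<gamma>\<in>?Z1. 2 * real (mu \<gamma>) * norm (window_transform k \<sigma> (t - \<gamma>)))"
   by (rule sum_norm_le) (unfold norm_mult, intro mult_right_mono zcoeff_bound norm_ge_zero)
  have n2: "norm (\<Sum>\<gamma>\<in>?Z2. zcoeff \<gamma> * window_transform k \<sigma> (t - \<gamma>)) <= 128 * D / l"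
  proof -
   have "norm (\<Sum>\<gamma>\<in>?Z2. zcoeff \<gamma> * window_transform k \<sigma> (t - \<gamma>)) <= (\<Sum>\<gamma>\<in>?Z2. real (mu \<gamma>) * (128 / l))"
    by (rule sum_norm_le) (rule far)
   also have "... = (\<Sum>\<gamma>\<in>?Z2. real (mu \<gamma>)) * (128 / l)" by (rule sum_distrib_right[symmetric])
   also have "... <= num * (128 / l)"
    unfolding num_def using fin l by (intro mult_right_mono sum_mono2) auto
   also have "... <= D * (128 / l)" using num l by (intro mult_right_mono) auto
   finally show ?thesis by (simp add: mult.commute)
  qed
  have "norm (\<Sum>\<gamma>\<in>Z. zcoeff \<gamma> * window_transform k \<sigma> (t - \<gamma>)) <= (\<Sum>\<gamma>\<in>?Z1. 2 * real (mu \<gamma>) * norm (window_transform k \<sigma> (t - \<gamma>))) + 128 * D / l"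
   unfolding eq by (rule norm_triangle_mono[OF n1 n2])
  then show ?thesis unfolding window_decomposition[OF k \<sigma>(1)] using I R norm_triangle_ineq4[of "?I / (2 * pi)" "\<Sum>\<gamma>\<in>Z. zcoeff \<gamma> * window_transform k \<sigma> (t - \<gamma>)"] by linarith
 qed
 have wc: "window_const >= 0" unfolding window_const_def using C sc0 by (intro add_nonneg_nonneg mult_nonneg_nonneg) auto
 have [measurable]: "(%t. window_transform k \<sigma> (t - \<gamma>)) \<in> borel_measurable borel" for \<gamma>
  unfolding window_transform_def Complex_eq by measurable
 have "(\<integral>\<^sup>+t. ennreal (norm (windowed k \<sigma> (%n. mangoldt n * X n) t)) * indicator {-(1/4)..1/4} t \<partial>lborel)
   <= (\<integral>\<^sup>+t. (\<Sum>\<gamma>\<in>?Z1. ennreal (2 * real (mu \<gamma>)) * ennreal (norm (window_transform k \<sigma> (t - \<gamma>)))) + ennreal (window_const * s) * indicator {-(1/4)..1/4} t \<partial>lborel)"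
 proof (intro nn_integral_mono)
  fix t :: real
  have e: "(\<Sum>\<gamma>\<in>?Z1. ennreal (2 * real (mu \<gamma>)) * ennreal (norm (window_transform k \<sigma> (t - \<gamma>)))) = ennreal (\<Sum>\<gamma>\<in>?Z1. 2 * real (mu \<gamma>) * norm (window_transform k \<sigma> (t - \<gamma>)))"
  proof -
   have "(\<Sum>\<gamma>\<in>?Z1. ennreal (2 * real (mu \<gamma>)) * ennreal (norm (window_transform k \<sigma> (t - \<gamma>)))) = (\<Sum>\<gamma>\<in>?Z1. ennreal (2 * real (mu \<gamma>) * norm (window_transform k \<sigma> (t - \<gamma>))))"
    by (rule sum.cong[OF refl]) (rule ennreal_mult[symmetric], simp_all)
   also have "... = ennreal (\<Sum>\<gamma>\<in>?Z1. 2 * real (mu \<gamma>) * norm (window_transform k \<sigma> (t - \<gamma>)))"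
    by (rule sum_ennreal) simp
   finally show ?thesis .
  qed
  show "ennreal (norm (windowed k \<sigma> (%n. mangoldt n * X n) t)) * indicator {-(1/4)..1/4} t
   <= (\<Sum>\<gamma>\<in>?Z1. ennreal (2 * real (mu \<gamma>)) * ennreal (norm (window_transform k \<sigma> (t - \<gamma>)))) + ennreal (window_const * s) * indicator {-(1/4)..1/4} t"
  proof (cases "t \<in> {-(1/4)..1/4}")
   case True
   then have "\<bar>t\<bar> <= 1 / 4" unfolding atLeastAtMost_iff by linarith
   from ennreal_leI[OF pt[OF this]] True show ?thesis unfolding e
    using wc s by (subst (asm) ennreal_plus) (auto intro!: sum_nonneg)
  qed simp
 qed
 also have "... = (\<Sum>\<gamma>\<in>?Z1. ennreal (2 * real (mu \<gamma>)) * (\<integral>\<^sup>+t. ennreal (norm (window_transform k \<sigma> (t - \<gamma>))) \<partial>lborel)) + ennreal (window_const * s) * ennreal (1 / 2)"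
  by (subst nn_integral_add) (auto simp: nn_integral_sum nn_integral_cmult nn_integral_cmult_indicator)
 also have "... <= (\<Sum>\<gamma>\<in>?Z1. ennreal (2 * real (mu \<gamma>)) * ennreal 128) + ennreal (window_const * s) * 1"
 proof (intro add_mono sum_mono mult_left_mono)
  show "(\<integral>\<^sup>+t. ennreal (norm (window_transform k \<sigma> (t - \<gamma>))) \<partial>lborel) <= ennreal 128" for \<gamma>
   using window_transform_integral[OF k \<sigma>(1), of \<gamma>] by (simp add: k\<sigma>)
  show "ennreal (1 / 2) <= 1" unfolding ennreal_1[symmetric] by (rule ennreal_leI) simp
 qed auto
 also have "... = ennreal ((\<Sum>\<gamma>\<in>?Z1. 2 * real (mu \<gamma>) * 128) + window_const * s)"
 proof -
  have "(\<Sum>\<gamma>\<in>?Z1. ennreal (2 * real (mu \<gamma>)) * ennreal 128) = (\<Sum>\<gamma>\<in>?Z1. ennreal (2 * real (mu \<gamma>) * 128))"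
   by (rule sum.cong[OF refl]) (rule ennreal_mult[symmetric], simp_all)
  also have "... = ennreal (\<Sum>\<gamma>\<in>?Z1. 2 * real (mu \<gamma>) * 128)" by (rule sum_ennreal) simp
  finally have e: "(\<Sum>\<gamma>\<in>?Z1. ennreal (2 * real (mu \<gamma>)) * ennreal 128) = ennreal (\<Sum>\<gamma>\<in>?Z1. 2 * real (mu \<gamma>) * 128)" .
  show ?thesis unfolding e mult_1_right using wc s by (intro ennreal_plus[symmetric] sum_nonneg) auto
 qed
 also have "(\<Sum>\<gamma>\<in>?Z1. 2 * real (mu \<gamma>) * 128) = 256 * (\<Sum>\<gamma>\<in>?Z1. real (mu \<gamma>))" by (simp add: sum_distrib_left mult_ac)
 finally show ?thesis by (simp add: k_def \<sigma>_def s_def)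
qed

end

section \<open>Moments over characters\<close>

definition window_coeff :: "real => real => real => nat => complex" where
 "window_coeff h \<sigma> t n = (LBINT y. indicator {ln (real n)..} y *\<^sub>R exp (- Complex (1 / 2 + \<sigma>) t * of_real y) * of_real (triangle h (y - 2 * h)))"

text \<open>The window ends at 3h, which leaves the integers up to exp(3h), and each enters the
  integral from y = ln n on.\<close>

lemma windowed_eq_sum:
 assumes c: "step_function c B" and h: "h > 0" and \<sigma>: "\<sigma> > 0"
 shows "windowed h \<sigma> c t = (\<Sum>n\<in>{1..nat \<lfloor>exp (3 * h)\<rfloor>}. c n * window_coeff h \<sigma> t n)"
proof -
 let ?N = "nat \<lfloor>exp (3 * h)\<rfloor>"
 let ?w = "%y. complex_of_real (triangle h (y - 2 * h))"
 let ?e = "%n y. indicator {ln (real n)..} y *\<^sub>R exp (- Complex (1 / 2 + \<sigma>) t * of_real y)"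
 have i: "integrable lborel (%y. c n * (?e n y * ?w y))" for n
  by (intro integrable_mult_right integrable_mult_triangle[OF h] exp_tail_integral(1)) (use \<sigma> in simp)
 have F_eq: "step_function.F c y = step_sum c y * of_real (exp (- y / 2))" for y
  by (rule step_function.F_def[OF c])
 have pt: "step_function.F c y * exp (- Complex \<sigma> t * of_real y) * ?w y = (\<Sum>n\<in>{1..?N}. c n * (?e n y * ?w y))" for y
 proof (cases "\<bar>y - 2 * h\<bar> >= h")
  case True
  then show ?thesis using triangle_eq_0[OF h True] by simp
 next
  case False
  then have y: "exp y <= exp (3 * h)" by (simp add: abs_if split: if_splits)
  let ?M = "nat \<lfloor>exp y\<rfloor>"
  have MN: "?M <= ?N" by (rule nat_mono) (rule floor_mono[OF y])
  have ex: "of_real (exp (- y / 2)) * exp (- Complex \<sigma> t * of_real y) = exp (- Complex (1 / 2 + \<sigma>) t * of_real y)"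
   unfolding exp_of_real[symmetric] exp_add[symmetric] by (rule arg_cong[of _ _ exp]) (simp add: complex_eq_iff algebra_simps)
  have ind: "n <= ?M \<longleftrightarrow> ln (real n) <= y" if "n >= 1" for n
  proof -
   have "n <= ?M \<longleftrightarrow> real n <= exp y" by (simp add: le_nat_iff le_floor_iff)
   also have "... \<longleftrightarrow> ln (real n) <= ln (exp y)" using that by (subst ln_le_cancel_iff) auto
   finally show ?thesis by simp
  qed
  have "(\<Sum>n\<in>{1..?N}. c n * (?e n y * ?w y)) = (\<Sum>n\<in>{1..?M}. c n * (?e n y * ?w y))"
   using MN ind by (intro sum.mono_neutral_right) auto
  also have "... = (\<Sum>n\<in>{1..?M}. c n * (exp (- Complex (1 / 2 + \<sigma>) t * of_real y) * ?w y))"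
   using ind by (intro sum.cong[OF refl]) auto
  also have "... = (\<Sum>n\<in>{1..?M}. c n) * (of_real (exp (- y / 2)) * exp (- Complex \<sigma> t * of_real y) * ?w y)"
   unfolding ex by (simp add: sum_distrib_right)
  finally show ?thesis unfolding F_eq step_sum_def step_sum_set by (simp only: mult.assoc)
 qed
 show ?thesis unfolding windowed_def pt window_coeff_def
  by (subst Bochner_Integration.integral_sum[OF i]) (simp only: integral_mult_right_zero)
qed

lemma sum_Un_le_nonneg:
 fixes f :: "'a => real"
 assumes "finite A" "finite B" "!!x. f x >= 0"
 shows "sum f (A \<union> B) <= sum f A + sum f B"
 using sum_Un[OF assms(1,2), of f] sum_nonneg[of "A \<inter> B" f] assms(3) by simp

lemma exp_ln_half: "n >= 1 ==> exp (- (1 / 2 * ln (real n))) = 1 / sqrt (real n)"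
proof -
 assume n: "n >= 1"
 have "exp (- (1 / 2 * ln (real n))) = exp (- ln (sqrt (real n)))" using n by (simp add: ln_sqrt)
 also have "... = 1 / sqrt (real n)" using n by (simp add: exp_minus divide_inverse)
 finally show ?thesis .
qed

text \<open>Bound the triangle by 1 and integrate the exponential from ln n on.\<close>

lemma window_coeff_upper:
 assumes h: "h > 0" and \<sigma>: "\<sigma> > 0" and n: "n >= 1"
 shows "norm (window_coeff h \<sigma> t n) <= 2 / sqrt (real n)"
proof -
 let ?L = "ln (real n)"
 let ?e = "%y. indicator {?L..} y *\<^sub>R exp (- Complex (1 / 2 + \<sigma>) t * of_real y)"
 have s: "Re (Complex (1 / 2 + \<sigma>) t) > 0" using \<sigma> by simp
 have L: "?L >= 0" using n by simp
 have "norm (window_coeff h \<sigma> t n) <= (LBINT y. norm (?e y * of_real (triangle h (y - 2 * h))))"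
  unfolding window_coeff_def by (rule integral_norm_bound)
 also have "... <= (LBINT y. norm (?e y))"
 proof (rule integral_mono)
  show "integrable lborel (%y. norm (?e y * of_real (triangle h (y - 2 * h))))"
   by (intro integrable_norm integrable_mult_triangle[OF h] exp_tail_integral(1) s)
  show "integrable lborel (%y. norm (?e y))" by (intro integrable_norm exp_tail_integral(1) s)
  show "norm (?e y * of_real (triangle h (y - 2 * h))) <= norm (?e y)" for y
   unfolding norm_mult using triangle_bounds[of h "y - 2 * h"] h by (intro mult_left_le) auto
 qed
 also have "... = exp (- (1 / 2 + \<sigma>) * ?L) / (1 / 2 + \<sigma>)" using exp_tail_integral(3)[OF s] by simp
 also have "... <= exp (- (1 / 2 * ?L)) / (1 / 2)"
 proof -
  have "1 / 2 * ?L <= (1 / 2 + \<sigma>) * ?L" using L \<sigma> by (intro mult_right_mono) auto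
  then have "exp (- (1 / 2 + \<sigma>) * ?L) <= exp (- (1 / 2 * ?L))" by (simp only: exp_le_cancel_iff mult_minus_left neg_le_iff_le)
  then show ?thesis using \<sigma> by (intro frac_le) auto
 qed
 finally show ?thesis using exp_ln_half[OF n] by simp
qed

text \<open>The exponential decays on a scale O(1) beyond ln n, while the triangle changes only on
  the scale h and is at least 1/2 at ln n. Freezing the triangle at ln n gives A/2 with an error of
  16 A / h <= A/4, and A >= 1 / (3 sqrt n) because exp(-\<sigma> ln n) >= 1/3.\<close>

lemma window_coeff_lower:
 assumes h: "h >= 64" and \<sigma>: "0 < \<sigma>" "\<sigma> <= 1 / 4" and t: "\<bar>t\<bar> <= 1 / 4"
  and n: "n >= 1" "3 / 2 * h <= ln (real n)" "ln (real n) <= 5 / 2 * h" and L1: "\<sigma> * ln (real n) <= 1"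
 shows "norm (window_coeff h \<sigma> t n) >= 1 / (12 * sqrt (real n))"
proof -
 let ?L = "ln (real n)" and ?s = "Complex (1 / 2 + \<sigma>) t" and ?a = "1 / 2 + \<sigma>"
 let ?e = "%y. indicator {?L..} y *\<^sub>R exp (- ?s * of_real y)" and ?w = "%y. triangle h (y - 2 * h)"
 have h0: "h > 0" using h by simp
 have s: "Re ?s > 0" "?s ~= 0" using \<sigma> by (auto simp: complex_eq_iff)
 have ns: "norm ?s <= 1" using cmod_le[of ?s] \<sigma> t by simp
 have wL: "?w ?L >= 1 / 2"
 proof -
  have "\<bar>?L - 2 * h\<bar> <= h / 2" using n(2,3) by linarith
  then have "\<bar>?L - 2 * h\<bar> / h <= 1 / 2" using h0 by (simp add: divide_le_eq)
  then show ?thesis unfolding triangle_def by linarith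
 qed
 have ei: "integrable lborel ?e" by (rule exp_tail_integral(1)[OF s(1)])
 have ewi: "integrable lborel (%y. ?e y * of_real (?w y))" by (rule integrable_mult_triangle[OF h0 ei])
 have ecw: "integrable lborel (%y. ?e y * of_real (?w ?L))" by (rule integrable_mult_left) (rule ei)
 define A where "A = exp (- (?a * ?L))"
 have main: "norm (LBINT y. ?e y * of_real (?w ?L)) >= A / 2"
 proof -
  have "(LBINT y. ?e y * of_real (?w ?L)) = exp (- ?s * of_real ?L) / ?s * of_real (?w ?L)"
   by (simp only: integral_mult_left_zero exp_tail_integral(2)[OF s(1)])
  then have "norm (LBINT y. ?e y * of_real (?w ?L)) = A * ?w ?L / norm ?s"
   using triangle_bounds(1)[of h] by (simp add: norm_mult norm_divide norm_exp_eq_Re A_def)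
  also have "... >= A * (1 / 2) / 1" using wL ns s(2) by (intro frac_le mult_left_mono) (auto simp: A_def)
  finally show ?thesis by simp
 qed
 let ?b = "complex_of_real (1 / 4 + \<sigma>)"
 let ?E = "%y. indicator {?L..} y *\<^sub>R exp (- ?b * of_real y)"
 have b: "Re ?b > 0" using \<sigma> by simp
 have err: "norm (LBINT y. ?e y * of_real (?w y) - ?e y * of_real (?w ?L)) <= 16 * A / h"
 proof -
  have "norm (LBINT y. ?e y * of_real (?w y) - ?e y * of_real (?w ?L)) <= (LBINT y. norm (?e y * of_real (?w y) - ?e y * of_real (?w ?L)))"
   by (rule integral_norm_bound)
  also have "... <= (LBINT y. 4 / h * exp (- ?L / 4) * norm (?E y))"
  proof (rule integral_mono)
   show "integrable lborel (%y. norm (?e y * of_real (?w y) - ?e y * of_real (?w ?L)))"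
    by (intro integrable_norm Bochner_Integration.integrable_diff ewi ecw)
   show "integrable lborel (%y. 4 / h * exp (- ?L / 4) * norm (?E y))"
    by (intro integrable_mult_right integrable_norm exp_tail_integral(1)[OF b])
   fix y
   show "norm (?e y * of_real (?w y) - ?e y * of_real (?w ?L)) <= 4 / h * exp (- ?L / 4) * norm (?E y)"
   proof (cases "y >= ?L")
    case True
    have "norm (?e y * of_real (?w y) - ?e y * of_real (?w ?L)) = norm (exp (- ?s * of_real y) * of_real (?w y - ?w ?L))"
     using True by (simp add: right_diff_distrib)
    also have "... = exp (- ?a * y) * \<bar>?w y - ?w ?L\<bar>" unfolding norm_mult norm_of_real norm_exp_eq_Re by (simp add: algebra_simps)
    also have "... <= exp (- ?a * y) * ((y - ?L) / h)"
     using triangle_lipschitz[OF h0, of "y - 2 * h" "?L - 2 * h"] True by (intro mult_left_mono) auto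
    also have "... <= exp (- ?a * y) * (4 * exp ((y - ?L) / 4) / h)"
    proof -
     have "y - ?L <= 4 * exp ((y - ?L) / 4)"
     proof -
      have "1 + d / 4 <= e ==> d <= 4 * e" for d e :: real by simp
      from this[OF exp_ge_add_one_self] show ?thesis .
     qed
     then show ?thesis using h0 by (intro mult_left_mono divide_right_mono) auto
    qed
    also have "... = 4 / h * (exp (- ?a * y) * exp ((y - ?L) / 4))" by simp
    also have "exp (- ?a * y) * exp ((y - ?L) / 4) = exp (- ?L / 4) * exp (- (1 / 4 + \<sigma>) * y)"
     unfolding exp_add[symmetric] by (rule arg_cong[of _ _ exp]) (simp add: field_simps)
    also have "exp (- (1 / 4 + \<sigma>) * y) = norm (?E y)" using True by (simp add: norm_exp_eq_Re)
    finally show ?thesis by simp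
   qed simp
  qed
  also have "... = 4 / h * exp (- ?L / 4) * (exp (- (1 / 4 + \<sigma>) * ?L) / (1 / 4 + \<sigma>))"
   using exp_tail_integral(3)[OF b, of ?L] by (simp only: integral_mult_right_zero Re_complex_of_real)
  also have "... = 4 / h * (exp (- ?L / 4) * exp (- (1 / 4 + \<sigma>) * ?L)) / (1 / 4 + \<sigma>)" by simp
  also have "exp (- ?L / 4) * exp (- (1 / 4 + \<sigma>) * ?L) = A"
   unfolding A_def exp_add[symmetric] by (rule arg_cong[of _ _ exp]) (simp add: field_simps)
  also have "4 / h * A / (1 / 4 + \<sigma>) <= 4 / h * A / (1 / 4)"
   using \<sigma> h0 by (intro divide_left_mono mult_nonneg_nonneg mult_pos_pos) (auto simp: A_def)
  finally show ?thesis by simp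
 qed
 have "window_coeff h \<sigma> t n = (LBINT y. ?e y * of_real (?w y) - ?e y * of_real (?w ?L)) + (LBINT y. ?e y * of_real (?w ?L))"
  unfolding Bochner_Integration.integral_diff[OF ewi ecw] window_coeff_def by simp
 then have "norm (LBINT y. ?e y * of_real (?w ?L)) <= norm (window_coeff h \<sigma> t n) + norm (LBINT y. ?e y * of_real (?w y) - ?e y * of_real (?w ?L))"
  using norm_triangle_ineq4[of "window_coeff h \<sigma> t n" "LBINT y. ?e y * of_real (?w y) - ?e y * of_real (?w ?L)"] by simp
 moreover have "16 * A / h <= A / 4" using h by (simp add: A_def divide_le_eq)
 ultimately have "norm (window_coeff h \<sigma> t n) >= A / 4" using main err by linarith
 moreover have "A >= 1 / (3 * sqrt (real n))"
 proof -
  have "A = exp (- (1 / 2 * ?L)) * exp (- (\<sigma> * ?L))"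
   unfolding A_def exp_add[symmetric] by (rule arg_cong[of _ _ exp]) (simp add: algebra_simps)
  also have "exp (- (1 / 2 * ?L)) = 1 / sqrt (real n)" by (rule exp_ln_half[OF n(1)])
  finally have "A = 1 / sqrt (real n) * exp (- (\<sigma> * ?L))" .
  moreover have "exp (- (\<sigma> * ?L)) >= 1 / 3"
  proof -
   have "exp (\<sigma> * ?L) <= exp 1" using L1 by simp
   then have "exp (\<sigma> * ?L) <= 3" using exp_le by linarith
   from le_imp_inverse_le[OF this exp_gt_zero] show ?thesis by (simp only: exp_minus inverse_eq_divide)
  qed
  then have "1 / sqrt (real n) * exp (- (\<sigma> * ?L)) >= 1 / sqrt (real n) * (1 / 3)" by (intro mult_left_mono) auto
  ultimately show ?thesis by (simp add: mult.commute)
 qed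
 ultimately show ?thesis by simp
qed

text \<open>All indices are below \<open>q\<close>, so congruence modulo \<open>q\<close> is
  equality and only the diagonal survives.\<close>

lemma character_mean_square:
 assumes q: "q > 0" and I: "finite I" "!!n. n \<in> I ==> n < q"
 shows "(\<Sum>X | dirichlet_character q X. (norm (\<Sum>n\<in>I. a n * X n))\<^sup>2) = real (totient q) * (\<Sum>n\<in>{n\<in>I. coprime n q}. (norm (a n))\<^sup>2)"
proof -
 let ?C = "{X. dirichlet_character q X}"
 let ?J = "{n\<in>I. coprime n q}"
 have fJ: "finite ?J" using I by simp
 have red: "(\<Sum>n\<in>I. a n * X n) = (\<Sum>n\<in>?J. a n * X n)" if "X \<in> ?C" for X
  using I(1) that by (intro sum.mono_neutral_right) (auto simp: dirichlet_character_def)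
 have "complex_of_real (\<Sum>X\<in>?C. (norm (\<Sum>n\<in>I. a n * X n))\<^sup>2) = (\<Sum>X\<in>?C. (\<Sum>m\<in>?J. a m * X m) * cnj (\<Sum>n\<in>?J. a n * X n))"
  unfolding of_real_sum by (rule sum.cong[OF refl]) (simp only: red complex_norm_square)
 also have "... = (\<Sum>X\<in>?C. \<Sum>m\<in>?J. \<Sum>n\<in>?J. (a m * cnj (a n)) * (X m * cnj (X n)))"
  by (rule sum.cong[OF refl]) (simp add: sum_product cnj_sum mult_ac)
 also have "... = (\<Sum>m\<in>?J. \<Sum>n\<in>?J. \<Sum>X\<in>?C. (a m * cnj (a n)) * (X m * cnj (X n)))"
  by (subst sum.swap, rule sum.cong[OF refl], rule sum.swap)
 also have "... = (\<Sum>m\<in>?J. \<Sum>n\<in>?J. if m = n then a m * cnj (a n) * of_nat (totient q) else 0)"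
 proof (intro sum.cong[OF refl])
  fix m n assume mn: "m \<in> ?J" "n \<in> ?J"
  have "(\<Sum>X\<in>?C. X m * cnj (X n)) = (if [m = n] (mod q) then of_nat (totient q) else 0)"
   using orthogonality_characters[OF q] mn by auto
  moreover have "[m = n] (mod q) \<longleftrightarrow> m = n" using mn I(2) cong_less_modulus_unique_nat by (auto simp: cong_def)
  ultimately show "(\<Sum>X\<in>?C. (a m * cnj (a n)) * (X m * cnj (X n))) = (if m = n then a m * cnj (a n) * of_nat (totient q) else 0)"
   unfolding sum_distrib_left[symmetric] by auto
 qed
 also have "... = (\<Sum>m\<in>?J. a m * cnj (a m) * of_nat (totient q))"
  by (rule sum.cong[OF refl]) (use fJ in \<open>simp add: sum.delta\<close>)
 also have "... = of_real (real (totient q) * (\<Sum>n\<in>?J. (norm (a n))\<^sup>2))"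
  by (simp only: of_real_mult of_real_sum complex_norm_square sum_distrib_left of_real_of_nat_eq mult_ac)
 finally show ?thesis by (simp only: of_real_eq_iff)
qed

text \<open>The square of the sum is a sum over products of two primes. By unique factorisation each
  product comes from at most two ordered pairs, and \<open>p * r < q\<close> lets
  \<open>character_mean_square\<close> apply to it.\<close>

lemma character_fourth_moment:
 assumes q: "q > 0" and P: "finite P" "!!p. p \<in> P ==> prime p" "!!p r. p \<in> P ==> r \<in> P ==> p * r < q"
 shows "(\<Sum>X | dirichlet_character q X. (norm (\<Sum>p\<in>P. a p * X p)) ^ 4) <= 2 * real (totient q) * (\<Sum>p\<in>P. (norm (a p))\<^sup>2)\<^sup>2"
proof -
 let ?C = "{X. dirichlet_character q X}"
 define I where "I = (%(p, r). p * r) ` (P \<times> P)"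
 define S where "S m = {x \<in> P \<times> P. (case x of (p, r) => p * r) = m}" for m
 define b where "b m = (\<Sum>x\<in>S m. a (fst x) * a (snd x))" for m
 have fI: "finite I" and fS: "finite (S m)" for m using P(1) by (auto simp: I_def S_def)
 have Iq: "n < q" if "n \<in> I" for n using that P(3) by (auto simp: I_def)
 have card: "card (S m) <= 2" for m
 proof (cases "S m = {}")
  case False
  then obtain p r where pr: "p \<in> P" "r \<in> P" "p * r = m" by (auto simp: S_def)
  have "S m \<subseteq> set [(p, r), (r, p)]"
  proof
   fix x assume "x \<in> S m"
   then obtain u v where x: "x = (u, v)" "u \<in> P" "v \<in> P" "u * v = p * r" using pr by (auto simp: S_def)
   have pos: "u > 0" using P(2)[OF x(2)] by (simp add: prime_gt_0_nat)
   have "u dvd p * r" using x(4) by (metis dvd_triv_left)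
   then have "u dvd p \<or> u dvd r" using P(2)[OF x(2)] by (simp add: prime_dvd_mult_iff)
   then have "u = p \<or> u = r" using primes_dvd_imp_eq[OF P(2)[OF x(2)] P(2)[OF pr(1)]] primes_dvd_imp_eq[OF P(2)[OF x(2)] P(2)[OF pr(2)]] by blast
   then show "x \<in> set [(p, r), (r, p)]" using x(1,4) pos by (auto simp: mult.commute)
  qed
  then have "card (S m) <= card (set [(p, r), (r, p)])" by (rule card_mono[rotated]) simp
  also have "... <= length [(p, r), (r, p)]" by (rule card_length)
  finally show ?thesis by (simp only: list.size numeral_2_eq_2 add_0 add_Suc_right)
 qed simp
 have sq: "(\<Sum>p\<in>P. a p * X p)\<^sup>2 = (\<Sum>m\<in>I. b m * X m)" if X: "X \<in> ?C" for X
 proof -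
  have "(\<Sum>p\<in>P. a p * X p)\<^sup>2 = (\<Sum>x\<in>P \<times> P. (a (fst x) * X (fst x)) * (a (snd x) * X (snd x)))"
   unfolding power2_eq_square sum_product by (subst sum.cartesian_product) (simp add: case_prod_unfold)
  also have "... = (\<Sum>m\<in>I. \<Sum>x\<in>S m. (a (fst x) * X (fst x)) * (a (snd x) * X (snd x)))"
   unfolding S_def I_def using P(1) by (intro sum.image_gen[of "P \<times> P" _ "%(p, r). p * r"]) auto
  also have "... = (\<Sum>m\<in>I. b m * X m)"
   unfolding b_def sum_distrib_right using X
   by (intro sum.cong[OF refl]) (auto simp: S_def dirichlet_character_def)
  finally show ?thesis .
 qed
 have "(\<Sum>X\<in>?C. (norm (\<Sum>p\<in>P. a p * X p)) ^ 4) = (\<Sum>X\<in>?C. (norm (\<Sum>m\<in>I. b m * X m))\<^sup>2)"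
  by (rule sum.cong[OF refl]) (simp add: sq[symmetric] norm_power flip: power_mult)
 also have "... = real (totient q) * (\<Sum>n\<in>{n\<in>I. coprime n q}. (norm (b n))\<^sup>2)" by (rule character_mean_square[OF q fI Iq])
 also have "... <= real (totient q) * (\<Sum>n\<in>I. (norm (b n))\<^sup>2)"
  using fI by (intro mult_left_mono sum_mono2) auto
 also have "... <= real (totient q) * (\<Sum>n\<in>I. 2 * (\<Sum>x\<in>S n. (norm (a (fst x)))\<^sup>2 * (norm (a (snd x)))\<^sup>2))"
 proof (intro mult_left_mono sum_mono)
  fix n
  have "(norm (b n))\<^sup>2 = (norm (\<Sum>x\<in>S n. of_real 1 * (a (fst x) * a (snd x))))\<^sup>2" by (simp add: b_def)
  also have "... <= (\<Sum>x\<in>S n. 1) * (\<Sum>x\<in>S n. 1 * (norm (a (fst x) * a (snd x)))\<^sup>2)" by (rule sum_weighted_square_le) simp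
  also have "... <= 2 * (\<Sum>x\<in>S n. (norm (a (fst x)))\<^sup>2 * (norm (a (snd x)))\<^sup>2)"
   using card[of n] by (intro mult_mono) (auto simp: norm_mult power_mult_distrib intro!: sum_nonneg)
  finally show "(norm (b n))\<^sup>2 <= 2 * (\<Sum>x\<in>S n. (norm (a (fst x)))\<^sup>2 * (norm (a (snd x)))\<^sup>2)" .
 qed simp
 also have "(\<Sum>n\<in>I. 2 * (\<Sum>x\<in>S n. (norm (a (fst x)))\<^sup>2 * (norm (a (snd x)))\<^sup>2)) = 2 * (\<Sum>x\<in>P \<times> P. (norm (a (fst x)))\<^sup>2 * (norm (a (snd x)))\<^sup>2)"
  unfolding sum_distrib_left[symmetric] S_def I_def
  using P(1) by (subst sum.image_gen[of "P \<times> P" _ "%(p, r). p * r"]) auto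
 also have "(\<Sum>x\<in>P \<times> P. (norm (a (fst x)))\<^sup>2 * (norm (a (snd x)))\<^sup>2) = (\<Sum>p\<in>P. (norm (a p))\<^sup>2)\<^sup>2"
  unfolding power2_eq_square[of "sum _ P"] sum_product by (subst sum.cartesian_product) (simp add: case_prod_unfold)
 finally show ?thesis by simp
qed

text \<open>Mertens between exp(3h/2) and exp(2h) gives at least h/2 - 6. Proper prime powers cost
  at most 12 and divisors of \<open>q\<close> at most 6, and h/2 - 24 >= h/4 is the condition h >=
  96.\<close>

lemma prime_sum_window:
 assumes q: "q >= 1" and h: "h >= 96" and hq: "ln (real q) = 8 * h"
 shows "(\<Sum>p\<in>{p\<in>{1..nat \<lfloor>exp (3 * h)\<rfloor>}. prime p \<and> coprime p q \<and> 3 / 2 * h <= ln (real p) \<and> ln (real p) <= 2 * h}. mangoldt p / real p) >= h / 4"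
proof -
 define N1 where "N1 = nat \<lfloor>exp (3 / 2 * h)\<rfloor>"
 define N2 where "N2 = nat \<lfloor>exp (2 * h)\<rfloor>"
 define W where "W = {p\<in>{1..nat \<lfloor>exp (3 * h)\<rfloor>}. prime p \<and> coprime p q \<and> 3 / 2 * h <= ln (real p) \<and> ln (real p) <= 2 * h}"
 let ?f = "%n::nat. mangoldt n / real n :: real"
 have f0: "?f n >= 0" for n by (simp add: mangoldt_nonneg)
 have N1: "real N1 <= exp (3 / 2 * h)" "N1 >= 1"
  using h by (auto simp: N1_def le_nat_iff le_floor_iff intro!: of_nat_floor)
 have N2: "real N2 >= exp (2 * h) / 2" "N2 >= 1" "real N2 <= exp (2 * h)"
 proof -
  have e: "exp (2 * h) >= 2" using exp_ge_add_one_self[of "2 * h"] h by linarith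
  have "exp (2 * h) - 1 <= real N2" unfolding N2_def by linarith
  then show "real N2 >= exp (2 * h) / 2" using e by linarith
  then show "N2 >= 1" using e by linarith
  show "real N2 <= exp (2 * h)" unfolding N2_def by (rule of_nat_floor) simp
 qed
 have N12: "N1 <= N2" unfolding N1_def N2_def using h by (intro nat_mono floor_mono) simp
 have "ln (exp (2 * h) / 2) <= ln (real N2)" using N2 by (subst ln_le_cancel_iff) auto
 then have lN2: "ln (real N2) >= 2 * h - 1" using ln_2_less_1 by (simp add: ln_div)
 have "ln (real N1) <= ln (exp (3 / 2 * h))" using N1 by (subst ln_le_cancel_iff) auto
 then have lN1: "ln (real N1) <= 3 / 2 * h" by simp
 have "sum ?f {1..N2} = sum ?f {1..N1} + sum ?f {N1<..N2}"
  using N1(2) N12 by (subst sum.union_disjoint[symmetric]) (auto intro!: sum.cong)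
 then have big: "sum ?f {N1<..N2} >= h / 2 - 6"
  using mertens_bounds(1)[OF N2(2)] mertens_bounds(2)[OF N1(2)] lN1 lN2 by linarith
 have lnge: "ln (real n) >= 3 / 2 * h" if "n \<in> {N1<..N2}" for n
 proof -
  have "\<lfloor>exp (3 / 2 * h)\<rfloor> < int n" using that by (simp add: N1_def nat_less_iff)
  then have "exp (3 / 2 * h) < real n" by (simp add: floor_less_iff)
  then show ?thesis by (metis exp_gt_zero less_imp_le less_trans ln_ge_iff)
 qed
 have lnle: "ln (real n) <= 2 * h" if "n \<in> {N1<..N2}" for n
 proof -
  have "real n <= exp (2 * h)" using that N2(3) by (simp add: order_trans[OF of_nat_mono])
  then have "ln (real n) <= ln (exp (2 * h))" using that by (subst ln_le_cancel_iff) auto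
  then show ?thesis by simp
 qed
 have N23: "N2 <= nat \<lfloor>exp (3 * h)\<rfloor>" unfolding N2_def using h by (intro nat_mono floor_mono) simp
 have sub: "{N1<..N2} \<subseteq> W \<union> ({n\<in>{N1<..N2}. \<not> prime n} \<union> {n\<in>{N1<..N2}. n dvd q})"
 proof
  fix n assume n: "n \<in> {N1<..N2}"
  show "n \<in> W \<union> ({n\<in>{N1<..N2}. \<not> prime n} \<union> {n\<in>{N1<..N2}. n dvd q})"
   using n lnge[OF n] lnle[OF n] N23 prime_imp_coprime[of n q] by (auto simp: W_def)
 qed
 \<comment> \<open>The divisors of \<open>q\<close> have total \<open>mangoldt\<close> sum ln q =
   8h, and those counted here are at least exp(3h/2).\<close>
 have dv: "sum ?f {n\<in>{N1<..N2}. n dvd q} <= 6"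
 proof -
  have "sum ?f {n\<in>{N1<..N2}. n dvd q} <= (\<Sum>n\<in>{n\<in>{N1<..N2}. n dvd q}. mangoldt n * exp (- (3 / 2 * h)))"
  proof (rule sum_mono)
   fix n assume n: "n \<in> {n\<in>{N1<..N2}. n dvd q}"
   then have "3 / 2 * h <= ln (real n)" "real n > 0" using lnge[of n] by auto
   then have "exp (3 / 2 * h) <= real n" by (simp only: ln_ge_iff)
   from le_imp_inverse_le[OF this exp_gt_zero]
   have "1 / real n <= exp (- (3 / 2 * h))" by (simp only: exp_minus inverse_eq_divide)
   then have "mangoldt n * (1 / real n) <= mangoldt n * exp (- (3 / 2 * h))" by (intro mult_left_mono mangoldt_nonneg)
   then show "?f n <= mangoldt n * exp (- (3 / 2 * h))" by simp
  qed
  also have "... = (\<Sum>n\<in>{n\<in>{N1<..N2}. n dvd q}. mangoldt n) * exp (- (3 / 2 * h))" by (simp add: sum_distrib_right)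
  also have "(\<Sum>n\<in>{n\<in>{N1<..N2}. n dvd q}. mangoldt n :: real) <= (\<Sum>n | n dvd q. mangoldt n)"
   using q by (intro sum_mono2 mangoldt_nonneg) auto
  also have "(\<Sum>n | n dvd q. mangoldt n :: real) = 8 * h" using mangoldt_sum[of q, where 'a = real] q hq by simp
  finally have "sum ?f {n\<in>{N1<..N2}. n dvd q} <= 8 * h * exp (- (3 / 2 * h))" by simp
  also have "... <= 6"
  proof -
   have "3 / 2 * h <= exp (3 / 2 * h)" using exp_ge_add_one_self[of "3 / 2 * h"] by linarith
   then have "8 * h <= 6 * exp (3 / 2 * h)" using h by linarith
   then show ?thesis by (simp add: exp_minus divide_inverse[symmetric] divide_le_eq)
  qed
  finally show ?thesis .
 qed
 have "sum ?f {N1<..N2} <= sum ?f (W \<union> ({n\<in>{N1<..N2}. \<not> prime n} \<union> {n\<in>{N1<..N2}. n dvd q}))"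
  using sub f0 by (intro sum_mono2) (auto simp: W_def)
 also have "... <= sum ?f W + sum ?f ({n\<in>{N1<..N2}. \<not> prime n} \<union> {n\<in>{N1<..N2}. n dvd q})"
  using f0 by (intro sum_Un_le_nonneg) (auto simp: W_def)
 also have "sum ?f ({n\<in>{N1<..N2}. \<not> prime n} \<union> {n\<in>{N1<..N2}. n dvd q}) <= sum ?f {n\<in>{N1<..N2}. \<not> prime n} + sum ?f {n\<in>{N1<..N2}. n dvd q}"
  using f0 by (intro sum_Un_le_nonneg) auto
 finally show ?thesis using big dv sum_mangoldt_nonprime[of "{N1<..N2}"] h unfolding W_def[symmetric] by simp
qed

lemma norm_mangoldt_complex: "norm (mangoldt n :: complex) = mangoldt n"
proof -
 have "(mangoldt n :: complex) = of_real (mangoldt n)" by (simp add: mangoldt_def)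
 then show ?thesis using mangoldt_nonneg[of n] by (simp only: norm_of_real abs_of_nonneg)
qed

lemma mangoldt_prime: "prime n ==> mangoldt n = ln (real n)"
 using aprimedivisor_prime_power[of n 1] by (simp add: mangoldt_def)

text \<open>The inequality s^2 - s^4 <= s for s >= 0, rescaled by \<open>c\<close> and summed. It
  gives a lower bound for the first moment that is linear in the other two.\<close>

lemma first_moment_from_moments:
 fixes f :: "'a => real"
 assumes "!!i. i \<in> I ==> f i >= 0" "c > 0"
 shows "(\<Sum>i\<in>I. f i) >= (\<Sum>i\<in>I. (f i)\<^sup>2) / c - (\<Sum>i\<in>I. f i ^ 4) / c ^ 3"
proof -
 have "x >= x\<^sup>2 / c - x ^ 4 / c ^ 3" if x: "x >= 0" for x
 proof -
  define s where "s = x / c"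
  have s: "s >= 0" using x assms(2) by (simp add: s_def)
  have "s\<^sup>2 - s ^ 4 <= s"
  proof (cases "s <= 1")
   case True
   then have "s * s <= s * 1" using s by (intro mult_left_mono) auto
   moreover have "s ^ 4 >= 0" using s by simp
   ultimately show ?thesis unfolding power2_eq_square by linarith
  next
   case False
   then have "s ^ 2 <= s ^ 4" by (intro power_increasing) auto
   then show ?thesis using s by linarith
  qed
  then have "c * (s\<^sup>2 - s ^ 4) <= c * s" using assms(2) by simp
  moreover have "c * (s\<^sup>2 - s ^ 4) = x\<^sup>2 / c - x ^ 4 / c ^ 3"
   using assms(2) by (simp add: s_def field_simps power_numeral_reduce)
  moreover have "c * s = x" using assms(2) by (simp add: s_def)
  ultimately show ?thesis by simp
 qed
 then have "(\<Sum>i\<in>I. (f i)\<^sup>2 / c - f i ^ 4 / c ^ 3) <= (\<Sum>i\<in>I. f i)" using assms(1) by (intro sum_mono) auto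
 then show ?thesis by (simp add: sum_subtractf sum_divide_distrib)
qed

text \<open>With q = exp(8h) only n <= exp(3h) enter. The primes \<open>P\<close> carry the main
  term; the remaining prime powers \<open>R\<close> have a second moment smaller by a factor of
  order h and are subtracted at the end.\<close>

lemma character_window_sum:
 assumes q: "q >= 3" and hq: "ln (real q) = 8 * h" and h: "h >= 10 ^ 17" and t: "\<bar>t\<bar> <= 1 / 4"
 shows "(\<Sum>X\<in>{X. dirichlet_character q X} - {principal_character q}. norm (windowed h (1 / (8 * h)) (%n. mangoldt n * X n) t))
  >= real (totient q) * h / 10 ^ 7"
proof -
 let ?C = "{X. dirichlet_character q X}" and ?x0 = "principal_character q"
 let ?\<phi> = "real (totient q)"
 define \<sigma> where "\<sigma> = 1 / (8 * h)"
 have h0: "h > 0" "h >= 96" using h by auto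
 have \<sigma>: "0 < \<sigma>" "\<sigma> <= 1 / 4" using h0 by (auto simp: \<sigma>_def divide_le_eq)
 have q0: "q > 0" using q by simp
 have fC: "finite ?C" by (rule finite_dirichlet_characters[OF q0])
 have x0: "?x0 \<in> ?C" using dirichlet_character_principal by simp
 have \<phi>0: "?\<phi> > 0" using q by simp
 have qe: "real q = exp (8 * h)" using hq q by (metis exp_ln of_nat_0_less_iff q0)
 define N where "N = nat \<lfloor>exp (3 * h)\<rfloor>"
 have N: "real N <= exp (3 * h)" unfolding N_def by (rule of_nat_floor) simp
 define k where "k = window_coeff h \<sigma> t"
 define a where "a n = mangoldt n * k n" for n
 define P where "P = {n\<in>{1..N}. prime n}"
 define R where "R = {n\<in>{1..N}. \<not> prime n}"
 have fP: "finite P" and fR: "finite R" by (auto simp: P_def R_def)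
 define A where "A X = (\<Sum>n\<in>P. a n * X n)" for X
 define A' where "A' X = (\<Sum>n\<in>R. a n * X n)" for X
 have lnN: "ln (real n) <= 3 * h" if "n \<in> {1..N}" for n
 proof -
  have "real n <= exp (3 * h)" using that N by (simp add: order_trans[OF of_nat_mono])
  then have "ln (real n) <= ln (exp (3 * h))" using that by (subst ln_le_cancel_iff) auto
  then show ?thesis by simp
 qed
 have Nq: "n < q" if "n \<in> {1..N}" for n
 proof -
  have "real n <= exp (3 * h)" using that N by (simp add: order_trans[OF of_nat_mono])
  also have "... < real q" unfolding qe using h0 by simp
  finally show ?thesis by simp
 qed
 have PPq: "p * r < q" if "p \<in> P" "r \<in> P" for p r
 proof -
  have "real p <= exp (3 * h)" "real r <= exp (3 * h)" using that N by (auto simp: P_def order_trans[OF of_nat_mono])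
  then have "real p * real r <= exp (3 * h) * exp (3 * h)" by (intro mult_mono) auto
  also have "... = exp (6 * h)" by (simp flip: exp_add)
  also have "... < real q" unfolding qe using h0 by simp
  finally show ?thesis by (simp flip: of_nat_mult)
 qed
 have split: "windowed h \<sigma> (%n. mangoldt n * X n) t = A X + A' X" if X: "X \<in> ?C" for X
 proof -
  have "step_function (%n. mangoldt n * X n) 1"
  proof unfold_locales
   fix n
   have "norm (X (Suc n)) <= 1" using norm_dirichlet_character[of q X "Suc n"] X q0 by simp
   then show "norm (mangoldt (Suc n) * X (Suc n)) <= 1 * ln (real (Suc n))"
    unfolding norm_mult using mult_mono[OF mangoldt_le_ln[of n], of "norm (X (Suc n))" 1] by (simp del: of_nat_Suc)
  qed auto
  from windowed_eq_sum[OF this h0(1) \<sigma>(1), of t]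
  have "windowed h \<sigma> (%n. mangoldt n * X n) t = (\<Sum>n\<in>{1..N}. a n * X n)"
   unfolding N_def[symmetric] k_def[symmetric] a_def by (simp add: mult_ac)
  also have "{1..N} = P \<union> R" by (auto simp: P_def R_def)
  also have "(\<Sum>n\<in>P \<union> R. a n * X n) = A X + A' X"
   unfolding A_def A'_def using fP fR by (subst sum.union_disjoint) (auto simp: P_def R_def)
  finally show ?thesis .
 qed
 have asq: "(norm (a n))\<^sup>2 <= 12 * h * (mangoldt n / real n)" if n: "n \<in> {1..N}" for n
 proof -
  have "norm (a n) <= mangoldt n * (2 / sqrt (real n))"
   unfolding a_def norm_mult k_def using window_coeff_upper[OF h0(1) \<sigma>(1), of n t] n mangoldt_nonneg[of n]
   by (intro mult_mono) (auto simp: norm_mangoldt_complex)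
  then have "(norm (a n))\<^sup>2 <= (mangoldt n * (2 / sqrt (real n)))\<^sup>2" by (intro power_mono) auto
  also have "... = mangoldt n * (4 * (mangoldt n / real n))" by (simp add: power_mult_distrib power_divide) (simp add: power2_eq_square)
  also have "... <= (3 * h) * (4 * (mangoldt n / real n))"
   using lnN[OF n] mangoldt_le[of n] n by (intro mult_right_mono mult_nonneg_nonneg divide_nonneg_nonneg mangoldt_nonneg) auto
  finally show ?thesis by simp
 qed
 have N1: "N >= 1" using h0 by (auto simp: N_def le_nat_iff le_floor_iff)
 have S2: "(\<Sum>n\<in>P. (norm (a n))\<^sup>2) <= 48 * h\<^sup>2"
 proof -
  have "(\<Sum>n\<in>P. (norm (a n))\<^sup>2) <= (\<Sum>n\<in>{1..N}. (norm (a n))\<^sup>2)" by (intro sum_mono2) (auto simp: P_def)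
  also have "... <= (\<Sum>n\<in>{1..N}. 12 * h * (mangoldt n / real n))" by (intro sum_mono asq)
  also have "... = 12 * h * (\<Sum>n\<in>{1..N}. mangoldt n / real n)" by (rule sum_distrib_left[symmetric])
  also have "... <= 12 * h * (4 * h)"
   using mertens_bounds(2)[OF N1] lnN[of N] N1 h0 by (intro mult_left_mono) auto
  finally show ?thesis by (simp add: power2_eq_square)
 qed
 have R2: "(\<Sum>X\<in>?C. (norm (A' X))\<^sup>2) <= ?\<phi> * (144 * h)"
 proof -
  have "(\<Sum>X\<in>?C. (norm (A' X))\<^sup>2) = ?\<phi> * (\<Sum>n\<in>{n\<in>R. coprime n q}. (norm (a n))\<^sup>2)"
   unfolding A'_def by (rule character_mean_square[OF q0 fR]) (auto simp: R_def intro: Nq)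
  also have "... <= ?\<phi> * (\<Sum>n\<in>R. 12 * h * (mangoldt n / real n))"
  proof (rule mult_left_mono)
   have "(\<Sum>n\<in>{n\<in>R. coprime n q}. (norm (a n))\<^sup>2) <= (\<Sum>n\<in>R. (norm (a n))\<^sup>2)" using fR by (intro sum_mono2) auto
   also have "... <= (\<Sum>n\<in>R. 12 * h * (mangoldt n / real n))" by (intro sum_mono asq) (auto simp: R_def)
   finally show "(\<Sum>n\<in>{n\<in>R. coprime n q}. (norm (a n))\<^sup>2) <= (\<Sum>n\<in>R. 12 * h * (mangoldt n / real n))" .
  qed simp
  also have "(\<Sum>n\<in>R. 12 * h * (mangoldt n / real n)) = 12 * h * (\<Sum>n\<in>R. mangoldt n / real n)" by (rule sum_distrib_left[symmetric])
  also have "... <= 12 * h * 12" unfolding R_def using h0 by (intro mult_left_mono sum_mangoldt_nonprime) auto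
  finally show ?thesis using \<phi>0 by (simp add: mult_left_mono)
 qed
 have M4: "(\<Sum>X\<in>?C. norm (A X) ^ 4) <= ?\<phi> * (4608 * h ^ 4)"
 proof -
  have "(\<Sum>X\<in>?C. norm (A X) ^ 4) <= 2 * ?\<phi> * (\<Sum>n\<in>P. (norm (a n))\<^sup>2)\<^sup>2"
   unfolding A_def by (rule character_fourth_moment[OF q0 fP _ PPq]) (auto simp: P_def)
  also have "... <= 2 * ?\<phi> * (48 * h\<^sup>2)\<^sup>2" using S2 by (intro mult_left_mono power_mono) (auto intro: sum_nonneg)
  also have "... = ?\<phi> * (4608 * h ^ 4)" by (simp add: power_mult_distrib flip: power_mult)
  finally show ?thesis .
 qed
 have M2: "(\<Sum>X\<in>?C. (norm (A X))\<^sup>2) >= ?\<phi> * (h\<^sup>2 / 384)"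
 proof -
  let ?W = "{p\<in>{1..N}. prime p \<and> coprime p q \<and> 3 / 2 * h <= ln (real p) \<and> ln (real p) <= 2 * h}"
  have low: "(norm (a n))\<^sup>2 >= h / 96 * (mangoldt n / real n)" if n: "n \<in> ?W" for n
  proof -
   have L1: "\<sigma> * ln (real n) <= 1" using n h0 by (simp add: \<sigma>_def divide_le_eq)
   have "norm (k n) >= 1 / (12 * sqrt (real n))"
    unfolding k_def using n h0 by (intro window_coeff_lower \<sigma> t L1) auto
   then have "mangoldt n * (1 / (12 * sqrt (real n))) <= norm (a n)"
    unfolding a_def norm_mult norm_mangoldt_complex by (intro mult_left_mono mangoldt_nonneg)
   then have "(mangoldt n * (1 / (12 * sqrt (real n))))\<^sup>2 <= (norm (a n))\<^sup>2"
    by (intro power_mono mult_nonneg_nonneg mangoldt_nonneg) auto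
   moreover have "(mangoldt n * (1 / (12 * sqrt (real n))))\<^sup>2 = mangoldt n * (1 / 144 * (mangoldt n / real n))"
    by (simp add: power_mult_distrib power_divide) (simp add: power2_eq_square)
   moreover have "mangoldt n = ln (real n)" using n by (simp add: mangoldt_prime)
   then have "3 / 2 * h * (1 / 144 * (mangoldt n / real n)) <= mangoldt n * (1 / 144 * (mangoldt n / real n))"
    using n by (intro mult_right_mono mult_nonneg_nonneg divide_nonneg_nonneg mangoldt_nonneg) auto
   ultimately show ?thesis by simp
  qed
  have "h\<^sup>2 / 384 = h / 96 * (h / 4)" by (simp add: power2_eq_square)
  also have "... <= h / 96 * (\<Sum>n\<in>?W. mangoldt n / real n)"
   using prime_sum_window[OF _ h0(2) hq] q h0 unfolding N_def by (intro mult_left_mono) auto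
  also have "... <= (\<Sum>n\<in>?W. (norm (a n))\<^sup>2)" unfolding sum_distrib_left by (intro sum_mono low)
  also have "... <= (\<Sum>n\<in>{n\<in>P. coprime n q}. (norm (a n))\<^sup>2)" using fP by (intro sum_mono2) (auto simp: P_def)
  finally have "?\<phi> * (h\<^sup>2 / 384) <= ?\<phi> * (\<Sum>n\<in>{n\<in>P. coprime n q}. (norm (a n))\<^sup>2)" by (intro mult_left_mono) auto
  also have "... = (\<Sum>X\<in>?C. (norm (A X))\<^sup>2)"
   unfolding A_def by (rule character_mean_square[OF q0 fP, symmetric]) (auto simp: P_def intro: Nq)
  finally show ?thesis .
 qed
 \<comment> \<open>The principal character has to be left out. Trivially its sum is at most exp(3h)
   * 6h, whose square is of order q^(3/4) up to a power of h, and this is far below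
   \<open>totient q\<close>.\<close>
 have pr: "(norm (A ?x0))\<^sup>2 <= ?\<phi> * (h\<^sup>2 / 768)"
 proof -
  have an: "norm (a n) <= 6 * h" if n: "n \<in> {1..N}" for n
  proof -
   have "norm (k n) <= 2 / sqrt (real n)" unfolding k_def using n by (intro window_coeff_upper h0 \<sigma>) auto
   also have "... <= 2 / 1" using n by (intro divide_left_mono) auto
   finally have "norm (k n) <= 2" by simp
   then have "norm (a n) <= 3 * h * 2"
    unfolding a_def norm_mult using lnN[OF n] mangoldt_le[of n] n h0 by (intro mult_mono) (auto simp: norm_mangoldt_complex)
   then show ?thesis by simp
  qed
  have "norm (A ?x0) <= (\<Sum>n\<in>P. 6 * h)"
   unfolding A_def
  proof (rule sum_norm_le)
   fix n assume "n \<in> P"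
   then have "norm (a n) <= 6 * h" using an by (simp add: P_def)
   moreover have "norm (?x0 n) <= 1" by (simp add: principal_character_def)
   ultimately show "norm (a n * ?x0 n) <= 6 * h" unfolding norm_mult using mult_mono[of "norm (a n)" "6 * h" "norm (?x0 n)" 1] h0 by simp
  qed
  also have "... = real (card P) * (6 * h)" by simp
  also have "... <= real N * (6 * h)"
  proof -
   have "card P <= card {1..N}" by (rule card_mono) (auto simp: P_def)
   then show ?thesis using h0 by (intro mult_right_mono) auto
  qed
  also have "... <= exp (3 * h) * (6 * h)" using N h0 by (intro mult_right_mono) auto
  finally have "(norm (A ?x0))\<^sup>2 <= (exp (3 * h) * (6 * h))\<^sup>2" by (intro power_mono) auto
  also have "... = exp (6 * h) * (36 * h\<^sup>2)" by (simp add: power_mult_distrib flip: exp_double)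
  also have "... <= (?\<phi> / 27648) * (36 * h\<^sup>2)"
  proof (rule mult_right_mono)
   have "27648 * (16 * h + 1) <= (10 ^ 6) * h" using h by simp
   also have "... <= h * h" using h by (intro mult_right_mono) auto
   also have "... <= exp h * exp h"
   proof -
    have "h <= exp h" using exp_ge_add_one_self[of h] by linarith
    then show ?thesis using h0 by (intro mult_mono) auto
   qed
   finally have "27648 * (16 * h + 1) <= exp (2 * h)" by (simp flip: exp_add)
   then have "exp (6 * h) * (27648 * (16 * h + 1)) <= exp (6 * h) * exp (2 * h)" by (intro mult_left_mono) auto
   also have "... = real q" unfolding qe by (simp flip: exp_add)
   also have "... <= ?\<phi> * (16 * h + 1)" using totient_lower_bound[OF q0] unfolding hq by simp
   finally have "(27648 * exp (6 * h)) * (16 * h + 1) <= ?\<phi> * (16 * h + 1)" by (simp add: algebra_simps)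
   then have "27648 * exp (6 * h) <= ?\<phi>" by (rule mult_right_le_imp_le) (use h0 in auto)
   then show "exp (6 * h) <= ?\<phi> / 27648" by simp
  qed simp
  also have "... = ?\<phi> * (h\<^sup>2 / 768)" by simp
  finally show ?thesis .
 qed
 let ?N = "?C - {?x0}"
 have 2: "(\<Sum>X\<in>?N. (norm (A X))\<^sup>2) >= ?\<phi> * h\<^sup>2 / 768"
  using M2 pr sum.remove[OF fC x0, of "%X. (norm (A X))\<^sup>2"] by simp
 have 4: "(\<Sum>X\<in>?N. norm (A X) ^ 4) <= ?\<phi> * (4608 * h ^ 4)"
 proof -
  have "(\<Sum>X\<in>?N. norm (A X) ^ 4) <= (\<Sum>X\<in>?C. norm (A X) ^ 4)" by (rule sum_mono2[OF fC]) auto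
  then show ?thesis using M4 by linarith
 qed
 have fst: "(\<Sum>X\<in>?N. norm (A X)) >= ?\<phi> * h / 5000000"
 proof -
  \<comment> \<open>The scale 4096h balances the moments: the fourth takes 4608 / 4096^3 away from
    the 1 / (768 * 4096) supplied by the second.\<close>
  have f1: "(\<Sum>X\<in>?N. norm (A X)) >= (\<Sum>X\<in>?N. (norm (A X))\<^sup>2) / (4096 * h) - (\<Sum>X\<in>?N. norm (A X) ^ 4) / (4096 * h) ^ 3"
   using h0 by (intro first_moment_from_moments) auto
  have f2: "(\<Sum>X\<in>?N. (norm (A X))\<^sup>2) / (4096 * h) >= (?\<phi> * h\<^sup>2 / 768) / (4096 * h)" using 2 h0 by (intro divide_right_mono) auto
  have f3: "(\<Sum>X\<in>?N. norm (A X) ^ 4) / (4096 * h) ^ 3 <= (?\<phi> * (4608 * h ^ 4)) / (4096 * h) ^ 3" using 4 h0 by (intro divide_right_mono) auto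
  have e2: "(?\<phi> * h\<^sup>2 / 768) / (4096 * h) = ?\<phi> * h / 3145728" using h0 by (simp add: power2_eq_square)
  have e3: "(?\<phi> * (4608 * h ^ 4)) / (4096 * h) ^ 3 = ?\<phi> * h * (4608 / 68719476736)"
   using h0 by (simp add: power_numeral_reduce)
  have f4: "?\<phi> * h >= 0" using \<phi>0 h0 by simp
  have gen: "s2 - s4 <= s1 ==> x / 3145728 <= s2 ==> s4 <= x * (4608 / 68719476736) ==> 0 <= x ==> x / 5000000 <= s1" for s1 s2 s4 x :: real
   by linarith
  show ?thesis by (rule gen[OF f1 f2[unfolded e2] f3[unfolded e3] f4])
 qed
 have snd: "(\<Sum>X\<in>?N. norm (A' X)) <= ?\<phi> * (12 * sqrt h)"
 proof -
  define \<nu> where "\<nu> = 12 * sqrt h"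
  have \<nu>: "\<nu> > 0" "\<nu>\<^sup>2 = 144 * h" using h0 by (auto simp: \<nu>_def power_mult_distrib)
  have "(\<Sum>X\<in>?N. norm (A' X)) <= (\<Sum>X\<in>?C. norm (A' X))" using fC by (intro sum_mono2) auto
  also have "... <= (\<Sum>X\<in>?C. (norm (A' X))\<^sup>2 / (2 * \<nu>) + \<nu> / 2)"
  proof (rule sum_mono)
   fix X
   have "0 <= (norm (A' X) - \<nu>)\<^sup>2" by simp
   then show "norm (A' X) <= (norm (A' X))\<^sup>2 / (2 * \<nu>) + \<nu> / 2" using \<nu>(1) by (simp add: field_simps power2_eq_square)
  qed
  also have "... = (\<Sum>X\<in>?C. (norm (A' X))\<^sup>2) / (2 * \<nu>) + ?\<phi> * (\<nu> / 2)"
   using card_dirichlet_characters[OF q0] by (simp add: sum.distrib sum_divide_distrib)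
  also have "... <= (?\<phi> * \<nu>\<^sup>2) / (2 * \<nu>) + ?\<phi> * (\<nu> / 2)" using R2 \<nu> by (intro add_right_mono divide_right_mono) auto
  also have "... = ?\<phi> * \<nu>" using \<nu>(1) by (simp add: power2_eq_square)
  finally show ?thesis by (simp add: \<nu>_def)
 qed
 \<comment> \<open>Here the size 10^17 of h is consumed: it makes the prime powers at most half of
   the main term h / 5000000.\<close>
 have sq: "12 * sqrt h <= h / 10000000"
 proof -
  have "(120000000::real) ^ 2 <= 10 ^ 17" by simp
  then have "(120000000::real) <= sqrt h" using h by (intro real_le_rsqrt) linarith
  then have "120000000 * sqrt h <= sqrt h * sqrt h" using h0 by (intro mult_right_mono) auto
  also have "sqrt h * sqrt h = h" using h0 by simp
  finally show ?thesis by simp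
 qed
 have "?\<phi> * (12 * sqrt h) <= ?\<phi> * (h / 10000000)" by (rule mult_left_mono[OF sq]) simp
 then have "?\<phi> * h / 10 ^ 7 <= (\<Sum>X\<in>?N. norm (A X)) - (\<Sum>X\<in>?N. norm (A' X))" using fst snd by simp
 also have "... = (\<Sum>X\<in>?N. norm (A X) - norm (A' X))" by (rule sum_subtractf[symmetric])
 also have "... <= (\<Sum>X\<in>?N. norm (windowed h \<sigma> (%n. mangoldt n * X n) t))"
 proof (rule sum_mono)
  fix X assume "X \<in> ?N"
  then show "norm (A X) - norm (A' X) <= norm (windowed h \<sigma> (%n. mangoldt n * X n) t)"
   using split[of X] norm_diff_ineq[of "A X" "A' X"] by simp
 qed
 finally show ?thesis by (simp add: \<sigma>_def)
qed

section \<open>The error term in the progression 1 mod q\<close>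

lemma (in character_zeros) windowed_measurable: "windowed k \<sigma> (%n. mangoldt n * X n) \<in> borel_measurable borel"
 unfolding windowed_def[abs_def] Complex_eq by measurable

lemma sum_of_squares_le:
 fixes f :: "'a => real"
 assumes "!!i. i \<in> I ==> f i >= 0"
 shows "(\<Sum>i\<in>I. (f i)\<^sup>2) <= (\<Sum>i\<in>I. f i)\<^sup>2"
 using assms
proof (induction I rule: infinite_finite_induct)
 case (insert x A)
 have "(\<Sum>i\<in>A. (f i)\<^sup>2) <= (\<Sum>i\<in>A. f i)\<^sup>2" using insert by simp
 moreover have "0 <= f x * (\<Sum>i\<in>A. f i)" using insert by (intro mult_nonneg_nonneg sum_nonneg) auto
 ultimately show ?case using insert by (simp add: power2_sum)
qed auto

locale modulus = zero_data +
 fixes q :: nat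
 assumes q3: "q >= 3"
begin

definition "chars = {X. dirichlet_character q X} - {principal_character q}"
definition "zeros X = {\<gamma>\<in>G q X 0. \<bar>\<gamma>\<bar> <= 1}"
definition "zero_number = (\<Sum>X\<in>chars. \<Sum>\<gamma>\<in>zeros X. real (m q X 0 \<gamma>))"
abbreviation "l \<equiv> ln (real q)"
abbreviation "phi \<equiv> real (totient q)"

lemma q0: "q > 0" and l1: "l >= 1"
 using q3 conductor_log_le'(2)[OF q3] by auto

lemma character: "X \<in> chars ==> character_zeros C G m h q X"
 using q0 by (auto simp: chars_def intro!: character_zeros.intro zero_data_axioms nonprincipal.intro)

lemma finite_chars: "finite chars" and card_chars: "real (card chars) <= phi" and phi: "0 < phi" "phi <= real q"
proof -
 have f: "finite {X. dirichlet_character q X}" by (rule finite_dirichlet_characters[OF q0])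
 show "finite chars" using f by (simp add: chars_def)
 have "card chars <= card {X. dirichlet_character q X}" unfolding chars_def by (rule card_mono[OF f]) auto
 then show "real (card chars) <= phi" using card_dirichlet_characters[OF q0] by simp
 show "0 < phi" "phi <= real q" using q0 by (auto simp: totient_le)
qed

text \<open>Integrate both estimates over |t| <= 1/4: from below by
  \<open>character_window_sum\<close>, from above by \<open>windowed_integral_bound\<close>. The
  condition on \<open>w\<close> makes the total error at most half of the lower bound.\<close>

lemma zero_number_lower:
 assumes l: "l >= 8 * 10 ^ 17" and w: "w >= 0" "w >= character_zeros.window_const C" "320000000 * w <= sqrt l"
 shows "zero_number >= phi * l / 10 ^ 11"
proof -
 let ?W = "%X t. windowed (l / 8) (1 / l) (%n. mangoldt n * X n) t"
 let ?n = "%X. \<Sum>\<gamma>\<in>zeros X. real (m q X 0 \<gamma>)"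
 have n0: "?n X >= 0" for X by (rule sum_nonneg) simp
 have up: "(\<integral>\<^sup>+t. ennreal (norm (?W X t)) * indicator {-(1/4)..1/4} t \<partial>lborel) <= ennreal (256 * ?n X + w * sqrt l)" if "X \<in> chars" for X
 proof -
  have "(\<integral>\<^sup>+t. ennreal (norm (?W X t)) * indicator {-(1/4)..1/4} t \<partial>lborel) <= ennreal (256 * ?n X + character_zeros.window_const C * sqrt l)"
   unfolding zeros_def by (rule character_zeros.windowed_integral_bound[OF character[OF that] q3])
  also have "... <= ennreal (256 * ?n X + w * sqrt l)" using w l1 by (intro ennreal_leI add_left_mono mult_right_mono) auto
  finally show ?thesis .
 qed
 have low: "(\<Sum>X\<in>chars. norm (?W X t)) >= phi * (l / 8) / 10 ^ 7" if "\<bar>t\<bar> <= 1 / 4" for t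
  using character_window_sum[OF q3, of "l / 8" t] that l by (simp add: chars_def)
 have meas [measurable]: "(%t. ennreal (norm (?W X t)) * indicator {-(1/4)..1/4} t) \<in> borel_measurable lborel" if "X \<in> chars" for X
 proof -
  have [measurable]: "?W X \<in> borel_measurable borel" by (rule character_zeros.windowed_measurable[OF character[OF that]])
  show ?thesis by measurable
 qed
 have "ennreal (phi * (l / 8) / 10 ^ 7) * ennreal (1 / 2) = (\<integral>\<^sup>+t. ennreal (phi * (l / 8) / 10 ^ 7) * indicator {-(1/4)..1/4::real} t \<partial>lborel)"
  by (subst nn_integral_cmult_indicator) auto
 also have "... <= (\<integral>\<^sup>+t. (\<Sum>X\<in>chars. ennreal (norm (?W X t)) * indicator {-(1/4)..1/4} t) \<partial>lborel)"
 proof (rule nn_integral_mono)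
  fix t :: real
  show "ennreal (phi * (l / 8) / 10 ^ 7) * indicator {-(1/4)..1/4} t <= (\<Sum>X\<in>chars. ennreal (norm (?W X t)) * indicator {-(1/4)..1/4} t)"
  proof (cases "t \<in> {-(1/4)..1/4}")
   case True
   then have "\<bar>t\<bar> <= 1 / 4" unfolding atLeastAtMost_iff by linarith
   from ennreal_leI[OF low[OF this]] True show ?thesis by (simp add: sum_ennreal)
  qed simp
 qed
 also have "... = (\<Sum>X\<in>chars. \<integral>\<^sup>+t. ennreal (norm (?W X t)) * indicator {-(1/4)..1/4} t \<partial>lborel)"
  by (rule nn_integral_sum) (rule meas)
 also have "... <= (\<Sum>X\<in>chars. ennreal (256 * ?n X + w * sqrt l))" by (rule sum_mono) (rule up)
 also have "... = ennreal (\<Sum>X\<in>chars. 256 * ?n X + w * sqrt l)"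
  by (rule sum_ennreal) (use n0 w l1 in auto)
 also have "(\<Sum>X\<in>chars. 256 * ?n X + w * sqrt l) = 256 * zero_number + real (card chars) * (w * sqrt l)"
  by (simp add: sum.distrib sum_distrib_left zero_number_def)
 finally have "ennreal (phi * (l / 8) / 10 ^ 7) * ennreal (1 / 2) <= ennreal (256 * zero_number + real (card chars) * (w * sqrt l))" .
 moreover have "ennreal (phi * (l / 8) / 10 ^ 7 * (1 / 2)) = ennreal (phi * (l / 8) / 10 ^ 7) * ennreal (1 / 2)"
  by (rule ennreal_mult) (use phi l1 in auto)
 ultimately have "ennreal (phi * (l / 8) / 10 ^ 7 * (1 / 2)) <= ennreal (256 * zero_number + real (card chars) * (w * sqrt l))" by (simp only:)
 moreover have "0 <= 256 * zero_number + real (card chars) * (w * sqrt l)"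
  unfolding zero_number_def using w l1 by (intro add_nonneg_nonneg mult_nonneg_nonneg sum_nonneg) auto
 ultimately have "phi * (l / 8) / 10 ^ 7 * (1 / 2) <= 256 * zero_number + real (card chars) * (w * sqrt l)"
  by (simp only: ennreal_le_iff)
 also have "real (card chars) * (w * sqrt l) <= phi * (l / 320000000)"
 proof (rule mult_mono[OF card_chars])
  have "320000000 * w * sqrt l <= sqrt l * sqrt l" using w l1 by (intro mult_right_mono) auto
  also have "sqrt l * sqrt l = l" using l1 by simp
  finally show "w * sqrt l <= l / 320000000" by simp
 qed (use w l1 phi in auto)
 finally have "phi * l / 160000000 - phi * l / 320000000 <= 256 * zero_number" by simp
 moreover have "phi * l > 0" by (rule mult_pos_pos[OF phi(1)]) (use l1 in linarith)
 ultimately show ?thesis by simp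
qed

definition "residue_coeff n = mangoldt n * ((if [n = 1] (mod q) then 1 else 0) - principal_character q n / of_nat (totient q))"

lemma residue_coeff_eq: "residue_coeff n = (\<Sum>X\<in>chars. mangoldt n * X n) / of_nat (totient q)"
 using phi unfolding sum_distrib_left[symmetric] chars_def sum_nonprincipal_characters[OF q0, of n] by (simp add: residue_coeff_def)

sublocale residue: step_function residue_coeff 1
proof unfold_locales
 fix n
 have "norm ((if [Suc n = 1] (mod q) then 1 else 0) - principal_character q (Suc n) / of_nat (totient q)) <= 1"
 proof (cases "[Suc n = 1] (mod q)")
  case True
  then have "coprime (Suc n) q" by (metis cong_imp_coprime cong_sym coprime_1_left)
  then have "(if [Suc n = 1] (mod q) then 1 else 0) - principal_character q (Suc n) / of_nat (totient q) = complex_of_real (1 - 1 / phi)"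
   using True by (simp add: principal_character_def)
  moreover have "\<bar>1 - 1 / phi\<bar> <= 1"
  proof -
   have "totient q >= 1" using phi(1) unfolding of_nat_0_less_iff by linarith
   then have "phi >= 1" by linarith
   moreover have "0 <= 1 / x" "1 / x <= 1" if "1 <= x" for x :: real using that by (simp_all add: divide_le_eq)
   ultimately have "0 <= 1 / phi" "1 / phi <= 1" by blast+
   then show ?thesis by linarith
  qed
  ultimately show ?thesis by (simp only: norm_of_real)
 next
  case False
  have "totient q >= 1" using phi(1) unfolding of_nat_0_less_iff by linarith
  then have "phi >= 1" by linarith
  moreover have "1 / x <= 1" if "1 <= x" for x :: real using that by (simp add: divide_le_eq)
  ultimately have "1 / phi <= 1" by blast
  then show ?thesis using False by (simp add: principal_character_def norm_divide)
 qed
 then show "norm (residue_coeff (Suc n)) <= 1 * ln (real (Suc n))"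
  unfolding residue_coeff_def norm_mult using mult_mono[OF mangoldt_le_ln[of n], of _ 1] by (simp del: of_nat_Suc)
qed auto

definition "H z = (\<Sum>X\<in>chars. psi_transform X z) / of_nat (totient q)"

lemma F_eq: "residue.F y = (\<Sum>X\<in>chars. step_function.F (%n. mangoldt n * X n) y) / of_nat (totient q)"
proof -
 have F: "step_function.F (%n. mangoldt n * X n) y = step_sum (%n. mangoldt n * X n) y * of_real (exp (- y / 2))" if "X \<in> chars" for X
 proof -
  interpret character_zeros C G m h q X by (rule character[OF that])
  show ?thesis by (rule Psi.F_def)
 qed
 have "step_sum residue_coeff y = (\<Sum>X\<in>chars. step_sum (%n. mangoldt n * X n) y) / of_nat (totient q)"
  unfolding step_sum_def residue_coeff_eq sum_divide_distrib[symmetric] by (subst sum.swap) (rule refl)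
 then show ?thesis unfolding residue.F_def using F by (simp add: sum_distrib_right)
qed

sublocale PW: paley_wiener residue.F H 10 "3 / 5"
proof unfold_locales
 show "H holomorphic_on {z. Re z > 0}"
  unfolding H_def[abs_def] using phi character_zeros.psi_transform_holomorphic[OF character]
  by (intro holomorphic_intros) auto
next
 fix d B :: real assume d: "d > 0"
 have "\<forall>X\<in>chars. \<exists>K. \<forall>z. d <= Re z --> Re z <= B --> norm (psi_transform X z) <= K * (1 + \<bar>Im z\<bar>) powr (- (3 / 4))"
  using character_zeros.psi_transform_bound[OF character d] by blast
 then obtain K where K: "!!X z. X \<in> chars ==> d <= Re z ==> Re z <= B ==> norm (psi_transform X z) <= K X * (1 + \<bar>Im z\<bar>) powr (- (3 / 4))"
  by metis
 have "norm (H z) <= (\<Sum>X\<in>chars. K X) / phi * (1 + \<bar>Im z\<bar>) powr (- (3 / 4))" if "d <= Re z" "Re z <= B" for z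
 proof -
  have "norm (\<Sum>X\<in>chars. psi_transform X z) <= (\<Sum>X\<in>chars. K X * (1 + \<bar>Im z\<bar>) powr (- (3 / 4)))"
   by (rule sum_norm_le) (rule K[OF _ that])
  also have "... = (\<Sum>X\<in>chars. K X) * (1 + \<bar>Im z\<bar>) powr (- (3 / 4))" by (rule sum_distrib_right[symmetric])
  finally show ?thesis unfolding H_def norm_divide using phi by (simp add: divide_right_mono)
 qed
 then show "\<exists>K. \<forall>z. d <= Re z --> Re z <= B --> norm (H z) <= K * (1 + \<bar>Im z\<bar>) powr (- (3 / 4))" by blast
next
 fix z :: complex assume z: "Re z > 3 / 5"
 have L: "integrable lborel (%y. step_function.F (%n. mangoldt n * X n) y * exp (- z * of_real y))"
  "psi_transform X z = (LBINT y. step_function.F (%n. mangoldt n * X n) y * exp (- z * of_real y))" if "X \<in> chars" for X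
 proof -
  interpret character_zeros C G m h q X by (rule character[OF that])
  have "Re z > 0" using z by simp
  from PW.laplace_integrable[OF this]
  show "integrable lborel (%y. step_function.F (%n. mangoldt n * X n) y * exp (- z * of_real y))"
   "psi_transform X z = (LBINT y. step_function.F (%n. mangoldt n * X n) y * exp (- z * of_real y))" by auto
 qed
 have "(LBINT y. residue.F y * exp (- z * of_real y)) = (LBINT y. (\<Sum>X\<in>chars. step_function.F (%n. mangoldt n * X n) y * exp (- z * of_real y)) / of_nat (totient q))"
  unfolding F_eq by (simp add: sum_distrib_right)
 also have "... = (\<Sum>X\<in>chars. LBINT y. step_function.F (%n. mangoldt n * X n) y * exp (- z * of_real y)) / of_nat (totient q)"
  unfolding Bochner_Integration.integral_divide_zero using L(1) by (subst Bochner_Integration.integral_sum) auto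
 also have "... = H z" unfolding H_def using L(2) by simp
 finally show "H z = (LBINT y. residue.F y * exp (- z * of_real y))" by simp
qed (use residue.F_neg residue.F_bound residue.F_cont in auto)

abbreviation "S \<equiv> character_zeros.square_const C"

lemma square_const_nonneg: "S >= 0"
proof -
 have "card chars = totient q - 1"
  unfolding chars_def using card_dirichlet_characters[OF q0] dirichlet_character_principal[of q] by (subst card_Diff_singleton) auto
 then have "card chars > 0" using totient_gt_1[of q] q3 by simp
 then obtain X where "X \<in> chars" by (auto simp: card_gt_0_iff)
 then interpret character_zeros C G m h q X by (rule character)
 show ?thesis unfolding square_const_def by (intro mult_nonneg_nonneg integral_nonneg_AE) auto
qed

text \<open>Cauchy--Schwarz over at most \<open>phi\<close> characters; the division by
  \<open>totient q\<close> in \<open>H\<close> compensates for their number.\<close>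

lemma H_square_upper:
 assumes \<sigma>: "0 < \<sigma>" "\<sigma> <= 1"
 shows "(LBINT t. (norm (H (Complex \<sigma> t)))\<^sup>2) <= S * l\<^sup>2 / \<sigma>"
proof -
 have i: "integrable lborel (%t. (norm (psi_transform X (Complex \<sigma> t)))\<^sup>2)"
  "(LBINT t. (norm (psi_transform X (Complex \<sigma> t)))\<^sup>2) <= S * l\<^sup>2 / \<sigma>" if "X \<in> chars" for X
 proof -
  interpret character_zeros C G m h q X by (rule character[OF that])
  show "integrable lborel (%t. (norm (psi_transform X (Complex \<sigma> t)))\<^sup>2)" by (rule PW.H_square_integrable[OF \<sigma>(1)])
  show "(LBINT t. (norm (psi_transform X (Complex \<sigma> t)))\<^sup>2) <= S * l\<^sup>2 / \<sigma>" by (rule psi_square_integral[OF \<sigma> q3])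
 qed
 have "(LBINT t. (norm (H (Complex \<sigma> t)))\<^sup>2) <= (LBINT t. (1 / phi) * (\<Sum>X\<in>chars. (norm (psi_transform X (Complex \<sigma> t)))\<^sup>2))"
 proof (rule integral_mono)
  show "integrable lborel (%t. (norm (H (Complex \<sigma> t)))\<^sup>2)" by (rule PW.H_square_integrable[OF \<sigma>(1)])
  show "integrable lborel (%t. (1 / phi) * (\<Sum>X\<in>chars. (norm (psi_transform X (Complex \<sigma> t)))\<^sup>2))"
   using i(1) by (intro integrable_mult_right Bochner_Integration.integrable_sum) auto
  fix t
  let ?p = "%X. psi_transform X (Complex \<sigma> t)"
  have "(norm (\<Sum>X\<in>chars. ?p X))\<^sup>2 = (norm (\<Sum>X\<in>chars. of_real 1 * ?p X))\<^sup>2" by simp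
  also have "... <= (\<Sum>X\<in>chars. 1) * (\<Sum>X\<in>chars. 1 * (norm (?p X))\<^sup>2)" by (rule sum_weighted_square_le) simp
  also have "... <= phi * (\<Sum>X\<in>chars. (norm (?p X))\<^sup>2)" using card_chars by (simp add: mult_right_mono sum_nonneg)
  finally have "(norm (H (Complex \<sigma> t)))\<^sup>2 <= phi * (\<Sum>X\<in>chars. (norm (?p X))\<^sup>2) / phi\<^sup>2"
   unfolding H_def norm_divide power_divide using phi by (simp add: divide_right_mono)
  also have "... = (1 / phi) * (\<Sum>X\<in>chars. (norm (?p X))\<^sup>2)" using phi by (simp add: power2_eq_square)
  finally show "(norm (H (Complex \<sigma> t)))\<^sup>2 <= (1 / phi) * (\<Sum>X\<in>chars. (norm (?p X))\<^sup>2)" .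
 qed
 also have "... = (1 / phi) * (\<Sum>X\<in>chars. LBINT t. (norm (psi_transform X (Complex \<sigma> t)))\<^sup>2)"
  unfolding integral_mult_right_zero using i(1) by (subst Bochner_Integration.integral_sum) auto
 also have "... <= (1 / phi) * (\<Sum>X\<in>chars. S * l\<^sup>2 / \<sigma>)" using phi i(2) by (intro mult_left_mono sum_mono) auto
 also have "... = (1 / phi) * (real (card chars) * (S * l\<^sup>2 / \<sigma>))" by simp
 also have "... <= (1 / phi) * (phi * (S * l\<^sup>2 / \<sigma>))"
  using phi card_chars square_const_nonneg \<sigma> by (intro mult_left_mono mult_right_mono) auto
 also have "... = S * l\<^sup>2 / \<sigma>" using phi by simp
 finally show ?thesis .
qed

text \<open>On Re z = \<sigma> every zero adds a Poisson kernel with positive real part, and in the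
  sum over characters these cannot cancel. The 9 comes from |1/2 + z| <= 3 for |t| <= 1, and 242 = 2
  * 11^2 from the squared regular part over an interval of length 2.\<close>

lemma H_square_lower:
 assumes \<sigma>: "0 < \<sigma>" "\<sigma> <= 1"
 shows "9 * phi\<^sup>2 * (LBINT t. (norm (H (Complex \<sigma> t)))\<^sup>2) + 242 * C\<^sup>2 * phi\<^sup>2 * l\<^sup>2 >= zero_number / (8 * \<sigma>)"
proof -
 let ?m = "%X \<gamma>. real (m q X 0 \<gamma>)"
 define p where "p t \<gamma> = \<sigma> / (\<sigma>\<^sup>2 + (t - \<gamma>)\<^sup>2)" for t \<gamma>
 have p0: "p t \<gamma> >= 0" for t \<gamma> using \<sigma> by (simp add: p_def)
 define E where "E = 11 * C * l"
 have E0: "E >= 0" using C l1 by (simp add: E_def)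
 \<comment> \<open>The half of the \<sigma>-neighbourhood of \<gamma> on the side of 0, so that it
   stays within [-1, 1]. On it the Poisson kernel is at least 1 / (2\<sigma>).\<close>
 define J where "J \<gamma> = (if \<gamma> >= 0 then {\<gamma> - \<sigma>..\<gamma>} else {\<gamma>..\<gamma> + \<sigma>})" for \<gamma>
 have fz: "finite (zeros X)" if "X \<in> chars" for X
  using character_zeros.finite_zeros[OF character[OF that]] by (simp add: zeros_def)
 have pt: "(\<Sum>X\<in>chars. \<Sum>\<gamma>\<in>zeros X. ?m X \<gamma> * (1 / (8 * \<sigma>\<^sup>2)) * indicator (J \<gamma>) t) <= 9 * phi\<^sup>2 * (norm (H (Complex \<sigma> t)))\<^sup>2 + phi\<^sup>2 * E\<^sup>2 * indicator {-1..1} t" for t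
 proof (cases "\<bar>t\<bar> <= 1")
  case False
  have "indicator (J \<gamma>) t = (0::real)" if "\<gamma> \<in> zeros X" for \<gamma> X
   using False that \<sigma> by (auto simp: J_def zeros_def indicator_def abs_le_iff)
  then have "(\<Sum>X\<in>chars. \<Sum>\<gamma>\<in>zeros X. ?m X \<gamma> * (1 / (8 * \<sigma>\<^sup>2)) * indicator (J \<gamma>) t) = 0" by (intro sum.neutral ballI) simp
  then show ?thesis by simp
 next
  case True
  let ?z = "Complex \<sigma> t"
  define s where "s X = (\<Sum>\<gamma>\<in>zeros X. ?m X \<gamma> * p t \<gamma>)" for X
  have s0: "s X >= 0" for X unfolding s_def by (intro sum_nonneg mult_nonneg_nonneg p0) simp
  have re: "Re (log_deriv_half X ?z) >= s X - E" if X: "X \<in> chars" for X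
  proof -
   interpret character_zeros C G m h q X by (rule character[OF X])
   have zb: "?z \<in> cball (center 0) (27 / 10)" "?z \<in> ball (center 0) (14 / 5)" using near_center[of ?z 0] \<sigma> True by auto
   have t1: "Re (of_nat (m q X 0 \<gamma>) / (?z - \<i> * of_real \<gamma>)) = ?m X \<gamma> * p t \<gamma>" for \<gamma>
   proof -
    have "?z - \<i> * of_real \<gamma> = Complex \<sigma> (t - \<gamma>)" by (simp add: complex_eq_iff)
    then show ?thesis by (simp add: p_def Re_divide cmod_power2)
   qed
   have "Re (log_deriv_half X ?z) = (\<Sum>\<gamma>\<in>G q X 0. ?m X \<gamma> * p t \<gamma>) + Re (h q X 0 ?z)"
    using expansion[OF zb(2)] \<sigma> by (simp add: Re_sum t1)
   moreover have "s X <= (\<Sum>\<gamma>\<in>G q X 0. ?m X \<gamma> * p t \<gamma>)"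
    unfolding s_def zeros_def using finite_zeros p0 by (intro sum_mono2 mult_nonneg_nonneg) auto
   moreover have "\<bar>Re (h q X 0 ?z)\<bar> <= E"
   proof -
    have "\<bar>Re (h q X 0 ?z)\<bar> <= C * conductor_log q 0" using remainder_bound[OF zb(1)] abs_Re_le_cmod order_trans by blast
    also have "... <= C * (11 * l)" using conductor_log_le'(1)[OF q3, of 0] C by (intro mult_left_mono) auto
    finally show ?thesis by (simp add: E_def)
   qed
   ultimately show ?thesis by linarith
  qed
  have "(\<Sum>X\<in>chars. s X) - phi * E <= (\<Sum>X\<in>chars. s X) - real (card chars) * E" using card_chars E0 by (simp add: mult_right_mono)
  also have "... = (\<Sum>X\<in>chars. s X - E)" by (simp add: sum_subtractf)
  also have "... <= (\<Sum>X\<in>chars. Re (log_deriv_half X ?z))" by (intro sum_mono re)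
  also have "... = Re (\<Sum>X\<in>chars. log_deriv_half X ?z)" by simp
  also have "... <= norm (\<Sum>X\<in>chars. log_deriv_half X ?z)" by (rule complex_Re_le_cmod)
  also have "(\<Sum>X\<in>chars. log_deriv_half X ?z) = - (of_nat (totient q) * (1 / 2 + ?z) * H ?z)"
  proof -
   have "1 / 2 + ?z ~= 0" using \<sigma> by (simp add: complex_eq_iff)
   then show ?thesis unfolding H_def psi_transform_def using phi by (simp add: sum_negf flip: sum_divide_distrib)
  qed
  also have "norm (- (of_nat (totient q) * (1 / 2 + ?z) * H ?z)) = phi * norm (1 / 2 + ?z) * norm (H ?z)" by (simp add: norm_mult)
  also have "... <= phi * 3 * norm (H ?z)"
   using cmod_le[of "1 / 2 + ?z"] \<sigma> True by (intro mult_right_mono mult_left_mono) auto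
  finally have b: "(\<Sum>X\<in>chars. s X) <= 3 * phi * norm (H ?z) + phi * E" by simp
  have gen: "x\<^sup>2 / 2 <= u\<^sup>2 + v\<^sup>2" if "x <= u + v" "0 <= x" for x u v :: real
  proof -
   have "x\<^sup>2 <= (u + v)\<^sup>2" using that by (intro power_mono) auto
   also have "... <= 2 * (u\<^sup>2 + v\<^sup>2)" using sum_squares_bound[of u v] by (simp add: power2_sum)
   finally show ?thesis by simp
  qed
  have "(\<Sum>X\<in>chars. s X)\<^sup>2 / 2 <= (3 * phi * norm (H ?z))\<^sup>2 + (phi * E)\<^sup>2"
   by (rule gen[OF b]) (intro sum_nonneg s0)
  \<comment> \<open>The square of a sum of nonnegative terms dominates the sum of their squares, so
    the argument is indifferent to coincidences among zeros; multiplicities obey m <= m^2.\<close>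
  moreover have "(\<Sum>X\<in>chars. \<Sum>\<gamma>\<in>zeros X. ?m X \<gamma> * (1 / (4 * \<sigma>\<^sup>2)) * indicator (J \<gamma>) t) <= (\<Sum>X\<in>chars. s X)\<^sup>2"
  proof -
   have "(\<Sum>X\<in>chars. \<Sum>\<gamma>\<in>zeros X. ?m X \<gamma> * (1 / (4 * \<sigma>\<^sup>2)) * indicator (J \<gamma>) t) <= (\<Sum>X\<in>chars. \<Sum>\<gamma>\<in>zeros X. (?m X \<gamma> * p t \<gamma>)\<^sup>2)"
   proof (intro sum_mono)
    fix X \<gamma>
    have mm: "?m X \<gamma> <= (?m X \<gamma>)\<^sup>2"
     by (metis of_nat_le_iff of_nat_power le_square power2_eq_square)
    have "1 / (4 * \<sigma>\<^sup>2) * indicator (J \<gamma>) t <= (p t \<gamma>)\<^sup>2"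
    proof (cases "t \<in> J \<gamma>")
     case True
     then have "\<bar>t - \<gamma>\<bar> <= \<sigma>" using \<sigma> by (auto simp: J_def split: if_splits)
     then have "(t - \<gamma>)\<^sup>2 <= \<sigma>\<^sup>2" using \<sigma> by (simp add: abs_le_square_iff[symmetric])
     then have "\<sigma> / (2 * \<sigma>\<^sup>2) <= p t \<gamma>" unfolding p_def using \<sigma> by (intro divide_left_mono mult_pos_pos add_pos_nonneg) auto
     then have "(\<sigma> / (2 * \<sigma>\<^sup>2))\<^sup>2 <= (p t \<gamma>)\<^sup>2" using \<sigma> by (intro power_mono) auto
     moreover have "(\<sigma> / (2 * \<sigma>\<^sup>2))\<^sup>2 = 1 / (4 * \<sigma>\<^sup>2)" using \<sigma> by (simp add: power2_eq_square)
     ultimately show ?thesis using True by simp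
    qed simp
    then have "?m X \<gamma> * (1 / (4 * \<sigma>\<^sup>2) * indicator (J \<gamma>) t) <= (?m X \<gamma>)\<^sup>2 * (p t \<gamma>)\<^sup>2"
     using mm by (intro mult_mono) auto
    then show "?m X \<gamma> * (1 / (4 * \<sigma>\<^sup>2)) * indicator (J \<gamma>) t <= (?m X \<gamma> * p t \<gamma>)\<^sup>2"
     by (simp only: power_mult_distrib mult.assoc)
   qed
   also have "... <= (\<Sum>X\<in>chars. (s X)\<^sup>2)" unfolding s_def by (intro sum_mono sum_of_squares_le mult_nonneg_nonneg p0) simp
   also have "... <= (\<Sum>X\<in>chars. s X)\<^sup>2" by (rule sum_of_squares_le) (rule s0)
   finally show ?thesis .
  qed
  moreover have "(\<Sum>X\<in>chars. \<Sum>\<gamma>\<in>zeros X. ?m X \<gamma> * (1 / (8 * \<sigma>\<^sup>2)) * indicator (J \<gamma>) t) = (\<Sum>X\<in>chars. \<Sum>\<gamma>\<in>zeros X. ?m X \<gamma> * (1 / (4 * \<sigma>\<^sup>2)) * indicator (J \<gamma>) t) / 2"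
   unfolding sum_divide_distrib by (intro sum.cong refl) simp
  moreover have "indicator {-1..1} t = (1::real)" using True by (auto simp: indicator_def abs_le_iff)
  ultimately show ?thesis by (simp add: power_mult_distrib)
 qed
 have Jm: "J \<gamma> \<in> sets lborel" "emeasure lborel (J \<gamma>) < \<infinity>" "measure lborel (J \<gamma>) = \<sigma>" for \<gamma> using \<sigma> by (auto simp: J_def)
 have Ji: "integrable lborel (%t. ?m X \<gamma> * (1 / (8 * \<sigma>\<^sup>2)) * indicator (J \<gamma>) t)"
  "(LBINT t. ?m X \<gamma> * (1 / (8 * \<sigma>\<^sup>2)) * indicator (J \<gamma>) t) = ?m X \<gamma> / (8 * \<sigma>)" for X \<gamma>
 proof -
  show "integrable lborel (%t. ?m X \<gamma> * (1 / (8 * \<sigma>\<^sup>2)) * indicator (J \<gamma>) t)"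
   using Jm by (intro integrable_mult_right integrable_real_indicator) auto
  show "(LBINT t. ?m X \<gamma> * (1 / (8 * \<sigma>\<^sup>2)) * indicator (J \<gamma>) t) = ?m X \<gamma> / (8 * \<sigma>)"
   using Jm \<sigma> by (simp add: power2_eq_square)
 qed
 have Hi: "integrable lborel (%t. 9 * phi\<^sup>2 * (norm (H (Complex \<sigma> t)))\<^sup>2)" by (intro integrable_mult_right PW.H_square_integrable \<sigma>)
 have Ei: "integrable lborel (%t::real. phi\<^sup>2 * E\<^sup>2 * indicator {-1..1} t)" by (intro integrable_mult_right) simp
 have "zero_number / (8 * \<sigma>) = (\<Sum>X\<in>chars. \<Sum>\<gamma>\<in>zeros X. ?m X \<gamma> / (8 * \<sigma>))"
  unfolding zero_number_def sum_divide_distrib by (rule refl)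
 also have "... = (LBINT t. (\<Sum>X\<in>chars. \<Sum>\<gamma>\<in>zeros X. ?m X \<gamma> * (1 / (8 * \<sigma>\<^sup>2)) * indicator (J \<gamma>) t))"
  by (simp only: Bochner_Integration.integral_sum Bochner_Integration.integrable_sum Ji)
 also have "... <= (LBINT t. 9 * phi\<^sup>2 * (norm (H (Complex \<sigma> t)))\<^sup>2 + phi\<^sup>2 * E\<^sup>2 * indicator {-1..1} t)"
  by (intro integral_mono Bochner_Integration.integrable_sum Ji Bochner_Integration.integrable_add Hi Ei pt)
 also have "... = 9 * phi\<^sup>2 * (LBINT t. (norm (H (Complex \<sigma> t)))\<^sup>2) + phi\<^sup>2 * E\<^sup>2 * 2"
  unfolding Bochner_Integration.integral_add[OF Hi Ei] integral_mult_right_zero by simp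
 finally show ?thesis by (simp add: E_def power_mult_distrib algebra_simps)
qed

end

context modulus
begin

text \<open>If the error term were small throughout (U, V), its mean square at \<sigma> = 4l / V
  would be too small for the zeros: y <= U contributes at most order l^2 U, against a required order
  l / (phi \<sigma>), and y >= V is suppressed exponentially. \<open>n1\<close>, \<open>n2\<close>
  and \<open>n3\<close> say that the regular part and these two ranges are negligible.\<close>

lemma residue_large_value:
 fixes c w U V :: real
 defines "c \<equiv> 1 / 10 ^ 11"
 assumes l: "l >= 8 * 10 ^ 17" and w: "w >= 0" "w >= character_zeros.window_const C" "320000000 * w <= sqrt l"
  and U: "U >= 1" and V: "(real q)\<^sup>2 <= V"
  and n1: "242 * C\<^sup>2 * (4 * l\<^sup>2 / real q) <= c / 16" and n2: "6 * S * l\<^sup>2 * (real q * U / V) <= c / 9216" and n3: "S * l / real q ^ 3 <= c / 9216"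
 shows "\<exists>y. U < y \<and> y < V \<and> norm (residue.F y) >= sqrt (c / 1152) * sqrt (l / phi)"
proof (rule ccontr)
 assume neg: "\<not> ?thesis"
 have c0: "c > 0" by (simp add: c_def)
 define \<eta> where "\<eta> = sqrt (c / 1152) * sqrt (l / phi)"
 have \<eta>: "\<eta> >= 0" "\<eta>\<^sup>2 = c / 1152 * (l / phi)" using c0 l1 phi by (auto simp: \<eta>_def power_mult_distrib)
 have small: "norm (residue.F y) <= \<eta>" if "U < y" "y < V" for y using neg that unfolding \<eta>_def by (meson less_imp_le not_le)
 have lq: "l <= real q" using ln_le_minus_one[of "real q"] q0 by simp
 have q4: "real q >= 4" using l lq by simp
 have qpos: "real q > 0" using q0 by simp
 have V0: "V > 0" using V qpos by (intro less_le_trans[OF _ V]) simp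
 \<comment> \<open>Chosen so that exp(-\<sigma>V) = q^(-4).\<close>
 define \<sigma> where "\<sigma> = 4 * l / V"
 have \<sigma>0: "\<sigma> > 0" using l1 V0 by (simp add: \<sigma>_def)
 have \<sigma>q: "\<sigma> <= 4 * l / (real q)\<^sup>2" unfolding \<sigma>_def using V l1 qpos V0 by (intro divide_left_mono mult_pos_pos) auto
 have \<sigma>1: "\<sigma> <= 1"
 proof -
  have "4 * l <= real q * real q" using lq q4 l1 by (intro mult_mono) auto
  then have "4 * l / (real q)\<^sup>2 <= 1" using qpos by (simp add: power2_eq_square)
  then show ?thesis using \<sigma>q by linarith
 qed
 let ?I = "%s. LBINT y. (norm (residue.F y))\<^sup>2 * exp (- s * (2 * max 0 y))"
 have up: "?I s <= S * l\<^sup>2 / (6 * s)" if "0 < s" "s <= 1" for s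
 proof -
  have "6 * ?I s <= 2 * pi * ?I s" using pi_gt3 by (intro mult_right_mono Bochner_Integration.integral_nonneg) auto
  also have "... <= S * l\<^sup>2 / s" using H_square_upper[OF that] PW.plancherel_laplace(2)[OF that(1)] by simp
  finally show ?thesis by simp
 qed
 define E where "E y = norm (indicator {0..} y *\<^sub>R exp (- complex_of_real (2 * \<sigma>) * of_real y))" for y :: real
 have s2: "Re (complex_of_real (2 * \<sigma>)) > 0" using \<sigma>0 by simp
 have Ei: "integrable lborel E" "(LBINT y. E y) = 1 / (2 * \<sigma>)"
 proof -
  show "integrable lborel E" unfolding E_def[abs_def] by (rule integrable_norm[OF exp_tail_integral(1)[OF s2]])
  show "(LBINT y. E y) = 1 / (2 * \<sigma>)" unfolding E_def exp_tail_integral(3)[OF s2] by simp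
 qed
 have Ey: "E y = exp (- (2 * \<sigma> * y))" if "y >= 0" for y using that by (simp add: E_def norm_exp_eq_Re)
 have E0: "E y >= 0" for y by (simp add: E_def)
 have U1: "0 < 1 / U" "1 / U <= 1" and \<sigma>2: "0 < \<sigma> / 2" "\<sigma> / 2 <= 1" using U \<sigma>0 \<sigma>1 by auto
 have ii: "integrable lborel (%y. (norm (residue.F y))\<^sup>2 * exp (- s * (2 * max 0 y)))" if "s > 0" for s
  using PW.plancherel_laplace(1)[OF that] .
 \<comment> \<open>Up to \<open>U\<close> the weight is at most exp(2) times the one of rate 1 / U.
   Beyond \<open>V\<close> half of the rate is given up to extract exp(-\<sigma>V), and the other
   half keeps the integral convergent.\<close>
 have pt: "(norm (residue.F y))\<^sup>2 * exp (- \<sigma> * (2 * max 0 y)) <=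
   exp 2 * ((norm (residue.F y))\<^sup>2 * exp (- (1 / U) * (2 * max 0 y))) + \<eta>\<^sup>2 * E y + exp (- (\<sigma> * V)) * ((norm (residue.F y))\<^sup>2 * exp (- (\<sigma> / 2) * (2 * max 0 y)))" for y
 proof -
  let ?F = "(norm (residue.F y))\<^sup>2"
  have t: "0 <= exp 2 * (?F * exp (- (1 / U) * (2 * max 0 y)))" "0 <= \<eta>\<^sup>2 * E y" "0 <= exp (- (\<sigma> * V)) * (?F * exp (- (\<sigma> / 2) * (2 * max 0 y)))"
   using E0 by auto
  consider "y < 0" | "0 <= y" "y <= U" | "U < y" "y < V" | "U < y" "V <= y" by linarith
  then show ?thesis
  proof cases
   case 1
   then show ?thesis using residue.F_neg[of y] t by simp
  next
   case 2
   have "exp (- \<sigma> * (2 * max 0 y)) <= exp 2 * exp (- (1 / U) * (2 * max 0 y))"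
   proof -
    have "0 <= \<sigma> * y" using 2 \<sigma>0 by simp
    moreover have "y / U <= 1" using 2 U by simp
    ultimately have "- \<sigma> * (2 * max 0 y) <= 2 + - (1 / U) * (2 * max 0 y)" using 2 by simp
    then show ?thesis by (simp only: exp_add[symmetric] exp_le_cancel_iff)
   qed
   then have "?F * exp (- \<sigma> * (2 * max 0 y)) <= ?F * (exp 2 * exp (- (1 / U) * (2 * max 0 y)))" by (rule mult_left_mono) simp
   also have "... = exp 2 * (?F * exp (- (1 / U) * (2 * max 0 y)))" by (simp only: mult.left_commute)
   finally show ?thesis using t by linarith
  next
   case 3
   have "?F <= \<eta>\<^sup>2" using small[OF 3] by (intro power_mono) auto
   moreover have "exp (- \<sigma> * (2 * max 0 y)) = E y" using 3 U by (simp add: Ey mult_ac)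
   ultimately have "?F * exp (- \<sigma> * (2 * max 0 y)) <= \<eta>\<^sup>2 * E y" using mult_right_mono[OF _ E0] by simp
   then show ?thesis using t by linarith
  next
   case 4
   have "exp (- \<sigma> * (2 * max 0 y)) <= exp (- (\<sigma> * V)) * exp (- (\<sigma> / 2) * (2 * max 0 y))"
   proof -
    have "\<sigma> * V <= \<sigma> * y" using 4 \<sigma>0 by (intro mult_left_mono) auto
    then have "- \<sigma> * (2 * max 0 y) <= - (\<sigma> * V) + - (\<sigma> / 2) * (2 * max 0 y)" using 4 U by simp
    then show ?thesis by (simp only: exp_add[symmetric] exp_le_cancel_iff)
   qed
   then have "?F * exp (- \<sigma> * (2 * max 0 y)) <= ?F * (exp (- (\<sigma> * V)) * exp (- (\<sigma> / 2) * (2 * max 0 y)))" by (rule mult_left_mono) simp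
   also have "... = exp (- (\<sigma> * V)) * (?F * exp (- (\<sigma> / 2) * (2 * max 0 y)))" by (simp only: mult.left_commute)
   finally show ?thesis using t by linarith
  qed
 qed
 note i1 = integrable_mult_right[OF ii[OF U1(1)], of "exp 2"] and i2 = integrable_mult_right[OF Ei(1), of "\<eta>\<^sup>2"] and i3 = integrable_mult_right[OF ii[OF \<sigma>2(1)], of "exp (- (\<sigma> * V))"]
 have "?I \<sigma> <= (LBINT y. exp 2 * ((norm (residue.F y))\<^sup>2 * exp (- (1 / U) * (2 * max 0 y))) + \<eta>\<^sup>2 * E y + exp (- (\<sigma> * V)) * ((norm (residue.F y))\<^sup>2 * exp (- (\<sigma> / 2) * (2 * max 0 y))))"
  by (intro integral_mono ii[OF \<sigma>0] Bochner_Integration.integrable_add i1 i2 i3 pt)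
 also have "... = exp 2 * ?I (1 / U) + \<eta>\<^sup>2 * (1 / (2 * \<sigma>)) + exp (- (\<sigma> * V)) * ?I (\<sigma> / 2)"
  unfolding Bochner_Integration.integral_add[OF Bochner_Integration.integrable_add[OF i1 i2] i3] Bochner_Integration.integral_add[OF i1 i2] integral_mult_right_zero Ei(2) by (rule refl)
 also have "... <= 9 * (S * l\<^sup>2 / (6 * (1 / U))) + \<eta>\<^sup>2 * (1 / (2 * \<sigma>)) + exp (- (\<sigma> * V)) * (S * l\<^sup>2 / (6 * (\<sigma> / 2)))"
 proof (intro add_mono mult_mono mult_left_mono order_refl up U1 \<sigma>2)
  have "exp (2::real) = exp 1 * exp 1" by (simp flip: exp_add)
  also have "... <= 3 * 3" using exp_le by (intro mult_mono) auto
  finally show "exp (2::real) <= 9" by simp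
 qed (use \<sigma>0 in auto)
 also have "exp (- (\<sigma> * V)) = 1 / real q ^ 4"
 proof -
  have "- (\<sigma> * V) = - (4 * l)" using V0 by (simp add: \<sigma>_def)
  also have "exp (- (4 * l)) = 1 / real q ^ 4"
   using exp_of_nat_mult[of 4 l] qpos by (simp add: exp_minus divide_inverse)
  finally show ?thesis .
 qed
 finally have hi: "?I \<sigma> <= 9 * (S * l\<^sup>2 / (6 * (1 / U))) + \<eta>\<^sup>2 * (1 / (2 * \<sigma>)) + 1 / real q ^ 4 * (S * l\<^sup>2 / (6 * (\<sigma> / 2)))" .
 have "phi * l / 10 ^ 11 / (8 * \<sigma>) <= zero_number / (8 * \<sigma>)"
  using zero_number_lower[OF l w] \<sigma>0 by (intro divide_right_mono) auto
 also have "... <= 9 * phi\<^sup>2 * (2 * pi * ?I \<sigma>) + 242 * C\<^sup>2 * phi\<^sup>2 * l\<^sup>2"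
  using H_square_lower[OF \<sigma>0 \<sigma>1] PW.plancherel_laplace(2)[OF \<sigma>0] by simp
 also have "9 * phi\<^sup>2 * (2 * pi * ?I \<sigma>) <= 9 * phi\<^sup>2 * (8 * ?I \<sigma>)"
  using pi_less_4 by (intro mult_left_mono mult_right_mono Bochner_Integration.integral_nonneg) auto
 finally have lo: "c * phi * l / (8 * \<sigma>) <= 72 * phi\<^sup>2 * ?I \<sigma> + 242 * C\<^sup>2 * phi\<^sup>2 * l\<^sup>2" by (simp add: c_def)
 \<comment> \<open>This scaling turns the contribution of the zeros into the constant c / 8.\<close>
 define k where "k = \<sigma> / (phi * l)"
 have lpos: "l > 0" using l1 by linarith
 have pl: "phi * l > 0" by (rule mult_pos_pos[OF phi(1)]) (use l1 in linarith)
 have k0: "k > 0" unfolding k_def by (rule divide_pos_pos[OF \<sigma>0 pl])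
 have ql: "\<sigma> * phi * l <= 4 * l\<^sup>2 / real q"
 proof -
  have "\<sigma> * phi * l <= (4 * l / (real q)\<^sup>2) * real q * l" using \<sigma>q \<sigma>0 phi l1 by (intro mult_mono) auto
  also have "... = 4 * l\<^sup>2 / real q" using qpos by (simp add: power2_eq_square)
  finally show ?thesis .
 qed
 have "k * (c * phi * l / (8 * \<sigma>)) <= k * (72 * phi\<^sup>2 * ?I \<sigma> + 242 * C\<^sup>2 * phi\<^sup>2 * l\<^sup>2)" by (rule mult_left_mono[OF lo less_imp_le[OF k0]])
 moreover have "k * (c * phi * l / (8 * \<sigma>)) = c / 8"
 proof -
  have "s / (p * L) * (d * p * L / (8 * s)) = d / 8" if "p > 0" "L > 0" "s > 0" for s p L d :: real
   using that by (simp add: field_simps)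
  from this[OF phi(1) lpos \<sigma>0] show ?thesis unfolding k_def .
 qed
 moreover have "k * (72 * phi\<^sup>2 * ?I \<sigma> + 242 * C\<^sup>2 * phi\<^sup>2 * l\<^sup>2) = 72 * (phi * \<sigma> / l * ?I \<sigma>) + 242 * C\<^sup>2 * (\<sigma> * phi * l)"
 proof -
  have "s / (p * L) * (72 * p\<^sup>2 * i + 242 * d\<^sup>2 * p\<^sup>2 * L\<^sup>2) = 72 * (p * s / L * i) + 242 * d\<^sup>2 * (s * p * L)" if "p > 0" "L > 0" for s p L d i :: real
   using that by (simp add: field_simps power2_eq_square)
  from this[OF phi(1) lpos] show ?thesis unfolding k_def .
 qed
 moreover have "242 * C\<^sup>2 * (\<sigma> * phi * l) <= c / 16" by (rule order_trans[OF mult_left_mono[OF ql] n1]) simp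
 ultimately have "c / 16 <= 72 * (phi * \<sigma> / l * ?I \<sigma>)" by linarith
 also have "... <= 72 * (phi * \<sigma> / l * (9 * (S * l\<^sup>2 / (6 * (1 / U))) + \<eta>\<^sup>2 * (1 / (2 * \<sigma>)) + 1 / real q ^ 4 * (S * l\<^sup>2 / (6 * (\<sigma> / 2)))))"
  using phi \<sigma>0 l1 by (intro mult_left_mono hi) auto
 also have "phi * \<sigma> / l * (9 * (S * l\<^sup>2 / (6 * (1 / U))) + \<eta>\<^sup>2 * (1 / (2 * \<sigma>)) + 1 / real q ^ 4 * (S * l\<^sup>2 / (6 * (\<sigma> / 2))))
   = 3 / 2 * S * l * U * (\<sigma> * phi) + c / 2304 + S * l * phi / (3 * real q ^ 4)"
 proof -
  have "p * s / L * (9 * (r * L\<^sup>2 / (6 * (1 / u))) + c / 1152 * (L / p) * (1 / (2 * s)) + 1 / Q * (r * L\<^sup>2 / (6 * (s / 2)))) = 3 / 2 * r * L * u * (s * p) + c / 2304 + r * L * p / (3 * Q)"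
   if "p > 0" "L > 0" "s > 0" "u > 0" "Q > 0" for p s L r u Q :: real
   using that by (simp add: field_simps power2_eq_square)
  note gen = this
  have "U > 0" "real q ^ 4 > 0" using U qpos by simp_all
  from gen[OF phi(1) lpos \<sigma>0 this] show ?thesis unfolding \<eta>(2) .
 qed
 also have "3 / 2 * S * l * U * (\<sigma> * phi) <= 6 * S * l\<^sup>2 * (real q * U / V)"
 proof -
  have "3 / 2 * S * l * U * (\<sigma> * phi) <= 3 / 2 * S * l * U * (\<sigma> * real q)"
   using phi \<sigma>0 l1 U square_const_nonneg by (intro mult_left_mono) auto
  also have "... = 6 * S * l\<^sup>2 * (real q * U / V)" by (simp add: \<sigma>_def power2_eq_square)
  finally show ?thesis .
 qed
 also have "S * l * phi / (3 * real q ^ 4) <= S * l / real q ^ 3"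
 proof -
  have "S * l * phi / (3 * real q ^ 4) <= S * l * (3 * real q) / (3 * real q ^ 4)"
   using phi l1 square_const_nonneg qpos by (intro divide_right_mono mult_left_mono) auto
  also have "... = S * l / real q ^ 3" using qpos by (simp add: power_numeral_reduce)
  finally show ?thesis .
 qed
 \<comment> \<open>The contradiction is numerical: 72 (1/9216 + 1/2304 + 1/9216) = 3/64 is smaller
   than 1/16.\<close>
 finally have "c / 16 <= 72 * (6 * S * l\<^sup>2 * (real q * U / V) + c / 2304 + S * l / real q ^ 3)" by simp
 also have "... <= 72 * (c / 9216 + c / 2304 + c / 9216)" by (intro mult_left_mono add_mono n2 n3 order_refl) simp
 finally show False using c0 by simp
qed

lemma norm_F_eq:
 "norm (residue.F y) = \<bar>psi_residue (exp y) q 1 - psi_coprime (exp y) q / phi\<bar> * exp (- y / 2)"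
proof -
 let ?A = "{n::nat. 1 <= n \<and> real n <= exp y}"
 have "psi_residue (exp y) q 1 = (\<Sum>n\<in>{n\<in>?A. [n = 1] (mod q)}. mangoldt n)"
  unfolding psi_residue_def by (rule sum.cong) auto
 also have "... = (\<Sum>n\<in>?A. if [n = 1] (mod q) then mangoldt n else 0)" by (rule sum.inter_filter[OF finite_step_set])
 finally have r: "psi_residue (exp y) q 1 = (\<Sum>n\<in>?A. if [n = 1] (mod q) then mangoldt n else 0)" .
 have "psi_coprime (exp y) q = (\<Sum>n\<in>{n\<in>?A. coprime n q}. mangoldt n)"
  unfolding psi_coprime_def by (rule sum.cong) auto
 also have "... = (\<Sum>n\<in>?A. if coprime n q then mangoldt n else 0)" by (rule sum.inter_filter[OF finite_step_set])
 finally have p: "psi_coprime (exp y) q = (\<Sum>n\<in>?A. if coprime n q then mangoldt n else 0)" .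
 have "residue_coeff n = complex_of_real ((if [n = 1] (mod q) then mangoldt n else 0) - (if coprime n q then mangoldt n else 0) / phi)" for n
 proof -
  have "(mangoldt n :: complex) = of_real (mangoldt n)" by (simp add: mangoldt_def)
  then show ?thesis unfolding residue_coeff_def principal_character_def by (simp add: right_diff_distrib)
 qed
 then have "step_sum residue_coeff y = complex_of_real (psi_residue (exp y) q 1 - psi_coprime (exp y) q / phi)"
  unfolding step_sum_def r p by (simp add: sum_subtractf sum_divide_distrib)
 then show ?thesis unfolding residue.F_def norm_mult by (simp only: norm_of_real abs_exp_cancel)
qed

end

lemma eventually_small_real_nat:
 fixes f :: "real => real"
 assumes "(f \<longlongrightarrow> 0) at_top" "d > 0"
 shows "\<forall>\<^sub>F n :: nat in at_top. k * f (real n) <= d"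
proof -
 have "((%x. k * f x) \<longlongrightarrow> 0) at_top" using tendsto_mult[OF tendsto_const assms(1), of k] by simp
 then have "((%n. k * f (real n)) \<longlongrightarrow> 0) sequentially"
  using filterlim_compose[OF _ filterlim_real_sequentially] by blast
 then have "\<forall>\<^sub>F n in sequentially. k * f (real n) < d" using assms(2) by (rule order_tendstoD(2))
 then show ?thesis by (rule eventually_mono) simp
qed

theorem corollary1p5:
  assumes "GRH"
  shows "\<exists>c>0. \<exists>\<epsilon>\<^sub>0>0. \<forall>\<epsilon> M :: real. \<forall>g :: real \<Rightarrow> real.
           0 < \<epsilon> \<longrightarrow> \<epsilon> < \<epsilon>\<^sub>0 \<longrightarrow> M > 1 + \<epsilon> \<longrightarrow>
           (\<forall>u\<ge>1. g u \<ge> 3) \<longrightarrow> mono_on {1..} g \<longrightarrow> filterlim g at_top at_top \<longrightarrow>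
           (\<forall>\<^sub>F u in at_top. g u \<le> u powr (1 / M)) \<longrightarrow>
           (\<forall>\<^sub>F q :: nat in at_top. \<exists>x :: real. x > 0 \<and> ln x \<ge> 1 \<and>
              (ln x powr (1 - 1 / M - 2 * \<epsilon>) \<ge> 1 \<longrightarrow> g (ln x powr (1 - 1 / M - 2 * \<epsilon>)) \<le> real q) \<and>
              real q \<le> g (ln x) \<and>
              \<bar>psi_residue x q 1 - psi_coprime x q / real (totient q)\<bar>
                \<ge> c * ((x * ln (real q)) powr (1 / 2) / real (totient q) powr (1 / 2)))"
proof -
 obtain C G m h where "zero_data C G m h" by (rule zero_data_exists[OF assms])
 then interpret zero_data C G m h .
 define w where "w = max 0 (character_zeros.window_const C)"
 define S where "S = character_zeros.square_const C"
 define c :: real where "c = 1 / 10 ^ 11"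
 have c0: "c > 0" by (simp add: c_def)
 \<comment> \<open>The constant is fixed before \<epsilon>, \<open>M\<close> and \<open>g\<close>;
   these only decide how large \<open>q\<close> must be.\<close>
 have main: "\<forall>\<^sub>F q :: nat in at_top. \<exists>x :: real. x > 0 \<and> ln x >= 1 \<and>
       (ln x powr (1 - 1 / M - 2 * \<epsilon>) >= 1 --> g (ln x powr (1 - 1 / M - 2 * \<epsilon>)) <= real q) \<and>
       real q <= g (ln x) \<and>
       \<bar>psi_residue x q 1 - psi_coprime x q / real (totient q)\<bar>
        >= sqrt (c / 1152) * ((x * ln (real q)) powr (1 / 2) / real (totient q) powr (1 / 2))"
  if \<epsilon>: "0 < \<epsilon>" and M: "M > 1 + \<epsilon>" and mono: "mono_on {1..} g" and lim: "filterlim g at_top at_top"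
   and gM: "\<forall>\<^sub>F u in at_top. g u <= u powr (1 / M)" for \<epsilon> M :: real and g :: "real => real"
 proof -
  obtain u0 where u0: "u0 >= 1" "!!u. u >= u0 ==> g u <= u powr (1 / M)"
  proof -
   obtain b where "!!u. u >= b ==> g u <= u powr (1 / M)" using gM unfolding eventually_at_top_linorder by blast
   then show ?thesis by (intro that[of "max 1 b"]) auto
  qed
  have M1: "M > 1" using \<epsilon> M by simp
  have e1: "\<forall>\<^sub>F q :: nat in at_top. ln (real q) >= 8 * 10 ^ 17"
   using filterlim_compose[OF ln_at_top filterlim_real_sequentially] by (simp add: filterlim_at_top)
  have e2: "\<forall>\<^sub>F q :: nat in at_top. sqrt (ln (real q)) >= 320000000 * w"
   using filterlim_compose[OF filterlim_compose[OF sqrt_at_top ln_at_top] filterlim_real_sequentially] by (simp add: filterlim_at_top)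
  have "((%x::real. (ln x)\<^sup>2 / x) \<longlongrightarrow> 0) at_top" by real_asymp
  then have e3: "\<forall>\<^sub>F q :: nat in at_top. 968 * C\<^sup>2 * ((ln (real q))\<^sup>2 / real q) <= c / 16"
   by (rule eventually_small_real_nat) (use c0 in simp)
  have "((%x::real. (ln x)\<^sup>2 * x powr (- (2 * \<epsilon>))) \<longlongrightarrow> 0) at_top" using \<epsilon> by real_asymp
  then have e4: "\<forall>\<^sub>F q :: nat in at_top. 6 * S * ((ln (real q))\<^sup>2 * real q powr (- (2 * \<epsilon>))) <= c / 9216"
   by (rule eventually_small_real_nat) (use c0 in simp)
  have "((%x::real. ln x / x ^ 3) \<longlongrightarrow> 0) at_top" by real_asymp
  then have e5: "\<forall>\<^sub>F q :: nat in at_top. S * (ln (real q) / real q ^ 3) <= c / 9216"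
   by (rule eventually_small_real_nat) (use c0 in simp)
  have e6: "\<forall>\<^sub>F q :: nat in at_top. real q > g u0"
   using filterlim_real_sequentially by (simp add: filterlim_at_top_dense)
  have e7: "\<forall>\<^sub>F q :: nat in at_top. q >= 3" by (rule eventually_ge_at_top)
  from e1 e2 e3 e4 e5 e6 e7 show ?thesis
  proof eventually_elim
   case (elim q)
   interpret modulus C G m h q using elim(7) by unfold_locales
   have q1: "real q >= 1" using elim(7) by simp
   \<comment> \<open>As \<open>g\<close> need not be continuous, the point \<open>U\<close> where it
     passes \<open>q\<close> is taken as an infimum; only values strictly to either side of
     \<open>U\<close> are used.\<close>
   define A where "A = {u. u >= 1 \<and> g u >= real q}"
   have A_ne: "A ~= {}"
   proof -
    have "\<forall>\<^sub>F u in at_top. g u >= real q" using lim by (simp add: filterlim_at_top)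
    then have "\<forall>\<^sub>F u in at_top. u >= 1 \<and> g u >= real q" using eventually_ge_at_top[of "1::real"] by eventually_elim auto
    then show ?thesis unfolding A_def using eventually_happens by fastforce
   qed
   \<comment> \<open>Since \<open>q\<close> exceeds \<open>g u0\<close>, such a \<open>u\<close>
     lies beyond \<open>u0\<close>, where \<open>g\<close> is bounded by the power; so q <=
     u^(1/M).\<close>
   have A_ge: "real q powr M <= u" if "u \<in> A" for u
   proof -
    have u: "u >= 1" "g u >= real q" using that by (auto simp: A_def)
    have "u > u0"
    proof (rule ccontr)
     assume "\<not> u > u0"
     then have "g u <= g u0" using mono u u0(1) by (intro mono_onD[OF mono]) auto
     then show False using u(2) elim(6) by linarith
    qed
    then have "real q <= u powr (1 / M)" using u0(2)[of u] u(2) by linarith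
    then have "real q powr M <= (u powr (1 / M)) powr M" using M1 by (intro powr_mono2) auto
    then show ?thesis using u(1) M1 by (simp add: powr_powr)
   qed
   define U where "U = Inf A"
   have bdd: "bdd_below A" by (rule bdd_belowI[of _ 1]) (simp add: A_def)
   have Uq: "real q powr M <= U" unfolding U_def by (rule cInf_greatest[OF A_ne A_ge])
   have qM1: "real q powr M >= 1" using q1 M1 by (intro ge_one_powr_ge_zero) auto
   have U1: "U >= 1" using Uq qM1 by linarith
   have above: "real q <= g y" if "y > U" for y
   proof -
    from cInf_lessD[OF A_ne that[unfolded U_def]] obtain u where u: "u \<in> A" "u < y" by blast
    have "g u <= g y" using u U1 by (intro mono_onD[OF mono]) (auto simp: A_def)
    then show ?thesis using u(1) by (simp add: A_def)
   qed
   have below: "g y <= real q" if "1 <= y" "y < U" for y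
   proof (rule ccontr)
    assume "\<not> g y <= real q"
    then have "y \<in> A" using that by (simp add: A_def)
    then show False using cInf_lower[OF _ bdd, of y] that unfolding U_def by linarith
   qed
   \<comment> \<open>The exponent in the theorem is 1 - a.\<close>
   define a where "a = 1 / M + 2 * \<epsilon>"
   have a0: "a > 0" using M1 \<epsilon> by (simp add: a_def add_pos_pos)
   have Ma: "M * a >= 1 + 2 * \<epsilon>"
   proof -
    have "M * a = 1 + M * (2 * \<epsilon>)" using M1 by (simp add: a_def distrib_left)
    moreover have "1 * (2 * \<epsilon>) <= M * (2 * \<epsilon>)" using M1 \<epsilon> by (intro mult_right_mono) auto
    ultimately show ?thesis by linarith
   qed
   \<comment> \<open>For y < V the power y^(1-a) is below U^((1+a)(1-a)) <= U when a < 1, which is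
     the lower condition on \<open>q\<close>.\<close>
   define V where "V = U powr (1 + a)"
   have Ua: "real q powr (1 + 2 * \<epsilon>) <= U powr a"
   proof -
    have "real q powr (1 + 2 * \<epsilon>) <= real q powr (M * a)" using Ma q1 by (intro powr_mono) auto
    also have "... = (real q powr M) powr a" by (simp add: powr_powr)
    also have "... <= U powr a" using Uq a0 by (intro powr_mono2) auto
    finally show ?thesis .
   qed
   have VU: "V = U * U powr a" using U1 by (simp add: V_def powr_add)
   have qU: "real q <= U"
   proof -
    have "real q powr 1 <= real q powr M" using q1 M1 by (intro powr_mono) auto
    then show ?thesis using Uq q1 by simp
   qed
   have V2: "(real q)\<^sup>2 <= V"
   proof -
    have "real q powr 1 <= real q powr (1 + 2 * \<epsilon>)" using q1 \<epsilon> by (intro powr_mono) auto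
    then have "real q <= U powr a" using Ua q1 by simp
    then show ?thesis unfolding VU power2_eq_square using qU q1 by (intro mult_mono) auto
   qed
   \<comment> \<open>The decisive gain: U^a >= q^(Ma) >= q^(1+2\<epsilon>), and the saving
     q^(-2\<epsilon>) beats the (ln q)^2 in the mean-square bound.\<close>
   have quo: "real q * U / V <= real q powr (- (2 * \<epsilon>))"
   proof -
    have "real q * U / V = real q / U powr a" using U1 by (simp add: VU)
    also have "... <= real q / real q powr (1 + 2 * \<epsilon>)" using Ua q1 by (intro divide_left_mono mult_pos_pos) auto
    also have "... = real q powr (- (2 * \<epsilon>))" using q1 by (simp add: powr_add powr_minus_divide)
    finally show ?thesis .
   qed
   have "\<exists>y. U < y \<and> y < V \<and> norm (residue.F y) >= sqrt (c / 1152) * sqrt (ln (real q) / real (totient q))"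
    unfolding c_def
   proof (rule residue_large_value[of w])
    show "w >= 0" "w >= character_zeros.window_const C" by (auto simp: w_def)
    show "6 * character_zeros.square_const C * (ln (real q))\<^sup>2 * (real q * U / V) <= 1 / 10 ^ 11 / 9216"
    proof -
     have "6 * S * ((ln (real q))\<^sup>2 * (real q * U / V)) <= 6 * S * ((ln (real q))\<^sup>2 * real q powr (- (2 * \<epsilon>)))"
      using quo square_const_nonneg by (intro mult_left_mono) (auto simp: S_def)
     then show ?thesis using elim(4) by (simp add: S_def c_def mult.assoc)
    qed
   qed (use elim U1 V2 in \<open>simp_all add: c_def S_def mult.assoc\<close>)
   then obtain y where y: "U < y" "y < V" "norm (residue.F y) >= sqrt (c / 1152) * sqrt (ln (real q) / real (totient q))" by blast
   have y1: "y > 1" using y(1) U1 by linarith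
   have theta: "g (y powr (1 - 1 / M - 2 * \<epsilon>)) <= real q" if ge: "y powr (1 - 1 / M - 2 * \<epsilon>) >= 1"
   proof -
    have e: "1 - 1 / M - 2 * \<epsilon> = 1 - a" by (simp add: a_def)
    show ?thesis
    proof (cases "a < 1")
     case True
     have "y powr (1 - a) < V powr (1 - a)" using y y1 True by (intro powr_less_mono2) auto
     also have "V powr (1 - a) = U powr ((1 + a) * (1 - a))" by (simp add: V_def powr_powr)
     also have "... <= U powr 1"
     proof (rule powr_mono[OF _ U1])
      have "(1 + a) * (1 - a) = 1 - a * a" by (simp add: algebra_simps)
      then show "(1 + a) * (1 - a) <= 1" by simp
     qed
     finally show ?thesis using below ge U1 unfolding e by simp
    next
     \<comment> \<open>For a >= 1 the power is at most 1, so the premise forces it to be 1, and g 1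
       <= g u0 < q.\<close>
     case False
     have "y powr (1 - a) <= y powr 0" using False y1 by (intro powr_mono) auto
     then have "y powr (1 - a) = 1" using ge y1 unfolding e by simp
     moreover have "g 1 <= g u0" using u0(1) by (intro mono_onD[OF mono]) auto
     ultimately show ?thesis using elim(6) unfolding e by simp
    qed
   qed
   let ?D = "\<bar>psi_residue (exp y) q 1 - psi_coprime (exp y) q / real (totient q)\<bar>"
   have D: "?D >= sqrt (c / 1152) * ((exp y * ln (real q)) powr (1 / 2) / real (totient q) powr (1 / 2))"
   proof -
    have "sqrt (c / 1152) * sqrt (ln (real q) / real (totient q)) * exp (y / 2) <= ?D * exp (- y / 2) * exp (y / 2)"
     using y(3) unfolding norm_F_eq by (intro mult_right_mono) auto
    also have "... = ?D" by (simp add: mult.assoc flip: exp_add)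
    also have "sqrt (c / 1152) * sqrt (ln (real q) / real (totient q)) * exp (y / 2) = sqrt (c / 1152) * ((exp y * ln (real q)) powr (1 / 2) / real (totient q) powr (1 / 2))"
    proof -
     have "sqrt (exp y) = exp (y / 2)"
      by (rule real_sqrt_unique) (simp_all add: power2_eq_square flip: exp_add)
     then show ?thesis using l1 phi by (simp add: powr_half_sqrt real_sqrt_mult real_sqrt_divide)
    qed
    finally show ?thesis .
   qed
   show ?case using y1 theta above[OF y(1)] D by (intro exI[of _ "exp y"]) auto
  qed
 qed
 have "sqrt (c / 1152) > 0" using c0 by simp
 then show ?thesis using main by (intro exI[of _ "sqrt (c / 1152)"] conjI exI[of _ "1::real"]) (assumption, simp, blast)
qed

end
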